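(* Let $V\in L^\infty_{loc}(Q_T)$ be nonnegative and let $u\in\bigcap_{1\le p<\infty}W^{2,1}_{p,loc}(Q_T)$ be a positive solution of $\partial_tu-\Delta u+V(x,t)u=0$ in $Q_T$ with singular set $\mathcal{S}(u)\subsetneq\mathbb{R}^n$. If $\mu\in\mathfrak M_{T\,+}(\mathcal{S}(u))$, set $v_\mu=\inf\{u,u_{\mu^*}\}$. Then $$\partial_tv_\mu-\Delta v_\mu+Vv_\mu\ge0\quad\text{in }Q_T$$ (in the sense of distributions), and $v_\mu$ admits an initial trace $\gamma_u(\mu)\in\mathfrak M_{T\,+}(\mathcal{S}(u))$. The mapping $\mu\mapsto\gamma_u(\mu)$ is nondecreasing and $\gamma_u(\mu)\le\mu$.
   Context: Here $n\ge1$, $T>0$, $Q_T=\mathbb{R}^n\times(0,T]$, $H(x,t)=(4\pi t)^{-n/2}e^{-|x|^2/(4t)}$, $\mathbb{H}[\mu](x,t)=\int_{\mathbb{R}^n}H(x-y,t)\,d\mu(y)$. $W^{2,1}_{p,loc}(Q_T)$ is the parabolic Sobolev space. The regular set $\mathcal{R}(u)$ of $u$ is the set of $y\in\mathbb{R}^n$ having a bounded neighborhood $U$ with $\iint_{U\times(0,T)}uV\,dx\,dt<\infty$, and $\mathcal{S}(u)=\mathbb{R}^n\setminus\mathcal{R}(u)$. For a Borel set $A\subset\mathbb{R}^n$, $\mathfrak M_{T\,+}(A)$ is the set of nonnegative Radon measures $\mu$ on $\mathbb{R}^n$ with $\mu(\mathbb{R}^n\setminus A)=0$ and $\int_Ae^{-|x|^2/(4T)}d\mu<\infty$.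 The initial trace of a nonnegative function $v$ on $Q_T$ is the Radon measure $\gamma$ (if it exists) with $\lim_{t\to0}\int v(x,t)\phi(x)\,dx=\int\phi\,d\gamma$ for all $\phi\in C_c(\mathbb{R}^n)$. Reduced measure $\mu^*$ and $u_{\mu^*}$: for a bounded nonnegative measurable $W$, let $H_W(x,y,t)$ be the heat kernel of $\partial_t-\Delta+W$ (the solution with initial datum $\delta_y$, $0\le H_W\le H(x-y,t)$). With $V^k=\min\{V,k\}$, $H_{V^k}$ decreases to $H_V$ as $k\to\infty$. For nonnegative $\mu$ with $\int_{\mathbb{R}^n}e^{-|x|^2/(4T)}d\mu<\infty$, put $w(x,t)=\int_{\mathbb{R}^n}H_V(x,y,t)\,d\mu(y)$. The function $w(x,t)+\int_0^t\int_{\mathbb{R}^n}H(x-y,t-s)V(y,s)w(y,s)\,dy\,ds$ is a nonnegative solution of the heat equation; its initial trace is the reduced measure $\mu^*$, so that $w+\int_0^t\int H(x-y,t-s)Vw\,dy\,ds=\mathbb{H}[\mu^*]$. Then $\mu^*\le\mu$, and $w$ is the solution, denoted $u_{\mu^*}$, of $\partial_tw-\Delta w+Vw=0$ in $Q_T$ with $w(\cdot,0)=\mu^*$. *)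

theory Defs
  imports "HOL-Probability.Probability"
begin

text \<open>
  Functions of \<open>(x, t)\<close> are functions on the product \<open>'a \<times> real\<close>, with \<open>'a\<close> a Euclidean space.
  The cylinder \<open>Q T\<close> contains its top \<open>t = T\<close>; distributions live on its interior.
\<close>

definition Q :: "real \<Rightarrow> ('a::euclidean_space \<times> real) set" where
  "Q T = UNIV \<times> {0<..T}"

definition Q_int :: "real \<Rightarrow> ('a::euclidean_space \<times> real) set" where
  "Q_int T = UNIV \<times> {0<..<T}"

subsection \<open>Test functions, distributional and weak derivatives\<close>

definition dir_deriv :: "('b::euclidean_space \<Rightarrow> real) \<Rightarrow> 'b \<Rightarrow> 'b \<Rightarrow> real" where
  "dir_deriv f v z = frechet_derivative f (at z) v"

fun Ck :: "nat \<Rightarrow> ('b::euclidean_space \<Rightarrow> real) \<Rightarrow> bool" where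
  "Ck 0 f \<longleftrightarrow> continuous_on UNIV f"
| "Ck (Suc k) f \<longleftrightarrow> (\<forall>z. f differentiable (at z)) \<and> (\<forall>v. Ck k (dir_deriv f v))"

definition test_function :: "'b::euclidean_space set \<Rightarrow> ('b \<Rightarrow> real) \<Rightarrow> bool" where
  "test_function \<Omega> \<phi> \<longleftrightarrow> (\<forall>k. Ck k \<phi>) \<and>
     compact (closure {z. \<phi> z \<noteq> 0}) \<and> closure {z. \<phi> z \<noteq> 0} \<subseteq> \<Omega>"

text \<open>Here \<open>A\<close> need not be open: for \<open>A = Q T\<close> the compact sets may touch the top \<open>t = T\<close>.\<close>

definition Lp_loc :: "real \<Rightarrow> 'b::euclidean_space set \<Rightarrow> ('b \<Rightarrow> real) \<Rightarrow> bool" where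
  "Lp_loc p A f \<longleftrightarrow> f \<in> borel_measurable (lebesgue_on A) \<and>
     (\<forall>K. compact K \<and> K \<subseteq> A \<longrightarrow> set_integrable lebesgue K (\<lambda>z. \<bar>f z\<bar> powr p))"

definition Linf_loc :: "'b::euclidean_space set \<Rightarrow> ('b \<Rightarrow> real) \<Rightarrow> bool" where
  "Linf_loc A f \<longleftrightarrow> f \<in> borel_measurable (lebesgue_on A) \<and>
     (\<forall>K. compact K \<and> K \<subseteq> A \<longrightarrow> (\<exists>C. AE z in lebesgue_on K. \<bar>f z\<bar> \<le> C))"

text \<open>\<open>g\<close> is the weak derivative of \<open>f\<close> in the direction \<open>v\<close> on the open set \<open>\<Omega>\<close>.\<close>

definition has_weak_deriv ::
    "'b::euclidean_space set \<Rightarrow> ('b \<Rightarrow> real) \<Rightarrow> 'b \<Rightarrow> ('b \<Rightarrow> real) \<Rightarrow> bool" where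
  "has_weak_deriv \<Omega> f v g \<longleftrightarrow> Lp_loc 1 \<Omega> f \<and> Lp_loc 1 \<Omega> g \<and>
     (\<forall>\<phi>. test_function \<Omega> \<phi> \<longrightarrow>
        (LINT z:\<Omega>|lebesgue. f z * dir_deriv \<phi> v z) = - (LINT z:\<Omega>|lebesgue. g z * \<phi> z))"

text \<open>
  The parabolic Sobolev space: one weak derivative in time and two in space, all of them
  in \<open>L\<^sup>p\<close> on every compact subset of \<open>Q T\<close>.
\<close>

definition W21_loc :: "real \<Rightarrow> real \<Rightarrow> ('a::euclidean_space \<times> real \<Rightarrow> real) \<Rightarrow> bool" where
  "W21_loc p T u \<longleftrightarrow> Lp_loc p (Q T) u \<and>
     (\<exists>ut. has_weak_deriv (Q_int T) u (0, 1) ut \<and> Lp_loc p (Q T) ut) \<and>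
     (\<forall>i\<in>Basis. \<exists>ui. has_weak_deriv (Q_int T) u (i, 0) ui \<and> Lp_loc p (Q T) ui \<and>
        (\<forall>j\<in>Basis. \<exists>uij. has_weak_deriv (Q_int T) ui (j, 0) uij \<and> Lp_loc p (Q T) uij))"

text \<open>\<open>\<partial>\<^sub>t u - \<Delta>u + V u = 0\<close> almost everywhere, the derivatives being weak derivatives.\<close>

definition strong_solution ::
    "real \<Rightarrow> ('a::euclidean_space \<times> real \<Rightarrow> real) \<Rightarrow> ('a \<times> real \<Rightarrow> real) \<Rightarrow> bool" where
  "strong_solution T V u \<longleftrightarrow>
     (\<exists>ut g h. has_weak_deriv (Q_int T) u (0, 1) ut \<and>
        (\<forall>i\<in>Basis. has_weak_deriv (Q_int T) u (i, 0) (g i) \<and>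
                   has_weak_deriv (Q_int T) (g i) (i, 0) (h i)) \<and>
        (AE z in lebesgue_on (Q T). ut z - (\<Sum>i\<in>Basis. h i z) + V z * u z = 0))"

text \<open>The formal adjoint \<open>-\<partial>\<^sub>t \<phi> - \<Delta>\<phi> + V \<phi>\<close>, applied to a test function.\<close>

definition adjoint_op ::
    "('a::euclidean_space \<times> real \<Rightarrow> real) \<Rightarrow> ('a \<times> real \<Rightarrow> real) \<Rightarrow> 'a \<times> real \<Rightarrow> real" where
  "adjoint_op V \<phi> z = - dir_deriv \<phi> (0, 1) z
     - (\<Sum>i\<in>Basis. dir_deriv (dir_deriv \<phi> (i, 0)) (i, 0) z) + V z * \<phi> z"

definition dist_solution ::
    "real \<Rightarrow> ('a::euclidean_space \<times> real \<Rightarrow> real) \<Rightarrow> ('a \<times> real \<Rightarrow> real) \<Rightarrow> bool" where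
  "dist_solution T V v \<longleftrightarrow>
     Lp_loc 1 (Q_int T) v \<and> Lp_loc 1 (Q_int T) (\<lambda>z. V z * v z) \<and>
     (\<forall>\<phi>. test_function (Q_int T) \<phi> \<longrightarrow>
        (LINT z:Q_int T|lebesgue. v z * adjoint_op V \<phi> z) = 0)"

definition dist_supersolution ::
    "real \<Rightarrow> ('a::euclidean_space \<times> real \<Rightarrow> real) \<Rightarrow> ('a \<times> real \<Rightarrow> real) \<Rightarrow> bool" where
  "dist_supersolution T V v \<longleftrightarrow>
     Lp_loc 1 (Q_int T) v \<and> Lp_loc 1 (Q_int T) (\<lambda>z. V z * v z) \<and>
     (\<forall>\<phi>. test_function (Q_int T) \<phi> \<and> (\<forall>z. 0 \<le> \<phi> z) \<longrightarrow>
        (LINT z:Q_int T|lebesgue. v z * adjoint_op V \<phi> z) \<ge> 0)"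

subsection \<open>Radon measures and initial traces\<close>

text \<open>On a Euclidean space every locally finite Borel measure is regular.\<close>

definition radon_measure :: "'a::euclidean_space measure \<Rightarrow> bool" where
  "radon_measure \<mu> \<longleftrightarrow> sets \<mu> = sets borel \<and> (\<forall>K. compact K \<longrightarrow> emeasure \<mu> K < \<infinity>)"

definition M_plus :: "real \<Rightarrow> 'a::euclidean_space set \<Rightarrow> 'a measure set" where
  "M_plus T A = {\<mu>. radon_measure \<mu> \<and> - A \<in> null_sets \<mu> \<and>
     (\<integral>\<^sup>+ x\<in>A. ennreal (exp (- (norm x)\<^sup>2 / (4 * T))) \<partial>\<mu>) < \<infinity>}"

definition has_initial_trace ::
    "('a::euclidean_space \<times> real \<Rightarrow> real) \<Rightarrow> 'a measure \<Rightarrow> bool" where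
  "has_initial_trace v \<gamma> \<longleftrightarrow> radon_measure \<gamma> \<and>
     (\<forall>\<phi>::'a \<Rightarrow> real. continuous_on UNIV \<phi> \<and> compact (closure {x. \<phi> x \<noteq> 0}) \<longrightarrow>
        (\<forall>\<^sub>F t in at_right 0. integrable lebesgue (\<lambda>x. v (x, t) * \<phi> x)) \<and>
        ((\<lambda>t. \<integral>x. v (x, t) * \<phi> x \<partial>lebesgue) \<longlongrightarrow> (\<integral>x. \<phi> x \<partial>\<gamma>)) (at_right 0))"

definition initial_trace :: "('a::euclidean_space \<times> real \<Rightarrow> real) \<Rightarrow> 'a measure" where
  "initial_trace v = (THE \<gamma>. has_initial_trace v \<gamma>)"

subsection \<open>Regular and singular set\<close>

definition regular_set ::
    "real \<Rightarrow> ('a::euclidean_space \<times> real \<Rightarrow> real) \<Rightarrow> ('a \<times> real \<Rightarrow> real) \<Rightarrow> 'a set" where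
  "regular_set T V u = {y. \<exists>U. open U \<and> bounded U \<and> y \<in> U \<and>
     (\<integral>\<^sup>+ z\<in>U \<times> {0<..<T}. ennreal (u z * V z) \<partial>lebesgue) < \<infinity>}"

definition singular_set ::
    "real \<Rightarrow> ('a::euclidean_space \<times> real \<Rightarrow> real) \<Rightarrow> ('a \<times> real \<Rightarrow> real) \<Rightarrow> 'a set" where
  "singular_set T V u = UNIV - regular_set T V u"

subsection \<open>Heat kernels, reduced measure and the associated solution\<close>

definition gauss_kernel :: "'a::euclidean_space \<Rightarrow> real \<Rightarrow> real" where
  "gauss_kernel x t =
     (4 * pi * t) powr (- real DIM('a) / 2) * exp (- (norm x)\<^sup>2 / (4 * t))"

text \<open>
  The heat kernel of \<open>\<partial>\<^sub>t - \<Delta> + W\<close> with pole \<open>y\<close>. Continuity selects the representative for which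
  the values at single points are meaningful; the initial datum is the Dirac measure at \<open>y\<close>.
\<close>

definition is_heat_kernel ::
    "real \<Rightarrow> ('a::euclidean_space \<times> real \<Rightarrow> real) \<Rightarrow> 'a \<Rightarrow> ('a \<times> real \<Rightarrow> real) \<Rightarrow> bool" where
  "is_heat_kernel T W y K \<longleftrightarrow> continuous_on (Q T) K \<and>
     (\<forall>(x, t)\<in>Q T. 0 \<le> K (x, t) \<and> K (x, t) \<le> gauss_kernel (x - y) t) \<and>
     dist_solution T W K \<and> has_initial_trace K (return borel y)"

definition heat_kernel_bdd ::
    "real \<Rightarrow> ('a::euclidean_space \<times> real \<Rightarrow> real) \<Rightarrow> 'a \<Rightarrow> 'a \<Rightarrow> real \<Rightarrow> real" where
  "heat_kernel_bdd T W x y t = (THE r. \<exists>K. is_heat_kernel T W y K \<and> r = K (x, t))"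

definition heat_kernel ::
    "real \<Rightarrow> ('a::euclidean_space \<times> real \<Rightarrow> real) \<Rightarrow> 'a \<Rightarrow> 'a \<Rightarrow> real \<Rightarrow> real" where
  "heat_kernel T V x y t = lim (\<lambda>k::nat. heat_kernel_bdd T (\<lambda>z. min (V z) (real k)) x y t)"

text \<open>
  The solution \<open>u_{\<mu>*}\<close> whose initial datum is the reduced measure \<open>\<mu>*\<close> of \<open>\<mu>\<close>. It is finite for
  \<open>t < T\<close>; at \<open>t = T\<close> it may be infinite, hence the extended values.
\<close>

definition reduced_solution ::
    "real \<Rightarrow> ('a::euclidean_space \<times> real \<Rightarrow> real) \<Rightarrow> 'a measure \<Rightarrow> 'a \<times> real \<Rightarrow> ennreal" where
  "reduced_solution T V \<mu> = (\<lambda>(x, t). \<integral>\<^sup>+ y. ennreal (heat_kernel T V x y t) \<partial>\<mu>)"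

text \<open>
  The reduced measure itself. It is determined by \<open>\<mu>\<close> and enters what follows only through
  the solution \<open>reduced_solution T V \<mu>\<close> it generates.
\<close>

definition reduced_measure ::
    "real \<Rightarrow> ('a::euclidean_space \<times> real \<Rightarrow> real) \<Rightarrow> 'a measure \<Rightarrow> 'a measure" where
  "reduced_measure T V \<mu> = initial_trace (\<lambda>(x, t). enn2real (reduced_solution T V \<mu> (x, t) +
     (\<integral>\<^sup>+ (y, s)\<in>UNIV \<times> {0<..<t}.
        ennreal (gauss_kernel (x - y) (t - s) * V (y, s)) * reduced_solution T V \<mu> (y, s)
        \<partial>lebesgue)))"

definition v_inf :: "real \<Rightarrow> ('a::euclidean_space \<times> real \<Rightarrow> real) \<Rightarrow> ('a \<times> real \<Rightarrow> real) \<Rightarrow>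
    'a measure \<Rightarrow> 'a \<times> real \<Rightarrow> real" where
  "v_inf T V u \<mu> z = enn2real (min (ennreal (u z)) (reduced_solution T V \<mu> z))"

definition gamma_trace :: "real \<Rightarrow> ('a::euclidean_space \<times> real \<Rightarrow> real) \<Rightarrow>
    ('a \<times> real \<Rightarrow> real) \<Rightarrow> 'a measure \<Rightarrow> 'a measure" where
  "gamma_trace T V u \<mu> = initial_trace (v_inf T V u \<mu>)"

end

theory Submission
 imports Defs
begin

text \<open>
 Let \<open>w\<^sub>k\<close> be the solution with initial measure \<open>\<mu>\<close> for the truncated potential \<open>min V k\<close>; it decreases
 to the solution \<open>w\<close> generated by the reduced measure. Kato's inequality for \<open>u - w\<^sub>k\<close> makes \<open>min u w\<^sub>k\<close> a
 supersolution for \<open>V\<close>, and the inequality survives \<open>k \<rightarrow> \<infinity>\<close> because \<open>min u w\<^sub>k \<le> u\<close>. Testing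
 \<open>v = min u w\<close> on a time slab with a function \<open>\<xi>\<close> of \<open>x\<close> alone shows that \<open>\<integral> v(x, t) \<xi>(x) dx\<close> is nondecreasing
 in \<open>t\<close> up to slab integrals of \<open>v \<bar>\<Delta>\<xi>\<bar>\<close> and \<open>V v \<xi>\<close>. These stay bounded down to \<open>t = 0\<close>: the first
 because \<open>v \<le> w\<^sub>0\<close>, the second by the equation for \<open>w\<^sub>k\<close>. Hence the limit at \<open>t = 0\<close> exists; it is a
 positive functional below \<open>\<mu>\<close>, so it is a measure \<open>\<gamma> \<le> \<mu>\<close>, which does not charge the \<open>\<mu>\<close>-null
 complement of the singular set. The truncated kernels come from a Duhamel series; a uniqueness theorem
 identifies them with the heat kernels of the definition.
\<close>

text \<open>\<open>V\<close> is bounded only on compact subsets of the cylinder and may blow up as t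
  tends to 0. The truncations have continuous kernels; for their decreasing limit only measurability
  is at hand, so Kato's inequality is used at fixed k, and k \<rightarrow> \<infinity> is taken in
  integrated inequalities. The delicate term is the integral of V v \<xi> down to t = 0. Testing the
  equation of w_k on a slab bounds the integral of min(V, k) w_k \<xi> by the mass of w_k \<xi> at
  the lower time plus an integral of w_k \<Delta>\<xi>, uniformly in k and in the slab; then v \<le>
  w_k replaces w_k by v, and k is sent to infinity. Uniformity rests on the Gauss kernel bounding
  every kernel. For t < T it is locally dominated by the weight exp(-|y|^2/(4T)); near t = 0 only
  its average over a ball is, and the semigroup law gives this for t \<le> T/4, the source of the
  recurring T/4. Continuity and comparison of the kernels are read off the Duhamel series: the sum
  and its complement to an explicit function are both lower semicontinuous, and every term is
  monotone in the potential.\<close>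

type_synonym 'a stfun = "'a \<times> real => real"

lemmas lint_cong = Bochner_Integration.integral_cong[OF refl]
 and lint_diff = Bochner_Integration.integral_diff
 and lint_sum = Bochner_Integration.integral_sum
 and L1_bound = Bochner_Integration.integrable_bound
 and L1_add = Bochner_Integration.integrable_add
 and lint_add = Bochner_Integration.integral_add
 and lint_nonneg = Bochner_Integration.integral_nonneg

section \<open>Smooth functions and mollification\<close>

lemma dir_deriv_eq: "(f has_derivative D) (at z) ==> dir_deriv f v z = D v"
 unfolding dir_deriv_def by (metis frechet_derivative_at)

lemma has_derivative_dir_deriv:
 "f differentiable (at z) ==> (f has_derivative (\<lambda>v. dir_deriv f v z)) (at z)"
 unfolding dir_deriv_def by (metis frechet_derivative_works)

definition smooth :: "('b::euclidean_space => real) => bool" where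
 "smooth f \<longleftrightarrow> (\<forall>k. Ck k f)"

lemma Ck_continuous: "Ck k f ==> continuous_on UNIV f"
 by (cases k) (auto intro!: continuous_at_imp_continuous_on differentiable_imp_continuous_within)

lemma Ck_Suc_D: "Ck (Suc k) f ==> Ck k f"
proof (induction k arbitrary: f)
 case 0
 then show ?case using Ck_continuous[of "Suc 0" f] by simp
next
 case (Suc k)
 from Suc.prems have "\<forall>z. f differentiable (at z)" "!!v. Ck (Suc k) (dir_deriv f v)"
  unfolding Ck.simps(2)[of "Suc k"] by auto
 then show ?case using Suc.IH by simp
qed

lemma Ck_const [simp]: "Ck k (\<lambda>_. c)"
proof (induction k arbitrary: c)
 case (Suc k)
 have "dir_deriv (\<lambda>_. c) v = (\<lambda>_. 0)" for v :: 'a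
  by (rule ext, rule dir_deriv_eq) (rule has_derivative_const)
 then show ?case using Suc by simp
qed simp

lemma dir_deriv_add:
 assumes "\<forall>z. f differentiable (at z)" "\<forall>z. g differentiable (at z)"
 shows "dir_deriv (\<lambda>z. f z + g z) v = (\<lambda>z. dir_deriv f v z + dir_deriv g v z)"
 using assms by (intro ext dir_deriv_eq has_derivative_add has_derivative_dir_deriv) auto

lemma dir_deriv_mult:
 fixes f g :: "'b::euclidean_space => real"
 assumes "\<forall>z. f differentiable (at z)" "\<forall>z. g differentiable (at z)"
 shows "dir_deriv (\<lambda>z. f z * g z) v = (\<lambda>z. f z * dir_deriv g v z + dir_deriv f v z * g z)"
 by (intro ext dir_deriv_eq has_derivative_mult has_derivative_dir_deriv) (use assms in auto)

lemma Ck_add: "Ck k f ==> Ck k g ==> Ck k (\<lambda>z. f z + g z)"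
 by (induction k arbitrary: f g) (auto simp: dir_deriv_add intro!: continuous_intros)

lemma Ck_mult: "Ck k f ==> Ck k g ==> Ck k (\<lambda>z. f z * g z)"
proof (induction k arbitrary: f g)
 case (Suc k)
 then have "Ck k f" "Ck k g" by (auto intro: Ck_Suc_D)
 then show ?case using Suc by (auto simp: dir_deriv_mult intro!: Ck_add)
qed (auto intro!: continuous_intros)

lemma Ck_affine:
 fixes f :: "'b::euclidean_space => real" and L :: "'c::euclidean_space => 'b"
 assumes "bounded_linear L"
 shows "Ck k f ==> Ck k (\<lambda>z. f (a + L z))"
proof (induction k arbitrary: f)
 case 0
 then show ?case
  by (auto intro!: continuous_intros continuous_on_compose2[of UNIV f]
    linear_continuous_on[OF assms])
next
 case (Suc k)
 have D: "((\<lambda>z. f (a + L z)) has_derivative (\<lambda>v. dir_deriv f (L v) (a + L z))) (at z)" for z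
 proof -
  have "((\<lambda>z. a + L z) has_derivative L) (at z)"
   by (auto intro!: derivative_eq_intros bounded_linear.has_derivative[OF assms])
  moreover have "(f has_derivative (\<lambda>v. dir_deriv f v (a + L z))) (at (a + L z))"
   using Suc by (intro has_derivative_dir_deriv) auto
  ultimately show ?thesis by (rule has_derivative_compose)
 qed
 then have "dir_deriv (\<lambda>z. f (a + L z)) v = (\<lambda>z. dir_deriv f (L v) (a + L z))" for v
  by (intro ext dir_deriv_eq)
 then show ?case using D Suc by (auto simp: differentiable_def)
qed

lemma smooth_D: "smooth f ==> f differentiable (at z)"
 unfolding smooth_def by (metis Ck.simps(2))

lemma smooth_dir_deriv: "smooth f ==> smooth (dir_deriv f v)"
 unfolding smooth_def by (metis Ck.simps(2))

lemma smooth_continuous: "smooth f ==> continuous_on A f"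
 unfolding smooth_def using Ck_continuous continuous_on_subset by blast

lemma smooth_has_derivative: "smooth f ==> (f has_derivative (\<lambda>v. dir_deriv f v z)) (at z)"
 by (rule has_derivative_dir_deriv[OF smooth_D])

lemma smooth_const [simp]: "smooth (\<lambda>_. c)"
 and smooth_add: "smooth f ==> smooth g ==> smooth (\<lambda>z. f z + g z)"
 and smooth_mult: "smooth f ==> smooth g ==> smooth (\<lambda>z. f z * g z)"
 by (auto simp: smooth_def Ck_add Ck_mult)

lemma smooth_affine:
 fixes f :: "'b::euclidean_space => real" and L :: "'c::euclidean_space => 'b"
 shows "smooth f ==> bounded_linear L ==> smooth (\<lambda>z. f (a + L z))"
 by (auto simp: smooth_def Ck_affine)

lemma smooth_sum: "(!!i. i \<in> I ==> smooth (f i)) ==> smooth (\<lambda>z. \<Sum>i\<in>I. f i z)"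
 by (induction I rule: infinite_finite_induct) (auto intro!: smooth_add)

lemma smooth_linear:
 fixes L :: "'b::euclidean_space => real"
 assumes L: "bounded_linear L"
 shows "smooth L"
 unfolding smooth_def
proof
 fix k
 show "Ck k L"
 proof (cases k)
  case 0
  then show ?thesis using linear_continuous_on[OF L] by simp
 next
  case (Suc m)
  have D: "(L has_derivative L) (at z)" for z
   using bounded_linear.has_derivative[OF L has_derivative_ident] by simp
  then have "dir_deriv L v = (\<lambda>_. L v)" for v by (intro ext dir_deriv_eq)
  then show ?thesis using D Suc by (auto simp: differentiable_def)
 qed
qed

lemma smooth_exp_linear:
 fixes L :: "'b::euclidean_space => real"
 assumes L: "bounded_linear L"
 shows "smooth (\<lambda>z. exp (L z))"
proof -
 have D: "((\<lambda>z. exp (L z)) has_derivative (\<lambda>v. exp (L z) * L v)) (at z)" for z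
  using bounded_linear.has_derivative[OF L has_derivative_ident, of "at z"]
  by (auto intro!: derivative_eq_intros)
 then have eq: "dir_deriv (\<lambda>z. exp (L z)) v = (\<lambda>z. exp (L z) * L v)" for v
  by (intro ext dir_deriv_eq)
 have "Ck k (\<lambda>z. exp (L z))" for k
 proof (induction k)
  case 0
  then show ?case by (auto intro!: continuous_intros linear_continuous_on[OF L])
 next
  case (Suc k)
  have "Ck k (\<lambda>z. exp (L z) * L v)" for v by (intro Ck_mult Suc Ck_const)
  then show ?case using D by (auto simp: eq differentiable_def)
 qed
 then show ?thesis by (simp add: smooth_def)
qed

text \<open>All derivatives of exp(-1/x) lie in the span of this family, extended by 0 to x \<le> 0.
  Carrying the exponent m as a parameter lets a single induction prove smoothness.\<close>

definition flat :: "nat => real => real" where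
 "flat m x = (if x > 0 then exp (- (1 / x)) / x ^ m else 0)"

lemma flat_nonneg: "0 <= flat m x" and flat_pos_iff: "0 < flat m x \<longleftrightarrow> 0 < x"
 by (auto simp: flat_def)

text \<open>With y = 1/x the claim is that the exponential outgrows every power; from the left the
  function is identically 0.\<close>

lemma flat_over_tendsto: "((\<lambda>x. flat m x) \<longlongrightarrow> 0) (at 0)"
proof -
 have "((\<lambda>y::real. y ^ m / exp y) \<longlongrightarrow> 0) at_top"
  by (rule tendsto_power_div_exp_0)
 then have "((\<lambda>x::real. inverse x ^ m / exp (inverse x)) \<longlongrightarrow> 0) (at_right 0)"
  by (rule filterlim_compose) (rule filterlim_inverse_at_top_right)
 then have "((\<lambda>x. flat m x) \<longlongrightarrow> 0) (at_right 0)"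
  by (rule Lim_transform_eventually)
   (auto simp: eventually_at_filter flat_def exp_minus divide_simps)
 moreover have "((\<lambda>x. flat m x) \<longlongrightarrow> 0) (at_left 0)"
  by (rule tendsto_eventually) (auto simp: eventually_at_filter flat_def)
 ultimately show ?thesis by (simp add: filterlim_split_at)
qed

lemma flat_has_derivative:
 "(flat m has_real_derivative - real m * flat (Suc m) x + flat (Suc (Suc m)) x) (at x)"
proof (cases x "0::real" rule: linorder_cases)
 case less
 have "(flat m has_real_derivative 0) (at x)"
 proof (rule DERIV_cong_ev[OF refl, THEN iffD1])
  show "((\<lambda>_. 0) has_real_derivative 0) (at x)" by simp
  show "\<forall>\<^sub>F y in nhds x. 0 = flat m y"
   using eventually_nhds_in_open[of "{..<0}" x] less
   by (auto simp: flat_def elim!: eventually_mono)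
 qed simp
 then show ?thesis using less by (simp add: flat_def)
next
 case greater
 have "((\<lambda>y. exp (- (1 / y)) / y ^ m) has_real_derivative
   (exp (- (1 / x)) * (1 / x\<^sup>2) * x ^ m - exp (- (1 / x)) * (real m * x ^ (m - 1))) / (x ^ m)\<^sup>2) (at x)"
  using greater by (auto intro!: derivative_eq_intros simp: power2_eq_square)
 moreover have "(exp (- (1 / x)) * (1 / x\<^sup>2) * x ^ m - exp (- (1 / x)) * (real m * x ^ (m - 1))) / (x ^ m)\<^sup>2
   = - real m * flat (Suc m) x + flat (Suc (Suc m)) x"
 proof (cases m)
  case (Suc j)
  have "(E * (1 / x\<^sup>2) * (x * X) - E * (real m * X)) / (x * X)\<^sup>2
    = - real m * (E / (x * (x * X))) + E / (x * (x * (x * X)))" if "X > 0" for E X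
   using that greater by (simp add: divide_simps power2_eq_square) (simp add: algebra_simps)
  from this[of "x ^ j" "exp (- (1 / x))"] show ?thesis using greater Suc by (simp add: flat_def)
 qed (use greater in \<open>simp add: flat_def power2_eq_square\<close>)
 ultimately have *: "((\<lambda>y. exp (- (1 / y)) / y ^ m) has_real_derivative
   - real m * flat (Suc m) x + flat (Suc (Suc m)) x) (at x)" by simp
 show ?thesis
 proof (rule DERIV_cong_ev[OF refl, THEN iffD1, OF _ _ *])
  show "\<forall>\<^sub>F y in nhds x. exp (- (1 / y)) / y ^ m = flat m y"
   using eventually_nhds_in_open[of "{0<..}" x] greater
   by (auto simp: flat_def elim!: eventually_mono)
 qed simp
next
 case equal
 \<comment> \<open>The difference quotient of \<open>flat m\<close> at 0 is
   \<open>flat (Suc m)\<close>, so differentiability at 0 is the limit already known, one index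
   higher.\<close>
 have "((\<lambda>h. flat (Suc m) h) \<longlongrightarrow> 0) (at 0)" by (rule flat_over_tendsto)
 then have "((\<lambda>h. (flat m (0 + h) - flat m 0) / h) \<longlongrightarrow> 0) (at 0)"
  by (rule Lim_transform_eventually) (auto simp: flat_def eventually_at_filter)
 then show ?thesis using equal by (simp add: DERIV_def flat_def)
qed

text \<open>Differentiation replaces \<open>flat m\<close> by a combination of the next two members
  of the family, so the induction on the order runs over all m at once.\<close>

lemma smooth_flat:
 assumes f: "smooth f"
 shows "smooth (\<lambda>z. flat m (f z))"
proof -
 have D: "((\<lambda>z. flat m (f z)) has_derivative
   (\<lambda>v. (- real m * flat (Suc m) (f z) + flat (Suc (Suc m)) (f z)) * dir_deriv f v z)) (at z)" for z m
  using has_derivative_compose[OF smooth_has_derivative[OF f]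
    flat_has_derivative[unfolded has_field_derivative_def]]
  by (simp add: mult.commute)
 have eq: "dir_deriv (\<lambda>z. flat m (f z)) v =
   (\<lambda>z. (- real m * flat (Suc m) (f z) + flat (Suc (Suc m)) (f z)) * dir_deriv f v z)" for v m
  by (intro ext dir_deriv_eq D)
 have "Ck k (\<lambda>z. flat m (f z))" for k
 proof (induction k arbitrary: m)
  case 0
  have "continuous_on UNIV (\<lambda>z. flat m (f z))"
   by (intro continuous_at_imp_continuous_on ballI differentiable_imp_continuous_within)
    (use D in \<open>auto simp: differentiable_def\<close>)
  then show ?case by simp
 next
  case (Suc k)
  have "Ck k (\<lambda>z. (- real m * flat (Suc m) (f z) + flat (Suc (Suc m)) (f z)) * dir_deriv f v z)" for v
   by (intro Ck_mult Ck_add Suc Ck_const) (use smooth_dir_deriv[OF f] in \<open>simp add: smooth_def\<close>)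
  then show ?case using D by (auto simp: eq differentiable_def)
 qed
 then show ?thesis by (simp add: smooth_def)
qed

text \<open>The argument is a polynomial in the coordinates; with the norm in place of its square,
  smoothness at the centre would need an extra argument.\<close>

definition bump :: "real => 'b::euclidean_space => real" where
 "bump r z = flat 0 (r\<^sup>2 - z \<bullet> z)"

lemma smooth_bump: "smooth (bump r :: 'b::euclidean_space => real)"
proof -
 have "smooth (\<lambda>z::'b. \<Sum>i\<in>Basis. (z \<bullet> i) * (z \<bullet> i))"
  by (intro smooth_sum smooth_mult smooth_linear) (auto simp: bounded_linear_inner_left)
 then have "smooth (\<lambda>z::'b. r\<^sup>2 + (-1) * (\<Sum>i\<in>Basis. (z \<bullet> i) * (z \<bullet> i)))"
  by (intro smooth_add smooth_mult) auto
 then have "smooth (\<lambda>z::'b. r\<^sup>2 - z \<bullet> z)" by (subst euclidean_inner) simp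
 then show ?thesis unfolding bump_def[abs_def] by (rule smooth_flat)
qed

lemma bump_nonneg: "0 <= bump r z"
 by (simp add: bump_def flat_nonneg)

lemma bump_pos_iff: "0 < r ==> 0 < bump r z \<longleftrightarrow> norm z < r"
 using power_strict_mono[of "norm z" r 2] power_less_imp_less_base[of "norm z" 2 r]
 by (auto simp: bump_def flat_pos_iff dot_square_norm)

lemma bump_eq_0: "0 < r ==> r <= norm z ==> bump r z = 0"
 using bump_pos_iff[of r z] bump_nonneg[of r z] by force

lemma test_functionI:
 "smooth f ==> compact K ==> K \<subseteq> \<Omega> ==> (!!z. z \<notin> K ==> f z = 0) ==> test_function \<Omega> f"
proof -
 assume *: "smooth f" "compact K" "K \<subseteq> \<Omega>" "!!z. z \<notin> K ==> f z = 0"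
 then have "closure {z. f z \<noteq> 0} \<subseteq> K"
  by (intro closure_minimal compact_imp_closed) auto
 moreover from this have "compact (closure {z. f z \<noteq> 0})"
  using * by (meson bounded_subset closed_closure compact_eq_bounded_closed)
 ultimately show ?thesis using * unfolding test_function_def smooth_def by auto
qed

lemma test_functionE:
 assumes "test_function \<Omega> f"
 obtains K where "smooth f" "compact K" "K \<subseteq> \<Omega>" "!!z. z \<notin> K ==> f z = 0"
proof (rule that[of "closure {z. f z \<noteq> 0}"])
 show "f z = 0" if "z \<notin> closure {z. f z \<noteq> 0}" for z
  using that closure_subset[of "{z. f z \<noteq> 0}"] by blast
qed (use assms in \<open>simp_all add: test_function_def smooth_def\<close>)

lemma dir_deriv_zero_off:
 assumes "compact K" "!!z. z \<notin> K ==> f z = 0" "z \<notin> K"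
 shows "dir_deriv f v z = 0"
proof (rule dir_deriv_eq)
 show "(f has_derivative (\<lambda>_. 0)) (at z)"
 proof (rule has_derivative_transform_within_open[of "\<lambda>_. 0"])
  show "open (- K)" using assms(1) by (simp add: compact_imp_closed open_Compl)
 qed (use assms in auto)
qed

lemma test_function_dir_deriv:
 assumes "test_function \<Omega> f"
 shows "test_function \<Omega> (dir_deriv f v)"
proof -
 from assms obtain K where "smooth f" "compact K" "K \<subseteq> \<Omega>" "!!z. z \<notin> K ==> f z = 0"
  by (rule test_functionE) blast
 then show ?thesis
  by (intro test_functionI[of _ K] smooth_dir_deriv dir_deriv_zero_off)
qed

section \<open>Invariance of Lebesgue measure, and functions of compact support\<close>

lemma nn_integral_lborel_translate:
 fixes a :: "'b::euclidean_space"
 assumes [measurable]: "f \<in> borel_measurable borel"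
 shows "(\<integral>\<^sup>+ z. f (a + z) \<partial>lborel) = (\<integral>\<^sup>+ z. f z \<partial>lborel)"
 by (subst lborel_distr_plus[symmetric, of a]) (simp add: nn_integral_distr)

lemma lborel_distr_reflect: "distr lborel borel (\<lambda>z. a - z) = (lborel :: 'b::euclidean_space measure)"
 by (subst lborel_affine[of "-1" a]) (auto simp: density_1)

lemma nn_integral_lborel_reflect:
 fixes a :: "'b::euclidean_space"
 assumes [measurable]: "f \<in> borel_measurable borel"
 shows "(\<integral>\<^sup>+ z. f (a - z) \<partial>lborel) = (\<integral>\<^sup>+ z. f z \<partial>lborel)"
 by (subst lborel_distr_reflect[symmetric, of a]) (simp add: nn_integral_distr)

lemma integral_lborel_translate:
 fixes a :: "'b::euclidean_space" and f :: "'b => real"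
 assumes [measurable]: "f \<in> borel_measurable borel"
 shows "(\<integral> z. f (a + z) \<partial>lborel) = (\<integral> z. f z \<partial>lborel)"
 by (subst lborel_distr_plus[symmetric, of a]) (simp add: integral_distr)

lemma integrable_lborel_translate:
 fixes a :: "'b::euclidean_space" and f :: "'b => real"
 assumes "integrable lborel f"
 shows "integrable lborel (\<lambda>z. f (a + z))"
 by (rule integrable_distr[where M=lborel and T="(+) a" and M'=borel])
  (use assms in \<open>simp_all add: lborel_distr_plus\<close>)

lemma integral_lborel_reflect:
 fixes a :: "'b::euclidean_space" and f :: "'b => real"
 assumes [measurable]: "f \<in> borel_measurable borel"
 shows "(\<integral> z. f (a - z) \<partial>lborel) = (\<integral> z. f z \<partial>lborel)"
 by (subst lborel_distr_reflect[symmetric, of a]) (simp add: integral_distr)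

lemma integrable_lborel_reflect:
 fixes a :: "'b::euclidean_space" and f :: "'b => real"
 assumes "integrable lborel f"
 shows "integrable lborel (\<lambda>z. f (a - z))"
 by (rule integrable_distr[where M=lborel and T="\<lambda>z. a - z" and M'=borel])
  (use assms in \<open>simp_all add: lborel_distr_reflect\<close>)

lemma integrable_compact_support:
 fixes f :: "'b::euclidean_space => real"
 assumes "continuous_on UNIV f" "compact K" "!!z. z \<notin> K ==> f z = 0"
 shows "integrable lborel f"
proof -
 have "integrable lborel (\<lambda>z. indicator K z *\<^sub>R f z)"
  using assms by (intro borel_integrable_compact) (auto intro: continuous_on_subset)
 moreover have "(\<lambda>z. indicator K z *\<^sub>R f z) = f"
  using assms(3) by (auto simp: indicator_def fun_eq_iff)
 ultimately show ?thesis by simp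
qed

lemma bounded_compact_support:
 fixes f :: "'b::euclidean_space => real"
 assumes "continuous_on UNIV f" "compact K" "!!z. z \<notin> K ==> f z = 0"
 obtains M where "M \<ge> 0" "!!z. \<bar>f z\<bar> <= M"
proof -
 have "bounded (f ` K)"
  using assms by (intro compact_imp_bounded compact_continuous_image) (auto intro: continuous_on_subset)
 then obtain M where "!!z. z \<in> K ==> \<bar>f z\<bar> <= M" by (auto simp: bounded_iff)
 then have "\<bar>f z\<bar> <= max M 0" for z
  using assms(3)[of z] by (cases "z \<in> K") (force simp: le_max_iff_disj)+
 then show ?thesis by (intro that[of "max M 0"]) auto
qed

lemma compact_cthicken:
 fixes K :: "'b::euclidean_space set"
 assumes "compact K"
 shows "compact {z + h | z h. z \<in> K \<and> h \<in> cball 0 r}"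
 using compact_sums[OF assms compact_cball[of 0 r]] .

text \<open>Heine-Cantor on the unit thickening \<open>L\<close> of \<open>K\<close>: if one of two
  points at distance below 1 lies in \<open>K\<close>, both lie in \<open>L\<close>; otherwise
  \<open>f\<close> vanishes at both.\<close>

lemma uniformly_continuous_compact_support:
 fixes f :: "'b::euclidean_space => real"
 assumes f: "continuous_on UNIV f" and K: "compact K" "!!z. z \<notin> K ==> f z = 0" and "e > 0"
 obtains d where "d > 0" "!!a b. norm (b - a) < d ==> \<bar>f b - f a\<bar> < e"
proof -
 define L where "L = {z + h | z h. z \<in> K \<and> h \<in> cball 0 1}"
 have "compact L" unfolding L_def by (rule compact_cthicken[OF K(1)])
 then have "uniformly_continuous_on L f"
  by (intro compact_uniformly_continuous continuous_on_subset[OF f]) auto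
 from uniformly_continuous_onE[OF this \<open>e > 0\<close>]
 obtain d where d: "d > 0" "!!a b. a \<in> L ==> b \<in> L ==> dist b a < d ==> dist (f b) (f a) < e"
  by blast
 have *: "y \<in> L" if "x \<in> K" "norm (y - x) < 1" for x y
  unfolding L_def using that by (intro CollectI exI[of _ x] exI[of _ "y - x"]) simp
 show ?thesis
 proof (rule that[of "min d 1"])
  show "0 < min d 1" using d(1) by simp
  fix a b :: 'b assume h: "norm (b - a) < min d 1"
  then have h': "norm (b - a) < d" "norm (b - a) < 1" "norm (a - b) < 1"
   by (auto simp: norm_minus_commute)
  show "\<bar>f b - f a\<bar> < e"
  proof (cases "a \<in> K \<or> b \<in> K")
   case True
   then have "a \<in> L \<and> b \<in> L"
    using *[of a a] *[of a b] *[of b a] *[of b b] h' by force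
   then show ?thesis using d(2)[of a b] h'(1) by (simp add: dist_norm)
  next
   case False
   then show ?thesis using K(2) \<open>e > 0\<close> by simp
  qed
 qed
qed

section \<open>Integration by parts against compactly supported functions\<close>

lemma segment_mvt:
 fixes f :: "'b::euclidean_space => real"
 assumes "!!z. f differentiable (at z)"
 obtains s where "0 < s" "s < 1" "f (a + h) - f a = dir_deriv f h (a + s *\<^sub>R h)"
proof -
 have "((\<lambda>s. f (a + s *\<^sub>R h)) has_real_derivative dir_deriv f h (a + s *\<^sub>R h)) (at s)" for s
 proof -
  have "((\<lambda>s. f (a + s *\<^sub>R h)) has_derivative (\<lambda>x. dir_deriv f (x *\<^sub>R h) (a + s *\<^sub>R h))) (at s)"
   by (rule has_derivative_compose[where g=f and f="\<lambda>s. a + s *\<^sub>R h"])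
    (auto intro!: derivative_eq_intros has_derivative_dir_deriv assms)
  moreover have "dir_deriv f (x *\<^sub>R h) z = dir_deriv f h z * x" for x z
   using linear_frechet_derivative[OF assms, of z]
   by (simp add: dir_deriv_def linear_cmul)
  ultimately show ?thesis by (simp add: has_field_derivative_def)
 qed
 from MVT2[of 0 1, OF _ this] obtain s where "0 < s" "s < 1"
  "f (a + 1 *\<^sub>R h) - f (a + 0 *\<^sub>R h) = (1 - 0) * dir_deriv f h (a + s *\<^sub>R h)"
  by auto
 then show ?thesis using that by auto
qed

lemma dir_deriv_scale:
 "f differentiable (at z) ==> dir_deriv f (c *\<^sub>R v) z = c * dir_deriv f v z"
 using linear_frechet_derivative[of f "at z"] by (simp add: dir_deriv_def linear_cmul)

lemma dir_deriv_basis: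
 fixes f :: "'b::euclidean_space => real"
 assumes "f differentiable (at z)"
 shows "dir_deriv f v z = (\<Sum>i\<in>Basis. (v \<bullet> i) * dir_deriv f i z)"
proof -
 have lin: "linear (frechet_derivative f (at z))" by (rule linear_frechet_derivative[OF assms])
 have "frechet_derivative f (at z) (\<Sum>i\<in>Basis. (v \<bullet> i) *\<^sub>R i) = (\<Sum>i\<in>Basis. (v \<bullet> i) * frechet_derivative f (at z) i)"
  by (simp add: linear_sum[OF lin] linear_cmul[OF lin])
 then show ?thesis by (simp add: dir_deriv_def euclidean_representation)
qed

text \<open>Difference quotients integrate to 0 by translation invariance. The mean value theorem
  bounds them by a constant on a thickened support, so dominated convergence carries this over to
  the derivative.\<close>

lemma integral_dir_deriv_eq_0:
 fixes f :: "'b::euclidean_space => real"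
 assumes f: "!!z. f differentiable (at z)" and c: "continuous_on UNIV (dir_deriv f v)"
  and K: "compact K" "!!z. z \<notin> K ==> f z = 0"
 shows "(LBINT z. dir_deriv f v z) = 0"
proof -
 have cf: "continuous_on UNIV f"
  using f by (auto intro!: continuous_at_imp_continuous_on differentiable_imp_continuous_within)
 have D0: "dir_deriv f v z = 0" if "z \<notin> K" for z using dir_deriv_zero_off[OF K that] .
 obtain M where M: "M \<ge> 0" "!!z. \<bar>dir_deriv f v z\<bar> <= M"
  using bounded_compact_support[OF c K(1) D0] by blast
 have if_: "integrable lborel f" by (rule integrable_compact_support[OF cf K])
 have [measurable]: "f \<in> borel_measurable borel" "dir_deriv f v \<in> borel_measurable borel"
  using cf c by (auto intro: borel_measurable_continuous_onI)
 define q where "q n z = real (Suc n) * (f ((1 / real (Suc n)) *\<^sub>R v + z) - f z)" for n z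
 let ?K = "{z + h | z h. z \<in> K \<and> h \<in> cball 0 (norm v)}"
 have K': "compact ?K" by (rule compact_cthicken[OF K(1)])
 have "(LBINT z. q n z) = 0" for n
  unfolding q_def using if_ integrable_lborel_translate[OF if_]
  by (simp add: integral_lborel_translate)
 moreover have "(\<lambda>n. LBINT z. q n z) \<longlonglongrightarrow> (LBINT z. dir_deriv f v z)"
 proof (rule integral_dominated_convergence[where w = "\<lambda>z. M * indicator ?K z"])
  show "integrable lborel (\<lambda>z. M * indicator ?K z)"
   using K' by (intro integrable_mult_right integrable_real_indicator)
    (use emeasure_compact_finite[OF K'] borel_compact[OF K'] in simp_all)
  show "AE z in lborel. (\<lambda>n. q n z) \<longlonglongrightarrow> dir_deriv f v z"
  proof (rule AE_I2)
   fix z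
   have "((\<lambda>s. f (z + s *\<^sub>R v)) has_derivative (\<lambda>x. dir_deriv f (x *\<^sub>R v) (z + 0 *\<^sub>R v))) (at 0)"
    by (rule has_derivative_compose[where g=f and f="\<lambda>s. z + s *\<^sub>R v"])
     (auto intro!: derivative_eq_intros has_derivative_dir_deriv f)
   then have "((\<lambda>s. f (z + s *\<^sub>R v)) has_real_derivative dir_deriv f v z) (at 0)"
    by (simp add: has_field_derivative_def dir_deriv_scale[OF f] mult_commute_abs)
   then have "((\<lambda>s. (f (z + s *\<^sub>R v) - f z) / s) \<longlongrightarrow> dir_deriv f v z) (at 0)"
    by (simp add: DERIV_def)
   moreover have "filterlim (\<lambda>n. 1 / real (Suc n)) (at 0) sequentially"
    unfolding filterlim_at by (intro conjI LIMSEQ_Suc[OF lim_1_over_n]) simp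
   ultimately have "(\<lambda>n. (f (z + (1 / real (Suc n)) *\<^sub>R v) - f z) / (1 / real (Suc n))) \<longlonglongrightarrow> dir_deriv f v z"
    by (rule filterlim_compose)
   then show "(\<lambda>n. q n z) \<longlonglongrightarrow> dir_deriv f v z"
    by (simp add: q_def add.commute mult.commute)
  qed
  show "AE z in lborel. norm (q n z) <= M * indicator ?K z" for n
  proof (rule AE_I2)
   fix z
   let ?h = "1 / real (Suc n)"
   obtain s where s: "0 < s" "s < 1" "f (z + ?h *\<^sub>R v) - f z = dir_deriv f (?h *\<^sub>R v) (z + s *\<^sub>R (?h *\<^sub>R v))"
    using segment_mvt[OF f] by metis
   then have q: "q n z = dir_deriv f v (z + s *\<^sub>R (?h *\<^sub>R v))"
    by (simp add: q_def dir_deriv_scale[OF f] add.commute)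
   show "norm (q n z) <= M * indicator ?K z"
   proof (cases "z + s *\<^sub>R (?h *\<^sub>R v) \<in> K")
    case True
    have "s * ?h <= 1 * 1" using s by (intro mult_mono) auto
    then have "(s * ?h) * norm v <= 1 * norm v" by (intro mult_right_mono) auto
    then have "norm (s *\<^sub>R (?h *\<^sub>R v)) <= 1 * norm v" using s(1) by simp
    then have "z \<in> ?K"
     using True by (intro CollectI exI[of _ "z + s *\<^sub>R (?h *\<^sub>R v)"] exI[of _ "- (s *\<^sub>R (?h *\<^sub>R v))"]) auto
    then show ?thesis using M(2) q by simp
   qed (use D0 q M in auto)
  qed
 qed (auto simp: q_def)
 ultimately show ?thesis by (simp add: LIMSEQ_const_iff)
qed

lemma integral_by_parts:
 fixes f g :: "'b::euclidean_space => real"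
 assumes f: "!!z. f differentiable (at z)" "continuous_on UNIV (dir_deriv f v)"
  and g: "!!z. g differentiable (at z)" "continuous_on UNIV (dir_deriv g v)"
  and K: "compact K" "!!z. z \<notin> K ==> g z = 0"
 shows "(LBINT z. f z * dir_deriv g v z) = - (LBINT z. dir_deriv f v z * g z)"
proof -
 have c: "continuous_on UNIV f" "continuous_on UNIV g"
  using f g by (auto intro!: continuous_at_imp_continuous_on differentiable_imp_continuous_within)
 have eq: "dir_deriv (\<lambda>z. f z * g z) v = (\<lambda>z. f z * dir_deriv g v z + dir_deriv f v z * g z)"
  using f g by (intro dir_deriv_mult) auto
 have "(LBINT z. dir_deriv (\<lambda>z. f z * g z) v z) = 0"
  by (rule integral_dir_deriv_eq_0[OF _ _ K(1)])
   (use f g c K in \<open>auto simp: eq intro!: continuous_intros\<close>)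
 moreover have "integrable lborel (\<lambda>z. f z * dir_deriv g v z)" "integrable lborel (\<lambda>z. dir_deriv f v z * g z)"
  by (rule integrable_compact_support[OF _ K(1)];
    use f g c K dir_deriv_zero_off[OF K] in \<open>auto intro!: continuous_intros\<close>)+
 ultimately show ?thesis by (simp add: eq)
qed

definition heat_op :: "('a::euclidean_space stfun) => 'a \<times> real => real" where
 "heat_op f z = dir_deriv f (0, 1) z - (\<Sum>i\<in>Basis. dir_deriv (dir_deriv f (i, 0)) (i, 0) z)"

text \<open>This is \<open>adjoint_op\<close> with the potential split off: for smooth
  \<open>f\<close> it is continuous, whereas the potential is only determined up to null sets and
  has to be treated separately.\<close>

definition adj_heat :: "('a::euclidean_space stfun) => 'a \<times> real => real" where
 "adj_heat f z = - dir_deriv f (0, 1) z - (\<Sum>i\<in>Basis. dir_deriv (dir_deriv f (i, 0)) (i, 0) z)"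

lemma adjoint_op_eq: "adjoint_op V f z = adj_heat f z + V z * f z"
 by (simp add: adjoint_op_def adj_heat_def)

lemma continuous_adj_heat: "smooth f ==> continuous_on A (adj_heat f)"
 unfolding adj_heat_def[abs_def] by (intro continuous_intros smooth_continuous smooth_dir_deriv)

lemma adj_heat_zero_off:
 assumes "compact K" "!!z. z \<notin> K ==> f z = 0" "z \<notin> K"
 shows "adj_heat f z = 0"
 using assms dir_deriv_zero_off[OF assms(1,2)] dir_deriv_zero_off[OF assms(1), of "dir_deriv f (i, 0)" for i]
 by (simp add: adj_heat_def)

text \<open>Each spatial term is integrated by parts twice, the time term once. The regularity asked
  of \<open>f\<close> is tailored to compositions with a twice differentiable function and to the
  Gauss kernel cut off near time 0.\<close>

lemma integral_adj_heat:
 fixes f \<phi> :: "'a::euclidean_space stfun"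
 assumes f: "!!z. f differentiable (at z)" "!!v. continuous_on UNIV (dir_deriv f v)"
  and f2: "!!i z. i \<in> Basis ==> dir_deriv f (i, 0) differentiable (at z)"
   "!!i. i \<in> Basis ==> continuous_on UNIV (dir_deriv (dir_deriv f (i, 0)) (i, 0))"
  and \<phi>: "smooth \<phi>" and K: "compact K" "!!z. z \<notin> K ==> \<phi> z = 0"
 shows "(LBINT z. f z * adj_heat \<phi> z) = (LBINT z. heat_op f z * \<phi> z)"
proof -
 note \<phi>' = smooth_D[OF \<phi>] smooth_continuous[OF smooth_dir_deriv[OF \<phi>]]
  smooth_D[OF smooth_dir_deriv[OF \<phi>]] smooth_continuous[OF smooth_dir_deriv[OF smooth_dir_deriv[OF \<phi>]]]
 have cf: "continuous_on UNIV f"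
  using f by (auto intro!: continuous_at_imp_continuous_on differentiable_imp_continuous_within)
 note off = dir_deriv_zero_off[OF K] and off2 = dir_deriv_zero_off[OF K(1) dir_deriv_zero_off[OF K]]
 have I1: "integrable lborel (\<lambda>z. f z * dir_deriv \<phi> (0, 1) z)"
  "integrable lborel (\<lambda>z. dir_deriv f (0, 1) z * \<phi> z)"
  "!!i. integrable lborel (\<lambda>z. f z * dir_deriv (dir_deriv \<phi> (i, 0)) (i, 0) z)"
  by (rule integrable_compact_support[OF _ K(1)];
    use f cf \<phi>' smooth_continuous[OF \<phi>] off off2 K in \<open>auto intro!: continuous_intros\<close>)+
 have I2: "!!i. i \<in> Basis ==> integrable lborel (\<lambda>z. dir_deriv (dir_deriv f (i, 0)) (i, 0) z * \<phi> z)"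
  by (rule integrable_compact_support[OF _ K(1)];
    use f2 smooth_continuous[OF \<phi>] K in \<open>auto intro!: continuous_intros\<close>)
 have t: "(LBINT z. f z * dir_deriv \<phi> (0, 1) z) = - (LBINT z. dir_deriv f (0, 1) z * \<phi> z)"
  by (rule integral_by_parts[OF _ _ _ _ K]) (use f \<phi>' in auto)
 have x: "(LBINT z. f z * dir_deriv (dir_deriv \<phi> (i, 0)) (i, 0) z) =
   (LBINT z. dir_deriv (dir_deriv f (i, 0)) (i, 0) z * \<phi> z)" if "i \<in> Basis" for i
  using integral_by_parts[OF f(1) f(2) \<phi>'(3) \<phi>'(4) K(1) off, of "(i, 0)" "(i, 0)"]
   integral_by_parts[OF f2(1)[OF that] f2(2)[OF that] \<phi>'(1) \<phi>'(2) K] by simp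
 have "(LBINT z. f z * adj_heat \<phi> z) =
   (LBINT z. - (f z * dir_deriv \<phi> (0, 1) z) - (\<Sum>i\<in>Basis. f z * dir_deriv (dir_deriv \<phi> (i, 0)) (i, 0) z))"
  by (simp only: adj_heat_def right_diff_distrib sum_distrib_left mult_minus_right)
 also have "\<dots> = - (LBINT z. f z * dir_deriv \<phi> (0, 1) z)
   - (\<Sum>i\<in>Basis. LBINT z. f z * dir_deriv (dir_deriv \<phi> (i, 0)) (i, 0) z)"
  using I1 by (subst lint_diff) (auto simp: lint_sum)
 also have "\<dots> = (LBINT z. dir_deriv f (0, 1) z * \<phi> z)
   - (\<Sum>i\<in>Basis. LBINT z. dir_deriv (dir_deriv f (i, 0)) (i, 0) z * \<phi> z)"
  using t x by simp
 also have "\<dots> = (LBINT z. dir_deriv f (0, 1) z * \<phi> z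
   - (\<Sum>i\<in>Basis. dir_deriv (dir_deriv f (i, 0)) (i, 0) z * \<phi> z))"
  using I1 I2 by (subst lint_diff) (auto simp: lint_sum)
 also have "\<dots> = (LBINT z. heat_op f z * \<phi> z)"
  by (simp only: heat_op_def left_diff_distrib sum_distrib_right)
 finally show ?thesis .
qed

section \<open>Convolution and mollifiers\<close>

definition conv :: "('b::euclidean_space => real) => ('b => real) => 'b => real" where
 "conv f \<rho> z = (LBINT \<zeta>. f \<zeta> * \<rho> (z - \<zeta>))"

lemma integrable_conv:
 fixes f \<rho> :: "'b::euclidean_space => real"
 assumes "integrable lborel f" "continuous_on UNIV \<rho>" "!!z. \<bar>\<rho> z\<bar> <= M"
 shows "integrable lborel (\<lambda>\<zeta>. f \<zeta> * \<rho> (z - \<zeta>))"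
proof (rule L1_bound[of _ "\<lambda>\<zeta>. M * f \<zeta>"])
 have [measurable]: "f \<in> borel_measurable borel" "\<rho> \<in> borel_measurable borel"
  using assms by (auto intro: borel_measurable_continuous_onI)
 show "(\<lambda>\<zeta>. f \<zeta> * \<rho> (z - \<zeta>)) \<in> borel_measurable lborel" by measurable
 have "0 <= M" using assms(3)[of 0] by linarith
 then show "AE \<zeta> in lborel. norm (f \<zeta> * \<rho> (z - \<zeta>)) <= norm (M * f \<zeta>)"
  using assms(3) by (auto simp: abs_mult mult.commute[of "\<bar>f _\<bar>"] intro!: mult_right_mono AE_I2)
qed (use assms in auto)

text \<open>All differentiation falls on \<rho>, whose partial derivatives are uniformly continuous;
  hence the first-order remainder of \<rho> is small uniformly in the base point and can be
  integrated against \<bar>f\<bar>.\<close>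

lemma conv_has_derivative:
 fixes f \<rho> :: "'b::euclidean_space => real"
 assumes f: "integrable lborel f" and \<rho>: "smooth \<rho>" and K: "compact K" "!!z. z \<notin> K ==> \<rho> z = 0"
 shows "(conv f \<rho> has_derivative (\<lambda>v. conv f (dir_deriv \<rho> v) z)) (at z)"
proof -
 note off = dir_deriv_zero_off[OF K]
 note c = smooth_continuous[OF \<rho>] smooth_continuous[OF smooth_dir_deriv[OF \<rho>]]
 have I: "integrable lborel (\<lambda>\<zeta>. f \<zeta> * \<rho> (z - \<zeta>))" for z
  using bounded_compact_support[OF c(1) K] integrable_conv[OF f c(1)] by metis
 have ID: "integrable lborel (\<lambda>\<zeta>. f \<zeta> * dir_deriv \<rho> v (z - \<zeta>))" for z v
  using bounded_compact_support[OF c(2) K(1) off] integrable_conv[OF f c(2)] by metis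
 have basis: "dir_deriv \<rho> v z = (\<Sum>i\<in>Basis. (v \<bullet> i) * dir_deriv \<rho> i z)" for v z
  by (rule dir_deriv_basis[OF smooth_D[OF \<rho>]])
 have lin: "conv f (dir_deriv \<rho> v) z = (\<Sum>i\<in>Basis. (v \<bullet> i) * conv f (dir_deriv \<rho> i) z)" for v z
 proof -
  have "conv f (dir_deriv \<rho> v) z = (LBINT \<zeta>. (\<Sum>i\<in>Basis. (v \<bullet> i) * (f \<zeta> * dir_deriv \<rho> i (z - \<zeta>))))"
   unfolding conv_def by (subst basis) (simp add: sum_distrib_left mult_ac)
  also have "\<dots> = (\<Sum>i\<in>Basis. (v \<bullet> i) * conv f (dir_deriv \<rho> i) z)"
   unfolding conv_def by (subst lint_sum) (use ID in auto)
  finally show ?thesis .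
 qed
 show ?thesis unfolding has_derivative_at_alt
 proof (intro conjI allI impI)
  show "bounded_linear (\<lambda>v. conv f (dir_deriv \<rho> v) z)"
  proof -
   have "(\<lambda>v. conv f (dir_deriv \<rho> v) z) = (\<lambda>v. \<Sum>i\<in>Basis. (v \<bullet> i) * conv f (dir_deriv \<rho> i) z)"
    by (rule ext, rule lin)
   then show ?thesis
    by (simp only:) (intro bounded_linear_sum bounded_linear_mult_const bounded_linear_inner_left)
  qed
  fix e :: real assume e: "0 < e"
  define A where "A = (LBINT \<zeta>. \<bar>f \<zeta>\<bar>)"
  have A: "A \<ge> 0" by (simp add: A_def)
  \<comment> \<open>The error is summed over the basis, whence the dimension, and then integrated
    against \<bar>f\<bar>, whence \<open>A\<close>; \<open>A + 1\<close> stays positive when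
    \<open>f\<close> vanishes almost everywhere.\<close>
  define e' where "e' = e / ((A + 1) * real DIM('b))"
  have e': "e' > 0" using e A by (simp add: e'_def)
  have "\<exists>d>0. \<forall>a b. norm (b - a) < d --> \<bar>dir_deriv \<rho> i b - dir_deriv \<rho> i a\<bar> < e'" for i
   using uniformly_continuous_compact_support[OF c(2) K(1) off e', of i] by metis
  then obtain d where d: "!!i. d i > 0"
   "!!i a b. norm (b - a) < d i ==> \<bar>dir_deriv \<rho> i b - dir_deriv \<rho> i a\<bar> < e'" by metis
  define D where "D = Min (d ` Basis)"
  have D: "D > 0" "!!i. i \<in> Basis ==> D <= d i" unfolding D_def using d(1) by auto
  have key: "\<bar>\<rho> (a + h) - \<rho> a - dir_deriv \<rho> h a\<bar> <= e / (A + 1) * norm h" if h: "norm h < D" for a h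
  proof -
   obtain s where s: "0 < s" "s < 1" "\<rho> (a + h) - \<rho> a = dir_deriv \<rho> h (a + s *\<^sub>R h)"
    using segment_mvt[OF smooth_D[OF \<rho>]] by metis
   have "s * norm h <= 1 * norm h" using s by (intro mult_right_mono) auto
   then have sh: "norm (s *\<^sub>R h) < d i" if "i \<in> Basis" for i using s h D(2)[OF that] by simp
   have "\<bar>\<rho> (a + h) - \<rho> a - dir_deriv \<rho> h a\<bar> = \<bar>\<Sum>i\<in>Basis. (h \<bullet> i) * (dir_deriv \<rho> i (a + s *\<^sub>R h) - dir_deriv \<rho> i a)\<bar>"
    unfolding s(3) basis[of h] by (simp only: right_diff_distrib sum_subtractf)
   also have "\<dots> <= (\<Sum>i\<in>Basis. \<bar>(h \<bullet> i) * (dir_deriv \<rho> i (a + s *\<^sub>R h) - dir_deriv \<rho> i a)\<bar>)"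
    by (rule sum_abs)
   also have "\<dots> <= (\<Sum>i\<in>(Basis :: 'b set). norm h * e')"
   proof (rule sum_mono)
    fix i :: 'b assume i: "i \<in> Basis"
    have "\<bar>dir_deriv \<rho> i (a + s *\<^sub>R h) - dir_deriv \<rho> i a\<bar> <= e'"
     using d(2)[of "a + s *\<^sub>R h" a i] sh[OF i] by simp
    then show "\<bar>(h \<bullet> i) * (dir_deriv \<rho> i (a + s *\<^sub>R h) - dir_deriv \<rho> i a)\<bar> <= norm h * e'"
     unfolding abs_mult using Basis_le_norm[OF i, of h] by (intro mult_mono) auto
   qed
   also have "\<dots> = e / (A + 1) * norm h" using A by (simp add: e'_def)
   finally show ?thesis .
  qed
  show "\<exists>d>0. \<forall>y. norm (y - z) < d -->
   norm (conv f \<rho> y - conv f \<rho> z - conv f (dir_deriv \<rho> (y - z)) z) <= e * norm (y - z)"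
  proof (intro exI[of _ D] conjI allI impI D(1))
   fix y assume y: "norm (y - z) < D"
   have "conv f \<rho> y - conv f \<rho> z - conv f (dir_deriv \<rho> (y - z)) z
    = (LBINT \<zeta>. f \<zeta> * (\<rho> (y - \<zeta>) - \<rho> (z - \<zeta>) - dir_deriv \<rho> (y - z) (z - \<zeta>)))"
    unfolding conv_def using I[of y] I[of z] ID[of "y - z" z] by (simp add: right_diff_distrib)
   also have "norm \<dots> <= (LBINT \<zeta>. \<bar>f \<zeta>\<bar> * (e / (A + 1) * norm (y - z)))"
   proof (rule Bochner_Integration.integral_norm_bound_integral)
    show "integrable lborel (\<lambda>\<zeta>. f \<zeta> * (\<rho> (y - \<zeta>) - \<rho> (z - \<zeta>) - dir_deriv \<rho> (y - z) (z - \<zeta>)))"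
     using I[of y] I[of z] ID[of "y - z" z] by (simp add: right_diff_distrib)
    fix \<zeta>
    show "norm (f \<zeta> * (\<rho> (y - \<zeta>) - \<rho> (z - \<zeta>) - dir_deriv \<rho> (y - z) (z - \<zeta>)))
     <= \<bar>f \<zeta>\<bar> * (e / (A + 1) * norm (y - z))"
     using mult_left_mono[OF key[OF y, of "z - \<zeta>"] abs_ge_zero[of "f \<zeta>"]]
     by (simp only: real_norm_def abs_mult) simp
   qed (use f in auto)
   also have "\<dots> = A / (A + 1) * (e * norm (y - z))" by (simp add: A_def)
   also have "\<dots> <= 1 * (e * norm (y - z))" using A e by (intro mult_right_mono) auto
   finally show "norm (conv f \<rho> y - conv f \<rho> z - conv f (dir_deriv \<rho> (y - z)) z) <= e * norm (y - z)" by simp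
  qed
 qed
qed

lemma dir_deriv_conv:
 fixes f \<rho> :: "'b::euclidean_space => real"
 assumes "integrable lborel f" "smooth \<rho>" "compact K" "!!z. z \<notin> K ==> \<rho> z = 0"
 shows "dir_deriv (conv f \<rho>) v = conv f (dir_deriv \<rho> v)"
 by (intro ext dir_deriv_eq conv_has_derivative[OF assms])

text \<open>A derivative of the convolution is the convolution with a derivative of \<rho>, which
  again vanishes off \<open>K\<close>; so the induction ranges over all such \<rho>.\<close>

lemma smooth_conv:
 fixes f \<rho> :: "'b::euclidean_space => real"
 assumes f: "integrable lborel f" and "smooth \<rho>" and K: "compact K" and "!!z. z \<notin> K ==> \<rho> z = 0"
 shows "smooth (conv f \<rho>)"
 unfolding smooth_def
proof
 fix k
 show "Ck k (conv f \<rho>)" using assms(2,4)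
 proof (induction k arbitrary: \<rho>)
  case 0
  then show ?case using conv_has_derivative[OF f 0(1) K 0(2)]
   by (auto intro!: continuous_at_imp_continuous_on has_derivative_continuous)
 next
  case (Suc k)
  then show ?case
   using conv_has_derivative[OF f Suc(2) K Suc(3)] dir_deriv_conv[OF f Suc(2) K Suc(3)]
    smooth_dir_deriv[OF Suc(2)] dir_deriv_zero_off[OF K Suc(3)]
   by (auto simp: differentiable_def)
 qed
qed

definition moll :: "real => 'b::euclidean_space => real" where
 "moll r z = bump r z / (LBINT z. bump r (z::'b))"

lemma integrable_bump: "0 < r ==> integrable lborel (bump r :: 'b::euclidean_space => real)"
 by (rule integrable_compact_support[of _ "cball 0 r"])
  (auto intro!: smooth_continuous smooth_bump bump_eq_0)

text \<open>A zero integral would make the bump vanish almost everywhere, although it is positive on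
  an open ball, which is not a null set.\<close>

lemma integral_bump_pos:
 assumes "0 < r"
 shows "0 < (LBINT z. bump r (z::'b::euclidean_space))"
proof -
 have "(LBINT z. bump r (z::'b)) \<noteq> 0"
 proof
  assume "(LBINT z. bump r (z::'b)) = 0"
  then have "AE z in lborel. bump r (z::'b) = 0"
   using integrable_bump[OF assms] bump_nonneg by (subst (asm) integral_nonneg_eq_0_iff_AE) auto
  then have "AE z in lborel. (z::'b) \<notin> ball 0 r"
   by eventually_elim (use bump_pos_iff[OF assms, where 'a='b] in force)
  then have "{z \<in> space lborel. \<not> (z::'b) \<notin> ball 0 r} \<in> null_sets lborel"
   by (subst AE_iff_null[symmetric]) auto
  then have "ball (0::'b) r \<in> null_sets (completion lborel)"
   by (intro null_sets_completionI) (simp add: ball_def)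
  then show False using open_not_negligible[of "ball (0::'b) r"] assms
   by (simp add: negligible_iff_null_sets)
 qed
 moreover have "0 <= (LBINT z. bump r (z::'b))" by (simp add: bump_nonneg)
 ultimately show ?thesis by linarith
qed

lemma
 assumes r: "0 < r"
 shows smooth_moll: "smooth (moll r :: 'b::euclidean_space => real)"
  and moll_nonneg: "0 <= moll r (z :: 'b)"
  and moll_eq_0: "z \<notin> cball 0 r ==> moll r (z :: 'b) = 0"
  and integrable_moll: "integrable lborel (moll r :: 'b => real)"
  and integral_moll: "(LBINT z. moll r (z::'b)) = 1"
  and moll_minus: "moll r (- z) = moll r (z :: 'b)"
proof -
 have "smooth (\<lambda>z::'b. bump r z * inverse (LBINT z. bump r (z::'b)))"
  by (intro smooth_mult smooth_bump smooth_const)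
 then show "smooth (moll r :: 'b => real)" by (simp add: moll_def[abs_def] divide_inverse)
 show "0 <= moll r z" using integral_bump_pos[OF r, where 'b='b] by (simp add: moll_def bump_nonneg)
 show "z \<notin> cball 0 r ==> moll r (z :: 'b) = 0" using bump_eq_0[OF r, of z] by (simp add: moll_def)
 show "integrable lborel (moll r :: 'b => real)"
  unfolding moll_def[abs_def] by (rule integrable_divide_zero) (use integrable_bump[OF r] in auto)
 show "(LBINT z. moll r (z::'b)) = 1"
  using integral_bump_pos[OF r, where 'b='b] by (simp add: moll_def)
 show "moll r (- z) = moll r z" by (simp add: moll_def bump_def)
qed

text \<open>Mollification at z is an average of \<open>f\<close> over the ball of radius r, so it is
  as close to \<open>a\<close> as \<open>f\<close> is there. The choice of \<open>a\<close> makes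
  this serve for limits as well as for plain bounds.\<close>

lemma conv_moll_close:
 fixes f :: "'b::euclidean_space => real"
 assumes r: "0 < r" and f: "integrable lborel f"
  and e: "!!\<zeta>. norm (\<zeta> - z) <= r ==> \<bar>f \<zeta> - a\<bar> <= e"
 shows "\<bar>conv f (moll r) z - a\<bar> <= e"
proof -
 have c: "continuous_on UNIV (moll r :: 'b => real)" by (rule smooth_continuous[OF smooth_moll[OF r]])
 have [measurable]: "(moll r :: 'b => real) \<in> borel_measurable borel"
  using c by (rule borel_measurable_continuous_onI)
 have I: "integrable lborel (\<lambda>\<zeta>. f \<zeta> * moll r (z - \<zeta>))"
  using bounded_compact_support[OF c compact_cball moll_eq_0[OF r]] integrable_conv[OF f c] by metis
 have I2: "integrable lborel (\<lambda>\<zeta>. moll r (z - \<zeta>))"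
  by (rule integrable_lborel_reflect[OF integrable_moll[OF r]])
 have one: "(LBINT \<zeta>. moll r (z - \<zeta>)) = 1"
  using integral_lborel_reflect[of "moll r" z] integral_moll[OF r, where 'b='b] by simp
 have "conv f (moll r) z - a = (LBINT \<zeta>. (f \<zeta> - a) * moll r (z - \<zeta>))"
  unfolding conv_def left_diff_distrib using I I2 one by simp
 also have "\<bar>\<dots>\<bar> <= (LBINT \<zeta>. e * moll r (z - \<zeta>))"
  unfolding real_norm_def[symmetric]
 proof (rule Bochner_Integration.integral_norm_bound_integral)
  fix \<zeta>
  show "norm ((f \<zeta> - a) * moll r (z - \<zeta>)) <= e * moll r (z - \<zeta>)"
  proof (cases "norm (\<zeta> - z) <= r")
   case True
   then show ?thesis using e moll_nonneg[OF r, of "z - \<zeta>"] by (auto simp: abs_mult intro!: mult_right_mono)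
  next
   case False
   then have "moll r (z - \<zeta>) = 0" by (intro moll_eq_0[OF r]) (auto simp: norm_minus_commute)
   then show ?thesis by simp
  qed
 qed (use I I2 in \<open>auto simp: left_diff_distrib\<close>)
 also have "\<dots> = e" using one by simp
 finally show ?thesis .
qed

lemma
 fixes g :: "'b::euclidean_space => real"
 assumes B: "!!x. (\<beta> has_real_derivative \<beta>' x) (at x)" "!!x. (\<beta>' has_real_derivative \<beta>'' x) (at x)"
  and g: "smooth g"
 shows comp_differentiable: "(\<lambda>z. \<beta> (g z)) differentiable (at z)"
  and dir_deriv_comp: "dir_deriv (\<lambda>z. \<beta> (g z)) v = (\<lambda>z. \<beta>' (g z) * dir_deriv g v z)"
  and dir_deriv_comp_differentiable: "dir_deriv (\<lambda>z. \<beta> (g z)) v differentiable (at z)"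
  and dir_deriv_dir_deriv_comp: "dir_deriv (dir_deriv (\<lambda>z. \<beta> (g z)) v) w =
    (\<lambda>z. \<beta>'' (g z) * dir_deriv g w z * dir_deriv g v z + \<beta>' (g z) * dir_deriv (dir_deriv g v) w z)"
proof -
 have C: "((\<lambda>z. b (g z)) has_derivative (\<lambda>v. b' (g z) * dir_deriv g v z)) (at z)"
  if "!!x. (b has_real_derivative b' x) (at x)" for b b' z
  using has_derivative_compose[OF smooth_has_derivative[OF g] that[unfolded has_field_derivative_def]] .
 show "(\<lambda>z. \<beta> (g z)) differentiable (at z)" using C[OF B(1)] by (auto simp: differentiable_def)
 show eq: "dir_deriv (\<lambda>z. \<beta> (g z)) v = (\<lambda>z. \<beta>' (g z) * dir_deriv g v z)"
  by (intro ext dir_deriv_eq C B)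
 have D: "((\<lambda>z. \<beta>' (g z) * dir_deriv g v z) has_derivative
   (\<lambda>w. \<beta>' (g z) * dir_deriv (dir_deriv g v) w z + \<beta>'' (g z) * dir_deriv g w z * dir_deriv g v z)) (at z)" for z
  by (intro has_derivative_mult C B smooth_has_derivative smooth_dir_deriv g)
 show "dir_deriv (\<lambda>z. \<beta> (g z)) v differentiable (at z)"
  unfolding eq using D by (auto simp: differentiable_def)
 show "dir_deriv (dir_deriv (\<lambda>z. \<beta> (g z)) v) w =
    (\<lambda>z. \<beta>'' (g z) * dir_deriv g w z * dir_deriv g v z + \<beta>' (g z) * dir_deriv (dir_deriv g v) w z)"
  unfolding eq by (subst add.commute) (intro ext dir_deriv_eq D)
qed

text \<open>The chain rule gives (\<partial>_t - \<Delta>) \<beta>(g) = \<beta>'(g) (\<partial>_t -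
  \<Delta>) g - \<beta>''(g) |\<nabla>g|^2, and convexity allows the last term to be dropped. This
  is Kato's inequality for smooth functions.\<close>

lemma integral_adj_heat_convex:
 fixes g \<phi> :: "'a::euclidean_space stfun"
 assumes B: "!!x. (\<beta> has_real_derivative \<beta>' x) (at x)" "!!x. (\<beta>' has_real_derivative \<beta>'' x) (at x)"
   "continuous_on UNIV \<beta>''" "!!x. 0 <= \<beta>'' x"
  and g: "smooth g"
  and \<phi>: "smooth \<phi>" "!!z. 0 <= \<phi> z" and K: "compact K" "!!z. z \<notin> K ==> \<phi> z = 0"
 shows "(LBINT z. \<beta> (g z) * adj_heat \<phi> z) <= (LBINT z. \<beta>' (g z) * heat_op g z * \<phi> z)"
proof -
 note cg = smooth_continuous[OF g, of UNIV] smooth_continuous[OF smooth_dir_deriv[OF g], of UNIV]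
  smooth_continuous[OF smooth_dir_deriv[OF smooth_dir_deriv[OF g]], of UNIV]
 have "continuous_on UNIV \<beta>'"
  using B(2) by (intro continuous_at_imp_continuous_on) (auto intro: DERIV_isCont)
 then have c': "continuous_on UNIV (\<lambda>z. \<beta>' (g z))" "continuous_on UNIV (\<lambda>z. \<beta>'' (g z))"
  using B(3) cg(1) by (auto intro: continuous_on_compose2)
 note d = comp_differentiable[OF B(1,2) g] dir_deriv_comp[OF B(1,2) g]
  dir_deriv_comp_differentiable[OF B(1,2) g] dir_deriv_dir_deriv_comp[OF B(1,2) g]
 have heat: "heat_op (\<lambda>z. \<beta> (g z)) z =
   \<beta>' (g z) * heat_op g z - \<beta>'' (g z) * (\<Sum>i\<in>Basis. (dir_deriv g (i, 0) z)\<^sup>2)" for z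
  unfolding heat_op_def d(4)
  by (simp only: d(2) sum.distrib sum_distrib_left right_diff_distrib power2_eq_square mult.assoc)
 have cHg: "continuous_on UNIV (heat_op g)"
  unfolding heat_op_def[abs_def] by (intro continuous_intros cg)
 have "(LBINT z. \<beta> (g z) * adj_heat \<phi> z) = (LBINT z. heat_op (\<lambda>z. \<beta> (g z)) z * \<phi> z)"
 proof (rule integral_adj_heat[OF d(1) _ d(3) _ \<phi>(1) K])
  show "continuous_on UNIV (dir_deriv (\<lambda>z. \<beta> (g z)) v)" for v
   unfolding d(2) by (intro continuous_intros c' cg)
  show "continuous_on UNIV (dir_deriv (dir_deriv (\<lambda>z. \<beta> (g z)) (i, 0)) (i, 0))" for i
   unfolding d(4) by (intro continuous_intros c' cg)
 qed
 also have "\<dots> <= (LBINT z. \<beta>' (g z) * heat_op g z * \<phi> z)"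
 proof (rule integral_mono)
  show "integrable lborel (\<lambda>z. heat_op (\<lambda>z. \<beta> (g z)) z * \<phi> z)"
   unfolding heat
   by (rule integrable_compact_support[OF _ K(1)])
    (use K(2) in \<open>auto intro!: continuous_intros c' cg cHg smooth_continuous[OF \<phi>(1)]\<close>)
  show "integrable lborel (\<lambda>z. \<beta>' (g z) * heat_op g z * \<phi> z)"
   by (rule integrable_compact_support[OF _ K(1)])
    (use K(2) in \<open>auto intro!: continuous_intros c' cg cHg smooth_continuous[OF \<phi>(1)]\<close>)
  show "heat_op (\<lambda>z. \<beta> (g z)) z * \<phi> z <= \<beta>' (g z) * heat_op g z * \<phi> z" for z
   unfolding heat using \<phi>(2)[of z] B(4)[of "g z"]
   by (intro mult_right_mono) (auto intro!: mult_nonneg_nonneg sum_nonneg)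
 qed
 finally show ?thesis .
qed

lemma dir_deriv_reflect:
 assumes "smooth f"
 shows "dir_deriv (\<lambda>\<zeta>. f (z - \<zeta>)) v = (\<lambda>\<zeta>. - dir_deriv f v (z - \<zeta>))"
proof (intro ext dir_deriv_eq)
 fix \<zeta>
 have "((\<lambda>\<zeta>. f (z - \<zeta>)) has_derivative (\<lambda>v. dir_deriv f (- v) (z - \<zeta>))) (at \<zeta>)"
  by (rule has_derivative_compose[where g=f and f="\<lambda>\<zeta>. z - \<zeta>"])
   (auto intro!: derivative_eq_intros smooth_has_derivative assms)
 moreover have "dir_deriv f (- v) w = - dir_deriv f v w" for v w
  using dir_deriv_scale[OF smooth_D[OF assms], of "-1" v w] by simp
 ultimately show "((\<lambda>\<zeta>. f (z - \<zeta>)) has_derivative (\<lambda>v. - dir_deriv f v (z - \<zeta>))) (at \<zeta>)" by simp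
qed

lemma smooth_reflect: "smooth f ==> smooth (\<lambda>\<zeta>. f (z - \<zeta>))"
 using smooth_affine[of f uminus z] by (simp add: bounded_linear_minus bounded_linear_ident)

lemma adj_heat_reflect:
 assumes "smooth f"
 shows "adj_heat (\<lambda>\<zeta>. f (z - \<zeta>)) \<zeta> = heat_op f (z - \<zeta>)"
proof -
 have "dir_deriv (\<lambda>\<zeta>. - dir_deriv f v (z - \<zeta>)) v = (\<lambda>\<zeta>. dir_deriv (dir_deriv f v) v (z - \<zeta>))" for v
 proof -
  have "dir_deriv (\<lambda>\<zeta>. - dir_deriv f v (z - \<zeta>)) v = dir_deriv (\<lambda>\<zeta>. (\<lambda>x. - 1 * x) (dir_deriv f v (z - \<zeta>))) v" by simp
  also have "\<dots> = (\<lambda>\<zeta>. - 1 * dir_deriv (\<lambda>\<zeta>. dir_deriv f v (z - \<zeta>)) v \<zeta>)"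
   by (rule dir_deriv_comp[where \<beta>''="\<lambda>_. 0"])
    (auto intro!: derivative_eq_intros smooth_reflect smooth_dir_deriv assms)
  finally show ?thesis by (simp add: dir_deriv_reflect[OF smooth_dir_deriv[OF assms]])
 qed
 then show ?thesis by (simp add: adj_heat_def heat_op_def dir_deriv_reflect[OF assms])
qed

text \<open>The derivatives in z fall on \<rho>(z - \<zeta>). Seen as a function of \<zeta>, the
  reflection flips the sign of the time derivative, so \<open>heat_op\<close> becomes
  \<open>adj_heat\<close>: mollifying means testing the weak equation with a reflected
  mollifier.\<close>

lemma heat_op_conv:
 fixes f \<rho> :: "'a::euclidean_space stfun"
 assumes f: "integrable lborel f" and \<rho>: "smooth \<rho>" and K: "compact K" "!!z. z \<notin> K ==> \<rho> z = 0"
 shows "heat_op (conv f \<rho>) z = (LBINT \<zeta>. f \<zeta> * adj_heat (\<lambda>\<zeta>. \<rho> (z - \<zeta>)) \<zeta>)"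
proof -
 note off = dir_deriv_zero_off[OF K]
 have I: "integrable lborel (\<lambda>\<zeta>. f \<zeta> * \<sigma> (z - \<zeta>))" if "smooth \<sigma>" "!!z. z \<notin> K ==> \<sigma> z = 0" for \<sigma>
  using bounded_compact_support[OF smooth_continuous[OF that(1)] K(1) that(2)]
   integrable_conv[OF f smooth_continuous[OF that(1)]] by metis
 have dc: "dir_deriv (conv f \<rho>) v = conv f (dir_deriv \<rho> v)" for v
  by (rule dir_deriv_conv[OF f \<rho> K])
 have dc2: "dir_deriv (conv f (dir_deriv \<rho> w)) v = conv f (dir_deriv (dir_deriv \<rho> w) v)" for v w
  by (rule dir_deriv_conv[OF f smooth_dir_deriv[OF \<rho>] K(1) off])
 have "heat_op (conv f \<rho>) z = conv f (dir_deriv \<rho> (0, 1)) z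
   - (\<Sum>i\<in>Basis. conv f (dir_deriv (dir_deriv \<rho> (i, 0)) (i, 0)) z)"
  unfolding heat_op_def dc dc2 ..
 also have "\<dots> = (LBINT \<zeta>. f \<zeta> * dir_deriv \<rho> (0, 1) (z - \<zeta>)
   - (\<Sum>i\<in>Basis. f \<zeta> * dir_deriv (dir_deriv \<rho> (i, 0)) (i, 0) (z - \<zeta>)))"
 proof -
  have "integrable lborel (\<lambda>\<zeta>. f \<zeta> * dir_deriv \<rho> (0, 1) (z - \<zeta>))"
   by (intro I smooth_dir_deriv \<rho> off)
  moreover have "integrable lborel (\<lambda>\<zeta>. f \<zeta> * dir_deriv (dir_deriv \<rho> (i, 0)) (i, 0) (z - \<zeta>))" for i
   by (intro I smooth_dir_deriv \<rho> dir_deriv_zero_off[OF K(1) off])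
  ultimately show ?thesis
   unfolding conv_def
   by (subst lint_diff) (auto simp: lint_sum)
 qed
 also have "\<dots> = (LBINT \<zeta>. f \<zeta> * heat_op \<rho> (z - \<zeta>))"
  by (simp only: heat_op_def right_diff_distrib sum_distrib_left)
 finally show ?thesis by (simp add: adj_heat_reflect[OF \<rho>])
qed

text \<open>A smooth convex approximation of \<bar>x\<bar> with derivative of modulus at most 1. As
  \<delta> tends to 0 the derivative tends to sgn x, including the value 0 at x = 0.\<close>

lemma
 fixes \<delta> :: real
 assumes \<delta>: "\<delta> > 0"
 shows sqrt_reg_deriv: "((\<lambda>x. sqrt (x\<^sup>2 + \<delta>\<^sup>2)) has_real_derivative x / sqrt (x\<^sup>2 + \<delta>\<^sup>2)) (at x)"
  and sqrt_reg_deriv2: "((\<lambda>x. x / sqrt (x\<^sup>2 + \<delta>\<^sup>2)) has_real_derivative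
    \<delta>\<^sup>2 / ((x\<^sup>2 + \<delta>\<^sup>2) * sqrt (x\<^sup>2 + \<delta>\<^sup>2))) (at x)"
  and sqrt_reg_pos: "0 < x\<^sup>2 + \<delta>\<^sup>2"
  and sqrt_reg_le: "sqrt (x\<^sup>2 + \<delta>\<^sup>2) <= \<bar>x\<bar> + \<delta>"
  and sqrt_reg_deriv_le: "\<bar>x / sqrt (x\<^sup>2 + \<delta>\<^sup>2)\<bar> <= 1"
proof -
 show p: "0 < x\<^sup>2 + \<delta>\<^sup>2" for x using \<delta> by (intro add_nonneg_pos) auto
 show D: "((\<lambda>x. sqrt (x\<^sup>2 + \<delta>\<^sup>2)) has_real_derivative x / sqrt (x\<^sup>2 + \<delta>\<^sup>2)) (at x)" for x
  using p[of x] by (auto intro!: derivative_eq_intros simp: field_simps)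
 have s: "sqrt (x\<^sup>2 + \<delta>\<^sup>2) > 0" "sqrt (x\<^sup>2 + \<delta>\<^sup>2) * sqrt (x\<^sup>2 + \<delta>\<^sup>2) = x\<^sup>2 + \<delta>\<^sup>2" for x using p[of x] by auto
 have "((\<lambda>x. x / sqrt (x\<^sup>2 + \<delta>\<^sup>2)) has_real_derivative
   (1 * sqrt (x\<^sup>2 + \<delta>\<^sup>2) - x * (x / sqrt (x\<^sup>2 + \<delta>\<^sup>2))) / (sqrt (x\<^sup>2 + \<delta>\<^sup>2) * sqrt (x\<^sup>2 + \<delta>\<^sup>2))) (at x)"
  using s(1)[of x] by (intro DERIV_divide D DERIV_ident) auto
 also have "(1 * sqrt (x\<^sup>2 + \<delta>\<^sup>2) - x * (x / sqrt (x\<^sup>2 + \<delta>\<^sup>2))) = \<delta>\<^sup>2 / sqrt (x\<^sup>2 + \<delta>\<^sup>2)"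
 proof -
  have "1 * r - x * (x / r) = (r * r - x\<^sup>2) / r" if "r > 0" for r
   using that by (simp add: diff_divide_distrib power2_eq_square)
  from this[OF s(1)] show ?thesis unfolding s(2) by simp
 qed
 finally show "((\<lambda>x. x / sqrt (x\<^sup>2 + \<delta>\<^sup>2)) has_real_derivative
    \<delta>\<^sup>2 / ((x\<^sup>2 + \<delta>\<^sup>2) * sqrt (x\<^sup>2 + \<delta>\<^sup>2))) (at x)"
  by (simp add: s(2) mult.commute)
 show "sqrt (x\<^sup>2 + \<delta>\<^sup>2) <= \<bar>x\<bar> + \<delta>"
  using sqrt_add_le_add_sqrt[of "x\<^sup>2" "\<delta>\<^sup>2"] \<delta> by simp
 have "\<bar>x\<bar> <= sqrt (x\<^sup>2 + \<delta>\<^sup>2)" by (rule real_le_rsqrt) simp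
 then show "\<bar>x / sqrt (x\<^sup>2 + \<delta>\<^sup>2)\<bar> <= 1" using s(1)[of x] by (simp add: abs_divide)
qed

text \<open>Convolution with an even kernel is self-adjoint. This moves the mollifier from the
  merely integrable right-hand side onto the test side, where pointwise limits can be
  controlled.\<close>

lemma Fubini_conv:
 fixes F \<psi> \<rho> :: "'b::euclidean_space => real"
 assumes F: "integrable lborel F" and \<psi>: "integrable lborel \<psi>"
  and \<rho>: "continuous_on UNIV \<rho>" "!!z. \<bar>\<rho> z\<bar> <= M" "!!z. \<rho> (- z) = \<rho> z"
 shows "(LBINT z. \<psi> z * conv F \<rho> z) = (LBINT \<zeta>. F \<zeta> * conv \<psi> \<rho> \<zeta>)"
proof -
 have [measurable]: "F \<in> borel_measurable borel" "\<psi> \<in> borel_measurable borel" "\<rho> \<in> borel_measurable borel"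
  using F \<psi> \<rho> by (auto intro: borel_measurable_continuous_onI)
 have "0 <= M" using \<rho>(2)[of 0] by linarith
 have "integrable (lborel \<Otimes>\<^sub>M lborel) (\<lambda>(z, \<zeta>). \<psi> z * F \<zeta>)"
 proof (rule lborel_pair.Fubini_integrable)
  show "(\<lambda>(z, \<zeta>). \<psi> z * F \<zeta>) \<in> borel_measurable (lborel \<Otimes>\<^sub>M lborel)" by measurable
 qed (use F \<psi> in \<open>auto simp: abs_mult\<close>)
 then have "integrable (lborel \<Otimes>\<^sub>M lborel) (\<lambda>p. M * (case p of (z, \<zeta>) => \<psi> z * F \<zeta>))" by simp
 then have "integrable (lborel \<Otimes>\<^sub>M lborel) (\<lambda>(z, \<zeta>). \<psi> z * (F \<zeta> * \<rho> (z - \<zeta>)))"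
 proof (rule L1_bound)
  show "(\<lambda>(z, \<zeta>). \<psi> z * (F \<zeta> * \<rho> (z - \<zeta>))) \<in> borel_measurable (lborel \<Otimes>\<^sub>M lborel)" by measurable
  show "AE p in lborel \<Otimes>\<^sub>M lborel. norm (case p of (z, \<zeta>) => \<psi> z * (F \<zeta> * \<rho> (z - \<zeta>)))
    <= norm (M * (case p of (z, \<zeta>) => \<psi> z * F \<zeta>))"
  proof (intro AE_I2, clarsimp simp: abs_mult)
   fix z \<zeta> :: 'b
   have "\<bar>\<psi> z\<bar> * \<bar>F \<zeta>\<bar> * \<bar>\<rho> (z - \<zeta>)\<bar> <= \<bar>\<psi> z\<bar> * \<bar>F \<zeta>\<bar> * M" by (intro mult_left_mono \<rho>) auto
   then show "\<bar>\<psi> z\<bar> * (\<bar>F \<zeta>\<bar> * \<bar>\<rho> (z - \<zeta>)\<bar>) <= \<bar>M\<bar> * (\<bar>\<psi> z\<bar> * \<bar>F \<zeta>\<bar>)"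
    using \<open>0 <= M\<close> by (simp add: mult_ac)
  qed
 qed
 note Fub = lborel_pair.Fubini_integral[OF this]
 have sym: "\<rho> (z - \<zeta>) = \<rho> (\<zeta> - z)" for z \<zeta> using \<rho>(3)[of "z - \<zeta>"] by simp
 have "(LBINT z. \<psi> z * conv F \<rho> z) = (LBINT z. (LBINT \<zeta>. \<psi> z * (F \<zeta> * \<rho> (z - \<zeta>))))"
  by (simp add: conv_def)
 also have "\<dots> = (LBINT \<zeta>. (LBINT z. \<psi> z * (F \<zeta> * \<rho> (z - \<zeta>))))" using Fub by simp
 also have "\<dots> = (LBINT \<zeta>. (LBINT z. F \<zeta> * (\<psi> z * \<rho> (\<zeta> - z))))"
  by (simp add: sym[of _ "_::'b"] mult_ac)
 also have "\<dots> = (LBINT \<zeta>. F \<zeta> * conv \<psi> \<rho> \<zeta>)" by (simp add: conv_def)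
 finally show ?thesis .
qed

section \<open>Kato's inequality\<close>

text \<open>Mollify \<open>d\<close>, apply the convex smooth case with sqrt(x^2 + \<delta>^2), let
  the mollification radius tend to 0 at fixed \<delta>, and then \<delta>. Continuity of
  \<open>d\<close> makes the mollifications converge at every point of the support, so that
  \<beta>'(d) is the correct limit factor in front of \<open>F\<close>.\<close>

lemma kato:
 fixes d F :: "'a::euclidean_space stfun"
 assumes \<Omega>: "open \<Omega>" and d: "continuous_on \<Omega> d"
  and Fm[measurable]: "F \<in> borel_measurable borel"
  and F: "!!K. compact K ==> K \<subseteq> \<Omega> ==> set_integrable lborel K F"
  and weak: "!!\<phi>. test_function \<Omega> \<phi> ==> (LBINT z. d z * adj_heat \<phi> z) = (LBINT z. F z * \<phi> z)"
  and \<phi>: "test_function \<Omega> \<phi>" "!!z. 0 <= \<phi> z"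
 shows "(LBINT z. \<bar>d z\<bar> * adj_heat \<phi> z) <= (LBINT z. sgn (d z) * F z * \<phi> z)"
proof -
 obtain K where s\<phi>: "smooth \<phi>" and K: "compact K" "K \<subseteq> \<Omega>" "!!z. z \<notin> K ==> \<phi> z = 0"
  using \<phi>(1) by (rule test_functionE) blast
 obtain r0' where r0': "r0' > 0" "(\<Union>x\<in>K. ball x r0') \<subseteq> \<Omega>"
  using compact_subset_open_imp_ball_epsilon_subset[OF K(1) \<Omega> K(2)] by metis
 \<comment> \<open>Half the radius, so that the closed thickening \<open>L\<close> stays inside the
   open balls around \<open>K\<close> that are contained in \<Omega>.\<close>
 define r0 where "r0 = r0' / 2"
 have r0: "r0 > 0" using r0' by (simp add: r0_def)
 define L where "L = {z + h | z h. z \<in> K \<and> h \<in> cball 0 r0}"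
 have L: "compact L" unfolding L_def by (rule compact_cthicken[OF K(1)])
 have inL: "\<zeta> \<in> L" if "z \<in> K" "norm (\<zeta> - z) <= r0" for z \<zeta>
  unfolding L_def using that by (intro CollectI exI[of _ z] exI[of _ "\<zeta> - z"]) simp
 have L\<Omega>: "L \<subseteq> \<Omega>"
 proof
  fix x assume "x \<in> L"
  then obtain z h where "x = z + h" "z \<in> K" "norm h <= r0" unfolding L_def by auto
  then have "x \<in> (\<Union>x\<in>K. ball x r0')" using r0 by (auto simp: r0_def dist_norm intro!: bexI[of _ z])
  then show "x \<in> \<Omega>" using r0'(2) by (rule subsetD[rotated])
 qed
 have KL: "K \<subseteq> L" using inL r0 by force
 have [measurable]: "L \<in> sets borel" "K \<in> sets borel"
  using L K(1) by (auto intro: borel_compact)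
 \<comment> \<open>Cutting off to \<open>L\<close> makes both functions integrable on the whole
   space without changing anything that a mollifier centred in \<open>K\<close> can see.\<close>
 define d' where "d' = (\<lambda>z. indicator L z * d z)"
 define F' where "F' = (\<lambda>z. indicator L z * F z)"
 have d'i: "integrable lborel d'"
  using borel_integrable_compact[OF L continuous_on_subset[OF d L\<Omega>]] by (simp add: d'_def)
 have F'i: "integrable lborel F'"
  using F[OF L L\<Omega>] by (simp add: F'_def set_integrable_def)
 have [measurable]: "d' \<in> borel_measurable borel" "F' \<in> borel_measurable borel"
  using d'i F'i by auto
 have cdL: "continuous_on L d" by (rule continuous_on_subset[OF d L\<Omega>])
 obtain Md where Md: "!!z. z \<in> L ==> \<bar>d z\<bar> <= Md"
  using compact_imp_bounded[OF compact_continuous_image[OF cdL L]] by (auto simp: bounded_iff)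
 have Md': "\<bar>d' z\<bar> <= \<bar>Md\<bar>" for z using Md[of z] by (cases "z \<in> L") (auto simp: d'_def)
 have c\<phi>: "continuous_on UNIV \<phi>" and ca: "continuous_on UNIV (adj_heat \<phi>)"
  using s\<phi> by (auto intro: smooth_continuous continuous_adj_heat)
 have aoff: "adj_heat \<phi> z = 0" if "z \<notin> K" for z using adj_heat_zero_off[OF K(1,3) that] .
 obtain M where M: "M \<ge> 0" "!!z. \<bar>\<phi> z\<bar> <= M" using bounded_compact_support[OF c\<phi> K(1,3)] by blast
 have i\<phi>: "integrable lborel \<phi>" and ia: "integrable lborel (adj_heat \<phi>)"
  by (rule integrable_compact_support[OF _ K(1)]; use c\<phi> ca K(3) aoff in auto)+
 have [measurable]: "\<phi> \<in> borel_measurable borel" "adj_heat \<phi> \<in> borel_measurable borel"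
  using c\<phi> ca by (auto intro: borel_measurable_continuous_onI)
 \<comment> \<open>The double \<open>Suc\<close> gives \<open>2 * r n <= r0\<close>: a point within
   \<open>r n\<close> of \<open>K\<close>, averaged over a ball of radius \<open>r n\<close>, still
   sees only \<open>L\<close>.\<close>
 define r where "r n = r0 / real (Suc (Suc n))" for n
 have r: "r n > 0" "2 * r n <= r0" for n using r0 by (auto simp: r_def field_simps)
 have rlim: "r \<longlonglongrightarrow> 0"
 proof -
  have "(\<lambda>n. r0 * (1 / real (Suc (Suc n)))) \<longlonglongrightarrow> r0 * 0"
   by (intro tendsto_mult tendsto_const LIMSEQ_Suc[OF LIMSEQ_Suc[OF lim_1_over_n]])
  then show ?thesis by (simp add: r_def[abs_def])
 qed
 define D where "D n = conv d' (moll (r n))" for n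
 note mo = smooth_moll[OF r(1)] moll_eq_0[OF r(1)] moll_nonneg[OF r(1)]
 have sD: "smooth (D n)" for n
  unfolding D_def by (rule smooth_conv[OF d'i mo(1) compact_cball mo(2)])
 have cD: "continuous_on UNIV (D n)" for n by (rule smooth_continuous[OF sD])
 have [measurable]: "D n \<in> borel_measurable borel" for n
  using cD by (auto intro: borel_measurable_continuous_onI)
 have near: "norm (\<zeta> - z) <= r0" if "norm (\<zeta> - z) <= r n" for \<zeta> z :: "'a \<times> real" and n
  using that r[of n] by linarith
 \<comment> \<open>On \<open>K\<close> the mollified function satisfies the equation pointwise,
   because the reflected mollifier is then a test function supported in \<Omega>.\<close>
 have heatD: "heat_op (D n) z = conv F' (moll (r n)) z" if z: "z \<in> K" for n z
 proof -
  let ?\<rho> = "\<lambda>\<zeta>. moll (r n) (z - \<zeta>)"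
  have off: "?\<rho> \<zeta> = 0" if "\<zeta> \<notin> cball z (r n)" for \<zeta>
   using that by (intro mo(2)) (simp add: dist_norm norm_minus_commute[of \<zeta> z])
  have sub: "cball z (r n) \<subseteq> L"
  proof
   fix y assume "y \<in> cball z (r n)"
   then have "norm (y - z) <= r n" by (simp add: dist_norm norm_minus_commute)
   from inL[OF z near[OF this]] show "y \<in> L" .
  qed
  have "heat_op (D n) z = (LBINT \<zeta>. d' \<zeta> * adj_heat ?\<rho> \<zeta>)"
   unfolding D_def by (rule heat_op_conv[OF d'i mo(1) compact_cball mo(2)])
  also have "\<dots> = (LBINT \<zeta>. d \<zeta> * adj_heat ?\<rho> \<zeta>)"
  proof (intro lint_cong)
   fix \<zeta>
   show "d' \<zeta> * adj_heat ?\<rho> \<zeta> = d \<zeta> * adj_heat ?\<rho> \<zeta>"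
   proof (cases "\<zeta> \<in> cball z (r n)")
    case True
    then have "\<zeta> \<in> L" using sub by (rule subsetD[rotated])
    then show ?thesis by (simp add: d'_def)
   next
    case False
    have "adj_heat ?\<rho> \<zeta> = 0" by (rule adj_heat_zero_off[OF compact_cball off False])
    then show ?thesis by simp
   qed
  qed
  also have "\<dots> = (LBINT \<zeta>. F \<zeta> * ?\<rho> \<zeta>)"
   by (rule weak, rule test_functionI[OF smooth_reflect[OF mo(1)] compact_cball order_trans[OF sub L\<Omega>] off])
  also have "\<dots> = conv F' (moll (r n)) z"
   unfolding conv_def
  proof (intro lint_cong)
   fix \<zeta>
   show "F \<zeta> * ?\<rho> \<zeta> = F' \<zeta> * ?\<rho> \<zeta>"
   proof (cases "\<zeta> \<in> cball z (r n)")
    case True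
    then have "\<zeta> \<in> L" using sub by (rule subsetD[rotated])
    then show ?thesis by (simp add: F'_def)
   next
    case False
    show ?thesis using off[OF False] by simp
   qed
  qed
  finally show ?thesis .
 qed
 have Dclose: "\<bar>D n z - d \<zeta>\<bar> <= e"
  if \<zeta>: "\<zeta> \<in> K" and n: "norm (z - \<zeta>) <= r n"
   and e: "!!y. y \<in> L ==> norm (y - \<zeta>) <= 2 * r n ==> \<bar>d y - d \<zeta>\<bar> <= e" for \<zeta> z n e
  unfolding D_def
 proof (rule conv_moll_close[OF r(1) d'i])
  fix y assume y: "norm (y - z) <= r n"
  have "norm (y - \<zeta>) <= norm (y - z) + norm (z - \<zeta>)" by (rule norm_diff_triangle_le) auto
  then have *: "norm (y - \<zeta>) <= 2 * r n" using y n by linarith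
  then have "y \<in> L" using inL[OF \<zeta>, of y] r(2)[of n] by linarith
  then show "\<bar>d' y - d \<zeta>\<bar> <= e" using e * by (simp add: d'_def)
 qed
 have dcont: "\<exists>N. \<forall>n\<ge>N. \<forall>y\<in>L. norm (y - \<zeta>) <= 2 * r n --> \<bar>d y - d \<zeta>\<bar> <= e" if \<zeta>: "\<zeta> \<in> K" and e: "e > 0" for \<zeta> e
 proof -
  have "\<zeta> \<in> L" using \<zeta> KL by auto
  then obtain \<eta> where \<eta>: "\<eta> > 0" "!!y. y \<in> L ==> dist y \<zeta> < \<eta> ==> dist (d y) (d \<zeta>) < e"
   using cdL e unfolding continuous_on_iff by metis
  have "eventually (\<lambda>n. r n < \<eta> / 2) sequentially" using \<eta>(1) by (intro order_tendstoD(2)[OF rlim]) simp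
  then obtain N where N: "!!n. n \<ge> N ==> r n < \<eta> / 2" by (auto simp: eventually_sequentially)
  have "\<bar>d y - d \<zeta>\<bar> <= e" if "n \<ge> N" "y \<in> L" "norm (y - \<zeta>) <= 2 * r n" for n y
  proof -
   have "norm (y - \<zeta>) < \<eta>" using N[OF that(1)] that(3) by linarith
   then show ?thesis using \<eta>(2)[OF that(2)] by (simp add: dist_norm)
  qed
  then show ?thesis by blast
 qed
 have Dlim: "(\<lambda>n. D n z) \<longlonglongrightarrow> d z" if z: "z \<in> K" for z
 proof (rule LIMSEQ_I)
  fix e :: real assume "e > 0"
  then obtain N where N: "!!n y. n \<ge> N ==> y \<in> L ==> norm (y - z) <= 2 * r n ==> \<bar>d y - d z\<bar> <= e / 2"
   using dcont[OF z, of "e / 2"] by auto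
  have "norm (D n z - d z) < e" if "n \<ge> N" for n
  proof -
   have "\<bar>D n z - d z\<bar> <= e / 2" using r(1)[of n] by (intro Dclose[OF z] N[OF that]) auto
   then show ?thesis using \<open>e > 0\<close> by simp
  qed
  then show "\<exists>N. \<forall>n\<ge>N. norm (D n z - d z) < e" by blast
 qed
 have Dbd: "\<bar>D n z\<bar> <= \<bar>Md\<bar>" for n z
  using conv_moll_close[OF r(1) d'i, of z n 0 "\<bar>Md\<bar>"] Md' by (simp add: D_def)
 have reg: "(LBINT z. sqrt ((d z)\<^sup>2 + \<delta>\<^sup>2) * adj_heat \<phi> z)
   <= (LBINT z. F' z * (d z / sqrt ((d z)\<^sup>2 + \<delta>\<^sup>2) * \<phi> z))" if \<delta>: "\<delta> > 0" for \<delta>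
 proof -
  let ?b = "\<lambda>x. sqrt (x\<^sup>2 + \<delta>\<^sup>2)" and ?b' = "\<lambda>x. x / sqrt (x\<^sup>2 + \<delta>\<^sup>2)"
  have pos: "x\<^sup>2 + \<delta>\<^sup>2 \<noteq> 0" "sqrt (x\<^sup>2 + \<delta>\<^sup>2) \<noteq> 0" for x using sqrt_reg_pos[OF \<delta>, of x] by auto
  have cb': "continuous_on A ?b'" for A by (intro continuous_intros ballI pos)
  \<comment> \<open>The function against which the mollified right-hand side is integrated; it
    depends on n through \<beta>'(D n), which is why its convergence needs care.\<close>
  define \<psi> where "\<psi> n z = ?b' (D n z) * \<phi> z" for n z
  have c\<psi>: "continuous_on UNIV (\<psi> n)" for n
   unfolding \<psi>_def[abs_def] by (intro continuous_intros c\<phi> cD ballI pos)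
  have \<psi>off: "\<psi> n z = 0" if "z \<notin> K" for n z using K(3)[OF that] by (simp add: \<psi>_def)
  have \<psi>i: "integrable lborel (\<psi> n)" for n by (rule integrable_compact_support[OF c\<psi> K(1) \<psi>off])
  have \<psi>bd: "\<bar>\<psi> n z\<bar> <= M" for n z
  proof -
   have "\<bar>\<psi> n z\<bar> <= 1 * M"
    unfolding \<psi>_def abs_mult by (intro mult_mono sqrt_reg_deriv_le[OF \<delta>] M) auto
   then show ?thesis by simp
  qed
  have ineq: "(LBINT z. ?b (D n z) * adj_heat \<phi> z) <= (LBINT \<zeta>. F' \<zeta> * conv (\<psi> n) (moll (r n)) \<zeta>)" for n
  proof -
   have "(LBINT z. ?b (D n z) * adj_heat \<phi> z) <= (LBINT z. ?b' (D n z) * heat_op (D n) z * \<phi> z)"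
    by (rule integral_adj_heat_convex[OF sqrt_reg_deriv[OF \<delta>] sqrt_reg_deriv2[OF \<delta>] _ _ sD s\<phi> \<phi>(2) K(1,3)])
     (use \<delta> in \<open>auto intro!: continuous_intros simp: pos less_imp_le[OF sqrt_reg_pos[OF \<delta>]]\<close>)
   also have "\<dots> = (LBINT z. \<psi> n z * conv F' (moll (r n)) z)"
   proof (intro lint_cong)
    fix z
    show "?b' (D n z) * heat_op (D n) z * \<phi> z = \<psi> n z * conv F' (moll (r n)) z"
     using heatD[of z n] K(3)[of z] by (cases "z \<in> K") (simp_all add: \<psi>_def)
   qed
   also have "\<dots> = (LBINT \<zeta>. F' \<zeta> * conv (\<psi> n) (moll (r n)) \<zeta>)"
   proof -
    obtain Mm where "!!z::'a \<times> real. \<bar>moll (r n) z\<bar> <= Mm"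
     using bounded_compact_support[OF smooth_continuous[OF mo(1)] compact_cball mo(2)] by metis
    then show ?thesis
     by (intro Fubini_conv[OF F'i \<psi>i smooth_continuous[OF mo(1)]] moll_minus[OF r(1)])
   qed
   finally show ?thesis .
  qed
  have lhs: "(\<lambda>n. LBINT z. ?b (D n z) * adj_heat \<phi> z) \<longlonglongrightarrow> (LBINT z. ?b (d' z) * adj_heat \<phi> z)"
  proof (rule integral_dominated_convergence[where w = "\<lambda>z. (\<bar>Md\<bar> + \<delta>) * \<bar>adj_heat \<phi> z\<bar>"])
   show "integrable lborel (\<lambda>z. (\<bar>Md\<bar> + \<delta>) * \<bar>adj_heat \<phi> z\<bar>)" using ia by simp
   show "AE z in lborel. (\<lambda>n. ?b (D n z) * adj_heat \<phi> z) \<longlonglongrightarrow> ?b (d' z) * adj_heat \<phi> z"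
   proof (rule AE_I2)
    fix z
    show "(\<lambda>n. ?b (D n z) * adj_heat \<phi> z) \<longlonglongrightarrow> ?b (d' z) * adj_heat \<phi> z"
    proof (cases "z \<in> K")
     case True
     then have "d' z = d z" using KL by (auto simp: d'_def)
     then show ?thesis using Dlim[OF True] by (auto intro!: tendsto_intros)
    qed (simp add: aoff)
   qed
   show "AE z in lborel. norm (?b (D n z) * adj_heat \<phi> z) <= (\<bar>Md\<bar> + \<delta>) * \<bar>adj_heat \<phi> z\<bar>" for n
   proof (rule AE_I2)
    fix z
    have "\<bar>?b (D n z)\<bar> <= \<bar>Md\<bar> + \<delta>" using sqrt_reg_le[OF \<delta>, of "D n z"] Dbd[of n z] by simp
    then show "norm (?b (D n z) * adj_heat \<phi> z) <= (\<bar>Md\<bar> + \<delta>) * \<bar>adj_heat \<phi> z\<bar>"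
     unfolding real_norm_def abs_mult by (intro mult_right_mono) auto
   qed
  qed measurable
  have rhs: "(\<lambda>n. LBINT \<zeta>. F' \<zeta> * conv (\<psi> n) (moll (r n)) \<zeta>)
   \<longlonglongrightarrow> (LBINT \<zeta>. F' \<zeta> * (?b' (d' \<zeta>) * \<phi> \<zeta>))"
  proof (rule integral_dominated_convergence[where w = "\<lambda>z. \<bar>F' z\<bar> * M"])
   show "integrable lborel (\<lambda>z. \<bar>F' z\<bar> * M)" using F'i by simp
   have "conv (\<psi> n) (moll (r n)) \<in> borel_measurable borel" for n
    by (intro borel_measurable_continuous_onI smooth_continuous smooth_conv[OF \<psi>i mo(1) compact_cball mo(2)])
   then show "(\<lambda>\<zeta>. F' \<zeta> * conv (\<psi> n) (moll (r n)) \<zeta>) \<in> borel_measurable lborel" for n by simp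
   show "AE z in lborel. norm (F' z * conv (\<psi> n) (moll (r n)) z) <= \<bar>F' z\<bar> * M" for n
   proof (rule AE_I2)
    fix z
    have "\<bar>conv (\<psi> n) (moll (r n)) z - 0\<bar> <= M"
     by (rule conv_moll_close[OF r(1) \<psi>i]) (simp add: \<psi>bd)
    then show "norm (F' z * conv (\<psi> n) (moll (r n)) z) <= \<bar>F' z\<bar> * M"
     by (simp add: abs_mult mult_left_mono)
   qed
   show "AE z in lborel. (\<lambda>n. F' z * conv (\<psi> n) (moll (r n)) z) \<longlonglongrightarrow> F' z * (?b' (d' z) * \<phi> z)"
   proof (intro AE_I2 tendsto_mult tendsto_const)
    fix \<zeta>
    show "(\<lambda>n. conv (\<psi> n) (moll (r n)) \<zeta>) \<longlonglongrightarrow> ?b' (d' \<zeta>) * \<phi> \<zeta>"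
    proof (rule LIMSEQ_I)
     fix e :: real assume e: "e > 0"
     \<comment> \<open>Since \<open>\<psi> n\<close> itself varies with n, it has to be close to the
       limit value on the whole ball of radius \<open>r n\<close>, not only at the centre.\<close>
     have "\<exists>N. \<forall>n\<ge>N. \<forall>z. norm (z - \<zeta>) <= r n --> \<bar>\<psi> n z - ?b' (d' \<zeta>) * \<phi> \<zeta>\<bar> <= e / 2"
     proof (cases "\<zeta> \<in> K")
      case True
      then have dd: "d' \<zeta> = d \<zeta>" using KL by (auto simp: d'_def)
      define e1 where "e1 = e / (4 * (M + 1))"
      have e1: "e1 > 0" "e1 * M <= e / 4" using e M(1) by (auto simp: e1_def field_simps)
      have "isCont ?b' (d \<zeta>)" using cb'[of UNIV] by (simp add: continuous_on_eq_continuous_at)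
      then obtain \<eta> where \<eta>: "\<eta> > 0" "!!x. \<bar>x - d \<zeta>\<bar> < \<eta> ==> \<bar>?b' x - ?b' (d \<zeta>)\<bar> < e1"
       using e1(1) unfolding continuous_at_eps_delta by (auto simp: dist_real_def)
      have "isCont \<phi> \<zeta>"
       using continuous_on_eq_continuous_at[OF open_UNIV, THEN iffD1, OF c\<phi>] by blast
      then obtain \<kappa> where \<kappa>: "\<kappa> > 0" "!!z. norm (z - \<zeta>) < \<kappa> ==> \<bar>\<phi> z - \<phi> \<zeta>\<bar> < e / 4"
       using e unfolding continuous_at_eps_delta by (metis divide_pos_pos dist_norm real_norm_def zero_less_numeral)
      obtain N1 where N1: "!!n y. n \<ge> N1 ==> y \<in> L ==> norm (y - \<zeta>) <= 2 * r n ==> \<bar>d y - d \<zeta>\<bar> <= \<eta> / 2"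
       using dcont[OF True, of "\<eta> / 2"] \<eta>(1) by auto
      obtain N2 where N2: "!!n. n \<ge> N2 ==> r n < \<kappa>"
       using order_tendstoD(2)[OF rlim \<kappa>(1)] by (auto simp: eventually_sequentially)
      have "\<bar>\<psi> n z - ?b' (d' \<zeta>) * \<phi> \<zeta>\<bar> <= e / 2"
       if n: "n \<ge> max N1 N2" and z: "norm (z - \<zeta>) <= r n" for n z
      proof -
       have "\<bar>D n z - d \<zeta>\<bar> <= \<eta> / 2"
        using n by (intro Dclose[OF True z] N1) auto
       then have 1: "\<bar>?b' (D n z) - ?b' (d \<zeta>)\<bar> <= e1" using \<eta> by (intro less_imp_le \<eta>(2)) auto
       have 2: "\<bar>\<phi> z - \<phi> \<zeta>\<bar> <= e / 4" using N2[of n] n z by (intro less_imp_le \<kappa>(2)) auto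
       have alg: "a * b - c * d = (a - c) * b + c * (b - d)" for a b c d :: real
        by (simp add: algebra_simps)
       have "\<psi> n z - ?b' (d' \<zeta>) * \<phi> \<zeta> =
         (?b' (D n z) - ?b' (d \<zeta>)) * \<phi> z + ?b' (d \<zeta>) * (\<phi> z - \<phi> \<zeta>)"
        unfolding \<psi>_def dd by (rule alg)
       also have "\<bar>\<dots>\<bar> <= \<bar>?b' (D n z) - ?b' (d \<zeta>)\<bar> * \<bar>\<phi> z\<bar> + \<bar>?b' (d \<zeta>)\<bar> * \<bar>\<phi> z - \<phi> \<zeta>\<bar>"
        unfolding abs_mult[symmetric] by (rule abs_triangle_ineq)
       also have "\<dots> <= e1 * M + 1 * (e / 4)"
        using less_imp_le[OF e1(1)] by (intro add_mono mult_mono 1 2 M sqrt_reg_deriv_le[OF \<delta>] abs_ge_zero zero_le_one)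
       also have "\<dots> <= e / 2" using e1(2) by simp
       finally show ?thesis .
      qed
      then show ?thesis by blast
     next
      case False
      have "open (- K)" using K(1) by (simp add: compact_imp_closed open_Compl)
      then obtain \<kappa> where \<kappa>: "\<kappa> > 0" "ball \<zeta> \<kappa> \<subseteq> - K" using False by (meson ComplI open_contains_ball)
      obtain N2 where N2: "!!n. n \<ge> N2 ==> r n < \<kappa>"
       using order_tendstoD(2)[OF rlim \<kappa>(1)] by (auto simp: eventually_sequentially)
      have "\<bar>\<psi> n z - ?b' (d' \<zeta>) * \<phi> \<zeta>\<bar> <= e / 2" if "n \<ge> N2" "norm (z - \<zeta>) <= r n" for n z
      proof -
       have "z \<in> ball \<zeta> \<kappa>" using N2[OF that(1)] that(2) by (simp add: dist_norm norm_minus_commute)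
       then have "z \<notin> K" using \<kappa>(2) by auto
       then show ?thesis using e by (simp add: \<psi>off K(3)[OF False])
      qed
      then show ?thesis by blast
     qed
     then obtain N where N: "!!n z. n \<ge> N ==> norm (z - \<zeta>) <= r n ==> \<bar>\<psi> n z - ?b' (d' \<zeta>) * \<phi> \<zeta>\<bar> <= e / 2"
      by blast
     have "norm (conv (\<psi> n) (moll (r n)) \<zeta> - ?b' (d' \<zeta>) * \<phi> \<zeta>) < e" if "n \<ge> N" for n
     proof -
      have "\<bar>conv (\<psi> n) (moll (r n)) \<zeta> - ?b' (d' \<zeta>) * \<phi> \<zeta>\<bar> <= e / 2"
       by (rule conv_moll_close[OF r(1) \<psi>i N[OF that]])
      then show ?thesis using e by simp
     qed
     then show "\<exists>N. \<forall>n\<ge>N. norm (conv (\<psi> n) (moll (r n)) \<zeta> - ?b' (d' \<zeta>) * \<phi> \<zeta>) < e" by blast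
    qed
   qed
  qed measurable
  have "(LBINT z. ?b (d' z) * adj_heat \<phi> z) <= (LBINT \<zeta>. F' \<zeta> * (?b' (d' \<zeta>) * \<phi> \<zeta>))"
   by (rule LIMSEQ_le[OF lhs rhs]) (use ineq in blast)
  moreover have "?b (d' z) * adj_heat \<phi> z = ?b (d z) * adj_heat \<phi> z" for z
   using KL aoff[of z] by (cases "z \<in> K") (auto simp: d'_def)
  moreover have "F' z * (?b' (d' z) * \<phi> z) = F' z * (?b' (d z) * \<phi> z)" for z
   using KL K(3)[of z] by (cases "z \<in> K") (auto simp: d'_def)
  ultimately show ?thesis by simp
 qed
 \<comment> \<open>The remaining limit \<delta> \<rightarrow> 0, dominated on the left by a multiple
   of the modulus of \<open>adj_heat \<phi>\<close> and on the right by a multiple of the modulus of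
   \<open>F'\<close>.\<close>
 define \<delta> where "\<delta> n = 1 / real (Suc n)" for n
 have \<delta>: "\<delta> n > 0" "\<delta> n <= 1" for n by (auto simp: \<delta>_def)
 have \<delta>lim: "\<delta> \<longlonglongrightarrow> 0" unfolding \<delta>_def[abs_def] by (rule LIMSEQ_Suc[OF lim_1_over_n])
 have rewr: "g (d' z) * adj_heat \<phi> z = g (d z) * adj_heat \<phi> z" "F' z * (g (d' z) * \<phi> z) = F' z * (g (d z) * \<phi> z)" for g z
  using KL aoff[of z] K(3)[of z] by (cases "z \<in> K"; auto simp: d'_def)+
 have lhs: "(\<lambda>n. LBINT z. sqrt ((d' z)\<^sup>2 + (\<delta> n)\<^sup>2) * adj_heat \<phi> z) \<longlonglongrightarrow> (LBINT z. \<bar>d' z\<bar> * adj_heat \<phi> z)"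
 proof (rule integral_dominated_convergence[where w = "\<lambda>z. (\<bar>Md\<bar> + 1) * \<bar>adj_heat \<phi> z\<bar>"])
  show "integrable lborel (\<lambda>z. (\<bar>Md\<bar> + 1) * \<bar>adj_heat \<phi> z\<bar>)" using ia by simp
  have "(\<lambda>n. sqrt (x\<^sup>2 + (\<delta> n)\<^sup>2)) \<longlonglongrightarrow> sqrt (x\<^sup>2 + 0\<^sup>2)" for x :: real
   by (intro tendsto_intros \<delta>lim)
  then show "AE z in lborel. (\<lambda>n. sqrt ((d' z)\<^sup>2 + (\<delta> n)\<^sup>2) * adj_heat \<phi> z) \<longlonglongrightarrow> \<bar>d' z\<bar> * adj_heat \<phi> z"
   by (intro AE_I2 tendsto_mult tendsto_const) simp
  show "AE z in lborel. norm (sqrt ((d' z)\<^sup>2 + (\<delta> n)\<^sup>2) * adj_heat \<phi> z) <= (\<bar>Md\<bar> + 1) * \<bar>adj_heat \<phi> z\<bar>" for n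
  proof (rule AE_I2)
   fix z
   have "\<bar>sqrt ((d' z)\<^sup>2 + (\<delta> n)\<^sup>2)\<bar> <= \<bar>Md\<bar> + 1"
    using sqrt_reg_le[OF \<delta>(1), of "d' z" n] Md'[of z] \<delta>(2)[of n] by simp
   then show "norm (sqrt ((d' z)\<^sup>2 + (\<delta> n)\<^sup>2) * adj_heat \<phi> z) <= (\<bar>Md\<bar> + 1) * \<bar>adj_heat \<phi> z\<bar>"
    unfolding real_norm_def abs_mult by (intro mult_right_mono) auto
  qed
 qed measurable
 have rhs: "(\<lambda>n. LBINT z. F' z * (d' z / sqrt ((d' z)\<^sup>2 + (\<delta> n)\<^sup>2) * \<phi> z)) \<longlonglongrightarrow> (LBINT z. F' z * (sgn (d' z) * \<phi> z))"
 proof (rule integral_dominated_convergence[where w = "\<lambda>z. \<bar>F' z\<bar> * M"])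
  show "integrable lborel (\<lambda>z. \<bar>F' z\<bar> * M)" using F'i by simp
  have "(\<lambda>n. x / sqrt (x\<^sup>2 + (\<delta> n)\<^sup>2)) \<longlonglongrightarrow> sgn x" for x :: real
  proof (cases "x = 0")
   case False
   then have "(\<lambda>n. x / sqrt (x\<^sup>2 + (\<delta> n)\<^sup>2)) \<longlonglongrightarrow> x / sqrt (x\<^sup>2 + 0\<^sup>2)"
    by (intro tendsto_intros \<delta>lim) auto
   then show ?thesis by (simp add: real_sgn_eq)
  qed simp
  then show "AE z in lborel. (\<lambda>n. F' z * (d' z / sqrt ((d' z)\<^sup>2 + (\<delta> n)\<^sup>2) * \<phi> z)) \<longlonglongrightarrow> F' z * (sgn (d' z) * \<phi> z)"
   by (intro AE_I2 tendsto_mult tendsto_const)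
  show "AE z in lborel. norm (F' z * (d' z / sqrt ((d' z)\<^sup>2 + (\<delta> n)\<^sup>2) * \<phi> z)) <= \<bar>F' z\<bar> * M" for n
  proof (rule AE_I2)
   fix z
   have "\<bar>d' z / sqrt ((d' z)\<^sup>2 + (\<delta> n)\<^sup>2)\<bar> * \<bar>\<phi> z\<bar> <= 1 * M"
    by (intro mult_mono sqrt_reg_deriv_le \<delta>(1) M) auto
   then have "\<bar>F' z\<bar> * (\<bar>d' z / sqrt ((d' z)\<^sup>2 + (\<delta> n)\<^sup>2)\<bar> * \<bar>\<phi> z\<bar>) <= \<bar>F' z\<bar> * M"
    by (intro mult_left_mono) auto
   then show "norm (F' z * (d' z / sqrt ((d' z)\<^sup>2 + (\<delta> n)\<^sup>2) * \<phi> z)) <= \<bar>F' z\<bar> * M"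
    by (simp only: real_norm_def abs_mult)
  qed
 qed measurable
 have "(LBINT z. \<bar>d' z\<bar> * adj_heat \<phi> z) <= (LBINT z. F' z * (sgn (d' z) * \<phi> z))"
 proof (rule LIMSEQ_le[OF lhs rhs], intro exI allI impI)
  fix n
  show "(LBINT z. sqrt ((d' z)\<^sup>2 + (\<delta> n)\<^sup>2) * adj_heat \<phi> z)
   <= (LBINT z. F' z * (d' z / sqrt ((d' z)\<^sup>2 + (\<delta> n)\<^sup>2) * \<phi> z))"
   using reg[OF \<delta>(1)[of n]]
   unfolding rewr(1)[of "\<lambda>x. sqrt (x\<^sup>2 + (\<delta> n)\<^sup>2)"] rewr(2)[of _ "\<lambda>x. x / sqrt (x\<^sup>2 + (\<delta> n)\<^sup>2)"] .
 qed
 moreover have "F' z * (sgn (d' z) * \<phi> z) = sgn (d z) * F z * \<phi> z" for z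
  using KL K(3)[of z] by (cases "z \<in> K") (auto simp: d'_def F'_def)
 ultimately show ?thesis unfolding rewr(1)[of abs] by simp
qed

lemma borel_measurable_fst_borel [measurable]:
  "(fst :: 'a::euclidean_space \<times> 'b::euclidean_space => 'a) \<in> borel_measurable borel"
 and borel_measurable_snd_borel [measurable]:
  "(snd :: 'a::euclidean_space \<times> 'b::euclidean_space => 'b) \<in> borel_measurable borel"
 by (auto intro!: borel_measurable_continuous_onI continuous_intros)

section \<open>Testing on time slabs\<close>

definition lap :: "('a::euclidean_space => real) => 'a => real" where
 "lap \<xi> x = (\<Sum>i\<in>Basis. dir_deriv (dir_deriv \<xi> i) i x)"

lemma continuous_lap: "smooth \<xi> ==> continuous_on A (lap \<xi>)"
 unfolding lap_def[abs_def] by (intro continuous_intros smooth_continuous smooth_dir_deriv)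

lemma lap_zero_off:
 assumes "compact K" "!!z. z \<notin> K ==> \<xi> z = 0" "z \<notin> K"
 shows "lap \<xi> z = 0"
 using dir_deriv_zero_off[OF assms(1) dir_deriv_zero_off[OF assms(1,2)] assms(3)]
 by (simp add: lap_def)

lemma dir_deriv_tensor:
 fixes \<xi> :: "'a::euclidean_space => real" and \<eta> :: "real => real"
 assumes "smooth \<xi>" "smooth \<eta>"
 shows "dir_deriv (\<lambda>z. \<xi> (fst z) * \<eta> (snd z)) (v, w) =
  (\<lambda>z. \<xi> (fst z) * dir_deriv \<eta> w (snd z) + dir_deriv \<xi> v (fst z) * \<eta> (snd z))"
proof
 fix z :: "'a \<times> real"
 have 1: "((\<lambda>z. \<xi> (fst z)) has_derivative (\<lambda>h. dir_deriv \<xi> (fst h) (fst z))) (at z)"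
  by (rule has_derivative_compose[where g=\<xi> and f=fst])
   (auto intro!: derivative_eq_intros smooth_has_derivative assms)
 have 2: "((\<lambda>z. \<eta> (snd z)) has_derivative (\<lambda>h. dir_deriv \<eta> (snd h) (snd z))) (at z)"
  by (rule has_derivative_compose[where g=\<eta> and f=snd])
   (auto intro!: derivative_eq_intros smooth_has_derivative assms)
 show "dir_deriv (\<lambda>z. \<xi> (fst z) * \<eta> (snd z)) (v, w) z =
   \<xi> (fst z) * dir_deriv \<eta> w (snd z) + dir_deriv \<xi> v (fst z) * \<eta> (snd z)"
  using dir_deriv_eq[OF has_derivative_mult[OF 1 2], of "(v, w)"] by simp
qed

lemma smooth_tensor:
 fixes \<xi> :: "'a::euclidean_space => real" and \<eta> :: "real => real"
 assumes "smooth \<xi>" "smooth \<eta>"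
 shows "smooth (\<lambda>z. \<xi> (fst z) * \<eta> (snd z))"
 using smooth_mult[OF smooth_affine[OF assms(1) bounded_linear_fst, of 0] smooth_affine[OF assms(2) bounded_linear_snd, of 0]]
 by simp

lemma adj_heat_tensor:
 fixes \<xi> :: "'a::euclidean_space => real" and \<eta> :: "real => real"
 assumes "smooth \<xi>" "smooth \<eta>"
 shows "adj_heat (\<lambda>z. \<xi> (fst z) * \<eta> (snd z)) z =
   - (\<xi> (fst z) * dir_deriv \<eta> 1 (snd z)) - lap \<xi> (fst z) * \<eta> (snd z)"
proof -
 have z: "dir_deriv f 0 = (\<lambda>_. 0)" if "smooth f" for f :: "'c::euclidean_space => real"
  using dir_deriv_scale[OF smooth_D[OF that], of 0 0] by (auto simp: fun_eq_iff)
 show ?thesis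
  unfolding adj_heat_def lap_def
  by (simp add: dir_deriv_tensor assms smooth_dir_deriv z sum_distrib_right)
qed

text \<open>A smoothed indicator of [s, t]. Its derivative is the difference of two mollifiers,
  centred at s and t, so using it as a time factor in a test function produces averages over times
  near s and near t.\<close>

definition plateau :: "real => real => real => real => real" where
 "plateau r s t = conv (indicator {s..t}) (moll r)"

lemma
 assumes r: "0 < r"
 shows smooth_plateau: "smooth (plateau r s t)"
  and dir_deriv_plateau: "s <= t ==> dir_deriv (plateau r s t) 1 \<tau> = moll r (s - \<tau>) - moll r (t - \<tau>)"
  and plateau_nonneg: "0 <= plateau r s t \<tau>"
  and plateau_le_1: "plateau r s t \<tau> <= 1"
  and plateau_eq_0: "\<tau> \<notin> {s - r..t + r} ==> plateau r s t \<tau> = 0"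
  and plateau_eq_1: "s + r <= \<tau> ==> \<tau> <= t - r ==> plateau r s t \<tau> = 1"
proof -
 have I: "integrable lborel (indicator {s..t} :: real => real)"
  by (intro integrable_real_indicator) (auto simp: emeasure_lborel_Icc_eq)
 note mo = smooth_moll[OF r, where 'b=real] moll_eq_0[OF r, where 'b=real]
 show "smooth (plateau r s t)" unfolding plateau_def by (rule smooth_conv[OF I mo(1) compact_cball mo(2)])
 have close: "\<bar>plateau r s t \<tau> - a\<bar> <= e" if "!!\<zeta>. norm (\<zeta> - \<tau>) <= r ==> \<bar>indicator {s..t} \<zeta> - a\<bar> <= e" for a e
  unfolding plateau_def by (rule conv_moll_close[OF r I that])
 show "plateau r s t \<tau> = 0" if "\<tau> \<notin> {s - r..t + r}"
 proof -
  have "\<bar>plateau r s t \<tau> - 0\<bar> <= 0" by (rule close) (use that in \<open>auto simp: indicator_def\<close>)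
  then show ?thesis by simp
 qed
 show "plateau r s t \<tau> = 1" if "s + r <= \<tau>" "\<tau> <= t - r"
 proof -
  have "\<bar>plateau r s t \<tau> - 1\<bar> <= 0" by (rule close) (use that in \<open>auto simp: indicator_def\<close>)
  then show ?thesis by simp
 qed
 \<comment> \<open>An indicator is always within 1/2 of 1/2, so this one application of
   \<open>close\<close> yields both bounds.\<close>
 have "\<bar>plateau r s t \<tau> - 1 / 2\<bar> <= 1 / 2" by (rule close) (auto simp: indicator_def)
 then show "0 <= plateau r s t \<tau>" "plateau r s t \<tau> <= 1" by arith+
 assume st: "s <= t"
 have "dir_deriv (plateau r s t) 1 \<tau> = (LBINT \<zeta>. indicator {s..t} \<zeta> * dir_deriv (moll r) 1 (\<tau> - \<zeta>))"
  unfolding plateau_def dir_deriv_conv[OF I mo(1) compact_cball[of 0 r] mo(2), simplified] conv_def ..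
 also have "\<dots> = (LBINT \<zeta>. dir_deriv (moll r) 1 (\<tau> - \<zeta>) * indicator {s..t} \<zeta>)"
  by (simp add: mult.commute)
 also have "\<dots> = - moll r (\<tau> - t) - (- moll r (\<tau> - s))"
 proof (rule integral_FTC_Icc_real[OF st])
  fix x
  have D: "((\<lambda>\<zeta>. moll r (\<tau> - \<zeta>)) has_derivative (\<lambda>v. dir_deriv (moll r) (- v) (\<tau> - x))) (at x)"
   by (rule has_derivative_compose[where g="moll r" and f="\<lambda>\<zeta>. \<tau> - \<zeta>"])
    (auto intro!: derivative_eq_intros smooth_has_derivative mo)
  have "dir_deriv (moll r) (- v) (\<tau> - x) = - dir_deriv (moll r) 1 (\<tau> - x) * v" for v
   using dir_deriv_scale[OF smooth_D[OF mo(1)], of "- v" 1] by simp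
  then have "(\<lambda>v. dir_deriv (moll r) (- v) (\<tau> - x)) = (*) (- dir_deriv (moll r) 1 (\<tau> - x))"
   by (simp add: fun_eq_iff)
  with D have "((\<lambda>\<zeta>. moll r (\<tau> - \<zeta>)) has_real_derivative - dir_deriv (moll r) 1 (\<tau> - x)) (at x)"
   by (simp only: has_field_derivative_def)
  then show "((\<lambda>\<zeta>. - moll r (\<tau> - \<zeta>)) has_real_derivative dir_deriv (moll r) 1 (\<tau> - x)) (at x)"
   using DERIV_minus by fastforce
  show "isCont (\<lambda>\<zeta>. dir_deriv (moll r) 1 (\<tau> - \<zeta>)) x"
   using smooth_continuous[OF smooth_reflect[OF smooth_dir_deriv[OF mo(1)]], of UNIV 1 \<tau>]
   by (simp add: continuous_on_eq_continuous_at)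
 qed
 also have "\<dots> = moll r (s - \<tau>) - moll r (t - \<tau>)"
  using moll_minus[OF r, of "\<tau> - t"] moll_minus[OF r, of "\<tau> - s"] by simp
 finally show "dir_deriv (plateau r s t) 1 \<tau> = moll r (s - \<tau>) - moll r (t - \<tau>)" .
qed

lemma open_Q_int: "open (Q_int T)"
 unfolding Q_int_def by (intro open_Times) auto

text \<open>The test function is \<xi>(x) times a plateau in t. The terms with the time derivative
  are mollifications in t of the slice integral, which is continuous because \<open>v\<close> is, so
  they converge to its values at t and s as the plateaus sharpen.\<close>

lemma time_slice:
 fixes v f :: "'a::euclidean_space stfun" and \<xi> :: "'a => real"
 assumes v: "continuous_on (Q_int T) v"
  and fm[measurable]: "f \<in> borel_measurable borel"
  and f: "!!K. compact K ==> K \<subseteq> Q_int T ==> set_integrable lborel K f"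
  and weak: "!!\<phi>. test_function (Q_int T) \<phi> ==> (!!z. 0 <= \<phi> z) ==>
    (LBINT z. f z * \<phi> z) <= (LBINT z. v z * adj_heat \<phi> z)"
  and \<xi>: "smooth \<xi>" "!!x. 0 <= \<xi> x" and K: "compact K" "!!x. x \<notin> K ==> \<xi> x = 0"
  and st: "0 < s" "s < t" "t < T"
 shows "(LBINT z. indicator {s..t} (snd z) * (v z * lap \<xi> (fst z) + f z * \<xi> (fst z)))
  <= (LBINT x. v (x, t) * \<xi> x) - (LBINT x. v (x, s) * \<xi> x)"
proof -
 \<comment> \<open>A margin that keeps the widened time interval \<open>{s - r0..t + r0}\<close>
   inside the open interval from 0 to T; the last term keeps the two transition zones apart.\<close>
 define r0 where "r0 = min (s / 2) (min ((T - t) / 2) ((t - s) / 2))"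
 have r0: "r0 > 0" "s - r0 > 0" "t + r0 < T" "s + r0 <= t - r0 "
  using st by (auto simp: r0_def min_def field_simps)
 let ?I = "{s - r0..t + r0}"
 define C where "C = K \<times> ?I"
 have C: "compact C" unfolding C_def by (intro compact_Times K) simp
 have CQ: "C \<subseteq> Q_int T" using r0 by (auto simp: C_def Q_int_def)
 have [measurable]: "C \<in> sets borel" using C by (rule borel_compact)
 have cv: "continuous_on C v" by (rule continuous_on_subset[OF v CQ])
 have c\<xi>: "continuous_on UNIV \<xi>" and cl: "continuous_on UNIV (lap \<xi>)"
  using \<xi> by (auto intro: smooth_continuous continuous_lap)
 have loff: "lap \<xi> x = 0" if "x \<notin> K" for x using lap_zero_off[OF K that] .
 have [measurable]: "\<xi> \<in> borel_measurable borel" "lap \<xi> \<in> borel_measurable borel"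
  using c\<xi> cl by (auto intro: borel_measurable_continuous_onI)
 obtain M where M: "M \<ge> 0" "!!x. \<bar>\<xi> x\<bar> <= M" using bounded_compact_support[OF c\<xi> K] by blast
 obtain N where N: "N \<ge> 0" "!!x. \<bar>lap \<xi> x\<bar> <= N" using bounded_compact_support[OF cl K(1) loff] by blast
 define v' where "v' = (\<lambda>z. indicator C z * v z)"
 define f' where "f' = (\<lambda>z. indicator C z * f z)"
 have v'i: "integrable lborel v'"
  using borel_integrable_compact[OF C cv] by (simp add: v'_def)
 have f'i: "integrable lborel f'"
  using f[OF C CQ] by (simp add: f'_def set_integrable_def)
 have [measurable]: "v' \<in> borel_measurable borel" "f' \<in> borel_measurable borel"
  using v'i f'i by auto
 define r where "r n = r0 / real (Suc n)" for n
 have r: "r n > 0" "r n <= r0" for n using r0 by (auto simp: r_def field_simps)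
 have rlim: "r \<longlonglongrightarrow> 0"
 proof -
  have "(\<lambda>n. r0 * (1 / real (Suc n))) \<longlonglongrightarrow> r0 * 0"
   by (intro tendsto_mult tendsto_const LIMSEQ_Suc[OF lim_1_over_n])
  then show ?thesis by (simp add: r_def[abs_def])
 qed
 define \<eta> where "\<eta> n = plateau (r n) s t" for n
 have \<eta>: "smooth (\<eta> n)" "0 <= \<eta> n \<tau>" "\<eta> n \<tau> <= 1" "\<tau> \<notin> ?I ==> \<eta> n \<tau> = 0"
  "dir_deriv (\<eta> n) 1 \<tau> = moll (r n) (s - \<tau>) - moll (r n) (t - \<tau>)" for n \<tau>
  using smooth_plateau[OF r(1)] plateau_nonneg[OF r(1)] plateau_le_1[OF r(1)] plateau_eq_0[OF r(1), of \<tau> s n t] r(2)[of n]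
   dir_deriv_plateau[OF r(1)] st by (auto simp: \<eta>_def)
 have [measurable]: "\<eta> n \<in> borel_measurable borel" for n
  using smooth_continuous[OF \<eta>(1)] by (rule borel_measurable_continuous_onI)
 \<comment> \<open>The endpoints are left out, since there the plateaus need not tend to the
   indicator; the two times form a null set in space-time.\<close>
 have \<eta>lim: "(\<lambda>n. \<eta> n \<tau>) \<longlonglongrightarrow> indicator {s..t} \<tau>" if "\<tau> \<noteq> s" "\<tau> \<noteq> t" for \<tau>
 proof (rule tendsto_eventually)
  have "min \<bar>\<tau> - s\<bar> \<bar>\<tau> - t\<bar> > 0" using that by auto
  from order_tendstoD(2)[OF rlim this]
  show "\<forall>\<^sub>F n in sequentially. \<eta> n \<tau> = indicator {s..t} \<tau>"
  proof eventually_elim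
   case (elim n)
   then show ?case using plateau_eq_0[OF r(1), of \<tau> s n t] plateau_eq_1[OF r(1), of s n \<tau> t]
    by (cases "\<tau> < s \<or> t < \<tau>") (auto simp: \<eta>_def indicator_def)
  qed
 qed
 define m where "m \<tau> = (LBINT x. v' (x, \<tau>) * \<xi> x)" for \<tau>
 have v'\<xi>: "integrable (lborel \<Otimes>\<^sub>M lborel) (\<lambda>z. v' z * \<xi> (fst z))"
  unfolding lborel_prod
 proof (rule L1_bound[of _ "\<lambda>z. M * v' z"])
  show "AE z in lborel. norm (v' z * \<xi> (fst z)) <= norm (M * v' z)"
   using M by (auto simp: abs_mult mult.commute[of "\<bar>v' _\<bar>"] intro!: mult_right_mono AE_I2)
 qed (use v'i in auto)
 have mi: "integrable lborel m"
  unfolding m_def using lborel_pair.integrable_snd[of "\<lambda>x t. v' (x, t) * \<xi> x"] v'\<xi> by (simp add: case_prod_beta')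
 have mconv: "(LBINT z. v' z * \<xi> (fst z) * moll (r n) (\<tau> - snd z)) = conv m (moll (r n)) \<tau>" for n \<tau>
 proof -
  obtain B where B: "!!x::real. \<bar>moll (r n) x\<bar> <= B"
   using bounded_compact_support[OF smooth_continuous[OF smooth_moll[OF r(1)]] compact_cball moll_eq_0[OF r(1)]] by metis
  have [measurable]: "moll (r n) \<in> borel_measurable (borel :: real measure)"
   by (intro borel_measurable_continuous_onI smooth_continuous smooth_moll r)
  have I: "integrable (lborel \<Otimes>\<^sub>M lborel) (\<lambda>(x, y). v' (x, y) * \<xi> x * moll (r n) (\<tau> - y))"
  proof (rule L1_bound[of _ "\<lambda>z. B * (v' z * \<xi> (fst z))"])
   have "B \<ge> 0" using B[of 0] by linarith
   then show "AE z in lborel \<Otimes>\<^sub>M lborel. norm (case z of (x, y) => v' (x, y) * \<xi> x * moll (r n) (\<tau> - y)) <= norm (B * (v' z * \<xi> (fst z)))"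
    using B by (auto simp: abs_mult mult.commute[of B] intro!: mult_left_mono AE_I2)
  qed (use v'\<xi> in \<open>auto simp: lborel_prod\<close>)
  have "(LBINT z. v' z * \<xi> (fst z) * moll (r n) (\<tau> - snd z)) =
    (\<integral>(x, y). v' (x, y) * \<xi> x * moll (r n) (\<tau> - y) \<partial>(lborel \<Otimes>\<^sub>M lborel))"
   by (simp add: lborel_prod case_prod_beta')
  also have "\<dots> = (LBINT y. (LBINT x. v' (x, y) * \<xi> x * moll (r n) (\<tau> - y)))"
   by (rule lborel_pair.integral_snd[symmetric]) (use I in simp)
  also have "\<dots> = conv m (moll (r n)) \<tau>" by (simp add: conv_def m_def)
  finally show ?thesis .
 qed
 \<comment> \<open>Uniform continuity of \<open>v\<close> on the compact set \<open>C\<close> makes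
   \<open>m\<close> continuous on the widened interval, so mollifying \<open>m\<close> recovers its
   values. The division by \<open>A + 1\<close> below allows for \<xi> = 0.\<close>
 have mlim: "(\<lambda>n. conv m (moll (r n)) \<tau>) \<longlonglongrightarrow> m \<tau>" if \<tau>: "s <= \<tau>" "\<tau> <= t" for \<tau>
 proof (rule LIMSEQ_I)
  fix e :: real assume e: "e > 0"
  define A where "A = (LBINT x. \<xi> x)"
  have \<xi>i: "integrable lborel \<xi>" by (rule integrable_compact_support[OF c\<xi> K])
  have A: "A \<ge> 0" unfolding A_def using \<xi>(2) by simp
  have "uniformly_continuous_on C v" by (rule compact_uniformly_continuous[OF cv C])
  moreover have e1: "e / (2 * (A + 1)) > 0" using e A by simp
  ultimately obtain d where d: "d > 0" "!!z z'. z \<in> C ==> z' \<in> C ==> dist z' z < d ==> dist (v z') (v z) < e / (2 * (A + 1))"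
   by (rule uniformly_continuous_onE) metis
  obtain N where N: "!!n. n \<ge> N ==> r n < d"
   using order_tendstoD(2)[OF rlim d(1)] by (auto simp: eventually_sequentially)
  have "norm (conv m (moll (r n)) \<tau> - m \<tau>) < e" if n: "n \<ge> N" for n
  proof -
   have "\<bar>conv m (moll (r n)) \<tau> - m \<tau>\<bar> <= e / 2"
   proof (rule conv_moll_close[OF r(1) mi])
    fix \<sigma> assume \<sigma>: "norm (\<sigma> - \<tau>) <= r n"
    have \<sigma>I: "\<sigma> \<in> ?I" "\<tau> \<in> ?I" using \<sigma> \<tau> r(2)[of n] r0(1) by (auto simp: abs_le_iff)
    have sect: "integrable lborel (\<lambda>x. v' (x, u) * \<xi> x)" if u: "u \<in> ?I" for u
    proof (rule integrable_cong_AE_imp)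
     have "continuous_on K (\<lambda>x. v (x, u) * \<xi> x)"
      using u by (auto simp: C_def intro!: continuous_intros continuous_on_compose2[OF cv] continuous_on_subset[OF c\<xi>])
     then show "integrable lborel (\<lambda>x. indicator K x *\<^sub>R (v (x, u) * \<xi> x))" by (rule borel_integrable_compact[OF K(1)])
     show "AE x in lborel. indicator K x *\<^sub>R (v (x, u) * \<xi> x) = v' (x, u) * \<xi> x"
      using u K(2) by (intro AE_I2) (auto simp: v'_def C_def indicator_def)
    qed measurable
    have "\<bar>m \<sigma> - m \<tau>\<bar> = norm (LBINT x. (v' (x, \<sigma>) - v' (x, \<tau>)) * \<xi> x)"
     unfolding m_def using sect[OF \<sigma>I(1)] sect[OF \<sigma>I(2)] by (simp add: left_diff_distrib)
    also have "\<dots> <= (LBINT x. e / (2 * (A + 1)) * \<xi> x)"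
    proof (rule Bochner_Integration.integral_norm_bound_integral)
     show "integrable lborel (\<lambda>x. (v' (x, \<sigma>) - v' (x, \<tau>)) * \<xi> x)"
      using sect[OF \<sigma>I(1)] sect[OF \<sigma>I(2)] by (simp add: left_diff_distrib)
     fix x
     show "norm ((v' (x, \<sigma>) - v' (x, \<tau>)) * \<xi> x) <= e / (2 * (A + 1)) * \<xi> x"
     proof (cases "x \<in> K")
      case True
      have "dist (x, \<sigma>) (x, \<tau>) < d" using \<sigma> N[OF n] by (simp add: dist_Pair_Pair dist_real_def)
      then have "\<bar>v' (x, \<sigma>) - v' (x, \<tau>)\<bar> <= e / (2 * (A + 1))"
       using d(2)[of "(x, \<tau>)" "(x, \<sigma>)"] True \<sigma>I by (auto simp: v'_def C_def dist_real_def)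
      then show ?thesis using \<xi>(2)[of x] by (simp only: real_norm_def abs_mult abs_of_nonneg) (rule mult_right_mono)
     qed (simp add: K(2))
    qed (use \<xi>i in auto)
    also have "\<dots> = e / (2 * (A + 1)) * A" by (simp add: A_def)
    also have "\<dots> = (A / (A + 1)) * (e / 2)" by (simp add: mult.commute)
    also have "\<dots> <= 1 * (e / 2)" using A e by (intro mult_right_mono) auto
    finally show "\<bar>m \<sigma> - m \<tau>\<bar> <= e / 2" by simp
   qed
   then show ?thesis using e by simp
  qed
  then show "\<exists>N. \<forall>n\<ge>N. norm (conv m (moll (r n)) \<tau> - m \<tau>) < e" by blast
 qed
 define g where "g z = v' z * lap \<xi> (fst z) + f' z * \<xi> (fst z)" for z
 have gi: "integrable lborel g"
  unfolding g_def
 proof (rule L1_add)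
  show "integrable lborel (\<lambda>z. v' z * lap \<xi> (fst z))"
  proof (rule L1_bound[of _ "\<lambda>z. N * v' z"])
   show "AE z in lborel. norm (v' z * lap \<xi> (fst z)) <= norm (N * v' z)"
    using N by (auto simp: abs_mult mult.commute[of "\<bar>v' _\<bar>"] intro!: mult_right_mono AE_I2)
  qed (use v'i in auto)
  show "integrable lborel (\<lambda>z. f' z * \<xi> (fst z))"
  proof (rule L1_bound[of _ "\<lambda>z. M * f' z"])
   show "AE z in lborel. norm (f' z * \<xi> (fst z)) <= norm (M * f' z)"
    using M by (auto simp: abs_mult mult.commute[of "\<bar>f' _\<bar>"] intro!: mult_right_mono AE_I2)
  qed (use f'i in auto)
 qed
 have [measurable]: "g \<in> borel_measurable borel" using gi by auto
 have glim: "(\<lambda>n. LBINT z. \<eta> n (snd z) * g z) \<longlonglongrightarrow> (LBINT z. indicator {s..t} (snd z) * g z)"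
 proof (rule integral_dominated_convergence[where w = "\<lambda>z. \<bar>g z\<bar>"])
  show "integrable lborel (\<lambda>z. \<bar>g z\<bar>)" using gi by simp
  have "AE z::'a \<times> real in lborel \<Otimes>\<^sub>M lborel. snd z \<noteq> s \<and> snd z \<noteq> t"
  proof (rule lborel_pair.AE_pair_measure)
   show "{z \<in> space (lborel \<Otimes>\<^sub>M lborel). snd z \<noteq> s \<and> snd z \<noteq> t} \<in> sets (lborel \<Otimes>\<^sub>M lborel :: ('a \<times> real) measure)"
    by measurable
   show "AE x in lborel. AE y in lborel. snd (x, y) \<noteq> s \<and> snd (x, y) \<noteq> t"
    using AE_lborel_singleton[of s] AE_lborel_singleton[of t] by auto
  qed
  then have "AE z::'a \<times> real in lborel. snd z \<noteq> s \<and> snd z \<noteq> t" unfolding lborel_prod .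
  then show "AE z in lborel. (\<lambda>n. \<eta> n (snd z) * g z) \<longlonglongrightarrow> indicator {s..t} (snd z) * g z"
   by eventually_elim (intro tendsto_intros \<eta>lim, auto)
  show "AE z in lborel. norm (\<eta> n (snd z) * g z) <= \<bar>g z\<bar>" for n
   using \<eta>(2,3)[of n] by (intro AE_I2) (simp add: abs_mult mult_left_le_one_le)
 qed measurable
 have ineq: "(LBINT z. \<eta> n (snd z) * g z) <= conv m (moll (r n)) t - conv m (moll (r n)) s" for n
 proof -
  define \<phi> where "\<phi> z = \<xi> (fst z) * \<eta> n (snd z)" for z
  have s\<phi>: "smooth \<phi>" unfolding \<phi>_def[abs_def] by (rule smooth_tensor[OF \<xi>(1) \<eta>(1)])
  have off: "\<phi> z = 0" if "z \<notin> C" for z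
   using that K(2)[of "fst z"] \<eta>(4)[of "snd z" n] by (cases z) (auto simp: \<phi>_def C_def)
  have aoff: "adj_heat \<phi> z = 0" if "z \<notin> C" for z using adj_heat_zero_off[OF C off that] .
  have adj: "adj_heat \<phi> z = \<xi> (fst z) * moll (r n) (t - snd z) - \<xi> (fst z) * moll (r n) (s - snd z) - lap \<xi> (fst z) * \<eta> n (snd z)" for z
   unfolding \<phi>_def[abs_def] adj_heat_tensor[OF \<xi>(1) \<eta>(1)] \<eta>(5) by (simp add: algebra_simps)
  have "(LBINT z. f z * \<phi> z) <= (LBINT z. v z * adj_heat \<phi> z)"
   by (intro weak test_functionI[OF s\<phi> C CQ off]) (use \<xi>(2) \<eta>(2) in \<open>auto simp: \<phi>_def\<close>)
  moreover have "f z * \<phi> z = f' z * \<xi> (fst z) * \<eta> n (snd z)" for z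
   using off[of z] by (cases "z \<in> C") (auto simp: f'_def \<phi>_def)
  moreover have "v z * adj_heat \<phi> z = v' z * adj_heat \<phi> z" for z
   using aoff[of z] by (cases "z \<in> C") (auto simp: v'_def)
  ultimately have w1: "(LBINT z. f' z * \<xi> (fst z) * \<eta> n (snd z)) <= (LBINT z. v' z * adj_heat \<phi> z)"
   by simp
  have im: "integrable lborel (\<lambda>z. v' z * \<xi> (fst z) * moll (r n) (\<tau> - snd z))" for \<tau>
  proof -
   have [measurable]: "moll (r n) \<in> borel_measurable (borel :: real measure)"
    by (intro borel_measurable_continuous_onI smooth_continuous smooth_moll r)
   obtain B where B: "!!x::real. \<bar>moll (r n) x\<bar> <= B"
    using bounded_compact_support[OF smooth_continuous[OF smooth_moll[OF r(1)]] compact_cball moll_eq_0[OF r(1)]] by metis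
   have "B \<ge> 0" using B[of 0] by linarith
   show ?thesis
   proof (rule L1_bound[of _ "\<lambda>z. B * (v' z * \<xi> (fst z))"])
    show "AE z in lborel. norm (v' z * \<xi> (fst z) * moll (r n) (\<tau> - snd z)) <= norm (B * (v' z * \<xi> (fst z)))"
     using B \<open>B \<ge> 0\<close> by (auto simp: abs_mult mult.commute[of B] intro!: mult_left_mono AE_I2)
   qed (use v'\<xi> in \<open>auto simp: lborel_prod\<close>)
  qed
  have ig: "integrable lborel (\<lambda>z. w z * \<eta> n (snd z))" if "integrable lborel w" for w
  proof (rule L1_bound[OF that])
   show "AE z in lborel. norm (w z * \<eta> n (snd z)) <= norm (w z)"
    using \<eta>(2,3)[of n] by (intro AE_I2) (simp add: abs_mult mult_right_le_one_le)
  qed (use that in auto)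
  have il: "integrable lborel (\<lambda>z. v' z * lap \<xi> (fst z) * \<eta> n (snd z))" "integrable lborel (\<lambda>z. f' z * \<xi> (fst z) * \<eta> n (snd z))"
  proof -
   have "integrable lborel (\<lambda>z. v' z * lap \<xi> (fst z))"
   proof (rule L1_bound[of _ "\<lambda>z. N * v' z"])
    show "AE z in lborel. norm (v' z * lap \<xi> (fst z)) <= norm (N * v' z)"
     using N by (auto simp: abs_mult mult.commute[of "\<bar>v' _\<bar>"] intro!: mult_right_mono AE_I2)
   qed (use v'i in auto)
   then show "integrable lborel (\<lambda>z. v' z * lap \<xi> (fst z) * \<eta> n (snd z))" by (rule ig)
   have "integrable lborel (\<lambda>z. f' z * \<xi> (fst z))"
   proof (rule L1_bound[of _ "\<lambda>z. M * f' z"])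
    show "AE z in lborel. norm (f' z * \<xi> (fst z)) <= norm (M * f' z)"
     using M by (auto simp: abs_mult mult.commute[of "\<bar>f' _\<bar>"] intro!: mult_right_mono AE_I2)
   qed (use f'i in auto)
   then show "integrable lborel (\<lambda>z. f' z * \<xi> (fst z) * \<eta> n (snd z))" by (rule ig)
  qed
  have "(LBINT z. v' z * adj_heat \<phi> z) =
    (LBINT z. v' z * \<xi> (fst z) * moll (r n) (t - snd z) - v' z * \<xi> (fst z) * moll (r n) (s - snd z)
     - v' z * lap \<xi> (fst z) * \<eta> n (snd z))"
   unfolding adj by (simp only: right_diff_distrib mult.assoc)
  also have "\<dots> = conv m (moll (r n)) t - conv m (moll (r n)) s - (LBINT z. v' z * lap \<xi> (fst z) * \<eta> n (snd z))"
   using im il mconv by simp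
  finally have w2: "(LBINT z. v' z * adj_heat \<phi> z) = conv m (moll (r n)) t - conv m (moll (r n)) s
   - (LBINT z. v' z * lap \<xi> (fst z) * \<eta> n (snd z))" .
  have "(LBINT z. \<eta> n (snd z) * g z) =
   (LBINT z. v' z * lap \<xi> (fst z) * \<eta> n (snd z)) + (LBINT z. f' z * \<xi> (fst z) * \<eta> n (snd z))"
   using il by (subst lint_add[symmetric]) (simp_all add: g_def algebra_simps)
  with w1 w2 show ?thesis by linarith
 qed
 have "(LBINT z. indicator {s..t} (snd z) * g z) <= m t - m s"
  by (rule LIMSEQ_le[OF glim tendsto_diff[OF mlim mlim]]) (use ineq st in auto)
 moreover have "m \<tau> = (LBINT x. v (x, \<tau>) * \<xi> x)" if "\<tau> \<in> ?I" for \<tau>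
  unfolding m_def using that K(2)
  by (intro lint_cong) (auto simp: v'_def C_def indicator_def)
 moreover have "indicator {s..t} (snd z) * g z = indicator {s..t} (snd z) * (v z * lap \<xi> (fst z) + f z * \<xi> (fst z))" for z
  using r0(1) K(2)[of "fst z"] loff[of "fst z"] by (cases z) (auto simp: g_def v'_def f'_def C_def indicator_def)
 ultimately show ?thesis using st r0 by simp
qed

section \<open>The heat kernel\<close>

text \<open>With the extension by 0 to nonpositive times, integrals over all of space-time are
  automatically causal: a source acts only at later times.\<close>

definition hk :: "'a::euclidean_space stfun" where
 "hk z = (if 0 < snd z then gauss_kernel (fst z) (snd z) else 0)"

lemma hk_nonneg: "0 <= hk z"
 by (simp add: hk_def gauss_kernel_def)

lemma hk_eq_0: "snd z <= 0 ==> hk z = 0"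
 by (simp add: hk_def)

lemma gauss_kernel_eq:
 fixes x :: "'a::euclidean_space"
 shows "0 < t ==> gauss_kernel x t = (4 * pi * t) powr (- real DIM('a) / 2) * exp (- (x \<bullet> x) / (4 * t))"
 by (simp add: gauss_kernel_def dot_square_norm)

lemma continuous_hk: "continuous_on {z. 0 < snd z} hk"
proof -
 have "continuous_on {z. 0 < snd z} (\<lambda>z. (4 * pi * snd z) powr (- real DIM('a) / 2) *
   exp (- (norm (fst z :: 'a))\<^sup>2 / (4 * snd z)))"
  by (intro continuous_intros) auto
 then show ?thesis
  by (rule continuous_on_cong[THEN iffD1, rotated -1]) (auto simp: hk_def gauss_kernel_def)
qed

lemma borel_measurable_hk [measurable]: "hk \<in> borel_measurable borel"
proof -
 have "hk = (\<lambda>z. if 0 < snd z then (4 * pi * snd z) powr (- real DIM('a) / 2) *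
   exp (- (norm (fst z :: 'a))\<^sup>2 / (4 * snd z)) else 0)"
  by (auto simp: hk_def gauss_kernel_def fun_eq_iff)
 also have "\<dots> \<in> borel_measurable borel" by measurable
 finally show ?thesis .
qed

lemma borel_measurable_Pair_borel [measurable (raw)]:
 fixes f :: "'c => 'a::euclidean_space" and g :: "'c => 'b::euclidean_space"
 assumes "f \<in> borel_measurable M" "g \<in> borel_measurable M"
 shows "(\<lambda>x. (f x, g x)) \<in> borel_measurable M"
 using assms unfolding borel_prod[symmetric] by measurable

text \<open>The kernel is the product over the coordinates of centred normal densities of variance
  2t.\<close>

lemma nn_integral_hk:
 assumes t: "0 < t"
 shows "(\<integral>\<^sup>+ x. ennreal (hk (x :: 'a::euclidean_space, t)) \<partial>lborel) = 1"
proof -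
 let ?n = "normal_density 0 (sqrt (2 * t))"
 have eq: "hk (x, t) = (\<Prod>b\<in>Basis. ?n (x \<bullet> b))" for x :: 'a
 proof -
  have n: "?n r = (4 * pi * t) powr (- (1 / 2)) * exp (- (r * r) / (4 * t))" for r
  proof -
   have "(4 * pi * t) powr (- (1 / 2)) = 1 / sqrt (4 * pi * t)"
    using t by (simp only: powr_minus_divide powr_half_sqrt) (simp add: powr_half_sqrt)
   moreover have "2 * pi * (sqrt (2 * t))\<^sup>2 = 4 * pi * t" "2 * (sqrt (2 * t))\<^sup>2 = 4 * t" using t by auto
   ultimately show ?thesis by (simp only: normal_density_def power2_eq_square diff_zero)
  qed
  have "(\<Prod>b\<in>(Basis :: 'a set). ?n (x \<bullet> b)) =
   (\<Prod>b\<in>(Basis :: 'a set). (4 * pi * t) powr (- (1 / 2))) * exp (\<Sum>b\<in>Basis. - ((x \<bullet> b) * (x \<bullet> b)) / (4 * t))"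
   by (simp only: n prod.distrib exp_sum finite_Basis)
  also have "(\<Prod>b\<in>(Basis :: 'a set). (4 * pi * t) powr (- (1 / 2))) = (4 * pi * t) powr (- real DIM('a) / 2)"
  proof -
   have "((4 * pi * t) powr (- (1 / 2))) ^ DIM('a) = ((4 * pi * t) powr (- (1 / 2))) powr real DIM('a)"
    using t by (intro powr_realpow[symmetric]) simp
   then show ?thesis by (simp add: powr_powr)
  qed
  also have "(\<Sum>b\<in>Basis. - ((x \<bullet> b) * (x \<bullet> b)) / (4 * t)) = - (x \<bullet> x) / (4 * t)"
  proof -
   have "x \<bullet> x = (\<Sum>b\<in>Basis. (x \<bullet> b) * (x \<bullet> b))" by (rule euclidean_inner)
   then show ?thesis by (simp only: sum_negf[symmetric] sum_divide_distrib)
  qed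
  finally show ?thesis using t by (simp add: hk_def gauss_kernel_eq)
 qed
 have "(\<integral>\<^sup>+ x. ennreal (hk (x :: 'a, t)) \<partial>lborel) = (\<integral>\<^sup>+ x. (\<Prod>b\<in>Basis. ennreal (?n ((x::'a) \<bullet> b))) \<partial>lborel)"
  by (simp add: eq prod_ennreal)
 also have "\<dots> = (\<Prod>b\<in>(Basis :: 'a set). (\<integral>\<^sup>+ x. ennreal (?n x) \<partial>lborel))"
  by (rule nn_integral_lborel_prod) auto
 also have "(\<integral>\<^sup>+ x. ennreal (?n x) \<partial>lborel) = 1"
  using t by (subst nn_integral_eq_integral) (auto simp: integrable_normal_density integral_normal_density)
 finally show ?thesis by simp
qed

lemma nn_integral_hk_shift:
 assumes t: "0 < t"
 shows "(\<integral>\<^sup>+ x. ennreal (hk (x - y :: 'a::euclidean_space, t)) \<partial>lborel) = 1"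
  and "(\<integral>\<^sup>+ x. ennreal (hk (y - x :: 'a::euclidean_space, t)) \<partial>lborel) = 1"
 using nn_integral_lborel_translate[of "\<lambda>x. ennreal (hk (x, t))" "- y"]
  nn_integral_lborel_reflect[of "\<lambda>x. ennreal (hk (x, t))" y] nn_integral_hk[OF t, where 'a='a]
 by simp_all

lemma integrable_hk:
 assumes "0 < t"
 shows "integrable lborel (\<lambda>x. hk (x - y :: 'a::euclidean_space, t))"
proof (rule integrableI_nonneg)
 show "(\<lambda>x. hk (x - y, t)) \<in> borel_measurable lborel" by measurable
qed (simp_all add: hk_nonneg nn_integral_hk_shift[OF assms])

lemma integral_hk:
 assumes "0 < t"
 shows "(LBINT x. hk (x - y :: 'a::euclidean_space, t)) = 1"
proof -
 have "ennreal (LBINT x. hk (x - y, t)) = 1"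
  using nn_integral_eq_integral[OF integrable_hk[OF assms, of y]] nn_integral_hk_shift(1)[OF assms, of y]
  by (simp add: hk_nonneg)
 then show ?thesis by simp
qed

text \<open>Completing the square in z: the product of the two Gaussians is again a Gaussian in z,
  centred at the weighted mean of x and y, with time parameter ts/(t + s). The prefactor is already
  the kernel at time t + s.\<close>

lemma hk_mult:
 fixes x y z :: "'a::euclidean_space"
 assumes t: "0 < t" and s: "0 < s"
 shows "hk (x - z, t) * hk (z - y, s) =
  hk (x - y, t + s) * hk (z - (1 / (t + s)) *\<^sub>R (s *\<^sub>R x + t *\<^sub>R y), t * s / (t + s))"
proof -
 define a b where "a = x - z" and "b = z - y"
 have ts: "t + s > 0" "t * s / (t + s) > 0" using t s by auto
 have z: "z - (1 / (t + s)) *\<^sub>R (s *\<^sub>R x + t *\<^sub>R y) = (1 / (t + s)) *\<^sub>R (t *\<^sub>R b - s *\<^sub>R a)"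
 proof -
  have "z = (1 / (t + s)) *\<^sub>R ((t + s) *\<^sub>R z)" using ts(1) by simp
  then have "z - (1 / (t + s)) *\<^sub>R (s *\<^sub>R x + t *\<^sub>R y) =
    (1 / (t + s)) *\<^sub>R ((t + s) *\<^sub>R z - (s *\<^sub>R x + t *\<^sub>R y))"
   by (metis scaleR_right_diff_distrib)
  also have "(t + s) *\<^sub>R z - (s *\<^sub>R x + t *\<^sub>R y) = t *\<^sub>R b - s *\<^sub>R a"
   by (simp add: a_def b_def algebra_simps)
  finally show ?thesis .
 qed
 have xy: "x - y = a + b" by (simp add: a_def b_def)
 let ?p = "- real DIM('a) / 2"
 have p: "(4 * pi * t) powr ?p * (4 * pi * s) powr ?p = (4 * pi * (t + s)) powr ?p * (4 * pi * (t * s / (t + s))) powr ?p"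
 proof -
  have "(4 * pi * t) * (4 * pi * s) = (4 * pi * (t + s)) * (4 * pi * (t * s / (t + s)))"
   using ts by simp
  moreover have m: "a powr ?p * b powr ?p = (a * b) powr ?p" if "a > 0" "b > 0" for a b :: real
   using that by (simp add: powr_mult)
  ultimately show ?thesis using t s ts
   by (subst (1 2) m) (simp_all only: mult_pos_pos pi_gt_zero zero_less_numeral)
 qed
 define A B C where "A = a \<bullet> a" and "B = b \<bullet> b" and "C = a \<bullet> b"
 have C': "b \<bullet> a = C" by (simp add: C_def inner_commute)
 have i1: "(a + b) \<bullet> (a + b) = A + B + 2 * C"
  by (simp add: inner_add_left inner_add_right A_def[symmetric] B_def[symmetric] C_def[symmetric] C')
 have i2: "((1 / (t + s)) *\<^sub>R (t *\<^sub>R b - s *\<^sub>R a)) \<bullet> ((1 / (t + s)) *\<^sub>R (t *\<^sub>R b - s *\<^sub>R a))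
   = (t\<^sup>2 * B + s\<^sup>2 * A - 2 * t * s * C) / (t + s)\<^sup>2"
 proof -
  have "(t *\<^sub>R b - s *\<^sub>R a) \<bullet> (t *\<^sub>R b - s *\<^sub>R a) = t\<^sup>2 * B + s\<^sup>2 * A - 2 * t * s * C"
   by (simp add: inner_diff_left inner_diff_right A_def[symmetric] B_def[symmetric] C_def[symmetric] C' power2_eq_square)
    (simp add: algebra_simps)
  then show ?thesis by (simp only: inner_scaleR_left inner_scaleR_right) (simp add: power2_eq_square)
 qed
 have e: "- A / (4 * t) + - B / (4 * s) =
   - (A + B + 2 * C) / (4 * (t + s)) + - ((t\<^sup>2 * B + s\<^sup>2 * A - 2 * t * s * C) / (t + s)\<^sup>2) / (4 * (t * s / (t + s)))"
 proof -
  have r: "- ((t\<^sup>2 * B + s\<^sup>2 * A - 2 * t * s * C) / (t + s)\<^sup>2) / (4 * (t * s / (t + s)))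
    = - (t\<^sup>2 * B + s\<^sup>2 * A - 2 * t * s * C) / (4 * (t + s) * t * s)"
   using t s ts by (simp add: power2_eq_square divide_simps) (simp add: algebra_simps)
  have e1: "- A / (4 * t) + - B / (4 * s) = (- A * s - B * t) * (t + s) / (4 * (t + s) * t * s)"
   using t s ts by (simp add: divide_simps)
  have e2: "- (A + B + 2 * C) / (4 * (t + s)) = - (A + B + 2 * C) * (t * s) / (4 * (t + s) * t * s)"
   using t s ts by (simp add: divide_simps)
  show ?thesis unfolding e1 e2 r add_divide_distrib[symmetric]
   by (rule arg_cong[where f = "\<lambda>x. x / (4 * (t + s) * t * s)"]) (simp add: algebra_simps power2_eq_square)
 qed
 have "hk (x - z, t) * hk (z - y, s) =
   ((4 * pi * t) powr ?p * (4 * pi * s) powr ?p) * exp (- A / (4 * t) + - B / (4 * s))"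
  by (simp only: hk_def gauss_kernel_eq t s a_def[symmetric] b_def[symmetric] A_def B_def exp_add mult_ac fst_conv snd_conv if_True)
 also have "\<dots> = hk (a + b, t + s) * hk ((1 / (t + s)) *\<^sub>R (t *\<^sub>R b - s *\<^sub>R a), t * s / (t + s))"
  unfolding p e exp_add using ts t s by (simp only: hk_def gauss_kernel_eq fst_conv snd_conv if_True i1 i2 mult_ac)
 finally show ?thesis unfolding z xy .
qed

lemma hk_semigroup:
 fixes x y :: "'a::euclidean_space"
 assumes t: "0 < t" and s: "0 < s"
 shows "(\<integral>\<^sup>+ z. ennreal (hk (x - z, t) * hk (z - y, s)) \<partial>lborel) = ennreal (hk (x - y, t + s))"
proof -
 let ?m = "(1 / (t + s)) *\<^sub>R (s *\<^sub>R x + t *\<^sub>R y)"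
 have "(\<integral>\<^sup>+ z. ennreal (hk (x - z, t) * hk (z - y, s)) \<partial>lborel)
   = (\<integral>\<^sup>+ z. ennreal (hk (x - y, t + s)) * ennreal (hk (z - ?m, t * s / (t + s))) \<partial>lborel)"
  by (simp only: hk_mult[OF t s] ennreal_mult hk_nonneg)
 also have "\<dots> = ennreal (hk (x - y, t + s)) * (\<integral>\<^sup>+ z. ennreal (hk (z - ?m, t * s / (t + s))) \<partial>lborel)"
  by (rule nn_integral_cmult) measurable
 also have "(\<integral>\<^sup>+ z. ennreal (hk (z - ?m, t * s / (t + s))) \<partial>lborel) = 1"
  using t s by (intro nn_integral_hk_shift) auto
 finally show ?thesis by simp
qed

text \<open>For x in a ball and times in a compact part of (0, T), the kernel as a function of its
  pole is dominated by the Gaussian weight at time T, which is the function that admissible measures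
  integrate.\<close>

lemma hk_weight_bound:
 fixes a b R T :: real
 assumes a: "0 < a" and b: "b < T"
 obtains C where "C > 0"
  "!!(x::'a::euclidean_space) y t. norm x <= R ==> a <= t ==> t <= b ==> hk (x - y, t) <= C * exp (- (norm y)\<^sup>2 / (4 * T))"
proof (cases "a <= b")
 case ab: True
 let ?p = "- real DIM('a) / 2"
 define C where "C = (4 * pi * a) powr ?p * exp (R\<^sup>2 / (4 * (T - b)))"
 show ?thesis
 proof (rule that[of C])
  show "C > 0" using a by (simp add: C_def)
  fix x y :: 'a and t
  assume x: "norm x <= R" and t: "a <= t" "t <= b"
  have pos: "0 < t" "0 < b" "0 < T" "0 < T - b" using a b t by auto
  \<comment> \<open>Cauchy-Schwarz in Engel form. The gap T - b > 0 pays for replacing |x - y| by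
    |y|, at the price of a constant depending on the radius.\<close>
  have titu: "(p + q)\<^sup>2 / T <= p\<^sup>2 / b + q\<^sup>2 / (T - b)" for p q :: real
  proof -
   have "p\<^sup>2 / b + q\<^sup>2 / (T - b) - (p + q)\<^sup>2 / T = (p * (T - b) - q * b)\<^sup>2 / (b * (T - b) * T)"
    using pos by (simp add: divide_simps) (simp add: algebra_simps power2_eq_square)
   also have "\<dots> \<ge> 0" using pos by simp
   finally show ?thesis by simp
  qed
  have "norm y <= norm (x - y) + norm x" using norm_triangle_ineq4[of x "x - y"] by simp
  then have "(norm y)\<^sup>2 / T <= (norm (x - y) + norm x)\<^sup>2 / T"
   using pos by (intro divide_right_mono power_mono) auto
  also have "\<dots> <= (norm (x - y))\<^sup>2 / b + (norm x)\<^sup>2 / (T - b)" by (rule titu)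
  also have "\<dots> <= (norm (x - y))\<^sup>2 / t + R\<^sup>2 / (T - b)"
   using pos t x by (intro add_mono divide_left_mono divide_right_mono power_mono) auto
  finally have "- (norm (x - y))\<^sup>2 / (4 * t) <= R\<^sup>2 / (4 * (T - b)) + - (norm y)\<^sup>2 / (4 * T)"
   using pos by (simp add: divide_simps) (simp add: algebra_simps)
  then have "exp (- (norm (x - y))\<^sup>2 / (4 * t)) <= exp (R\<^sup>2 / (4 * (T - b))) * exp (- (norm y)\<^sup>2 / (4 * T))"
   by (simp add: exp_add[symmetric])
  moreover have "(4 * pi * t) powr ?p <= (4 * pi * a) powr ?p"
   using a t by (intro powr_mono2') auto
  ultimately have "(4 * pi * t) powr ?p * exp (- (norm (x - y))\<^sup>2 / (4 * t))
    <= (4 * pi * a) powr ?p * (exp (R\<^sup>2 / (4 * (T - b))) * exp (- (norm y)\<^sup>2 / (4 * T)))"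
   by (intro mult_mono) auto
  then show "hk (x - y, t) <= C * exp (- (norm y)\<^sup>2 / (4 * T))"
   using pos by (simp add: hk_def gauss_kernel_def C_def mult.assoc)
 qed
qed (rule that[of 1]; force)

text \<open>As t tends to 0 there is no pointwise bound, but the average over a ball survives:
  weighting it with the kernel from the origin at time T/2 - t turns it into a convolution, which
  the semigroup law evaluates at time T/2 < T. The range t \<le> T/4 keeps that auxiliary time
  between T/4 and T/2.\<close>

lemma heat_average_bound:
 fixes T R :: real
 assumes T: "0 < T"
 obtains C where "C > 0"
  "!!(y::'a::euclidean_space) t. 0 < t ==> t <= T / 4 ==>
   (\<integral>\<^sup>+ x. indicator (cball 0 R) x * ennreal (hk (x - y, t)) \<partial>lborel) <= ennreal (C * exp (- (norm y)\<^sup>2 / (4 * T)))"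
proof -
 let ?p = "- real DIM('a) / 2"
 obtain C1 where C1: "C1 > 0" "!!(x::'a) y t. norm x <= 0 ==> T / 2 <= t ==> t <= T / 2 ==> hk (x - y, t) <= C1 * exp (- (norm y)\<^sup>2 / (4 * T))"
  using hk_weight_bound[of "T / 2" "T / 2" T 0, where 'a='a] T by auto
 define c where "c = (4 * pi * (T / 2)) powr ?p * exp (- R\<^sup>2 / T)"
 have c: "c > 0" using T by (simp add: c_def)
 have low: "c <= hk (x, s)" if x: "norm x <= R" and s: "T / 4 <= s" "s <= T / 2" for x :: 'a and s
 proof -
  have s0: "0 < s" using s T by linarith
  have "(norm x)\<^sup>2 / (4 * s) <= R\<^sup>2 / T"
   using x s s0 T by (intro frac_le power_mono) auto
  then have "exp (- R\<^sup>2 / T) <= exp (- (norm x)\<^sup>2 / (4 * s))" by simp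
  moreover have "(4 * pi * (T / 2)) powr ?p <= (4 * pi * s) powr ?p"
   using s s0 by (intro powr_mono2') auto
  ultimately show ?thesis using s0 by (simp add: c_def hk_def gauss_kernel_def mult_mono)
 qed
 show ?thesis
 proof (rule that[of "C1 / c"])
  show "C1 / c > 0" using C1 c by simp
  fix y :: 'a and t :: real assume t: "0 < t" "t <= T / 4"
  \<comment> \<open>On the ball the auxiliary kernel is at least c, so inserting it costs a factor
    1/c and makes the integrand meaningful over the whole space.\<close>
  have pt: "indicator (cball 0 R) x * ennreal (hk (x - y, t)) <= ennreal (1 / c) * ennreal (hk (0 - x, T / 2 - t) * hk (x - y, t))" for x :: 'a
  proof (cases "x \<in> cball 0 R")
   case True
   then have "1 <= 1 / c * hk (0 - x, T / 2 - t)"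
    using low[of "- x" "T / 2 - t"] t c by (simp add: field_simps)
   then have "1 * hk (x - y, t) <= 1 / c * hk (0 - x, T / 2 - t) * hk (x - y, t)"
    by (intro mult_right_mono hk_nonneg)
   then have "ennreal (hk (x - y, t)) <= ennreal (1 / c * (hk (0 - x, T / 2 - t) * hk (x - y, t)))"
    by (intro ennreal_leI) (simp only: mult_1 mult.assoc)
   also have "\<dots> = ennreal (1 / c) * ennreal (hk (0 - x, T / 2 - t) * hk (x - y, t))"
    using c by (intro ennreal_mult) (auto simp: hk_nonneg)
   finally show ?thesis using True by simp
  qed simp
  have "(\<integral>\<^sup>+ x. indicator (cball 0 R) x * ennreal (hk (x - y, t)) \<partial>lborel)
   <= (\<integral>\<^sup>+ x. ennreal (1 / c) * ennreal (hk (0 - x, T / 2 - t) * hk (x - y, t)) \<partial>lborel)"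
   by (intro nn_integral_mono pt)
  also have "\<dots> = ennreal (1 / c) * (\<integral>\<^sup>+ x. ennreal (hk (0 - x, T / 2 - t) * hk (x - y, t)) \<partial>lborel)"
   by (rule nn_integral_cmult) measurable
  also have "\<dots> = ennreal (1 / c) * ennreal (hk (0 - y, T / 2 - t + t))"
   using t T by (subst hk_semigroup) auto
  also have "\<dots> <= ennreal (1 / c) * ennreal (C1 * exp (- (norm y)\<^sup>2 / (4 * T)))"
   using C1(2)[of 0 "T / 2" y] by (intro mult_left_mono ennreal_leI) auto
  also have "\<dots> = ennreal (C1 / c * exp (- (norm y)\<^sup>2 / (4 * T)))"
   using c C1 by (simp add: ennreal_mult[symmetric])
  finally show "(\<integral>\<^sup>+ x. indicator (cball 0 R) x * ennreal (hk (x - y, t)) \<partial>lborel) <= \<dots>" .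
 qed
qed

section \<open>Parabolic scaling and the approximate identity\<close>

lemma hk_scale:
 fixes x :: "'a::euclidean_space"
 assumes c: "0 < c"
 shows "c ^ DIM('a) * hk (c *\<^sub>R x, c\<^sup>2) = hk (x, 1)"
proof -
 have "(4 * pi * c\<^sup>2) powr (- real DIM('a) / 2) = (4 * pi) powr (- real DIM('a) / 2) * (c\<^sup>2) powr (- real DIM('a) / 2)"
  using c by (subst powr_mult) auto
 also have "(c\<^sup>2) powr (- real DIM('a) / 2) = c powr (- real DIM('a))"
 proof -
  have "c\<^sup>2 = c powr 2" using c by simp
  then show ?thesis by (simp only: powr_powr) simp
 qed
 finally have "c ^ DIM('a) * (4 * pi * c\<^sup>2) powr (- real DIM('a) / 2) = (4 * pi) powr (- real DIM('a) / 2)"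
  using c by (simp add: powr_minus powr_realpow)
 moreover have "- ((c *\<^sub>R x) \<bullet> (c *\<^sub>R x)) / (4 * c\<^sup>2) = - (x \<bullet> x) / (4 * 1)"
  using c by (simp add: power2_eq_square)
 moreover have "0 < c\<^sup>2" using c by simp
 ultimately show ?thesis
  by (simp only: hk_def gauss_kernel_eq fst_conv snd_conv if_True zero_less_one mult.assoc[symmetric]) simp
qed

lemma integral_lborel_affine:
 fixes g :: "'a::euclidean_space => real"
 assumes [measurable]: "g \<in> borel_measurable borel" and c: "0 < c"
 shows "(LBINT x. g x) = c ^ DIM('a) * (LBINT x. g (y + c *\<^sub>R x))"
 using c by (subst lborel_affine[of c y]) (auto simp: integral_density integral_distr)

lemma integral_dominated_convergence_at_right:
 fixes s :: "real => 'b => real"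
 assumes m: "f \<in> borel_measurable M" "!!t. s t \<in> borel_measurable M" and w: "integrable M w"
  and lim: "AE x in M. ((\<lambda>t. s t x) \<longlongrightarrow> f x) (at_right a)"
  and bd: "\<forall>\<^sub>F t in at_right a. AE x in M. norm (s t x) <= w x"
 shows "((\<lambda>t. integral\<^sup>L M (s t)) \<longlongrightarrow> integral\<^sup>L M f) (at_right a)"
 unfolding tendsto_at_iff_sequentially comp_def
proof (intro allI impI)
 fix X assume X: "\<forall>i. X i \<in> {a<..} - {a}" "X \<longlonglongrightarrow> a"
 have FX: "filterlim X (at_right a) sequentially"
  using X by (auto simp: filterlim_at intro!: always_eventually less_imp_neq[symmetric])
 from filterlim_iff[THEN iffD1, OF this, rule_format, OF bd]
 obtain N where N: "!!n. n \<ge> N ==> AE x in M. norm (s (X n) x) <= w x"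
  by (auto simp: eventually_sequentially)
 have "(\<lambda>n. integral\<^sup>L M (s (X (n + N)))) \<longlonglongrightarrow> integral\<^sup>L M f"
 proof (rule integral_dominated_convergence[OF m w])
  show "AE x in M. (\<lambda>n. s (X (n + N)) x) \<longlonglongrightarrow> f x"
   using lim by eventually_elim (rule LIMSEQ_ignore_initial_segment, rule filterlim_compose[OF _ FX])
  show "AE x in M. norm (s (X (n + N)) x) <= w x" for n by (rule N) simp
 qed
 then show "(\<lambda>n. integral\<^sup>L M (s (X n))) \<longlonglongrightarrow> integral\<^sup>L M f" by (rule LIMSEQ_offset)
qed

text \<open>Substituting y + sqrt(t) x turns the kernel into the fixed Gaussian at time 1, so
  dominated convergence applies. \<open>f\<close> may depend on t because it will be a space-time
  test function.\<close>

lemma heat_approx_identity: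
 fixes f :: "'a::euclidean_space stfun"
 assumes f: "continuous_on UNIV f" and B: "!!z. \<bar>f z\<bar> <= B"
 shows "((\<lambda>t. LBINT x. hk (x - y, t) * f (x, t)) \<longlongrightarrow> f (y, 0)) (at_right 0)"
proof -
 have [measurable]: "f \<in> borel_measurable borel" using f by (rule borel_measurable_continuous_onI)
 have B0: "B \<ge> 0" using B[of 0] by linarith
 have eq: "(LBINT x. hk (x - y, t) * f (x, t)) = (LBINT x. hk (x - 0, 1) * f (y + sqrt t *\<^sub>R x, t))" if t: "0 < t" for t
 proof -
  have "(LBINT x. hk (x - y, t) * f (x, t)) =
    sqrt t ^ DIM('a) * (LBINT x. hk (y + sqrt t *\<^sub>R x - y, t) * f (y + sqrt t *\<^sub>R x, t))"
   using t by (intro integral_lborel_affine) auto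
  also have "\<dots> = (LBINT x. (sqrt t ^ DIM('a) * hk (sqrt t *\<^sub>R x, (sqrt t)\<^sup>2)) * f (y + sqrt t *\<^sub>R x, t))"
   using t by (simp add: mult.assoc)
  finally show ?thesis using t by (subst (asm) hk_scale) auto
 qed
 have "((\<lambda>t. LBINT x. hk (x - 0, 1) * f (y + sqrt t *\<^sub>R x, t)) \<longlongrightarrow> (LBINT x. hk (x - (0::'a), 1) * f (y, 0))) (at_right 0)"
 proof (rule integral_dominated_convergence_at_right[where w = "\<lambda>x::'a. B * hk (x - 0, 1)"])
  show "integrable lborel (\<lambda>x::'a. B * hk (x - 0, 1))" by (intro integrable_mult_right integrable_hk) simp
  show "\<forall>\<^sub>F t in at_right 0. AE x in lborel. norm (hk (x - 0, 1) * f (y + sqrt t *\<^sub>R x, t)) <= B * hk (x - 0, 1)"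
   using B by (intro always_eventually allI AE_I2) (simp add: abs_mult hk_nonneg mult.commute[of B] mult_left_mono)
  have "((\<lambda>t. f (y + sqrt t *\<^sub>R x, t)) \<longlongrightarrow> f (y + sqrt 0 *\<^sub>R x, 0)) (at_right 0)" for x
  proof (rule continuous_on_tendsto_compose[OF f])
   show "((\<lambda>t. (y + sqrt t *\<^sub>R x, t)) \<longlongrightarrow> (y + sqrt 0 *\<^sub>R x, 0)) (at_right 0)"
    by (intro tendsto_intros)
  qed auto
  then show "AE x in lborel. ((\<lambda>t. hk (x - 0, 1) * f (y + sqrt t *\<^sub>R x, t)) \<longlongrightarrow> hk (x - 0, 1) * f (y, 0)) (at_right 0)"
   by (intro AE_I2 tendsto_intros) simp
 qed measurable
 also have "(LBINT x. hk (x - (0::'a), 1) * f (y, 0)) = f (y, 0)"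
  using integral_hk[of 1 "0::'a"] by (simp del: diff_zero)
 finally show ?thesis
  by (rule Lim_transform_eventually) (auto simp: eventually_at_filter eq)
qed

section \<open>The Gauss kernel as fundamental solution of the heat equation\<close>

lemma hk_has_derivative:
 fixes z :: "'a::euclidean_space \<times> real"
 assumes z: "0 < snd z"
 shows "(hk has_derivative (\<lambda>h. hk z * (- (fst z \<bullet> fst h) / (2 * snd z) +
  snd h * ((fst z \<bullet> fst z) / (4 * (snd z)\<^sup>2) - real DIM('a) / (2 * snd z))))) (at z)"
proof -
 define q :: "'a stfun" where
  "q = (\<lambda>z. - real DIM('a) / 2 * ln (4 * pi * snd z) - (fst z \<bullet> fst z) / (4 * snd z))"
 have eq: "hk w = exp (q w)" if "0 < snd w" for w :: "'a \<times> real"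
  using that by (simp add: hk_def gauss_kernel_eq q_def powr_def mult_exp_exp)
 have D: "(q has_derivative (\<lambda>h. - (fst z \<bullet> fst h) / (2 * snd z) +
  snd h * ((fst z \<bullet> fst z) / (4 * (snd z)\<^sup>2) - real DIM('a) / (2 * snd z)))) (at z)"
 proof -
  have 1: "((\<lambda>z::'a \<times> real. - real DIM('a) / 2 * ln (4 * pi * snd z)) has_derivative
    (\<lambda>h. - real DIM('a) / 2 * (inverse (4 * pi * snd z) * (4 * pi * snd h)))) (at z)"
  proof (rule has_derivative_mult_right)
   have "((\<lambda>z::'a \<times> real. 4 * pi * snd z) has_derivative (\<lambda>h. 4 * pi * snd h)) (at z)"
    by (intro has_derivative_mult_right has_derivative_snd has_derivative_ident)
   from has_derivative_compose[OF this DERIV_ln[unfolded has_field_derivative_def]]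
   show "((\<lambda>z::'a \<times> real. ln (4 * pi * snd z)) has_derivative (\<lambda>h. inverse (4 * pi * snd z) * (4 * pi * snd h))) (at z)"
    using z by simp
  qed
  have 2: "((\<lambda>z::'a \<times> real. (fst z \<bullet> fst z) / (4 * snd z)) has_derivative
    (\<lambda>h. ((fst z \<bullet> fst h + fst h \<bullet> fst z) * (4 * snd z) - (fst z \<bullet> fst z) * (4 * snd h)) / ((4 * snd z) * (4 * snd z)))) (at z)"
   using z by (intro has_derivative_divide' has_derivative_inner has_derivative_fst has_derivative_snd
     has_derivative_mult_right has_derivative_ident) auto
  have 3: "- N / 2 * (inverse (4 * pi * t) * (4 * pi * \<sigma>)) - ((a + a) * (4 * t) - A * (4 * \<sigma>)) / ((4 * t) * (4 * t))
    = - a / (2 * t) + \<sigma> * (A / (4 * t\<^sup>2) - N / (2 * t))" if "t > 0" for N t \<sigma> a A :: real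
  proof -
   have i: "inverse (4 * pi * t) * (4 * pi * \<sigma>) = \<sigma> / t" using that by (simp add: field_simps)
   have "(a + a) * (4 * t) / ((4 * t) * (4 * t)) = a / (2 * t)" using that by simp
   moreover have "A * (4 * \<sigma>) / ((4 * t) * (4 * t)) = \<sigma> * (A / (4 * t\<^sup>2))"
    using that by (simp add: power2_eq_square)
   moreover have "- N / 2 * (\<sigma> / t) = - \<sigma> * (N / (2 * t))" using that by simp
   ultimately show ?thesis unfolding i diff_divide_distrib right_diff_distrib by simp
  qed
  show ?thesis
   unfolding q_def
  proof (rule has_derivative_eq_rhs[OF has_derivative_diff[OF 1 2]], rule ext)
   fix h :: "'a \<times> real"
   show "- real DIM('a) / 2 * (inverse (4 * pi * snd z) * (4 * pi * snd h)) -
     ((fst z \<bullet> fst h + fst h \<bullet> fst z) * (4 * snd z) - (fst z \<bullet> fst z) * (4 * snd h)) / ((4 * snd z) * (4 * snd z)) =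
     - (fst z \<bullet> fst h) / (2 * snd z) + snd h * ((fst z \<bullet> fst z) / (4 * (snd z)\<^sup>2) - real DIM('a) / (2 * snd z))"
    unfolding inner_commute[of "fst h" "fst z"] by (rule 3[OF z])
  qed
 qed
 have "((\<lambda>w. exp (q w)) has_derivative (\<lambda>h. exp (q z) * (- (fst z \<bullet> fst h) / (2 * snd z) +
  snd h * ((fst z \<bullet> fst z) / (4 * (snd z)\<^sup>2) - real DIM('a) / (2 * snd z))))) (at z)"
  by (rule has_derivative_compose[OF D DERIV_exp[unfolded has_field_derivative_def]])
 then show ?thesis
  unfolding eq[OF z]
 proof (rule has_derivative_transform_within_open)
  show "open {w :: 'a \<times> real. 0 < snd w}" by (intro open_Collect_less continuous_intros)
 qed (use z eq in auto)
qed

text \<open>The factor \<open>P\<close> vanishes for small times and so removes the singularity at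
  the origin. At nonpositive times the stated formula is 0 because of the factor
  \<open>hk z\<close>, whatever the quotients by \<open>snd z\<close> evaluate to.\<close>

lemma cutoff_hk_derivative:
 fixes P :: "'a::euclidean_space stfun"
 assumes \<delta>: "0 < \<delta>" and P0: "!!z. snd z < \<delta> ==> P z = 0"
  and P: "!!z. 0 < snd z ==> (P has_derivative P' z) (at z)"
 shows "((\<lambda>z. P z * hk z) has_derivative (\<lambda>h. P z * (hk z * (- (fst z \<bullet> fst h) / (2 * snd z) +
  snd h * ((fst z \<bullet> fst z) / (4 * (snd z)\<^sup>2) - real DIM('a) / (2 * snd z)))) + P' z h * hk z)) (at z)"
proof (cases "0 < snd z")
 case True
 show ?thesis by (intro has_derivative_mult P hk_has_derivative True)
next
 case False
 then have "snd z < \<delta>" "hk z = 0" using \<delta> by (auto simp: hk_def)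
 have "((\<lambda>z. P z * hk z) has_derivative (\<lambda>_. 0)) (at z)"
 proof (rule has_derivative_transform_within_open[of "\<lambda>_. 0"])
  show "open {w :: 'a \<times> real. snd w < \<delta>}" by (intro open_Collect_less continuous_intros)
 qed (use \<open>snd z < \<delta>\<close> P0 in auto)
 then show ?thesis using \<open>hk z = 0\<close> by simp
qed

lemma continuous_cutoff_hk:
 fixes P :: "'a::euclidean_space stfun"
 assumes \<delta>: "0 < \<delta>" and P0: "!!z. snd z < \<delta> ==> P z = 0" and P: "continuous_on {z. 0 < snd z} P"
 shows "continuous_on UNIV (\<lambda>z. P z * hk z)"
proof -
 have "continuous_on ({z. 0 < snd z} \<union> {z. snd z < \<delta>}) (\<lambda>z. P z * hk z)"
 proof (rule continuous_on_open_Un)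
  show "open {w :: 'a \<times> real. 0 < snd w}" "open {w :: 'a \<times> real. snd w < \<delta>}"
   by (intro open_Collect_less continuous_intros)+
  show "continuous_on {z. 0 < snd z} (\<lambda>z. P z * hk z)" by (intro continuous_intros P continuous_hk)
  show "continuous_on {z. snd z < \<delta>} (\<lambda>z. P z * hk z)"
   by (rule continuous_on_cong[THEN iffD2, OF refl _ continuous_on_const[of _ 0]]) (use P0 in auto)
 qed
 moreover have "{z. 0 < snd z} \<union> {z. snd z < \<delta>} = (UNIV :: ('a \<times> real) set)" using \<delta> by auto
 ultimately show ?thesis by simp
qed

text \<open>The kernel has mass 1 at every positive time and vanishes before, so its mass up to time
  M is finite.\<close>

lemma integrable_hk_strip:
 fixes g :: "'a::euclidean_space stfun"
 assumes [measurable]: "g \<in> borel_measurable borel" and B: "!!z. \<bar>g z\<bar> <= B"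
  and off: "!!z. M < snd z ==> g z = 0"
 shows "integrable lborel (\<lambda>z. hk z * g z)"
proof (rule L1_bound)
 have "(\<integral>\<^sup>+ z. ennreal (indicator {..M} (snd z) * hk (z :: 'a \<times> real)) \<partial>lborel)
   = (\<integral>\<^sup>+ t. (\<integral>\<^sup>+ x. ennreal (indicator {..M} t * hk (x :: 'a, t)) \<partial>lborel) \<partial>lborel)"
 proof -
  have "(\<lambda>z::'a \<times> real. ennreal (indicator {..M} (snd z) * hk z)) \<in> borel_measurable (lborel \<Otimes>\<^sub>M lborel)"
   unfolding lborel_prod by measurable
  from lborel_pair.nn_integral_snd[OF this] show ?thesis by (simp add: lborel_prod)
 qed
 also have "\<dots> <= (\<integral>\<^sup>+ t. indicator {0..M} t \<partial>lborel)"
 proof (rule nn_integral_mono)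
  fix t :: real
  show "(\<integral>\<^sup>+ x. ennreal (indicator {..M} t * hk (x :: 'a, t)) \<partial>lborel) <= indicator {0..M} t"
   using nn_integral_hk[of t, where 'a='a] by (cases "0 < t"; cases "t <= M") (auto simp: hk_eq_0)
 qed
 also have "\<dots> < \<infinity>" by (simp add: emeasure_lborel_Icc_eq)
 finally show "integrable lborel (\<lambda>z::'a \<times> real. B * (indicator {..M} (snd z) * hk z))"
  by (intro integrable_mult_right integrableI_nonneg) (auto simp: hk_nonneg)
 have "B \<ge> 0" using B[of undefined] by linarith
 then show "AE z in lborel. norm (hk z * g z) <= norm (B * (indicator {..M} (snd z) * hk z))"
  using B off by (intro AE_I2) (auto simp: abs_mult hk_nonneg indicator_def mult.commute[of B] intro!: mult_left_mono)
qed measurable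

text \<open>A time cut-off makes the kernel regular enough for integration by parts. What remains is
  an average, over times near \<epsilon>, of the integral of hk \<phi> in x, and this tends to
  \<phi> at the origin.\<close>

lemma fundamental_solution_0:
 fixes \<phi> :: "'a::euclidean_space stfun"
 assumes \<phi>: "smooth \<phi>" and K: "compact K" "!!z. z \<notin> K ==> \<phi> z = 0"
 shows "(LBINT z. hk z * adj_heat \<phi> z) = \<phi> 0"
proof -
 have c\<phi>: "continuous_on UNIV \<phi>" and ca: "continuous_on UNIV (adj_heat \<phi>)"
  using \<phi> by (auto intro: smooth_continuous continuous_adj_heat)
 have aoff: "adj_heat \<phi> z = 0" if "z \<notin> K" for z using adj_heat_zero_off[OF K that] .
 obtain M where M: "M \<ge> 0" "!!z. \<bar>\<phi> z\<bar> <= M" using bounded_compact_support[OF c\<phi> K] by blast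
 obtain N where N: "N \<ge> 0" "!!z. \<bar>adj_heat \<phi> z\<bar> <= N" using bounded_compact_support[OF ca K(1) aoff] by blast
 have [measurable]: "\<phi> \<in> borel_measurable borel" "adj_heat \<phi> \<in> borel_measurable borel"
  using c\<phi> ca by (auto intro: borel_measurable_continuous_onI)
 obtain R where R: "R > 0" "!!z. z \<in> K ==> norm z <= R"
  using compact_imp_bounded[OF K(1)] by (auto simp: bounded_pos)
 have Rsnd: "z \<notin> K" if "R < snd z" for z :: "'a \<times> real"
  using R(2)[of z] norm_snd_le[of "snd z" "fst z"] that by fastforce
 have ha: "integrable lborel (\<lambda>z. hk z * adj_heat \<phi> z)"
  by (rule integrable_hk_strip[where M=R and B=N]) (use N aoff Rsnd in auto)
 have hp: "integrable lborel (\<lambda>z. hk z * \<phi> z)"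
  by (rule integrable_hk_strip[where M=R and B=M]) (use M K Rsnd in auto)
 define F where "F t = (LBINT x. hk (x, t) * \<phi> (x, t))" for t
 have Fi: "integrable lborel F"
  unfolding F_def using lborel_pair.integrable_snd[of "\<lambda>x t. hk (x, t) * \<phi> (x, t)"] hp
  by (simp add: case_prod_beta' lborel_prod)
 define \<epsilon> where "\<epsilon> n = 1 / real (Suc n)" for n
 have \<epsilon>: "\<epsilon> n > 0" "\<epsilon> n <= 1" for n by (auto simp: \<epsilon>_def)
 have \<epsilon>lim: "\<epsilon> \<longlonglongrightarrow> 0" unfolding \<epsilon>_def[abs_def] by (rule LIMSEQ_Suc[OF lim_1_over_n])
 \<comment> \<open>The rise takes place within \<epsilon>/2 of time \<epsilon>, hence at positive
   times; the fall near R + 2 lies beyond the support of \<phi>, so it contributes nothing.\<close>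
 define \<theta> where "\<theta> n = plateau (\<epsilon> n / 2) (\<epsilon> n) (R + 2)" for n
 have e2: "0 < \<epsilon> n / 2" "\<epsilon> n <= R + 2" for n using \<epsilon>[of n] R(1) by auto
 have \<theta>: "smooth (\<theta> n)" "0 <= \<theta> n \<tau>" "\<theta> n \<tau> <= 1" "\<tau> < \<epsilon> n / 2 ==> \<theta> n \<tau> = 0"
   "2 * \<epsilon> n <= \<tau> ==> \<tau> <= R ==> \<theta> n \<tau> = 1"
   "dir_deriv (\<theta> n) 1 \<tau> = moll (\<epsilon> n / 2) (\<epsilon> n - \<tau>) - moll (\<epsilon> n / 2) (R + 2 - \<tau>)" for n \<tau>
  using smooth_plateau[OF e2(1)] plateau_nonneg[OF e2(1)] plateau_le_1[OF e2(1)] dir_deriv_plateau[OF e2]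
   plateau_eq_0[OF e2(1), of \<tau> "\<epsilon> n" n "R + 2"] plateau_eq_1[OF e2(1), of "\<epsilon> n" n \<tau> "R + 2"] \<epsilon>[of n]
  by (auto simp: \<theta>_def)
 have [measurable]: "\<theta> n \<in> borel_measurable borel" for n
  using smooth_continuous[OF \<theta>(1)] by (rule borel_measurable_continuous_onI)
 have step: "(LBINT z. \<theta> n (snd z) * hk z * adj_heat \<phi> z) = conv F (moll (\<epsilon> n / 2)) (\<epsilon> n)" for n
 proof -
  let ?f = "\<lambda>z::'a \<times> real. \<theta> n (snd z) * hk z"
  have P1: "((\<lambda>z::'a \<times> real. \<theta> n (snd z)) has_derivative (\<lambda>h. dir_deriv (\<theta> n) (snd h) (snd z))) (at z)" for z
   by (rule has_derivative_compose[where g="\<theta> n" and f=snd])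
    (auto intro!: derivative_eq_intros smooth_has_derivative \<theta>)
  have D1: "(?f has_derivative (\<lambda>h. \<theta> n (snd z) * (hk z * (- (fst z \<bullet> fst h) / (2 * snd z) +
    snd h * ((fst z \<bullet> fst z) / (4 * (snd z)\<^sup>2) - real DIM('a) / (2 * snd z)))) + dir_deriv (\<theta> n) (snd h) (snd z) * hk z)) (at z)" for z
   by (rule cutoff_hk_derivative[OF e2(1)[of n] \<theta>(4) P1])
  have dscale: "dir_deriv (\<theta> n) c \<tau> = c * dir_deriv (\<theta> n) 1 \<tau>" for c \<tau>
   using dir_deriv_scale[OF smooth_D[OF \<theta>(1)[of n]], of c 1 \<tau>] by simp
  have d1: "dir_deriv ?f v = (\<lambda>z. (\<theta> n (snd z) * (- (fst z \<bullet> fst v) / (2 * snd z) +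
    snd v * ((fst z \<bullet> fst z) / (4 * (snd z)\<^sup>2) - real DIM('a) / (2 * snd z))) + snd v * dir_deriv (\<theta> n) 1 (snd z)) * hk z)" for v
  proof
   fix z :: "'a \<times> real"
   show "dir_deriv ?f v z = (\<theta> n (snd z) * (- (fst z \<bullet> fst v) / (2 * snd z) +
    snd v * ((fst z \<bullet> fst z) / (4 * (snd z)\<^sup>2) - real DIM('a) / (2 * snd z))) + snd v * dir_deriv (\<theta> n) 1 (snd z)) * hk z"
    unfolding dir_deriv_eq[OF D1] by (subst dscale) (simp add: algebra_simps)
  qed
  have d\<theta>0: "dir_deriv (\<theta> n) 1 \<tau> = 0" if "\<tau> < \<epsilon> n / 2" for \<tau>
  proof (rule dir_deriv_eq)
   show "(\<theta> n has_derivative (\<lambda>_. 0)) (at \<tau>)"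
    by (rule has_derivative_transform_within_open[of "\<lambda>_. 0" _ _ _ "{..<\<epsilon> n / 2}"]) (use that \<theta>(4) in auto)
  qed
  have cth: "continuous_on A (\<lambda>z::'a \<times> real. \<theta> n (snd z))" "continuous_on A (\<lambda>z::'a \<times> real. dir_deriv (\<theta> n) 1 (snd z))" for A
   using smooth_continuous[OF \<theta>(1)] smooth_continuous[OF smooth_dir_deriv[OF \<theta>(1)]]
   by (auto intro!: continuous_on_compose2[of UNIV _ _ snd] continuous_intros)
  define P2 where "P2 i = (\<lambda>z::'a \<times> real. \<theta> n (snd z) * (- (fst z \<bullet> i) / (2 * snd z)))" for i
  have d1i: "dir_deriv ?f (i, 0) = (\<lambda>z. P2 i z * hk z)" for i unfolding d1 P2_def by simp
  have P2: "(P2 i has_derivative (\<lambda>h. \<theta> n (snd z) * (- (fst h \<bullet> i) / (2 * snd z) + snd h * (fst z \<bullet> i) / (2 * (snd z)\<^sup>2))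
    + dir_deriv (\<theta> n) (snd h) (snd z) * (- (fst z \<bullet> i) / (2 * snd z)))) (at z)" if z: "0 < snd z" for i z
   unfolding P2_def
  proof (rule has_derivative_mult[OF P1])
   show "((\<lambda>z::'a \<times> real. - (fst z \<bullet> i) / (2 * snd z)) has_derivative
     (\<lambda>h. - (fst h \<bullet> i) / (2 * snd z) + snd h * (fst z \<bullet> i) / (2 * (snd z)\<^sup>2))) (at z)"
    using z by (auto intro!: derivative_eq_intros simp: fun_eq_iff divide_simps power2_eq_square)
  qed
  have P20: "P2 i z = 0" if "snd z < \<epsilon> n / 2" for i z using \<theta>(4)[OF that] by (simp add: P2_def)
  have D2: "((\<lambda>z. P2 i z * hk z) has_derivative (\<lambda>h. P2 i z * (hk z * (- (fst z \<bullet> fst h) / (2 * snd z) +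
    snd h * ((fst z \<bullet> fst z) / (4 * (snd z)\<^sup>2) - real DIM('a) / (2 * snd z))))
   + (\<theta> n (snd z) * (- (fst h \<bullet> i) / (2 * snd z) + snd h * (fst z \<bullet> i) / (2 * (snd z)\<^sup>2))
    + dir_deriv (\<theta> n) (snd h) (snd z) * (- (fst z \<bullet> i) / (2 * snd z))) * hk z)) (at z)" for i z
   by (rule cutoff_hk_derivative[OF e2(1)[of n] P20 P2])
  have d2: "dir_deriv (dir_deriv ?f (i, 0)) (i, 0) =
    (\<lambda>z. \<theta> n (snd z) * ((fst z \<bullet> i)\<^sup>2 / (4 * (snd z)\<^sup>2) - (i \<bullet> i) / (2 * snd z)) * hk z)" for i
  proof
   fix z :: "'a \<times> real"
   have "dir_deriv (\<theta> n) 0 (snd z) = 0" by (subst dscale) simp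
   then show "dir_deriv (dir_deriv ?f (i, 0)) (i, 0) z = \<theta> n (snd z) * ((fst z \<bullet> i)\<^sup>2 / (4 * (snd z)\<^sup>2) - (i \<bullet> i) / (2 * snd z)) * hk z"
    unfolding d1i dir_deriv_eq[OF D2]
    by (simp add: P2_def power2_eq_square algebra_simps)
  qed
  \<comment> \<open>The Gauss kernel solves the heat equation, so only the derivative of the time
    cut-off survives.\<close>
  have heat: "heat_op ?f z = dir_deriv (\<theta> n) 1 (snd z) * hk z" for z :: "'a \<times> real"
  proof -
   have "(\<Sum>i\<in>(Basis :: 'a set). \<theta> n (snd z) * ((fst z \<bullet> i)\<^sup>2 / (4 * (snd z)\<^sup>2) - (i \<bullet> i) / (2 * snd z)) * hk z)
    = \<theta> n (snd z) * ((\<Sum>i\<in>(Basis :: 'a set). (fst z \<bullet> i)\<^sup>2 / (4 * (snd z)\<^sup>2) - 1 / (2 * snd z))) * hk z"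
    by (simp add: sum_distrib_left sum_distrib_right)
   also have "(\<Sum>i\<in>(Basis :: 'a set). (fst z \<bullet> i)\<^sup>2 / (4 * (snd z)\<^sup>2) - 1 / (2 * snd z)) =
    (fst z \<bullet> fst z) / (4 * (snd z)\<^sup>2) - real DIM('a) / (2 * snd z)"
    using euclidean_inner[of "fst z" "fst z"] by (simp only: sum_subtractf sum_divide_distrib[symmetric] power2_eq_square) simp
   finally show ?thesis unfolding heat_op_def d2 unfolding d1 by (simp add: algebra_simps)
  qed
  have "(LBINT z. ?f z * adj_heat \<phi> z) = (LBINT z. heat_op ?f z * \<phi> z)"
  proof (rule integral_adj_heat[OF _ _ _ _ \<phi> K])
   show "?f differentiable (at z)" for z unfolding differentiable_def using D1 by blast
   show "continuous_on UNIV (dir_deriv ?f v)" for v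
    unfolding d1 by (rule continuous_cutoff_hk[OF e2(1)[of n]])
     (auto simp: \<theta>(4) d\<theta>0 intro!: continuous_intros cth)
   show "dir_deriv ?f (i, 0) differentiable (at z)" for i z unfolding d1i differentiable_def using D2 by blast
   show "continuous_on UNIV (dir_deriv (dir_deriv ?f (i, 0)) (i, 0))" for i
    unfolding d2 by (rule continuous_cutoff_hk[OF e2(1)[of n]])
     (auto simp: \<theta>(4) intro!: continuous_intros cth)
  qed
  also have "\<dots> = (LBINT z. moll (\<epsilon> n / 2) (\<epsilon> n - snd z) * (hk z * \<phi> z))"
  proof (intro lint_cong)
   fix z :: "'a \<times> real"
   show "heat_op ?f z * \<phi> z = moll (\<epsilon> n / 2) (\<epsilon> n - snd z) * (hk z * \<phi> z)"
   proof (cases "z \<in> K")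
    case True
    then have "snd z <= R" using Rsnd[of z] by (meson linorder_not_less)
    then have "moll (\<epsilon> n / 2) (R + 2 - snd z) = 0"
     using \<epsilon>(2)[of n] by (intro moll_eq_0[OF e2(1)]) auto
    then show ?thesis unfolding heat \<theta>(6) by simp
   qed (simp add: K)
  qed
  also have "\<dots> = (\<integral>(x, t). moll (\<epsilon> n / 2) (\<epsilon> n - t) * (hk (x, t) * \<phi> (x, t)) \<partial>(lborel \<Otimes>\<^sub>M lborel))"
   by (simp add: lborel_prod case_prod_beta')
  also have "\<dots> = (LBINT t. (LBINT x. moll (\<epsilon> n / 2) (\<epsilon> n - t) * (hk (x, t) * \<phi> (x, t))))"
  proof (rule lborel_pair.integral_snd[symmetric])
   have [measurable]: "moll (\<epsilon> n / 2) \<in> borel_measurable (borel :: real measure)"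
    by (intro borel_measurable_continuous_onI smooth_continuous smooth_moll e2)
   obtain B where B: "!!x::real. \<bar>moll (\<epsilon> n / 2) x\<bar> <= B"
    using bounded_compact_support[OF smooth_continuous[OF smooth_moll[OF e2(1)]] compact_cball moll_eq_0[OF e2(1)]] by metis
   show "integrable (lborel \<Otimes>\<^sub>M lborel) (\<lambda>(x, t). moll (\<epsilon> n / 2) (\<epsilon> n - t) * (hk (x, t) * \<phi> (x, t)))"
   proof (rule L1_bound[of _ "\<lambda>z. B * (hk z * \<phi> z)"])
    have "B \<ge> 0" using B[of 0] by linarith
    then show "AE z in lborel \<Otimes>\<^sub>M lborel. norm (case z of (x, t) => moll (\<epsilon> n / 2) (\<epsilon> n - t) * (hk (x, t) * \<phi> (x, t))) <= norm (B * (hk z * \<phi> z))"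
     using B by (auto simp: abs_mult intro!: mult_right_mono AE_I2)
   qed (use hp in \<open>auto simp: lborel_prod\<close>)
  qed
  also have "\<dots> = conv F (moll (\<epsilon> n / 2)) (\<epsilon> n)"
   by (simp add: conv_def F_def mult.commute)
  finally show ?thesis .
 qed
 have lhs: "(\<lambda>n. LBINT z. \<theta> n (snd z) * hk z * adj_heat \<phi> z) \<longlonglongrightarrow> (LBINT z. hk z * adj_heat \<phi> z)"
 proof (rule integral_dominated_convergence[where w = "\<lambda>z. \<bar>hk z * adj_heat \<phi> z\<bar>"])
  show "integrable lborel (\<lambda>z. \<bar>hk z * adj_heat \<phi> z\<bar>)" using ha by simp
  show "AE z in lborel. norm (\<theta> n (snd z) * hk z * adj_heat \<phi> z) <= \<bar>hk z * adj_heat \<phi> z\<bar>" for n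
   using \<theta>(2,3)[of n] by (intro AE_I2) (simp add: abs_mult mult.assoc mult_left_le_one_le hk_nonneg)
  show "AE z in lborel. (\<lambda>n. \<theta> n (snd z) * hk z * adj_heat \<phi> z) \<longlonglongrightarrow> hk z * adj_heat \<phi> z"
  proof (intro AE_I2 tendsto_eventually)
   fix z :: "'a \<times> real"
   show "\<forall>\<^sub>F n in sequentially. \<theta> n (snd z) * hk z * adj_heat \<phi> z = hk z * adj_heat \<phi> z"
   proof (cases "0 < snd z \<and> z \<in> K")
    case True
    then have "snd z <= R" using Rsnd[of z] by (meson linorder_not_less)
    from True have "0 < snd z / 2" by simp
    from order_tendstoD(2)[OF \<epsilon>lim this] show ?thesis
    proof eventually_elim
     case (elim n)
     then have "\<theta> n (snd z) = 1" using \<open>snd z <= R\<close> by (intro \<theta>(5)) auto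
     then show ?case by simp
    qed
   next
    case False
    then show ?thesis using aoff[of z] by (auto simp: hk_def)
   qed
  qed
 qed measurable
 have rhs: "(\<lambda>n. conv F (moll (\<epsilon> n / 2)) (\<epsilon> n)) \<longlonglongrightarrow> \<phi> 0"
 proof (rule LIMSEQ_I)
  fix e :: real assume e: "0 < e"
  have "(F \<longlongrightarrow> \<phi> (0, 0)) (at_right 0)"
   using heat_approx_identity[OF c\<phi> M(2), of 0] by (simp add: F_def[abs_def])
  then have "\<forall>\<^sub>F t in at_right 0. dist (F t) (\<phi> (0, 0)) < e / 2" by (rule tendstoD) (use e in simp)
  then obtain d where d: "d > 0" "!!t. 0 < t ==> t < d ==> dist (F t) (\<phi> (0, 0)) < e / 2"
   unfolding eventually_at_right_field by auto
  obtain N where N: "!!n. n \<ge> N ==> \<epsilon> n < d / 2"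
   using order_tendstoD(2)[OF \<epsilon>lim, of "d / 2"] d(1) by (auto simp: eventually_sequentially)
  have "norm (conv F (moll (\<epsilon> n / 2)) (\<epsilon> n) - \<phi> 0) < e" if "n \<ge> N" for n
  proof -
   have "\<bar>conv F (moll (\<epsilon> n / 2)) (\<epsilon> n) - \<phi> 0\<bar> <= e / 2"
   proof (rule conv_moll_close[OF e2(1) Fi])
    fix t assume t: "norm (t - \<epsilon> n) <= \<epsilon> n / 2"
    then have "0 < t" "t < d"
     using N[OF that] \<epsilon>(1)[of n] unfolding real_norm_def by linarith+
    then show "\<bar>F t - \<phi> 0\<bar> <= e / 2" using d(2)[of t] by (simp add: dist_real_def zero_prod_def)
   qed
   then show ?thesis using e by simp
  qed
  then show "\<exists>N. \<forall>n\<ge>N. norm (conv F (moll (\<epsilon> n / 2)) (\<epsilon> n) - \<phi> 0) < e" by blast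
 qed
 show ?thesis using LIMSEQ_unique[OF lhs[unfolded step] rhs] .
qed

lemma dir_deriv_translate:
 fixes f :: "'b::euclidean_space => real"
 assumes "smooth f"
 shows "dir_deriv (\<lambda>z. f (a + z)) v = (\<lambda>z. dir_deriv f v (a + z))"
proof (intro ext dir_deriv_eq)
 fix z
 show "((\<lambda>z. f (a + z)) has_derivative (\<lambda>v. dir_deriv f v (a + z))) (at z)"
  by (rule has_derivative_compose[where g=f and f="\<lambda>z. a + z"])
   (auto intro!: derivative_eq_intros smooth_has_derivative assms)
qed

lemma fundamental_solution:
 fixes \<phi> :: "'a::euclidean_space stfun"
 assumes \<phi>: "smooth \<phi>" and K: "compact K" "!!z. z \<notin> K ==> \<phi> z = 0"
 shows "(LBINT z. hk (z - a) * adj_heat \<phi> z) = \<phi> a"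
proof -
 let ?\<phi> = "\<lambda>z. \<phi> (a + z)"
 have s: "smooth ?\<phi>" using smooth_affine[OF \<phi> bounded_linear_ident, of a] .
 have K': "compact ((\<lambda>z. z - a) ` K)"
  by (intro compact_continuous_image continuous_intros K)
 have off: "?\<phi> z = 0" if "z \<notin> (\<lambda>z. z - a) ` K" for z
 proof (rule K(2))
  show "a + z \<notin> K" using that by (auto simp: image_iff)
 qed
 have adj: "adj_heat ?\<phi> z = adj_heat \<phi> (a + z)" for z
  by (simp add: adj_heat_def dir_deriv_translate \<phi> smooth_dir_deriv)
 have [measurable]: "adj_heat \<phi> \<in> borel_measurable borel"
  by (intro borel_measurable_continuous_onI continuous_adj_heat \<phi>)
 have "(LBINT z. hk (z - a) * adj_heat \<phi> z) = (LBINT z. hk (a + z - a) * adj_heat \<phi> (a + z))"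
  by (rule integral_lborel_translate[symmetric]) measurable
 also have "\<dots> = \<phi> a" using fundamental_solution_0[OF s K' off] by (simp add: adj)
 finally show ?thesis .
qed

text \<open>As f = h - g with h continuous and g lower semicontinuous, f is upper semicontinuous as
  well. Lower semicontinuity of integrals of nonnegative functions is just Fatou's lemma, which
  makes this a cheap route to continuity of kernels.\<close>

lemma continuous_on_lsc_sum:
 fixes f g h :: "'b::metric_space => real"
 assumes h: "continuous_on S h" and sum: "!!x. x \<in> S ==> f x + g x = h x"
  and f: "!!X x. x \<in> S ==> (!!n. X n \<in> S) ==> X \<longlonglongrightarrow> x ==> ennreal (f x) <= liminf (\<lambda>n. ennreal (f (X n)))"
  and g: "!!X x. x \<in> S ==> (!!n. X n \<in> S) ==> X \<longlonglongrightarrow> x ==> ennreal (g x) <= liminf (\<lambda>n. ennreal (g (X n)))"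
  and nonneg: "!!x. x \<in> S ==> 0 <= f x" "!!x. x \<in> S ==> 0 <= g x"
 shows "continuous_on S f"
 unfolding continuous_on_sequentially comp_def
proof (intro ballI allI impI)
 fix x X assume x: "x \<in> S" and X': "(\<forall>n. X n \<in> S) \<and> X \<longlonglongrightarrow> x"
 then have X: "!!n. X n \<in> S" "X \<longlonglongrightarrow> x" by auto
 have low: "\<forall>\<^sub>F n in sequentially. p x - e < p (X n)"
  if p: "ennreal (p x) <= liminf (\<lambda>n. ennreal (p (X n)))" "!!x. x \<in> S ==> 0 <= p x" and e: "e > 0" for p :: "'b => real" and e
 proof (cases "p x - e < 0")
  case True
  then have "p x - e < p (X n)" for n using p(2)[OF X(1)[of n]] by linarith
  then show ?thesis by simp
 next
  case False
  then have "ennreal (p x - e) < ennreal (p x)" using e by (intro ennreal_lessI) auto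
  then have "ennreal (p x - e) < liminf (\<lambda>n. ennreal (p (X n)))" using p(1) by (rule less_le_trans)
  then have "\<forall>\<^sub>F n in sequentially. ennreal (p x - e) < ennreal (p (X n))" by (rule less_LiminfD)
  then show ?thesis
   by eventually_elim (use False in \<open>auto simp: ennreal_less_iff\<close>)
 qed
 have hX: "(\<lambda>n. h (X n)) \<longlonglongrightarrow> h x" using h x X' unfolding continuous_on_sequentially comp_def by blast
 show "(\<lambda>n. f (X n)) \<longlonglongrightarrow> f x"
 proof (rule tendstoI)
  fix e :: real assume "0 < e"
  then have e: "e / 2 > 0" by simp
  have "\<forall>\<^sub>F n in sequentially. dist (h (X n)) (h x) < e / 2" by (rule tendstoD[OF hX e])
  moreover have "\<forall>\<^sub>F n in sequentially. f x - e / 2 < f (X n)" by (rule low[OF f[OF x X] nonneg(1) e])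
  moreover have "\<forall>\<^sub>F n in sequentially. g x - e / 2 < g (X n)" by (rule low[OF g[OF x X] nonneg(2) e])
  ultimately show "\<forall>\<^sub>F n in sequentially. dist (f (X n)) (f x) < e"
  proof eventually_elim
   case (elim n)
   then show ?case using sum[OF x] sum[OF X(1)[of n]] \<open>0 < e\<close> unfolding dist_real_def by linarith
  qed
 qed
qed

lemma ennreal_liminf_add_mono:
 fixes u v :: "nat => ennreal"
 shows "liminf u + liminf v <= liminf (\<lambda>n. u n + v n)"
proof -
 have inc: "incseq (\<lambda>n. INF m\<in>{n..}. w m)" for w :: "nat => ennreal"
  by (intro incseq_SucI INF_superset_mono) auto
 have "liminf u + liminf v = (SUP n. (INF m\<in>{n..}. u m) + (INF m\<in>{n..}. v m))"
  unfolding liminf_SUP_INF by (rule ennreal_SUP_add[OF inc inc, symmetric])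
 also have "\<dots> <= (SUP n. INF m\<in>{n..}. u m + v m)"
  by (intro SUP_mono' INF_greatest add_mono INF_lower)
 finally show ?thesis unfolding liminf_SUP_INF .
qed

lemma AE_snd_neq: "AE z :: 'a::euclidean_space \<times> real in lborel. snd z \<noteq> s"
proof -
 have "AE z::'a \<times> real in lborel \<Otimes>\<^sub>M lborel. snd z \<noteq> s"
 proof (rule lborel_pair.AE_pair_measure)
  show "{z \<in> space (lborel \<Otimes>\<^sub>M lborel). snd z \<noteq> s} \<in> sets (lborel \<Otimes>\<^sub>M lborel :: ('a \<times> real) measure)"
   by measurable
  show "AE x in lborel. AE y in lborel. snd (x, y) \<noteq> s"
   using AE_lborel_singleton[of s] by auto
 qed
 then show ?thesis unfolding lborel_prod .
qed

text \<open>Time 0 is excluded because the kernel is discontinuous at the origin; in integrals over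
  space-time this costs only a null hyperplane.\<close>

lemma hk_tendsto:
 fixes X :: "nat => 'a::euclidean_space \<times> real"
 assumes "X \<longlonglongrightarrow> z" "snd z \<noteq> 0"
 shows "(\<lambda>n. hk (X n)) \<longlonglongrightarrow> hk z"
proof (cases "0 < snd z")
 case True
 have "open {z :: 'a \<times> real. 0 < snd z}" by (intro open_Collect_less continuous_intros)
 from continuous_on_eq_continuous_at[THEN iffD1, OF this continuous_hk] True have "isCont hk z" by blast
 then show ?thesis using assms(1) by (rule isCont_tendsto_compose)
next
 case False
 then have "snd z < 0" using assms(2) by simp
 from order_tendstoD(2)[OF tendsto_snd[OF assms(1)] this]
 have "\<forall>\<^sub>F n in sequentially. hk (X n) = hk z"
  by eventually_elim (use False in \<open>auto simp: hk_def\<close>)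
 then show ?thesis by (rule tendsto_eventually)
qed

section \<open>Kernels with a bounded potential\<close>

text \<open>The Duhamel integral of a source: since \<open>hk\<close> vanishes at nonpositive times,
  only sources before the time of z contribute.\<close>

definition heat_pot :: "('a::euclidean_space \<times> real => ennreal) => 'a \<times> real => ennreal" where
 "heat_pot g z = (\<integral>\<^sup>+ \<zeta>. ennreal (hk (z - \<zeta>)) * g \<zeta> \<partial>lborel)"

text \<open>Fatou's lemma, as the kernel converges for every \<zeta> off the null hyperplane of
  points with the same time as z.\<close>

lemma heat_pot_lsc:
 fixes g :: "'a::euclidean_space \<times> real => ennreal"
 assumes [measurable]: "g \<in> borel_measurable borel" and X: "X \<longlonglongrightarrow> z"
 shows "heat_pot g z <= liminf (\<lambda>n. heat_pot g (X n))"
proof -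
 have "heat_pot g z <= (\<integral>\<^sup>+ \<zeta>. liminf (\<lambda>n. ennreal (hk (X n - \<zeta>)) * g \<zeta>) \<partial>lborel)"
  unfolding heat_pot_def
 proof (rule nn_integral_mono_AE)
  show "AE \<zeta> in lborel. ennreal (hk (z - \<zeta>)) * g \<zeta> <= liminf (\<lambda>n. ennreal (hk (X n - \<zeta>)) * g \<zeta>)"
   using AE_snd_neq[of "snd z"]
  proof eventually_elim
   case (elim \<zeta>)
   have "(\<lambda>n. hk (X n - \<zeta>)) \<longlonglongrightarrow> hk (z - \<zeta>)" using elim by (intro hk_tendsto tendsto_intros X) auto
   then have *: "(\<lambda>n. ennreal (hk (X n - \<zeta>))) \<longlonglongrightarrow> ennreal (hk (z - \<zeta>))" by (rule tendsto_ennrealI)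
   show ?case
   proof (rule le_Liminf_iff[THEN iffD2], intro allI impI)
    fix y assume y: "y < ennreal (hk (z - \<zeta>)) * g \<zeta>"
    show "\<forall>\<^sub>F n in sequentially. y < ennreal (hk (X n - \<zeta>)) * g \<zeta>"
    \<comment> \<open>\<open>g \<zeta>\<close> may be infinite, and multiplication is not continuous
      at (0, \<infinity>); where the kernel vanishes the product is 0 and nothing lies below
      it.\<close>
    proof (cases "hk (z - \<zeta>) = 0")
     case False
     then have "(\<lambda>n. ennreal (hk (X n - \<zeta>)) * g \<zeta>) \<longlonglongrightarrow> ennreal (hk (z - \<zeta>)) * g \<zeta>"
      using hk_nonneg[of "z - \<zeta>"] by (intro tendsto_mult_ennreal * tendsto_const) auto
     then show ?thesis by (rule order_tendstoD) (rule y)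
    qed (use y in simp)
   qed
  qed
 qed
 also have "\<dots> <= liminf (\<lambda>n. heat_pot g (X n))"
  unfolding heat_pot_def by (rule nn_integral_liminf) measurable
 finally show ?thesis .
qed

text \<open>By the semigroup law, propagating from (y, 0) to time s and on to (x, t) gives the
  kernel at time t whatever s is, so only the time factor is left to integrate.\<close>

lemma heat_pot_hk:
 fixes x y :: "'a::euclidean_space" and g :: "real => ennreal"
 assumes [measurable]: "g \<in> borel_measurable borel" and t: "0 < t"
 shows "heat_pot (\<lambda>\<zeta>. ennreal (hk (\<zeta> - (y, 0))) * g (snd \<zeta>)) (x, t) =
  ennreal (hk (x - y, t)) * (\<integral>\<^sup>+ s. g s * indicator {0..t} s \<partial>lborel)"
proof -
 have "heat_pot (\<lambda>\<zeta>. ennreal (hk (\<zeta> - (y, 0))) * g (snd \<zeta>)) (x, t) =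
   (\<integral>\<^sup>+ s. (\<integral>\<^sup>+ z. ennreal (hk (x - z, t - s)) * (ennreal (hk (z - y, s)) * g s) \<partial>lborel) \<partial>lborel)"
 proof -
  have "(\<lambda>\<zeta>::'a \<times> real. ennreal (hk ((x, t) - \<zeta>)) * (ennreal (hk (\<zeta> - (y, 0))) * g (snd \<zeta>)))
    \<in> borel_measurable (lborel \<Otimes>\<^sub>M lborel)"
   unfolding lborel_prod by measurable
  from lborel_pair.nn_integral_snd[OF this] show ?thesis by (simp add: lborel_prod heat_pot_def)
 qed
 also have "\<dots> = (\<integral>\<^sup>+ s. ennreal (hk (x - y, t)) * (g s * indicator {0..t} s) \<partial>lborel)"
 proof (rule nn_integral_cong_AE)
  show "AE s in lborel. (\<integral>\<^sup>+ z. ennreal (hk (x - z, t - s)) * (ennreal (hk (z - y, s)) * g s) \<partial>lborel)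
   = ennreal (hk (x - y, t)) * (g s * indicator {0..t} s)"
   using AE_lborel_singleton[of 0] AE_lborel_singleton[of t]
  proof eventually_elim
   case (elim s)
   show ?case
   proof (cases "0 < s \<and> s < t")
    case True
    have "(\<integral>\<^sup>+ z. ennreal (hk (x - z, t - s)) * (ennreal (hk (z - y, s)) * g s) \<partial>lborel)
     = (\<integral>\<^sup>+ z. ennreal (hk (x - z, t - s) * hk (z - y, s)) * g s \<partial>lborel)"
     by (simp add: ennreal_mult hk_nonneg mult.assoc)
    also have "\<dots> = ennreal (hk (x - y, t)) * g s"
     using True by (subst nn_integral_multc) (auto simp: hk_semigroup)
    finally show ?thesis using True by (simp add: indicator_def)
   next
    case False
    then have "s < 0 \<or> t < s" using elim by auto
    then show ?thesis by (auto simp: hk_def indicator_def)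
   qed
  qed
 qed
 also have "\<dots> = ennreal (hk (x - y, t)) * (\<integral>\<^sup>+ s. g s * indicator {0..t} s \<partial>lborel)"
  by (rule nn_integral_cmult) measurable
 finally show ?thesis .
qed

text \<open>The kernel times exp(kt) solves the Duhamel equation with constant coefficient k
  exactly, which makes it the majorant of all iterates with coefficient at most k.\<close>

lemma heat_pot_exp:
 fixes x y :: "'a::euclidean_space"
 assumes k: "0 <= k"
 shows "heat_pot (\<lambda>\<zeta>. ennreal (k * exp (k * snd \<zeta>) * hk (\<zeta> - (y, 0)))) (x, t) =
  ennreal ((exp (k * t) - 1) * hk (x - y, t))"
proof (cases "0 < t")
 case True
 have "heat_pot (\<lambda>\<zeta>. ennreal (k * exp (k * snd \<zeta>) * hk (\<zeta> - (y, 0)))) (x, t) =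
   heat_pot (\<lambda>\<zeta>. ennreal (hk (\<zeta> - (y, 0))) * ennreal (k * exp (k * snd \<zeta>))) (x, t)"
  using k by (simp add: ennreal_mult hk_nonneg mult.commute)
 also have "\<dots> = ennreal (hk (x - y, t)) * (\<integral>\<^sup>+ s. ennreal (k * exp (k * s)) * indicator {0..t} s \<partial>lborel)"
  by (rule heat_pot_hk[OF _ True]) measurable
 also have "(\<integral>\<^sup>+ s. ennreal (k * exp (k * s)) * indicator {0..t} s \<partial>lborel) = ennreal (exp (k * t) - exp (k * 0))"
  using True k by (intro nn_integral_FTC_Icc) (auto intro!: derivative_eq_intros)
 finally show ?thesis using k True by (simp add: ennreal_mult hk_nonneg mult.commute)
next
 case False
 have "heat_pot (\<lambda>\<zeta>. ennreal (k * exp (k * snd \<zeta>) * hk (\<zeta> - (y, 0)))) (x, t) = (\<integral>\<^sup>+ \<zeta>. 0 \<partial>(lborel :: ('a \<times> real) measure))"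
  unfolding heat_pot_def
 proof (rule nn_integral_cong)
  fix \<zeta> :: "'a \<times> real"
  show "ennreal (hk ((x, t) - \<zeta>)) * ennreal (k * exp (k * snd \<zeta>) * hk (\<zeta> - (y, 0))) = 0"
   using False by (cases "snd \<zeta> <= 0") (auto simp: hk_eq_0)
 qed
 then show ?thesis using False by (simp add: hk_eq_0)
qed

text \<open>The iterates of the Duhamel equation for \<open>\<partial>\<^sub>t - \<Delta> - c\<close> with pole \<open>y\<close>, as functions of \<open>(y, z)\<close>.
 For \<open>0 \<le> c\<close> all terms are nonnegative, so that no convergence question arises.\<close>

primrec dyson :: "('a::euclidean_space stfun) => nat => 'a \<times> 'a \<times> real => ennreal" where
 "dyson c 0 p = ennreal (hk (snd p - (fst p, 0)))"
| "dyson c (Suc n) p = ennreal (hk (snd p - (fst p, 0))) +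
   (\<integral>\<^sup>+ \<zeta>. ennreal (hk (snd p - \<zeta>)) * (ennreal (c \<zeta>) * dyson c n (fst p, \<zeta>)) \<partial>lborel)"

definition dyson_sum :: "('a::euclidean_space stfun) => 'a \<times> 'a \<times> real => ennreal" where
 "dyson_sum c p = (SUP n. dyson c n p)"

text \<open>Measurability is needed jointly in the pole and the space-time point, for Fubini's
  theorem with the initial measure integrated over the pole.\<close>

lemma borel_measurable_dyson:
 fixes c :: "'a::euclidean_space stfun"
 assumes [measurable]: "c \<in> borel_measurable borel"
 shows "dyson c n \<in> borel_measurable borel"
proof (induction n)
 case 0
 have "(\<lambda>p :: 'a \<times> 'a \<times> real. ennreal (hk (snd p - (fst p, 0)))) \<in> borel_measurable borel" by measurable
 then show ?case by (simp add: fun_eq_iff[symmetric] cong: measurable_cong)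
next
 case (Suc n)
 note [measurable] = Suc
 have "(\<lambda>q :: ('a \<times> 'a \<times> real) \<times> 'a \<times> real. ennreal (hk (snd (fst q) - snd q)) *
   (ennreal (c (snd q)) * dyson c n (fst (fst q), snd q))) \<in> borel_measurable borel" by measurable
 then have "(\<lambda>(p, \<zeta>). ennreal (hk (snd p - \<zeta>)) * (ennreal (c \<zeta>) * dyson c n (fst p, \<zeta>)))
   \<in> borel_measurable (borel \<Otimes>\<^sub>M lborel)"
  by (simp add: borel_prod[symmetric] case_prod_beta' cong: measurable_cong_sets)
 from lborel.borel_measurable_nn_integral[OF this]
 have [measurable]: "(\<lambda>p :: 'a \<times> 'a \<times> real. \<integral>\<^sup>+ \<zeta>. ennreal (hk (snd p - \<zeta>)) * (ennreal (c \<zeta>) * dyson c n (fst p, \<zeta>)) \<partial>lborel)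
   \<in> borel_measurable borel" .
 have "(\<lambda>p :: 'a \<times> 'a \<times> real. ennreal (hk (snd p - (fst p, 0))) +
   (\<integral>\<^sup>+ \<zeta>. ennreal (hk (snd p - \<zeta>)) * (ennreal (c \<zeta>) * dyson c n (fst p, \<zeta>)) \<partial>lborel)) \<in> borel_measurable borel"
  by measurable
 then show ?case by (simp cong: measurable_cong)
qed

lemma borel_measurable_dyson_sum:
 assumes "c \<in> borel_measurable borel"
 shows "dyson_sum c \<in> borel_measurable borel"
 unfolding dyson_sum_def[abs_def] using borel_measurable_dyson[OF assms] by measurable

lemma dyson_mono_c:
 assumes "!!\<zeta>. c \<zeta> <= c' \<zeta>"
 shows "dyson c n p <= dyson c' n p"
 by (induction n arbitrary: p) (auto intro!: nn_integral_mono mult_mono add_mono ennreal_leI assms)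

lemma dyson_Suc_le: "dyson c n p <= dyson c (Suc n) p"
proof (induction n arbitrary: p)
 case (Suc n)
 show ?case
  by (subst (1 2) dyson.simps(2)) (intro add_left_mono nn_integral_mono mult_left_mono Suc; simp)
qed simp

text \<open>The iterates increase, so monotone convergence passes to the limit on both sides of the
  recursion.\<close>

lemma dyson_sum_eq:
 fixes c :: "'a::euclidean_space stfun"
 assumes [measurable]: "c \<in> borel_measurable borel"
 shows "dyson_sum c (y, z) = ennreal (hk (z - (y, 0))) + heat_pot (\<lambda>\<zeta>. ennreal (c \<zeta>) * dyson_sum c (y, \<zeta>)) z"
proof -
 note [measurable] = borel_measurable_dyson[of c]
 have inc: "incseq (\<lambda>n. dyson c n p)" for p by (rule incseq_SucI) (rule dyson_Suc_le)
 have "dyson_sum c (y, z) = (SUP n. dyson c (Suc n) (y, z))"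
  unfolding dyson_sum_def by (rule SUP_eq) (use dyson_Suc_le in blast)+
 also have "\<dots> = (SUP n. ennreal (hk (z - (y, 0))) +
   (\<integral>\<^sup>+ \<zeta>. ennreal (hk (z - \<zeta>)) * (ennreal (c \<zeta>) * dyson c n (y, \<zeta>)) \<partial>lborel))" by simp
 also have "\<dots> = ennreal (hk (z - (y, 0))) +
   (SUP n. \<integral>\<^sup>+ \<zeta>. ennreal (hk (z - \<zeta>)) * (ennreal (c \<zeta>) * dyson c n (y, \<zeta>)) \<partial>lborel)"
  by (rule ennreal_SUP_add_right[symmetric]) simp
 also have "(SUP n. \<integral>\<^sup>+ \<zeta>. ennreal (hk (z - \<zeta>)) * (ennreal (c \<zeta>) * dyson c n (y, \<zeta>)) \<partial>lborel)
   = (\<integral>\<^sup>+ \<zeta>. (SUP n. ennreal (hk (z - \<zeta>)) * (ennreal (c \<zeta>) * dyson c n (y, \<zeta>))) \<partial>lborel)"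
 proof (rule nn_integral_monotone_convergence_SUP[symmetric])
  show "incseq (\<lambda>n \<zeta>. ennreal (hk (z - \<zeta>)) * (ennreal (c \<zeta>) * dyson c n (y, \<zeta>)))"
   using inc by (intro incseq_SucI le_funI mult_left_mono dyson_Suc_le) auto
  show "(\<lambda>\<zeta>. ennreal (hk (z - \<zeta>)) * (ennreal (c \<zeta>) * dyson c n (y, \<zeta>))) \<in> borel_measurable lborel" for n
   by measurable
 qed
 also have "\<dots> = heat_pot (\<lambda>\<zeta>. ennreal (c \<zeta>) * dyson_sum c (y, \<zeta>)) z"
  unfolding heat_pot_def dyson_sum_def by (simp add: SUP_mult_left_ennreal)
 finally show ?thesis .
qed

text \<open>The bound is itself the solution for the constant coefficient k, so one step of the
  recursion preserves it.\<close>

lemma dyson_le: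
 fixes c :: "'a::euclidean_space stfun"
 assumes c: "!!z. c z <= k" and k: "0 <= k"
 shows "dyson c n (y, z) <= ennreal (exp (k * snd z) * hk (z - (y, 0)))"
proof (induction n arbitrary: z)
 case 0
 show ?case
 proof (cases "0 < snd z")
  case True
  then have "1 * hk (z - (y, 0)) <= exp (k * snd z) * hk (z - (y, 0))"
   using k by (intro mult_right_mono hk_nonneg) simp
  then show ?thesis by (simp add: ennreal_leI)
 qed (simp add: hk_eq_0)
next
 case (Suc n)
 obtain x t where z: "z = (x, t)" by (cases z)
 have "dyson c (Suc n) (y, z) <= ennreal (hk (z - (y, 0))) + heat_pot (\<lambda>\<zeta>. ennreal (k * exp (k * snd \<zeta>) * hk (\<zeta> - (y, 0)))) z"
  unfolding heat_pot_def dyson.simps fst_conv snd_conv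
 proof (intro add_left_mono nn_integral_mono mult_left_mono)
  fix \<zeta>
  have "ennreal (c \<zeta>) * dyson c n (y, \<zeta>) <= ennreal k * ennreal (exp (k * snd \<zeta>) * hk (\<zeta> - (y, 0)))"
   by (intro mult_mono Suc ennreal_leI c) auto
  then show "ennreal (c \<zeta>) * dyson c n (y, \<zeta>) <= ennreal (k * exp (k * snd \<zeta>) * hk (\<zeta> - (y, 0)))"
   using k by (simp add: ennreal_mult[symmetric] hk_nonneg mult.assoc)
 qed simp
 also have "\<dots> = ennreal (hk (x - y, t)) + ennreal ((exp (k * t) - 1) * hk (x - y, t))"
  unfolding z heat_pot_exp[OF k] by simp
 also have "\<dots> = ennreal (exp (k * snd z) * hk (z - (y, 0)))"
 proof (cases "0 < t")
  case True
  then have "0 <= (exp (k * t) - 1) * hk (x - y, t)" using k by (intro mult_nonneg_nonneg hk_nonneg) simp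
  then show ?thesis using True by (subst ennreal_plus[symmetric]) (auto simp: z hk_nonneg algebra_simps)
 qed (simp add: z hk_eq_0)
 finally show ?case .
qed

lemma dyson_sum_le:
 fixes c :: "'a::euclidean_space stfun"
 assumes "!!z. c z <= k" "0 <= k"
 shows "dyson_sum c (y, z) <= ennreal (exp (k * snd z) * hk (z - (y, 0)))"
 unfolding dyson_sum_def by (rule SUP_least) (rule dyson_le[OF assms])

text \<open>The kernel of \<open>\<partial>\<^sub>t - \<Delta> + W\<close> for \<open>0 \<le> W \<le> k\<close>: the factor \<open>exp (- k t)\<close> turns the potential
 \<open>W\<close> into \<open>- (k - W)\<close>.\<close>

definition bker :: "real => ('a::euclidean_space stfun) => 'a => 'a \<times> real => real" where
 "bker k W y z = exp (- k * snd z) * enn2real (dyson_sum (\<lambda>\<zeta>. k - W \<zeta>) (y, z))"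

locale bounded_potential =
 fixes k :: real and W :: "'a::euclidean_space stfun"
 assumes W_measurable [measurable]: "W \<in> borel_measurable borel"
  and W_nonneg: "0 <= W z" and W_le: "W z <= k"
begin

lemma k_nonneg: "0 <= k" using W_nonneg W_le order_trans by blast

definition c where "c = (\<lambda>z. k - W z)"

lemma c_measurable [measurable]: "c \<in> borel_measurable borel" unfolding c_def by measurable

lemma c_bounds: "0 <= c z" "c z <= k" using W_nonneg W_le by (auto simp: c_def)

definition s where "s y z = enn2real (dyson_sum c (y, z))"

lemmas dyson_sum_bound = dyson_sum_le[where c = c and k = k, OF c_bounds(2) k_nonneg]

lemma s_nonneg: "0 <= s y z" by (simp add: s_def)

lemma ennreal_s: "ennreal (s y z) = dyson_sum c (y, z)"
proof -
 have "dyson_sum c (y, z) < \<top>" using dyson_sum_bound by (rule le_less_trans) simp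
 then show ?thesis by (simp add: s_def)
qed

lemma s_le: "s y z <= exp (k * snd z) * hk (z - (y, 0))"
 using dyson_sum_bound[of y z] unfolding ennreal_s[symmetric]
 by (subst (asm) ennreal_le_iff) (auto simp: hk_nonneg)

lemma s_eq: "ennreal (s y z) = ennreal (hk (z - (y, 0))) + heat_pot (\<lambda>\<zeta>. ennreal (c \<zeta> * s y \<zeta>)) z"
 using dyson_sum_eq[OF c_measurable, of y z] unfolding ennreal_s[symmetric]
 by (simp add: ennreal_mult c_bounds s_nonneg)

lemma s_ge: "hk (z - (y, 0)) <= s y z"
proof -
 have "ennreal (hk (z - (y, 0))) <= ennreal (s y z)" unfolding s_eq by simp
 then show ?thesis by (simp add: s_nonneg)
qed

lemma s_measurable: "(\<lambda>p. s (fst p) (snd p)) \<in> borel_measurable borel"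
 unfolding s_def prod.collapse using borel_measurable_dyson_sum[OF c_measurable] by measurable

lemma s_measurable2 [measurable]: "s y \<in> borel_measurable borel"
proof -
 have "Pair y \<in> borel \<rightarrow>\<^sub>M (borel \<Otimes>\<^sub>M borel :: ('a \<times> 'a \<times> real) measure)"
  by (rule measurable_Pair1') simp
 then have "Pair y \<in> borel \<rightarrow>\<^sub>M (borel :: ('a \<times> 'a \<times> real) measure)" unfolding borel_prod .
 from measurable_compose[OF this s_measurable] show ?thesis by simp
qed

text \<open>Both \<open>s\<close> and its complement to exp(kt) times the Gauss kernel are lower
  semicontinuous at positive times, and their sum is continuous there.\<close>

lemma continuous_s: "continuous_on {z. 0 < snd z} (s y)"
proof (rule continuous_on_lsc_sum[where h = "\<lambda>z. exp (k * snd z) * hk (z - (y, 0))" and g = "\<lambda>z. exp (k * snd z) * hk (z - (y, 0)) - s y z"])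
 show "continuous_on {z. 0 < snd z} (\<lambda>z::'a \<times> real. exp (k * snd z) * hk (z - (y, 0)))"
  by (intro continuous_intros continuous_on_compose2[OF continuous_hk]) auto
 fix X and z :: "'a \<times> real" assume X: "X \<longlonglongrightarrow> z" and z: "z \<in> {z. 0 < snd z}"
 have hX: "(\<lambda>n. hk (X n - (y, 0))) \<longlonglongrightarrow> hk (z - (y, 0))"
  using z by (intro hk_tendsto tendsto_intros X) auto
 have "ennreal (s y z) = ennreal (hk (z - (y, 0))) + heat_pot (\<lambda>\<zeta>. ennreal (c \<zeta> * s y \<zeta>)) z" by (rule s_eq)
 also have "ennreal (hk (z - (y, 0))) = liminf (\<lambda>n. ennreal (hk (X n - (y, 0))))"
  by (intro lim_imp_Liminf[symmetric] tendsto_ennrealI hX) simp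
 also have "\<dots> + heat_pot (\<lambda>\<zeta>. ennreal (c \<zeta> * s y \<zeta>)) z <=
   \<dots> + liminf (\<lambda>n. heat_pot (\<lambda>\<zeta>. ennreal (c \<zeta> * s y \<zeta>)) (X n))"
  by (intro add_left_mono heat_pot_lsc[OF _ X]) measurable
 also have "\<dots> <= liminf (\<lambda>n. ennreal (hk (X n - (y, 0))) + heat_pot (\<lambda>\<zeta>. ennreal (c \<zeta> * s y \<zeta>)) (X n))"
  by (rule ennreal_liminf_add_mono)
 finally show "ennreal (s y z) <= liminf (\<lambda>n. ennreal (s y (X n)))" unfolding s_eq[symmetric] .
 \<comment> \<open>Subtracting the Duhamel equation of \<open>s\<close> from that of its majorant
   exhibits the difference as the potential of a source that is nonnegative, because c \<le> k and
   \<open>s\<close> lies below the majorant.\<close>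
 have eq: "ennreal (exp (k * snd z) * hk (z - (y, 0)) - s y z) =
   heat_pot (\<lambda>\<zeta>. ennreal (k * exp (k * snd \<zeta>) * hk (\<zeta> - (y, 0)) - c \<zeta> * s y \<zeta>)) z" for z
 proof -
  let ?g = "\<lambda>\<zeta>. ennreal (k * exp (k * snd \<zeta>) * hk (\<zeta> - (y, 0)) - c \<zeta> * s y \<zeta>)"
  obtain x t where z: "z = (x, t)" by (cases z)
  have le: "c \<zeta> * s y \<zeta> <= k * exp (k * snd \<zeta>) * hk (\<zeta> - (y, 0))" for \<zeta>
   unfolding mult.assoc by (intro mult_mono c_bounds s_le s_nonneg k_nonneg)
  have "heat_pot ?g z + heat_pot (\<lambda>\<zeta>. ennreal (c \<zeta> * s y \<zeta>)) z
   = heat_pot (\<lambda>\<zeta>. ennreal (k * exp (k * snd \<zeta>) * hk (\<zeta> - (y, 0)))) z"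
   unfolding heat_pot_def
   by (subst nn_integral_add[symmetric])
    (auto simp: distrib_left[symmetric] ennreal_plus[symmetric] le c_bounds s_nonneg simp del: ennreal_plus)
  also have "\<dots> = ennreal ((exp (k * t) - 1) * hk (x - y, t))" unfolding z by (rule heat_pot_exp[OF k_nonneg])
  finally have a: "heat_pot ?g z + heat_pot (\<lambda>\<zeta>. ennreal (c \<zeta> * s y \<zeta>)) z = ennreal ((exp (k * t) - 1) * hk (x - y, t))" .
  have nn: "0 <= (exp (k * t) - 1) * hk (x - y, t)"
   using k_nonneg by (cases "0 < t") (auto simp: hk_eq_0 intro!: mult_nonneg_nonneg hk_nonneg)
  have "heat_pot ?g z + ennreal (s y z) = ennreal (exp (k * snd z) * hk (z - (y, 0)))"
  proof -
   have "heat_pot ?g z + ennreal (s y z) = ennreal (hk (z - (y, 0))) + (heat_pot ?g z + heat_pot (\<lambda>\<zeta>. ennreal (c \<zeta> * s y \<zeta>)) z)"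
    unfolding s_eq[of y z] by (simp add: ac_simps)
   also have "\<dots> = ennreal (hk (z - (y, 0)) + (exp (k * t) - 1) * hk (x - y, t))"
    unfolding a using nn by (simp add: hk_nonneg)
   finally show ?thesis by (simp add: z algebra_simps)
  qed
  then have "ennreal (exp (k * snd z) * hk (z - (y, 0))) - ennreal (s y z) = (heat_pot ?g z + ennreal (s y z)) - ennreal (s y z)"
   by simp
  also have "\<dots> = heat_pot ?g z" by (rule ennreal_add_diff_cancel_right) simp
  finally have "ennreal (exp (k * snd z) * hk (z - (y, 0))) - ennreal (s y z) = heat_pot ?g z" .
  then show ?thesis by (simp add: ennreal_minus s_nonneg)
 qed
 show "ennreal (exp (k * snd z) * hk (z - (y, 0)) - s y z) <=
   liminf (\<lambda>n. ennreal (exp (k * snd (X n)) * hk (X n - (y, 0)) - s y (X n)))"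
  unfolding eq by (rule heat_pot_lsc[OF _ X]) measurable
qed (auto simp: s_nonneg s_le)

end

text \<open>Multiplying the test function by exp(-kt) adds k to the adjoint operator. This converts
  the weak equation of \<open>s\<close>, with potential -(k - W), into the one with potential
  W.\<close>

lemma adj_heat_exp_mult:
 fixes \<phi> :: "'a::euclidean_space stfun"
 assumes \<phi>: "smooth \<phi>"
 shows "smooth (\<lambda>z. exp (- k * snd z) * \<phi> z)"
  and "adj_heat (\<lambda>z. exp (- k * snd z) * \<phi> z) z = exp (- k * snd z) * (adj_heat \<phi> z + k * \<phi> z)"
proof -
 let ?E = "\<lambda>z::'a \<times> real. exp (- k * snd z)"
 have bl: "bounded_linear (\<lambda>z::'a \<times> real. - k * snd z)"
  by (intro bounded_linear_const_mult bounded_linear_snd)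
 have sE: "smooth ?E" using smooth_exp_linear[OF bl] .
 then show "smooth (\<lambda>z. ?E z * \<phi> z)" by (intro smooth_mult \<phi>)
 have "(?E has_derivative (\<lambda>v. ?E z * (- k * snd v))) (at z)" for z
  by (rule has_derivative_compose[OF bounded_linear.has_derivative[OF bl has_derivative_ident]
     DERIV_exp[unfolded has_field_derivative_def]])
 then have dE: "dir_deriv ?E v = (\<lambda>z. ?E z * (- k * snd v))" for v
  by (intro ext dir_deriv_eq)
 have d: "dir_deriv (\<lambda>z. ?E z * f z) v = (\<lambda>z. ?E z * (dir_deriv f v z - k * snd v * f z))" if "smooth f" for f v
 proof -
  have "dir_deriv (\<lambda>z. ?E z * f z) v = (\<lambda>z. ?E z * dir_deriv f v z + dir_deriv ?E v z * f z)"
   by (rule dir_deriv_mult) (use smooth_D[OF sE] smooth_D[OF that] in blast)+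
  then show ?thesis by (simp only: dE fun_eq_iff) (simp add: algebra_simps)
 qed
 have d0: "dir_deriv (\<lambda>z. ?E z * f z) (i, 0) = (\<lambda>z. ?E z * dir_deriv f (i, 0) z)" if "smooth f" for f i
  using d[OF that, of "(i, 0)"] by simp
 have d00: "dir_deriv (dir_deriv (\<lambda>z. ?E z * \<phi> z) (i, 0)) (i, 0) z = ?E z * dir_deriv (dir_deriv \<phi> (i, 0)) (i, 0) z" for i
  unfolding d0[OF \<phi>] d0[OF smooth_dir_deriv[OF \<phi>]] ..
 have d1: "dir_deriv (\<lambda>z. ?E z * \<phi> z) (0, 1) z = ?E z * (dir_deriv \<phi> (0, 1) z - k * \<phi> z)"
  unfolding d[OF \<phi>] by simp
 show "adj_heat (\<lambda>z. ?E z * \<phi> z) z = ?E z * (adj_heat \<phi> z + k * \<phi> z)"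
  unfolding adj_heat_def d00 d1 sum_distrib_left[symmetric] by (simp only: right_diff_distrib distrib_left)
qed

text \<open>The positivity set is open and null, hence empty; this upgrades almost everywhere
  vanishing to vanishing at every point.\<close>

lemma continuous_nn_integral_0:
 fixes f :: "'a::euclidean_space => real"
 assumes "continuous_on UNIV f" "!!x. 0 <= f x" "(\<integral>\<^sup>+x. ennreal (f x) \<partial>lborel) = 0"
 shows "f x = 0"
proof (rule ccontr)
 assume "f x \<noteq> 0"
 have [measurable]: "f \<in> borel_measurable borel" using assms(1) by (rule borel_measurable_continuous_onI)
 have o: "open {x. 0 < f x}" using assms(1) by (intro open_Collect_less continuous_intros)
 have "AE x in lborel. ennreal (f x) = 0" using assms(3) by (subst (asm) nn_integral_0_iff_AE) auto
 then have "AE x in lborel. x \<notin> {x. 0 < f x}" by eventually_elim auto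
 then have "{x \<in> space lborel. \<not> x \<notin> {x. 0 < f x}} \<in> null_sets lborel"
  by (subst AE_iff_null[symmetric]) auto
 then have "{x. 0 < f x} \<in> null_sets (completion lborel)"
  by (intro null_sets_completionI) simp
 moreover have "x \<in> {x. 0 < f x}" using assms(2)[of x] \<open>f x \<noteq> 0\<close> by auto
 ultimately show False using open_not_negligible[OF o] by (auto simp: negligible_iff_null_sets)
qed

lemma hk_test_bound:
 fixes g :: "'a::euclidean_space stfun"
 assumes g: "continuous_on UNIV g" and K: "compact K" "!!z. z \<notin> K ==> g z = 0"
 shows "integrable lborel (\<lambda>z. hk (z - a) * g z)"
proof -
 have K': "compact ((\<lambda>z. z - a) ` K)" by (intro compact_continuous_image continuous_intros K)
 have c': "continuous_on UNIV (\<lambda>z. g (a + z))" by (intro continuous_on_compose2[OF g] continuous_intros) auto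
 have [measurable]: "g \<in> borel_measurable borel" using g by (rule borel_measurable_continuous_onI)
 obtain M where M: "M \<ge> 0" "!!z. \<bar>g z\<bar> <= M" using bounded_compact_support[OF g K] by blast
 obtain R where R: "R > 0" "\<forall>z\<in>(\<lambda>z. z - a) ` K. norm z <= R"
  using compact_imp_bounded[OF K'] unfolding bounded_pos by blast
 have "integrable lborel (\<lambda>z. hk z * g (a + z))"
 proof (rule integrable_hk_strip[where M=R and B=M])
  fix z :: "'a \<times> real" assume z: "R < snd z"
  have "snd z <= norm z" using norm_snd_le[of "snd z" "fst z"] by simp
  then have "z \<notin> (\<lambda>z. z - a) ` K" using R(2) z by force
  then have "a + z \<notin> K" by (metis add_diff_cancel_left' imageI)
  then show "g (a + z) = 0" by (rule K(2))
 qed (use M in auto)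
 from integrable_lborel_translate[OF this, of "- a"] show ?thesis by simp
qed

context bounded_potential begin

lemma integrable_s_test:
 fixes g :: "'a stfun"
 assumes g: "continuous_on UNIV g" and K: "compact K" "!!z. z \<notin> K ==> g z = 0"
 shows "integrable lborel (\<lambda>z. s y z * g z)"
proof (rule L1_bound[OF hk_test_bound[of "\<lambda>z. exp (k * snd z) * g z" K "(y, 0)"]])
 show "continuous_on UNIV (\<lambda>z. exp (k * snd z) * g z)" by (intro continuous_intros g)
 have [measurable]: "g \<in> borel_measurable borel" using g by (rule borel_measurable_continuous_onI)
 show "(\<lambda>z. s y z * g z) \<in> borel_measurable lborel" by measurable
 show "AE z in lborel. norm (s y z * g z) <= norm (hk (z - (y, 0)) * (exp (k * snd z) * g z))"
 proof (rule AE_I2)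
  fix z
  have "s y z * \<bar>g z\<bar> <= exp (k * snd z) * hk (z - (y, 0)) * \<bar>g z\<bar>" by (intro mult_right_mono s_le) auto
  then show "norm (s y z * g z) <= norm (hk (z - (y, 0)) * (exp (k * snd z) * g z))"
   by (simp add: abs_mult s_nonneg hk_nonneg mult_ac)
 qed
qed (use K in auto)

text \<open>The Duhamel equation in real form: the potential is finite because \<open>s\<close>
  is.\<close>

lemma pot_integrable: "integrable lborel (\<lambda>\<zeta>. hk (z - \<zeta>) * (c \<zeta> * s y \<zeta>))"
 and pot_integral: "(LBINT \<zeta>. hk (z - \<zeta>) * (c \<zeta> * s y \<zeta>)) = s y z - hk (z - (y, 0))"
proof -
 have nn: "0 <= hk (z - \<zeta>) * (c \<zeta> * s y \<zeta>)" for \<zeta>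
  by (intro mult_nonneg_nonneg hk_nonneg c_bounds s_nonneg)
 have p: "heat_pot (\<lambda>\<zeta>. ennreal (c \<zeta> * s y \<zeta>)) z = (\<integral>\<^sup>+ \<zeta>. ennreal (hk (z - \<zeta>) * (c \<zeta> * s y \<zeta>)) \<partial>lborel)"
  unfolding heat_pot_def by (simp add: ennreal_mult hk_nonneg c_bounds s_nonneg)
 have fin: "(\<integral>\<^sup>+ \<zeta>. ennreal (hk (z - \<zeta>) * (c \<zeta> * s y \<zeta>)) \<partial>lborel) < \<infinity>"
 proof -
  have "heat_pot (\<lambda>\<zeta>. ennreal (c \<zeta> * s y \<zeta>)) z <= ennreal (s y z)" unfolding s_eq by simp
  then show ?thesis unfolding p by (rule le_less_trans) simp
 qed
 show i: "integrable lborel (\<lambda>\<zeta>. hk (z - \<zeta>) * (c \<zeta> * s y \<zeta>))"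
 proof (rule integrableI_nonneg)
  show "(\<lambda>\<zeta>. hk (z - \<zeta>) * (c \<zeta> * s y \<zeta>)) \<in> borel_measurable lborel" by measurable
 qed (use nn fin in auto)
 let ?I = "\<integral>\<zeta>. hk (z - \<zeta>) * (c \<zeta> * s y \<zeta>) \<partial>lborel"
 have "?I \<ge> 0" by (intro lint_nonneg nn)
 have "ennreal (s y z) = ennreal (hk (z - (y, 0)) + ?I)"
  unfolding s_eq p using nn_integral_eq_integral[OF i] nn \<open>?I \<ge> 0\<close> by (simp add: hk_nonneg)
 then have "s y z = hk (z - (y, 0)) + ?I"
  by (subst (asm) ennreal_inj) (auto intro!: add_nonneg_nonneg hk_nonneg s_nonneg \<open>?I \<ge> 0\<close>)
 then show "?I = s y z - hk (z - (y, 0))" by simp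
qed

text \<open>Insert the Duhamel equation and exchange the integrals: the fundamental solution
  property turns the test integral of hk(z - \<zeta>) into \<phi>(\<zeta>), leaving c s
  \<phi>.\<close>

lemma s_weak:
 fixes \<phi> :: "'a stfun"
 assumes \<phi>: "smooth \<phi>" and K: "compact K" "K \<subseteq> {z. 0 < snd z}" "!!z. z \<notin> K ==> \<phi> z = 0"
 shows "(LBINT z. s y z * adj_heat \<phi> z) = (LBINT z. c z * s y z * \<phi> z)"
proof -
 have ca: "continuous_on UNIV (adj_heat \<phi>)" using continuous_adj_heat[OF \<phi>] .
 have aoff: "adj_heat \<phi> z = 0" if "z \<notin> K" for z using adj_heat_zero_off[OF K(1,3) that] .
 have [measurable]: "adj_heat \<phi> \<in> borel_measurable borel" using ca by (rule borel_measurable_continuous_onI)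
 have nn: "0 <= hk (z - \<zeta>) * (c \<zeta> * s y \<zeta>)" for z \<zeta>
  by (intro mult_nonneg_nonneg hk_nonneg c_bounds s_nonneg)
 note ia = integrable_s_test[OF ca K(1) aoff, of y] hk_test_bound[OF ca K(1) aoff, of "(y, 0)"]
 let ?f = "\<lambda>z \<zeta>. hk (z - \<zeta>) * (c \<zeta> * s y \<zeta>) * adj_heat \<phi> z"
 have "integrable (lborel \<Otimes>\<^sub>M lborel) (\<lambda>(z, \<zeta>). ?f z \<zeta>)"
 proof (rule lborel_pair.Fubini_integrable)
  have [measurable]: "(\<lambda>q. s y (snd q)) \<in> borel_measurable (borel \<Otimes>\<^sub>M borel :: (('a \<times> real) \<times> 'a \<times> real) measure)"
   by measurable
  show "(\<lambda>(z, \<zeta>). ?f z \<zeta>) \<in> borel_measurable (lborel \<Otimes>\<^sub>M lborel)"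
   by measurable
  have "(LBINT \<zeta>. norm (?f z \<zeta>)) = \<bar>(s y z - hk (z - (y, 0))) * adj_heat \<phi> z\<bar>" for z
  proof -
   have "norm (?f z \<zeta>) = hk (z - \<zeta>) * (c \<zeta> * s y \<zeta>) * \<bar>adj_heat \<phi> z\<bar>" for \<zeta>
    unfolding real_norm_def abs_mult[of "hk (z - \<zeta>) * (c \<zeta> * s y \<zeta>)"] using nn[of z \<zeta>] by simp
   then have "(LBINT \<zeta>. norm (?f z \<zeta>)) = (s y z - hk (z - (y, 0))) * \<bar>adj_heat \<phi> z\<bar>"
    using pot_integral[of z y] by simp
   then show ?thesis using s_ge[of z y] by (simp add: abs_mult)
  qed
  moreover have "integrable lborel (\<lambda>z. \<bar>(s y z - hk (z - (y, 0))) * adj_heat \<phi> z\<bar>)"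
   using ia by (intro integrable_abs) (simp add: left_diff_distrib)
  ultimately show "integrable lborel (\<lambda>z. LBINT \<zeta>. norm (case (z, \<zeta>) of (z, \<zeta>) => ?f z \<zeta>))" by simp
  show "AE z in lborel. integrable lborel (\<lambda>\<zeta>. case (z, \<zeta>) of (z, \<zeta>) => ?f z \<zeta>)"
   using pot_integrable by auto
 qed
 note Fub = lborel_pair.Fubini_integral[OF this]
 have "(LBINT z. s y z * adj_heat \<phi> z) =
   (LBINT z. hk (z - (y, 0)) * adj_heat \<phi> z + (s y z - hk (z - (y, 0))) * adj_heat \<phi> z)"
  by (simp add: left_diff_distrib)
 also have "\<dots> = (LBINT z. hk (z - (y, 0)) * adj_heat \<phi> z) + (LBINT z. (s y z - hk (z - (y, 0))) * adj_heat \<phi> z)"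
  using ia by (intro lint_add) (auto simp: left_diff_distrib)
 also have "(LBINT z. hk (z - (y, 0)) * adj_heat \<phi> z) = \<phi> (y, 0)" by (rule fundamental_solution[OF \<phi> K(1,3)])
 \<comment> \<open>The Dirac mass of the free term sits at time 0, outside the support of a test
   function living at positive times.\<close>
 also have "\<phi> (y, 0) = 0" using K(2) by (intro K(3)) auto
 also have "(LBINT z. (s y z - hk (z - (y, 0))) * adj_heat \<phi> z) = (LBINT z. (LBINT \<zeta>. ?f z \<zeta>))"
  using pot_integral by simp
 also have "\<dots> = (LBINT \<zeta>. (LBINT z. ?f z \<zeta>))" using Fub by simp
 also have "\<dots> = (LBINT \<zeta>. (LBINT z. (c \<zeta> * s y \<zeta>) * (hk (z - \<zeta>) * adj_heat \<phi> z)))"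
  by (simp only: mult_ac)
 also have "\<dots> = (LBINT \<zeta>. (c \<zeta> * s y \<zeta>) * \<phi> \<zeta>)"
  using fundamental_solution[OF \<phi> K(1,3)] by simp
 finally show ?thesis by simp
qed

definition K0 where "K0 y z = exp (- k * snd z) * s y z"

lemma K0_bker: "K0 y z = bker k W y z"
 by (simp add: K0_def s_def c_def bker_def)

lemma K0_nonneg: "0 <= K0 y z"
 by (simp add: K0_def s_nonneg)

lemma K0_le: "K0 y z <= hk (z - (y, 0))"
proof -
 have "K0 y z <= exp (- k * snd z) * (exp (k * snd z) * hk (z - (y, 0)))"
  unfolding K0_def by (intro mult_left_mono s_le) auto
 then show ?thesis by (simp add: mult.assoc[symmetric] exp_add[symmetric])
qed

lemma K0_ge: "exp (- k * snd z) * hk (z - (y, 0)) <= K0 y z"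
 unfolding K0_def by (intro mult_left_mono s_ge) auto

lemma K0_measurable: "(\<lambda>p. K0 (fst p) (snd p)) \<in> borel_measurable borel"
 unfolding K0_def using s_measurable by measurable

lemma K0_measurable2 [measurable]: "K0 y \<in> borel_measurable borel"
 unfolding K0_def by measurable

lemma continuous_K0: "continuous_on {z. 0 < snd z} (K0 y)"
 unfolding K0_def by (intro continuous_intros continuous_s)

text \<open>Testing the equation of \<open>s\<close> with exp(-kt) \<phi> produces the extra term k
  s \<phi>, which cancels the k in c = k - W.\<close>

lemma K0_weak:
 fixes \<phi> :: "'a stfun"
 assumes "test_function {z. 0 < snd z} \<phi>"
 shows "(LBINT z. K0 y z * adj_heat \<phi> z) = - (LBINT z. W z * K0 y z * \<phi> z)"
proof -
 obtain K where \<phi>: "smooth \<phi>" and K: "compact K" "K \<subseteq> {z. 0 < snd z}" "!!z. z \<notin> K ==> \<phi> z = 0"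
  using assms by (rule test_functionE) blast
 let ?E = "\<lambda>z::'a \<times> real. exp (- k * snd z)"
 note E = adj_heat_exp_mult[OF \<phi>, of k]
 have c\<phi>: "continuous_on UNIV \<phi>" using smooth_continuous[OF \<phi>] .
 have [measurable]: "\<phi> \<in> borel_measurable borel" using c\<phi> by (rule borel_measurable_continuous_onI)
 have i: "integrable lborel (\<lambda>z. s y z * (?E z * \<phi> z))"
  by (rule integrable_s_test[OF _ K(1)]) (use K c\<phi> in \<open>auto intro!: continuous_intros\<close>)
 have iw: "integrable lborel (\<lambda>z. p z * (s y z * (?E z * \<phi> z)))"
  if [measurable]: "p \<in> borel_measurable borel" and p: "!!z. 0 <= p z" "!!z. p z <= k" for p
 proof (rule L1_bound[of _ "\<lambda>z. k * (s y z * (?E z * \<phi> z))"])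
  show "AE z in lborel. norm (p z * (s y z * (?E z * \<phi> z))) <= norm (k * (s y z * (?E z * \<phi> z)))"
  proof (rule AE_I2)
   fix z
   have "\<bar>p z\<bar> * \<bar>s y z * (?E z * \<phi> z)\<bar> <= \<bar>k\<bar> * \<bar>s y z * (?E z * \<phi> z)\<bar>"
    using p[of z] by (intro mult_right_mono) auto
   then show "norm (p z * (s y z * (?E z * \<phi> z))) <= norm (k * (s y z * (?E z * \<phi> z)))"
    unfolding real_norm_def abs_mult[of "p z"] abs_mult[of k] .
  qed
 qed (use i in auto)
 have ia: "integrable lborel (\<lambda>z. s y z * (?E z * adj_heat \<phi> z))"
  by (rule integrable_s_test[OF _ K(1)])
   (use adj_heat_zero_off[OF K(1,3)] in \<open>auto intro!: continuous_intros continuous_adj_heat \<phi>\<close>)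
 have "(LBINT z. s y z * adj_heat (\<lambda>z. ?E z * \<phi> z) z) = (LBINT z. c z * s y z * (?E z * \<phi> z))"
  by (rule s_weak[OF E(1) K(1,2)]) (simp add: K)
 then have "(LBINT z. s y z * (?E z * adj_heat \<phi> z) + k * (s y z * (?E z * \<phi> z)))
   = (LBINT z. k * (s y z * (?E z * \<phi> z)) - W z * (s y z * (?E z * \<phi> z)))"
 proof -
  have "s y z * (?E z * (adj_heat \<phi> z + k * \<phi> z)) = s y z * (?E z * adj_heat \<phi> z) + k * (s y z * (?E z * \<phi> z))"
   "c z * s y z * (?E z * \<phi> z) = k * (s y z * (?E z * \<phi> z)) - W z * (s y z * (?E z * \<phi> z))" for z
   by (simp_all add: c_def algebra_simps)
  then show ?thesis using \<open>_ = (LBINT z. c z * s y z * (?E z * \<phi> z))\<close> by (simp only: E(2))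
 qed
 then have "(LBINT z. s y z * (?E z * adj_heat \<phi> z)) = - (LBINT z. W z * (s y z * (?E z * \<phi> z)))"
  using i ia iw[OF W_measurable W_nonneg W_le] by simp
 then show ?thesis unfolding K0_def by (simp only: mult_ac)
qed

text \<open>The kernel lies between exp(-kt) times the Gauss kernel and the Gauss kernel, which has
  mass 1; so its integrals against \<phi> differ from the Gaussian ones by at most B (1 -
  exp(-kt)).\<close>

lemma K0_trace:
 fixes \<phi> :: "'a => real"
 assumes \<phi>: "continuous_on UNIV \<phi>" and B: "!!x. \<bar>\<phi> x\<bar> <= B"
 shows "0 < t ==> integrable lborel (\<lambda>x. K0 y (x, t) * \<phi> x)"
  and "((\<lambda>t. LBINT x. K0 y (x, t) * \<phi> x) \<longlongrightarrow> \<phi> y) (at_right 0)"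
proof -
 have [measurable]: "\<phi> \<in> borel_measurable borel" using \<phi> by (rule borel_measurable_continuous_onI)
 have B0: "0 <= B" using B[of 0] by linarith
 have bd: "\<bar>K0 y (x, t) * \<phi> x\<bar> <= B * hk (x - y, t)" for x t
 proof -
  have "K0 y (x, t) * \<bar>\<phi> x\<bar> <= hk (x - y, t) * B"
   using K0_le[of y "(x, t)"] by (intro mult_mono B) (auto simp: hk_nonneg)
  then show ?thesis by (simp add: abs_mult K0_nonneg mult.commute)
 qed
 have [measurable]: "(\<lambda>x. K0 y (x, t)) \<in> borel_measurable borel" for t by measurable
 show i: "integrable lborel (\<lambda>x. K0 y (x, t) * \<phi> x)" if "0 < t" for t
  by (rule L1_bound[of _ "\<lambda>x. B * hk (x - y, t)"])
   (use bd integrable_hk[OF that, of y] B0 in \<open>auto simp: hk_nonneg\<close>)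
 have ih: "integrable lborel (\<lambda>x. hk (x - y, t) * \<phi> x)" if "0 < t" for t
  by (rule L1_bound[of _ "\<lambda>x. B * hk (x - y, t)"])
   (use B integrable_hk[OF that, of y] B0 in \<open>auto simp: hk_nonneg abs_mult mult.commute[of B] intro!: mult_left_mono\<close>)
 have close: "\<bar>(LBINT x. K0 y (x, t) * \<phi> x) - (LBINT x. hk (x - y, t) * \<phi> x)\<bar> <= B * (1 - exp (- k * t))" if t: "0 < t" for t
 proof -
  have "(LBINT x. K0 y (x, t) * \<phi> x) - (LBINT x. hk (x - y, t) * \<phi> x) = (LBINT x. (K0 y (x, t) - hk (x - y, t)) * \<phi> x)"
   using i[OF t] ih[OF t] by (simp add: left_diff_distrib)
  also have "\<bar>\<dots>\<bar> <= (LBINT x. B * (1 - exp (- k * t)) * hk (x - y, t))"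
   unfolding real_norm_def[symmetric]
  proof (rule Bochner_Integration.integral_norm_bound_integral)
   show "integrable lborel (\<lambda>x. (K0 y (x, t) - hk (x - y, t)) * \<phi> x)" using i[OF t] ih[OF t] by (simp add: left_diff_distrib)
   show "integrable lborel (\<lambda>x. B * (1 - exp (- k * t)) * hk (x - y, t))" by (intro integrable_mult_right integrable_hk t)
   fix x
   have "\<bar>K0 y (x, t) - hk (x - y, t)\<bar> <= (1 - exp (- k * t)) * hk (x - y, t)"
    using K0_le[of y "(x, t)"] K0_ge[of "(x, t)" y] by (simp add: algebra_simps)
   then have "\<bar>K0 y (x, t) - hk (x - y, t)\<bar> * \<bar>\<phi> x\<bar> <= ((1 - exp (- k * t)) * hk (x - y, t)) * B"
    by (intro mult_mono B) auto
   then show "norm ((K0 y (x, t) - hk (x - y, t)) * \<phi> x) <= B * (1 - exp (- k * t)) * hk (x - y, t)"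
    by (simp only: real_norm_def abs_mult mult_ac)
  qed
  also have "\<dots> = B * (1 - exp (- k * t))" using integral_hk[OF t, of y] by simp
  finally show ?thesis .
 qed
 have h: "((\<lambda>t. LBINT x. hk (x - y, t) * \<phi> x) \<longlongrightarrow> \<phi> y) (at_right 0)"
 proof -
  have "continuous_on UNIV (\<lambda>z::'a \<times> real. \<phi> (fst z))" by (intro continuous_on_compose2[OF \<phi>] continuous_intros) auto
  from heat_approx_identity[OF this, of B y] B show ?thesis by simp
 qed
 have "((\<lambda>t. (LBINT x. K0 y (x, t) * \<phi> x) - (LBINT x. hk (x - y, t) * \<phi> x)) \<longlongrightarrow> 0) (at_right 0)"
 proof (rule Lim_null_comparison)
  show "\<forall>\<^sub>F t in at_right 0. norm ((LBINT x. K0 y (x, t) * \<phi> x) - (LBINT x. hk (x - y, t) * \<phi> x)) <= B * (1 - exp (- k * t))"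
   using close by (auto simp: eventually_at_filter)
  have "((\<lambda>t. B * (1 - exp (- k * t))) \<longlongrightarrow> B * (1 - exp (- k * 0))) (at_right 0)"
   by (intro tendsto_intros)
  then show "((\<lambda>t. B * (1 - exp (- k * t))) \<longlongrightarrow> 0) (at_right 0)" by simp
 qed
 from tendsto_add[OF this h] show "((\<lambda>t. LBINT x. K0 y (x, t) * \<phi> x) \<longlongrightarrow> \<phi> y) (at_right 0)" by simp
qed

end

lemma integrable_times_compact:
 fixes f g :: "'b::euclidean_space => real"
 assumes f: "continuous_on \<Omega> f" and g: "continuous_on UNIV g"
  and K: "compact K" "K \<subseteq> \<Omega>" "!!z. z \<notin> K ==> g z = 0"
 shows "integrable lborel (\<lambda>z. f z * g z)"
proof -
 have "integrable lborel (\<lambda>z. indicator K z *\<^sub>R (f z * g z))"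
  by (intro borel_integrable_compact K continuous_intros continuous_on_subset[OF f] continuous_on_subset[OF g]) auto
 moreover have "(\<lambda>z. indicator K z *\<^sub>R (f z * g z)) = (\<lambda>z. f z * g z)"
  using K(3) by (auto simp: indicator_def fun_eq_iff)
 ultimately show ?thesis by simp
qed

text \<open>A non-integrable \<open>f\<close> has Bochner integral 0 by convention, so the bound
  holds in that case as well.\<close>

lemma norm_integral_le_integral:
 fixes f g :: "'b::euclidean_space => real"
 assumes g: "integrable M g" and le: "!!x. norm (f x) <= g x"
 shows "norm (integral\<^sup>L M f) <= integral\<^sup>L M g"
proof (cases "integrable M f")
 case True
 from Bochner_Integration.integral_norm_bound_integral[OF this g] le show ?thesis by blast
next
 case False
 have "0 <= g x" for x using le[of x] norm_ge_zero order_trans by blast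
 then show ?thesis using False by (simp add: not_integrable_integral_eq)
qed

lemma hk_strip_mass:
 fixes y :: "'a::euclidean_space"
 assumes s: "0 < s" "s <= t"
 shows "integrable lborel (\<lambda>z. indicator {s..t} (snd z) * hk (z - (y, 0)))"
  and "(LBINT z. indicator {s..t} (snd z) * hk (z - (y, 0))) = t - s"
proof -
 have "(\<lambda>z::'a \<times> real. ennreal (indicator {s..t} (snd z) * hk (z - (y, 0)))) \<in> borel_measurable (lborel \<Otimes>\<^sub>M lborel)"
  unfolding lborel_prod by measurable
 from lborel_pair.nn_integral_snd[OF this]
 have "(\<integral>\<^sup>+ z. ennreal (indicator {s..t} (snd z) * hk (z - (y, 0))) \<partial>lborel)
   = (\<integral>\<^sup>+ \<tau>. (\<integral>\<^sup>+ x. ennreal (indicator {s..t} \<tau> * hk (x - y, \<tau>)) \<partial>lborel) \<partial>lborel)"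
  by (simp add: lborel_prod)
 also have "\<dots> = (\<integral>\<^sup>+ \<tau>. indicator {s..t} \<tau> \<partial>lborel)"
 proof (rule nn_integral_cong)
  fix \<tau> :: real
  show "(\<integral>\<^sup>+ x. ennreal (indicator {s..t} \<tau> * hk (x - y, \<tau>)) \<partial>lborel) = indicator {s..t} \<tau>"
   using nn_integral_hk_shift(1)[of \<tau> y] s by (cases "\<tau> \<in> {s..t}") auto
 qed
 also have "\<dots> = ennreal (t - s)" using s by simp
 finally have nn: "(\<integral>\<^sup>+ z. ennreal (indicator {s..t} (snd z) * hk (z - (y, 0))) \<partial>lborel) = ennreal (t - s)" .
 show i: "integrable lborel (\<lambda>z. indicator {s..t} (snd z) * hk (z - (y, 0)))"
 proof (rule integrableI_nonneg)
  show "(\<lambda>z. indicator {s..t} (snd z) * hk (z - (y, 0))) \<in> borel_measurable lborel" by measurable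
 qed (use nn in \<open>auto simp: hk_nonneg\<close>)
 show "(LBINT z. indicator {s..t} (snd z) * hk (z - (y, 0))) = t - s"
 proof -
  have "ennreal (LBINT z. indicator {s..t} (snd z) * hk (z - (y, 0))) = ennreal (t - s)"
   using nn_integral_eq_integral[OF i] nn by (simp add: hk_nonneg)
  then show ?thesis
   by (subst (asm) ennreal_inj) (auto simp: hk_nonneg s intro!: lint_nonneg)
 qed
qed

lemma dir_deriv_scaled:
 fixes f :: "'b::euclidean_space => real"
 assumes "smooth f"
 shows "dir_deriv (\<lambda>x. a * f (r *\<^sub>R x)) v = (\<lambda>x. (a * r) * dir_deriv f v (r *\<^sub>R x))"
proof
 fix x
 have "((\<lambda>x. f (r *\<^sub>R x)) has_derivative (\<lambda>v. dir_deriv f (r *\<^sub>R v) (r *\<^sub>R x))) (at x)"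
  by (rule has_derivative_compose[where g=f and f="\<lambda>x. r *\<^sub>R x"])
   (auto intro!: derivative_eq_intros smooth_has_derivative assms)
 from dir_deriv_eq[OF has_derivative_mult_right[OF this, of a], of v]
 show "dir_deriv (\<lambda>x. a * f (r *\<^sub>R x)) v x = (a * r) * dir_deriv f v (r *\<^sub>R x)"
  by (simp add: dir_deriv_scale[OF smooth_D[OF assms]])
qed

text \<open>The factor r^2 is what makes the Laplacian of ever wider cut-offs negligible in the
  uniqueness proof.\<close>

lemma lap_scaled:
 assumes "smooth f"
 shows "lap (\<lambda>x. f (r *\<^sub>R x)) x = r\<^sup>2 * lap f (r *\<^sub>R x)"
proof -
 have 1: "dir_deriv (\<lambda>x. f (r *\<^sub>R x)) v = (\<lambda>x. r * dir_deriv f v (r *\<^sub>R x))" for v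
  using dir_deriv_scaled[OF assms, of 1 r v] by simp
 show ?thesis
  unfolding lap_def 1 dir_deriv_scaled[OF smooth_dir_deriv[OF assms]]
  by (simp add: sum_distrib_left power2_eq_square)
qed

lemma bump_le_1: "bump r x <= 1"
 by (simp add: bump_def flat_def)

section \<open>Uniqueness of kernels\<close>

text \<open>The difference of two kernels is a subsolution in modulus, by Kato's inequality, so its
 \<open>L\<^sup>1\<close> norm decreases in time. Domination by the Gauss kernel makes it vanish as \<open>t \<rightarrow> 0\<close>.\<close>

lemma heat_kernel_unique:
 fixes K1 K2 W :: "'a::euclidean_space stfun"
 assumes Wm[measurable]: "W \<in> borel_measurable borel" and W: "!!z. 0 <= W z" "!!z. W z <= k"
  and c1: "continuous_on (Q T) K1" and c2: "continuous_on (Q T) K2"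
  and b1: "!!z. z \<in> Q T ==> 0 <= K1 z \<and> K1 z <= hk (z - (y, 0))"
  and b2: "!!z. z \<in> Q T ==> 0 <= K2 z \<and> K2 z <= hk (z - (y, 0))"
  and w1: "!!\<phi>. test_function (Q_int T) \<phi> ==> (LBINT z. K1 z * adj_heat \<phi> z) = - (LBINT z. W z * K1 z * \<phi> z)"
  and w2: "!!\<phi>. test_function (Q_int T) \<phi> ==> (LBINT z. K2 z * adj_heat \<phi> z) = - (LBINT z. W z * K2 z * \<phi> z)"
  and t1: "!!\<phi>. continuous_on UNIV \<phi> ==> compact (closure {x. \<phi> x \<noteq> 0}) ==> ((\<lambda>t. LBINT x. K1 (x, t) * \<phi> x) \<longlongrightarrow> \<phi> y) (at_right 0)"
  and t2: "!!\<phi>. continuous_on UNIV \<phi> ==> compact (closure {x. \<phi> x \<noteq> 0}) ==> ((\<lambda>t. LBINT x. K2 (x, t) * \<phi> x) \<longlongrightarrow> \<phi> y) (at_right 0)"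
  and z: "z \<in> Q T"
 shows "K1 z = K2 z"
proof -
 have QQ: "Q_int T \<subseteq> (Q T :: ('a \<times> real) set)" by (auto simp: Q_int_def Q_def)
 have T: "0 < T" using z by (auto simp: Q_def)
 define d where "d z = K1 z - K2 z" for z
 have cd: "continuous_on (Q T) d" unfolding d_def by (intro continuous_intros c1 c2)
 have cdi: "continuous_on (Q_int T) d" by (rule continuous_on_subset[OF cd QQ])
 have db: "\<bar>d z\<bar> <= hk (z - (y, 0))" if "z \<in> Q T" for z
  using b1[OF that] b2[OF that] by (auto simp: d_def)
 have [measurable]: "(Q_int T :: ('a \<times> real) set) \<in> sets borel" using open_Q_int by (rule borel_open)
 \<comment> \<open>The two kernels are controlled on the cylinder only; the indicator makes the
   right-hand side Borel on the whole space, and test functions do not see the difference.\<close>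
 define F where "F = (\<lambda>z. - (W z * (indicator (Q_int T) z *\<^sub>R d z)))"
 have [measurable]: "(\<lambda>z. indicator (Q_int T) z *\<^sub>R d z) \<in> borel_measurable borel"
  by (rule borel_measurable_continuous_on_indicator[OF _ cdi]) simp
 have Fm [measurable]: "F \<in> borel_measurable borel" unfolding F_def by measurable
 have Floc: "set_integrable lborel K F" if K: "compact K" "K \<subseteq> Q_int T" for K
 proof -
  have KB: "K \<in> sets borel" using K(1) by (rule borel_compact)
  note [measurable] = KB
  have "integrable lborel (\<lambda>z. indicator K z *\<^sub>R (k * d z))"
   by (intro borel_integrable_compact K continuous_intros continuous_on_subset[OF cdi])
  then show ?thesis unfolding set_integrable_def
  proof (rule L1_bound)
   show "AE z in lborel. norm (indicator K z *\<^sub>R F z) <= norm (indicator K z *\<^sub>R (k * d z))"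
   proof (rule AE_I2)
    fix z
    have "\<bar>W z\<bar> * \<bar>d z\<bar> <= \<bar>k\<bar> * \<bar>d z\<bar>" using W[of z] by (intro mult_right_mono) auto
    then show "norm (indicator K z *\<^sub>R F z) <= norm (indicator K z *\<^sub>R (k * d z))"
     using K(2) by (auto simp: indicator_def F_def abs_mult)
   qed
  qed measurable
 qed
 have weak: "(LBINT z. d z * adj_heat \<phi> z) = (LBINT z. F z * \<phi> z)" if \<phi>: "test_function (Q_int T) \<phi>" for \<phi>
 proof -
  obtain K where s\<phi>: "smooth \<phi>" and K: "compact K" "K \<subseteq> Q_int T" "!!z. z \<notin> K ==> \<phi> z = 0"
   using \<phi> by (rule test_functionE) blast
  have aoff: "adj_heat \<phi> z = 0" if "z \<notin> K" for z using adj_heat_zero_off[OF K(1,3) that] .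
  have [measurable]: "\<phi> \<in> borel_measurable borel" by (rule borel_measurable_continuous_onI[OF smooth_continuous[OF s\<phi>]])
  have I: "integrable lborel (\<lambda>z. p z * adj_heat \<phi> z)" "integrable lborel (\<lambda>z. W z * p z * \<phi> z)"
   if p: "continuous_on (Q T) p" for p
  proof -
   have cp: "continuous_on (Q_int T) p" by (rule continuous_on_subset[OF p QQ])
   show "integrable lborel (\<lambda>z. p z * adj_heat \<phi> z)"
    by (rule integrable_times_compact[OF cp continuous_adj_heat[OF s\<phi>] K(1,2) aoff])
   have i: "integrable lborel (\<lambda>z. p z * \<phi> z)"
    by (rule integrable_times_compact[OF cp smooth_continuous[OF s\<phi>] K])
   have m: "(\<lambda>z. p z * \<phi> z) \<in> borel_measurable lborel" using i by simp
   have "integrable lborel (\<lambda>z. W z * (p z * \<phi> z))"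
   proof (rule L1_bound[of _ "\<lambda>z. k * (p z * \<phi> z)"])
    show "(\<lambda>z. W z * (p z * \<phi> z)) \<in> borel_measurable lborel" by (intro borel_measurable_times m) simp
    show "AE z in lborel. norm (W z * (p z * \<phi> z)) <= norm (k * (p z * \<phi> z))"
    proof (rule AE_I2)
     fix z
     have "\<bar>W z\<bar> * \<bar>p z * \<phi> z\<bar> <= \<bar>k\<bar> * \<bar>p z * \<phi> z\<bar>" using W[of z] by (intro mult_right_mono) auto
     then show "norm (W z * (p z * \<phi> z)) <= norm (k * (p z * \<phi> z))"
      unfolding real_norm_def abs_mult[of "W z"] abs_mult[of k] .
    qed
   qed (use i in simp)
   then show "integrable lborel (\<lambda>z. W z * p z * \<phi> z)" by (simp only: mult.assoc)
  qed
  have "(LBINT z. d z * adj_heat \<phi> z) = - ((LBINT z. W z * K1 z * \<phi> z) - (LBINT z. W z * K2 z * \<phi> z))"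
   using I(1)[OF c1] I(1)[OF c2] w1[OF \<phi>] w2[OF \<phi>] by (simp add: d_def left_diff_distrib)
  also have "\<dots> = (LBINT z. - (W z * K1 z * \<phi> z - W z * K2 z * \<phi> z))"
   using I(2)[OF c1] I(2)[OF c2] by simp
  also have "\<dots> = (LBINT z. F z * \<phi> z)"
  proof (intro lint_cong)
   fix z
   show "- (W z * K1 z * \<phi> z - W z * K2 z * \<phi> z) = F z * \<phi> z"
    using K(2) K(3)[of z] by (cases "z \<in> K") (auto simp: F_def d_def algebra_simps)
  qed
  finally show ?thesis .
 qed
 \<comment> \<open>In the interior sgn(d) F equals -W \<bar>d\<bar>, which is nonpositive, so Kato's
   inequality makes \<bar>d\<bar> a subsolution of the heat equation.\<close>
 have sub: "(LBINT z. \<bar>d z\<bar> * adj_heat \<phi> z) <= 0" if \<phi>: "test_function (Q_int T) \<phi>" "!!z. 0 <= \<phi> z" for \<phi>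
 proof -
  have "(LBINT z. \<bar>d z\<bar> * adj_heat \<phi> z) <= (LBINT z. sgn (d z) * F z * \<phi> z)"
   by (rule kato[OF open_Q_int cdi Fm Floc weak \<phi>])
  also have "\<dots> <= 0"
  proof -
   have "sgn (d z) * F z * \<phi> z <= 0" for z
   proof -
    have "sgn (d z) * F z * \<phi> z = - (W z * (indicator (Q_int T) z * (sgn (d z) * d z)) * \<phi> z)"
     by (simp add: F_def)
    moreover have "0 <= W z * (indicator (Q_int T) z * (sgn (d z) * d z)) * \<phi> z"
    proof -
     have "sgn (d z) * d z = \<bar>d z\<bar>" by (simp only: abs_sgn[of "d z"] mult.commute)
     then show ?thesis using W[of z] \<phi>(2)[of z] by simp
    qed
    ultimately show ?thesis by linarith
   qed
   then have "0 <= (LBINT z. - (sgn (d z) * F z * \<phi> z))" by (intro lint_nonneg) simp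
   then show ?thesis by simp
  qed
  finally show ?thesis .
 qed
 define b where "b = (bump 1 :: 'a => real)"
 have sb: "smooth b" unfolding b_def by (rule smooth_bump)
 have boff: "b x = 0" if "x \<notin> cball 0 1" for x using that by (auto simp: b_def intro!: bump_eq_0)
 have bb: "0 <= b x" "b x <= 1" for x by (auto simp: b_def bump_nonneg bump_le_1)
 have b0: "0 < b 0" by (simp add: b_def bump_pos_iff)
 have lboff: "lap b x = 0" if "x \<notin> cball 0 1" for x by (rule lap_zero_off[OF compact_cball boff that])
 obtain N where N: "N \<ge> 0" "!!x. \<bar>lap b x\<bar> <= N"
  using bounded_compact_support[OF continuous_lap[OF sb] compact_cball lboff] by blast
 define \<xi> where "\<xi> n x = b ((1 / real (Suc n)) *\<^sub>R x)" for n x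
 have s\<xi>: "smooth (\<xi> n)" for n
  using smooth_affine[OF sb, of "\<lambda>x. (1 / real (Suc n)) *\<^sub>R x" 0] by (simp add: \<xi>_def[abs_def] bounded_linear_scaleR_right)
 have \<xi>off: "\<xi> n x = 0" if "x \<notin> cball 0 (real (Suc n))" for n x
  unfolding \<xi>_def by (rule boff) (use that in \<open>auto simp: divide_simps\<close>)
 have \<xi>b: "0 <= \<xi> n x" "\<xi> n x <= 1" for n x using bb by (auto simp: \<xi>_def)
 have [measurable]: "\<xi> n \<in> borel_measurable borel" for n
  by (rule borel_measurable_continuous_onI[OF smooth_continuous[OF s\<xi>]])
 have lap\<xi>: "\<bar>lap (\<xi> n) x\<bar> <= N / (real (Suc n))\<^sup>2" for n x
 proof -
  have "lap (\<xi> n) x = (1 / real (Suc n))\<^sup>2 * lap b ((1 / real (Suc n)) *\<^sub>R x)"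
   unfolding \<xi>_def[abs_def] by (rule lap_scaled[OF sb])
  then have "\<bar>lap (\<xi> n) x\<bar> = (1 / real (Suc n))\<^sup>2 * \<bar>lap b ((1 / real (Suc n)) *\<^sub>R x)\<bar>" by (simp add: abs_mult)
  also have "\<dots> <= (1 / real (Suc n))\<^sup>2 * N" by (intro mult_left_mono N) simp
  finally show ?thesis by (simp add: power_divide)
 qed
 have slice: "continuous_on UNIV (\<lambda>x. p (x, t))" if "continuous_on (Q T) p" "0 < t" "t <= T" for p :: "'a stfun" and t
  by (rule continuous_on_compose2[OF that(1)]) (use that in \<open>auto simp: Q_def intro!: continuous_intros\<close>)
 have slm: "(\<lambda>x. p (x, t)) \<in> borel_measurable lborel" if "continuous_on (Q T) p" "0 < t" "t <= T" for p :: "'a stfun" and t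
  using borel_measurable_continuous_onI[OF slice[OF that]] by simp
 have sli: "integrable lborel (\<lambda>x. p (x, t))"
  if "continuous_on (Q T) p" "!!z. z \<in> Q T ==> \<bar>p z\<bar> <= hk (z - (y, 0))" "0 < t" "t <= T" for p :: "'a stfun" and t
 proof (rule L1_bound[OF integrable_hk[OF that(3)] slm[OF that(1,3,4)]])
  show "AE x in lborel. norm (p (x, t)) <= norm (hk (x - y, t))"
   using that(2)[of "(_, t)"] that(3,4) by (auto simp: Q_def hk_nonneg)
 qed
 define m where "m t = (LBINT x. \<bar>d (x, t)\<bar>)" for t
 have di: "integrable lborel (\<lambda>x. \<bar>d (x, t)\<bar>)" if "0 < t" "t <= T" for t
  using sli[OF cd db that] by simp
 have mlim: "(m \<longlongrightarrow> 0) (at_right 0)"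
 proof -
  \<comment> \<open>A bump centred at y and normalised by its maximum, so that \<phi> y = 1 and
    \<phi> \<le> 1; it detects how much mass stays near the pole.\<close>
  define \<phi> where "\<phi> x = b (x - y) / b 0" for x
  have b1': "b x <= b 0" for x by (auto simp: b_def bump_def flat_def divide_simps)
  have \<phi>: "continuous_on UNIV \<phi>" unfolding \<phi>_def[abs_def]
   by (intro continuous_intros continuous_on_compose2[OF smooth_continuous[OF sb, of UNIV]]) (use b0 in auto)
  have \<phi>c: "compact (closure {x. \<phi> x \<noteq> 0})"
  proof -
   have "closure {x. \<phi> x \<noteq> 0} \<subseteq> cball y 1"
   proof (rule closure_minimal, rule subsetI)
    fix x assume "x \<in> {x. \<phi> x \<noteq> 0}"
    then have "b (x - y) \<noteq> 0" by (simp add: \<phi>_def)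
    then have "x - y \<in> cball 0 1" using boff by blast
    then show "x \<in> cball y 1" by (simp add: dist_norm norm_minus_commute)
   qed simp
   then show ?thesis by (meson bounded_cball bounded_subset closed_closure compact_eq_bounded_closed)
  qed
  have \<phi>b: "0 <= \<phi> x" "\<phi> x <= 1" for x using bb b1' b0 by (auto simp: \<phi>_def)
  have [measurable]: "\<phi> \<in> borel_measurable borel" using \<phi> by (rule borel_measurable_continuous_onI)
  \<comment> \<open>The Gauss kernel has mass 1 and the trace at y gives each kernel mass tending to
    at least 1, so the deficit to the Gauss kernel disappears as t tends to 0; \<bar>d\<bar> is at
    most the sum of the two deficits.\<close>
  have gap: "(LBINT x. hk (x - y, t) - p (x, t)) <= 1 - (LBINT x. p (x, t) * \<phi> x)"
   if p: "continuous_on (Q T) p" "!!z. z \<in> Q T ==> 0 <= p z \<and> p z <= hk (z - (y, 0))" and t: "0 < t" "t <= T" for p t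
  proof -
   have pp: "0 <= p (x, t)" for x using p(2)[of "(x, t)"] t by (auto simp: Q_def)
   have i: "integrable lborel (\<lambda>x. p (x, t))" by (rule sli[OF p(1) _ t]) (use p(2) in fastforce)
   have "(LBINT x. p (x, t) * \<phi> x) <= (LBINT x. p (x, t))"
   proof (rule integral_mono)
    show "integrable lborel (\<lambda>x. p (x, t) * \<phi> x)"
     by (rule L1_bound[OF i])
      (use i \<phi>b pp in \<open>auto simp: abs_mult intro!: mult_right_le_one_le borel_measurable_times\<close>)
   qed (use i \<phi>b pp in \<open>auto intro!: mult_right_le_one_le\<close>)
   then show ?thesis using i integrable_hk[OF t(1), of y] integral_hk[OF t(1), of y] by simp
  qed
  have up: "m t <= (1 - (LBINT x. K1 (x, t) * \<phi> x)) + (1 - (LBINT x. K2 (x, t) * \<phi> x))" if t: "0 < t" "t <= T" for t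
  proof -
   have i: "integrable lborel (\<lambda>x. hk (x - y, t) - K1 (x, t))" "integrable lborel (\<lambda>x. hk (x - y, t) - K2 (x, t))"
    using integrable_hk[OF t(1), of y] sli[OF c1 _ t] sli[OF c2 _ t] b1 b2 by fastforce+
   have "m t <= (LBINT x. (hk (x - y, t) - K1 (x, t)) + (hk (x - y, t) - K2 (x, t)))"
    unfolding m_def
   proof (rule integral_mono[OF di[OF t] L1_add[OF i]])
    fix x
    show "\<bar>d (x, t)\<bar> <= (hk (x - y, t) - K1 (x, t)) + (hk (x - y, t) - K2 (x, t))"
     using b1[of "(x, t)"] b2[of "(x, t)"] t by (auto simp: d_def Q_def)
   qed
   also have "\<dots> = (LBINT x. hk (x - y, t) - K1 (x, t)) + (LBINT x. hk (x - y, t) - K2 (x, t))"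
    by (rule lint_add[OF i])
   also have "\<dots> <= (1 - (LBINT x. K1 (x, t) * \<phi> x)) + (1 - (LBINT x. K2 (x, t) * \<phi> x))"
    by (intro add_mono gap c1 c2 b1 b2 t)
   finally show ?thesis .
  qed
  show ?thesis
  proof (rule tendsto_sandwich[of "\<lambda>_. 0"])
   show "\<forall>\<^sub>F t in at_right 0. 0 <= m t" by (simp add: m_def)
   show "\<forall>\<^sub>F t in at_right 0. m t <= (1 - (LBINT x. K1 (x, t) * \<phi> x)) + (1 - (LBINT x. K2 (x, t) * \<phi> x))"
    unfolding eventually_at_right_field by (intro exI[of _ T] conjI T allI impI up) auto
   have "\<phi> y = 1" using b0 by (simp add: \<phi>_def)
   then show "((\<lambda>t. (1 - (LBINT x. K1 (x, t) * \<phi> x)) + (1 - (LBINT x. K2 (x, t) * \<phi> x))) \<longlongrightarrow> 0) (at_right 0)"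
    using tendsto_add[OF tendsto_diff[OF tendsto_const[of 1] t1[OF \<phi> \<phi>c]] tendsto_diff[OF tendsto_const[of 1] t2[OF \<phi> \<phi>c]]] by simp
  qed simp
 qed
 \<comment> \<open>The slab inequality with a cut-off of width n + 1: the Laplacian costs N/(n +
   1)^2 times the strip mass of the Gauss kernel, and the term at the lower time s disappears as s
   tends to 0.\<close>
 have main: "(LBINT x. \<bar>d (x, t)\<bar> * \<xi> n x) <= N / (real (Suc n))\<^sup>2 * t" if t: "0 < t" "t < T" for t n
 proof -
  have step: "(LBINT x. \<bar>d (x, t)\<bar> * \<xi> n x) - N / (real (Suc n))\<^sup>2 * t <= m s" if s: "0 < s" "s < t" for s
  proof -
   have "(LBINT z. indicator {s..t} (snd z) * (- \<bar>d z\<bar> * lap (\<xi> n) (fst z) + 0 * \<xi> n (fst z)))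
    <= (LBINT x. - \<bar>d (x, t)\<bar> * \<xi> n x) - (LBINT x. - \<bar>d (x, s)\<bar> * \<xi> n x)"
   proof (rule time_slice[where v = "\<lambda>z. - \<bar>d z\<bar>" and f = "\<lambda>_. 0" and T = T and K = "cball 0 (real (Suc n))"])
    show "continuous_on (Q_int T) (\<lambda>z. - \<bar>d z\<bar>)" by (intro continuous_intros cdi)
    show "(LBINT z. 0 * \<phi> z) <= (LBINT z. - \<bar>d z\<bar> * adj_heat \<phi> z)"
     if "test_function (Q_int T) \<phi>" "!!z. 0 <= \<phi> z" for \<phi> using sub[OF that] by simp
   qed (use s t s\<xi> \<xi>b \<xi>off in \<open>auto simp: set_integrable_def\<close>)
   moreover have "\<bar>\<integral>z. indicator {s..t} (snd z) * (- \<bar>d z\<bar> * lap (\<xi> n) (fst z) + 0 * \<xi> n (fst z)) \<partial>lborel\<bar>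
     <= N / (real (Suc n))\<^sup>2 * (t - s)"
   proof -
    have "norm (LBINT z. indicator {s..t} (snd z) * (- \<bar>d z\<bar> * lap (\<xi> n) (fst z) + 0 * \<xi> n (fst z)))
     <= (LBINT z. N / (real (Suc n))\<^sup>2 * (indicator {s..t} (snd z) * hk (z - (y, 0))))"
    proof (rule norm_integral_le_integral)
     show "integrable lborel (\<lambda>z. N / (real (Suc n))\<^sup>2 * (indicator {s..t} (snd z) * hk (z - (y, 0))))"
      using hk_strip_mass(1)[of s t y] s by simp
     fix z :: "'a \<times> real"
     show "norm (indicator {s..t} (snd z) * (- \<bar>d z\<bar> * lap (\<xi> n) (fst z) + 0 * \<xi> n (fst z)))
      <= N / (real (Suc n))\<^sup>2 * (indicator {s..t} (snd z) * hk (z - (y, 0)))"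
     proof (cases "snd z \<in> {s..t}")
      case True
      then have "z \<in> Q T" using s t by (cases z) (auto simp: Q_def)
      then have "\<bar>lap (\<xi> n) (fst z)\<bar> * \<bar>d z\<bar> <= N / (real (Suc n))\<^sup>2 * hk (z - (y, 0))"
       using N by (intro mult_mono lap\<xi> db) auto
      then show ?thesis using True by (simp add: abs_mult mult.commute)
     qed simp
    qed
    then show ?thesis using hk_strip_mass(2)[of s t y] s by simp
   qed
   moreover have "(LBINT x. \<bar>d (x, s)\<bar> * \<xi> n x) <= m s"
    unfolding m_def
   proof (rule integral_mono)
    show i: "integrable lborel (\<lambda>x. \<bar>d (x, s)\<bar>)" using s t by (intro di) auto
    show "integrable lborel (\<lambda>x. \<bar>d (x, s)\<bar> * \<xi> n x)"
     by (rule L1_bound[OF i])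
      (use i \<xi>b in \<open>auto simp: abs_mult intro!: mult_right_le_one_le borel_measurable_times\<close>)
    show "\<bar>d (x, s)\<bar> * \<xi> n x <= \<bar>d (x, s)\<bar>" for x using \<xi>b by (intro mult_right_le_one_le) auto
   qed
   moreover have "N / (real (Suc n))\<^sup>2 * (t - s) <= N / (real (Suc n))\<^sup>2 * t" using N s by (intro mult_left_mono) auto
   ultimately show ?thesis by (simp add: abs_le_iff)
  qed
  have "(LBINT x. \<bar>d (x, t)\<bar> * \<xi> n x) - N / (real (Suc n))\<^sup>2 * t <= 0"
   by (rule tendsto_lowerbound[OF mlim])
    (use step t in \<open>auto simp: eventually_at_right_field intro!: exI[of _ t]\<close>)
  then show ?thesis by simp
 qed
 have zero: "d (x, t) = 0" if t: "0 < t" "t < T" for x t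
 proof -
  have "(\<lambda>n. LBINT x. \<bar>d (x, t)\<bar> * \<xi> n x) \<longlonglongrightarrow> (LBINT x. \<bar>d (x, t)\<bar> * b 0)"
  proof (rule integral_dominated_convergence[where w = "\<lambda>x. \<bar>d (x, t)\<bar>"])
   show i: "integrable lborel (\<lambda>x. \<bar>d (x, t)\<bar>)" using t by (intro di) auto
   then show "(\<lambda>x. \<bar>d (x, t)\<bar> * \<xi> n x) \<in> borel_measurable lborel" for n by (intro borel_measurable_times) auto
   show "(\<lambda>x. \<bar>d (x, t)\<bar> * b 0) \<in> borel_measurable lborel" using i by (intro borel_measurable_times) auto
   show "AE x in lborel. norm (\<bar>d (x, t)\<bar> * \<xi> n x) <= \<bar>d (x, t)\<bar>" for n
    using \<xi>b by (auto simp: abs_mult intro!: mult_right_le_one_le)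
   have "(\<lambda>n. \<xi> n x) \<longlonglongrightarrow> b 0" for x
   proof -
    have "(\<lambda>n. (1 / real (Suc n)) *\<^sub>R x) \<longlonglongrightarrow> 0 *\<^sub>R x"
     by (intro tendsto_scaleR LIMSEQ_Suc[OF lim_1_over_n] tendsto_const)
    then show ?thesis unfolding \<xi>_def
     by (intro continuous_on_tendsto_compose[OF smooth_continuous[OF sb, of UNIV]]) auto
   qed
   then show "AE x in lborel. (\<lambda>n. \<bar>d (x, t)\<bar> * \<xi> n x) \<longlonglongrightarrow> \<bar>d (x, t)\<bar> * b 0"
    by (intro AE_I2 tendsto_mult tendsto_const)
  qed
  moreover have "(\<lambda>n. N / (real (Suc n))\<^sup>2 * t) \<longlonglongrightarrow> 0"
  proof -
   have "(\<lambda>n. N * (1 / real (Suc n))\<^sup>2 * t) \<longlonglongrightarrow> N * 0\<^sup>2 * t"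
    by (intro tendsto_intros LIMSEQ_Suc[OF lim_1_over_n])
   then show ?thesis by (simp add: power_divide)
  qed
  ultimately have "(LBINT x. \<bar>d (x, t)\<bar> * b 0) <= 0"
   by (rule LIMSEQ_le) (use main[OF t] in blast)
  then have "b 0 * m t <= 0" by (simp add: m_def mult.commute)
  then have "m t <= 0" using b0 by (simp add: mult_le_0_iff)
  moreover have "0 <= m t" by (simp add: m_def)
  ultimately have "m t = 0" by simp
  then have "(\<integral>\<^sup>+ x. ennreal \<bar>d (x, t)\<bar> \<partial>lborel) = 0"
   using nn_integral_eq_integral[OF di[of t]] t by (simp add: m_def)
  moreover have "continuous_on UNIV (\<lambda>x. \<bar>d (x, t)\<bar>)" using slice[OF cd, of t] t by (intro continuous_on_rabs) auto
  ultimately have "\<bar>d (x, t)\<bar> = 0" by (intro continuous_nn_integral_0) auto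
  then show ?thesis by simp
 qed
 obtain x t where zt: "z = (x, t)" by (cases z)
 with z have t: "0 < t" "t <= T" by (auto simp: Q_def)
 \<comment> \<open>The weak equation lives on t < T; the top of the cylinder is reached by
   continuity along times increasing to T.\<close>
 have "d (x, t) = 0"
 proof (cases "t = T")
  case True
  have "(\<lambda>n. d (x, T - T / 2 * (1 / real (Suc n)))) \<longlonglongrightarrow> d (x, T)"
  proof (rule continuous_on_tendsto_compose[OF cd])
   have "(\<lambda>n. (x, T - T / 2 * (1 / real (Suc n)))) \<longlonglongrightarrow> (x, T - T / 2 * 0)"
    by (intro tendsto_intros LIMSEQ_Suc[OF lim_1_over_n])
   then show "(\<lambda>n. (x, T - T / 2 * (1 / real (Suc n)))) \<longlonglongrightarrow> (x, T)" by simp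
   show "\<forall>\<^sub>F n in sequentially. (x, T - T / 2 * (1 / real (Suc n))) \<in> Q T"
    using T by (intro always_eventually) (auto simp: Q_def divide_simps)
  qed (use T in \<open>auto simp: Q_def\<close>)
  moreover have "d (x, T - T / 2 * (1 / real (Suc n))) = 0" for n
   using T by (intro zero) (auto simp: divide_simps)
  ultimately show ?thesis using True by (simp add: LIMSEQ_const_iff)
 next
  case False
  then show ?thesis using t by (intro zero) auto
 qed
 then show ?thesis by (simp add: d_def zt)
qed

lemma bounded_potential_mono:
 assumes "bounded_potential k W" "k <= k'"
 shows "bounded_potential k' W"
proof -
 interpret bounded_potential k W by fact
 show ?thesis by standard (use W_nonneg order_trans[OF W_le assms(2)] in auto)
qed

lemma Q_int_subset: "Q_int T \<subseteq> {z. 0 < snd z}" and Q_subset: "Q T \<subseteq> {z. 0 < snd z}"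
 by (auto simp: Q_int_def Q_def)

lemma test_function_mono: "test_function \<Omega> \<phi> ==> \<Omega> \<subseteq> \<Omega>' ==> test_function \<Omega>' \<phi>"
 unfolding test_function_def by auto

text \<open>Different shifts k give different series for the same potential; uniqueness identifies
  the resulting kernels. This makes kernels of different truncations comparable through a common
  shift.\<close>

lemma bker_shift:
 fixes W :: "'a::euclidean_space stfun"
 assumes W: "bounded_potential k W" and k: "k <= k'" and z: "0 < snd z"
 shows "bker k' W y z = bker k W y z"
proof -
 interpret a: bounded_potential k W by (rule W)
 interpret b: bounded_potential k' W by (rule bounded_potential_mono[OF W k])
 have tr: "((\<lambda>t. LBINT x. p (x, t) * \<phi> x) \<longlongrightarrow> \<phi> y) (at_right 0)"
  if p: "p = a.K0 y \<or> p = b.K0 y" and \<phi>: "continuous_on UNIV \<phi>" "compact (closure {x. \<phi> x \<noteq> 0})" for p \<phi>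
 proof -
  have "\<phi> x = 0" if "x \<notin> closure {x. \<phi> x \<noteq> 0}" for x
   using that closure_subset[of "{x. \<phi> x \<noteq> 0}"] by blast
  then obtain B where "!!x. \<bar>\<phi> x\<bar> <= B" using bounded_compact_support[OF \<phi>] by blast
  then show ?thesis using p a.K0_trace(2)[OF \<phi>(1), of B y] b.K0_trace(2)[OF \<phi>(1), of B y] by auto
 qed
 have "b.K0 y z = a.K0 y z"
 proof (rule heat_kernel_unique[where T = "snd z" and W = W and k = k])
  show "continuous_on (Q (snd z)) (b.K0 y)" "continuous_on (Q (snd z)) (a.K0 y)"
   by (rule continuous_on_subset[OF b.continuous_K0 Q_subset], rule continuous_on_subset[OF a.continuous_K0 Q_subset])
  show "(LBINT z. b.K0 y z * adj_heat \<phi> z) = - (LBINT z. W z * b.K0 y z * \<phi> z)"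
   "(LBINT z. a.K0 y z * adj_heat \<phi> z) = - (LBINT z. W z * a.K0 y z * \<phi> z)"
   if "test_function (Q_int (snd z)) \<phi>" for \<phi>
   using test_function_mono[OF that Q_int_subset] by (rule b.K0_weak, rule a.K0_weak)
  show "z \<in> Q (snd z)" using z by (cases z) (auto simp: Q_def)
  show "0 <= b.K0 y z \<and> b.K0 y z <= hk (z - (y, 0))" "0 <= a.K0 y z \<and> a.K0 y z <= hk (z - (y, 0))" for z
   using a.K0_nonneg a.K0_le b.K0_nonneg b.K0_le by blast+
 qed (use a.W_nonneg a.W_le tr in auto)
 then show ?thesis by (simp add: a.K0_bker b.K0_bker)
qed

text \<open>With a common shift a larger potential W means a smaller coefficient k - W, and the
  Duhamel iterates are monotone in the coefficient.\<close>

lemma bker_antimono: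
 fixes W W' :: "'a::euclidean_space stfun"
 assumes W: "bounded_potential k W" and W': "bounded_potential k' W'" and k: "k <= k'"
  and le: "!!z. W z <= W' z" and z: "0 < snd z"
 shows "bker k' W' y z <= bker k W y z"
proof -
 interpret a: bounded_potential k' W by (rule bounded_potential_mono[OF W k])
 interpret b: bounded_potential k' W' by (rule W')
 have "dyson_sum b.c (y, z) <= dyson_sum a.c (y, z)"
  unfolding dyson_sum_def by (intro SUP_mono' dyson_mono_c) (simp add: a.c_def b.c_def le)
 then have "b.s y z <= a.s y z"
  unfolding a.ennreal_s[symmetric] b.ennreal_s[symmetric] by (simp add: a.s_nonneg)
 then have "b.K0 y z <= a.K0 y z" unfolding a.K0_def b.K0_def by (intro mult_left_mono) auto
 then show ?thesis using bker_shift[OF W k z, of y] by (simp add: a.K0_bker b.K0_bker)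
qed

section \<open>The solution with a given initial measure\<close>

text \<open>Here \<open>V\<close> stands for a Borel representative that is nonnegative everywhere;
  the potential of the theorem is determined only almost everywhere.\<close>

locale potential =
 fixes V :: "'a::euclidean_space stfun"
 assumes V_measurable [measurable]: "V \<in> borel_measurable borel" and V_nonneg: "0 <= V z"
begin

definition Vk :: "nat => 'a \<times> real => real" where "Vk k z = min (V z) (real k)"

lemma Vk_measurable [measurable]: "Vk k \<in> borel_measurable borel" unfolding Vk_def by measurable

lemma Vk_nonneg: "0 <= Vk k z" and Vk_le: "Vk k z <= real k" and Vk_le_V: "Vk k z <= V z"
 by (auto simp: Vk_def V_nonneg)

lemma Vk_mono: "Vk k z <= Vk (Suc k) z" by (auto simp: Vk_def)

lemma Vk_lim: "(\<lambda>k. Vk k z) \<longlonglongrightarrow> V z"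
proof (rule tendsto_eventually)
 obtain N where N: "V z <= real N" using real_arch_simple by blast
 show "\<forall>\<^sub>F k in sequentially. Vk k z = V z"
  unfolding eventually_sequentially by (intro exI[of _ N]) (use N in \<open>auto simp: Vk_def\<close>)
qed

lemma bp: "bounded_potential (real k) (Vk k)"
 by standard (auto simp: Vk_nonneg Vk_le)

definition KK :: "nat => 'a => 'a \<times> real => real" where "KK k y z = bker (real k) (Vk k) y z"

lemma KK_eq: "KK k y z = bounded_potential.K0 (real k) (Vk k) y z"
 using bounded_potential.K0_bker[OF bp] by (simp add: KK_def)

lemma KK_nonneg: "0 <= KK k y z" and KK_le: "KK k y z <= hk (z - (y, 0))"
 and KK_continuous: "continuous_on {z. 0 < snd z} (KK k y)"
 and KK_measurable: "(\<lambda>p. KK k (fst p) (snd p)) \<in> borel_measurable borel"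
 and KK_measurable2 [measurable]: "KK k y \<in> borel_measurable borel"
 and KK_weak: "test_function {z. 0 < snd z} \<phi> ==> (LBINT z. KK k y z * adj_heat \<phi> z) = - (LBINT z. Vk k z * KK k y z * \<phi> z)"
 unfolding KK_eq[abs_def]
 using bounded_potential.K0_nonneg[OF bp] bounded_potential.K0_le[OF bp] bounded_potential.continuous_K0[OF bp]
  bounded_potential.K0_measurable[OF bp] bounded_potential.K0_measurable2[OF bp] bounded_potential.K0_weak[OF bp]
 by auto

lemma KK_trace:
 assumes "continuous_on UNIV \<phi>" "!!x. \<bar>\<phi> x\<bar> <= B"
 shows "0 < t ==> integrable lborel (\<lambda>x. KK k y (x, t) * \<phi> x)"
  and "((\<lambda>t. LBINT x. KK k y (x, t) * \<phi> x) \<longlongrightarrow> \<phi> y) (at_right 0)"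
 unfolding KK_eq using bounded_potential.K0_trace[OF bp assms] by auto

lemma KK_decreasing: "0 < snd z ==> KK (Suc k) y z <= KK k y z"
 unfolding KK_def by (intro bker_antimono bp Vk_mono) auto

definition Kinf :: "'a => 'a \<times> real => real" where "Kinf y z = lim (\<lambda>k. KK k y z)"

lemma Kinf_lim:
 assumes z: "0 < snd z"
 shows "(\<lambda>k. KK k y z) \<longlonglongrightarrow> Kinf y z"
proof -
 have "decseq (\<lambda>k. KK k y z)" by (intro decseq_SucI KK_decreasing z)
 then have "convergent (\<lambda>k. KK k y z)"
  using decseq_convergent[of "\<lambda>k. KK k y z" 0] KK_nonneg by (metis convergentI)
 then show ?thesis unfolding Kinf_def convergent_LIMSEQ_iff .
qed

lemma Kinf_nonneg: "0 < snd z ==> 0 <= Kinf y z"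
 by (rule LIMSEQ_le_const[OF Kinf_lim]) (auto simp: KK_nonneg)

lemma Kinf_le: "0 < snd z ==> Kinf y z <= hk (z - (y, 0))"
 by (rule LIMSEQ_le_const2[OF Kinf_lim]) (auto simp: KK_le)

end

section \<open>Superposition of kernels over a measure with finite Gaussian weight\<close>

locale weighted_measure =
 fixes T :: real and \<mu> :: "'a::euclidean_space measure"
 assumes T: "0 < T" and radon: "radon_measure \<mu>"
  and finite_weight: "(\<integral>\<^sup>+ y. ennreal (exp (- (norm y)\<^sup>2 / (4 * T))) \<partial>\<mu>) < \<infinity>"
begin

lemma sets_mu [measurable_cong]: "sets \<mu> = sets borel"
 using radon by (simp add: radon_measure_def)

sublocale sigma_finite_measure \<mu>
proof
 have sp: "space \<mu> = UNIV" using sets_eq_imp_space_eq[OF sets_mu] by simp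
 show "\<exists>A::'a set set. countable A \<and> A \<subseteq> sets \<mu> \<and> \<Union> A = space \<mu> \<and> (\<forall>a\<in>A. emeasure \<mu> a \<noteq> \<infinity>)"
 proof (intro exI[of _ "range (\<lambda>n::nat. cball 0 (real n))"] conjI ballI)
  show "\<Union> (range (\<lambda>n::nat. cball (0::'a) (real n))) = space \<mu>"
   unfolding sp using real_arch_simple by fastforce
  show "emeasure \<mu> a \<noteq> \<infinity>" if "a \<in> range (\<lambda>n::nat. cball 0 (real n))" for a
   using that radon compact_cball unfolding radon_measure_def by (metis imageE less_irrefl)
 qed (auto simp: sets_mu)
qed

definition E :: "'a => real" where "E y = exp (- (norm y)\<^sup>2 / (4 * T))"

lemma E_measurable [measurable]: "E \<in> borel_measurable borel" unfolding E_def[abs_def] by measurable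

lemma E_pos: "0 < E y" by (simp add: E_def)

lemma E_integrable: "integrable \<mu> E"
proof (rule integrableI_nonneg)
 show "(\<integral>\<^sup>+ y. ennreal (E y) \<partial>\<mu>) < \<infinity>" using finite_weight by (simp add: E_def)
qed (auto simp: less_imp_le[OF E_pos])

text \<open>On a compact set the time is bounded away from 0 and T and the space variable is
  bounded, which is the situation of \<open>hk_weight_bound\<close>. The result is the integrable
  majorant for limits and Fubini arguments in \<mu>.\<close>

lemma hk_E_bound:
 assumes K: "compact K" "K \<subseteq> Q_int T"
 obtains C where "C > 0" "!!z y. z \<in> K ==> hk (z - (y, 0)) <= C * E y"
proof (cases "K = {}")
 case False
 have cs: "continuous_on K snd" "continuous_on K (\<lambda>z. norm (fst z))" by (intro continuous_intros)+
 obtain z1 where z1: "z1 \<in> K" "!!z. z \<in> K ==> snd z1 <= snd z" using continuous_attains_inf[OF K(1) False cs(1)] by blast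
 obtain z2 where z2: "z2 \<in> K" "!!z. z \<in> K ==> snd z <= snd z2" using continuous_attains_sup[OF K(1) False cs(1)] by blast
 obtain z3 :: "'a \<times> real" where "\<forall>z\<in>K. norm (fst z) <= norm (fst z3)" using continuous_attains_sup[OF K(1) False cs(2)] by blast
 then have z3: "!!z. z \<in> K ==> norm (fst z) <= norm (fst z3)" by blast
 have a: "0 < snd z1" "snd z2 < T" using z1(1) z2(1) K(2) by (auto simp: Q_int_def)
 obtain C where C: "C > 0" "!!(x::'a) y t. norm x <= norm (fst z3) ==> snd z1 <= t ==> t <= snd z2 ==> hk (x - y, t) <= C * exp (- (norm y)\<^sup>2 / (4 * T))"
  using hk_weight_bound[OF a, of "norm (fst z3)", where 'a='a] by blast
 show ?thesis
 proof (rule that[OF C(1)])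
  fix z y assume z: "z \<in> K"
  have "z - (y, 0) = (fst z - y, snd z)" by (cases z) simp
  then show "hk (z - (y, 0)) <= C * E y"
   unfolding E_def using C(2)[OF z3[OF z] z1(2)[OF z] z2(2)[OF z], of y] by simp
 qed
qed (rule that[of 1], auto)

lemma hk_E_bound_at:
 assumes "z \<in> Q_int T"
 obtains C where "C > 0" "!!y. hk (z - (y, 0)) <= C * E y"
proof -
 have "compact {z}" "{z} \<subseteq> Q_int T" using assms by auto
 then obtain C where "C > 0" "!!x y. x \<in> {z} ==> hk (x - (y, 0)) <= C * E y" using hk_E_bound by metis
 then show ?thesis using that[of C] by simp
qed

end

locale potential_measure = potential V + weighted_measure T \<mu> for V :: "'a::euclidean_space stfun" and T :: real and \<mu> :: "'a measure"
begin

lemma KK_mu_measurable: "(\<lambda>y. KK k y z) \<in> borel_measurable \<mu>"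
proof -
 have "(\<lambda>y. (y, z)) \<in> borel \<rightarrow>\<^sub>M (borel \<Otimes>\<^sub>M borel :: ('a \<times> 'a \<times> real) measure)"
  by (rule measurable_Pair2') simp
 then have "(\<lambda>y. (y, z)) \<in> borel \<rightarrow>\<^sub>M (borel :: ('a \<times> 'a \<times> real) measure)" unfolding borel_prod .
 from measurable_compose[OF this KK_measurable, of k] have "(\<lambda>y. KK k y z) \<in> borel_measurable borel" by simp
 then show ?thesis by (simp add: measurable_cong_sets[OF sets_mu refl])
qed

lemma KK_mu_integrable:
 assumes z: "z \<in> Q_int T"
 shows "integrable \<mu> (\<lambda>y. KK k y z)"
proof -
 obtain C where C: "C > 0" "!!y. hk (z - (y, 0)) <= C * E y" using hk_E_bound_at[OF z] by blast
 show ?thesis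
 proof (rule L1_bound[of _ "\<lambda>y. C * E y"])
  show "AE y in \<mu>. norm (KK k y z) <= norm (C * E y)"
   using order_trans[OF KK_le C(2)] C(1) E_pos by (intro AE_I2) (simp add: KK_nonneg less_imp_le)
 qed (use E_integrable KK_mu_measurable in auto)
qed

text \<open>Real-valued integrals suffice on the open cylinder, where the weight makes them finite;
  at t = T the integral may diverge, which is why \<open>reduced_solution\<close> is
  extended-valued.\<close>

definition wk :: "nat => 'a \<times> real => real" where "wk k z = (\<integral>y. KK k y z \<partial>\<mu>)"
definition w :: "'a stfun" where "w z = (\<integral>y. Kinf y z \<partial>\<mu>)"

lemma wk_nonneg: "0 <= wk k z" unfolding wk_def by (simp add: KK_nonneg)

lemma Kinf_mu_measurable: "0 < snd z ==> (\<lambda>y. Kinf y z) \<in> borel_measurable \<mu>"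
 by (rule borel_measurable_LIMSEQ_real[OF Kinf_lim KK_mu_measurable])

lemma wk_lim:
 assumes z: "z \<in> Q_int T"
 shows "(\<lambda>k. wk k z) \<longlonglongrightarrow> w z"
proof -
 have z0: "0 < snd z" using z Q_int_subset by auto
 obtain C where C: "C > 0" "!!y. hk (z - (y, 0)) <= C * E y" using hk_E_bound_at[OF z] by blast
 show ?thesis unfolding wk_def w_def
 proof (rule integral_dominated_convergence[where w = "\<lambda>y. C * E y"])
  show "AE y in \<mu>. norm (KK k y z) <= C * E y" for k
   using order_trans[OF KK_le C(2)] by (intro AE_I2) (simp add: KK_nonneg)
  show "AE y in \<mu>. (\<lambda>k. KK k y z) \<longlonglongrightarrow> Kinf y z" using Kinf_lim[OF z0] by simp
 qed (use E_integrable KK_mu_measurable Kinf_mu_measurable[OF z0] in auto)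
qed

lemma wk_decreasing:
 assumes z: "z \<in> Q_int T"
 shows "wk (Suc k) z <= wk k z"
 unfolding wk_def using z Q_int_subset
 by (intro integral_mono KK_mu_integrable KK_decreasing) auto

lemma nn_Kinf:
 assumes z: "z \<in> Q_int T"
 shows "(\<integral>\<^sup>+ y. ennreal (Kinf y z) \<partial>\<mu>) = ennreal (w z)"
proof -
 have z0: "0 < snd z" using z Q_int_subset by auto
 obtain C where C: "C > 0" "!!y. hk (z - (y, 0)) <= C * E y" using hk_E_bound_at[OF z] by blast
 have "integrable \<mu> (\<lambda>y. Kinf y z)"
 proof (rule L1_bound[of _ "\<lambda>y. C * E y"])
  show "AE y in \<mu>. norm (Kinf y z) <= norm (C * E y)"
   using order_trans[OF Kinf_le[OF z0] C(2)] Kinf_nonneg[OF z0] C(1) E_pos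
   by (intro AE_I2) (simp add: less_imp_le)
 qed (use E_integrable Kinf_mu_measurable[OF z0] in auto)
 then show ?thesis unfolding w_def using Kinf_nonneg[OF z0] by (intro nn_integral_eq_integral) auto
qed

lemma w_nonneg: "z \<in> Q_int T ==> 0 <= w z"
 unfolding w_def using Q_int_subset by (intro lint_nonneg Kinf_nonneg) auto

lemma w_le_wk: "z \<in> Q_int T ==> w z <= wk k z"
 by (rule decseq_ge[OF decseq_SucI wk_lim]) (auto intro: wk_decreasing)

lemma wk_bound:
 assumes K: "compact K" "K \<subseteq> Q_int T"
 obtains M where "M \<ge> 0" "!!k z. z \<in> K ==> wk k z <= M"
proof -
 obtain C where C: "C > 0" "!!z y. z \<in> K ==> hk (z - (y, 0)) <= C * E y" using hk_E_bound[OF K] by blast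
 show ?thesis
 proof (rule that[of "\<integral>y. C * E y \<partial>\<mu>"])
  show "0 <= (\<integral>y. C * E y \<partial>\<mu>)"
   using C(1) E_pos by (intro lint_nonneg) (simp add: less_imp_le)
  show "wk k z <= (\<integral>y. C * E y \<partial>\<mu>)" if "z \<in> K" for k z
   unfolding wk_def using that K(2) E_integrable
   by (intro integral_mono KK_mu_integrable order_trans[OF KK_le C(2)]) auto
 qed
qed

lemma continuous_wk: "continuous_on (Q_int T) (wk k)"
 unfolding continuous_on_sequentially comp_def
proof (intro ballI allI impI)
 fix z :: "'a \<times> real" and X assume z: "z \<in> Q_int T" and X: "(\<forall>n. X n \<in> Q_int T) \<and> X \<longlonglongrightarrow> z"
 let ?S = "insert z (range X)"
 have "compact ?S" using X compact_sequence_with_limit by blast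
 moreover have "?S \<subseteq> Q_int T" using z X by auto
 ultimately obtain C where C: "C > 0" "!!z y. z \<in> ?S ==> hk (z - (y, 0)) <= C * E y" using hk_E_bound by metis
 show "(\<lambda>n. wk k (X n)) \<longlonglongrightarrow> wk k z" unfolding wk_def
 proof (rule integral_dominated_convergence[where w = "\<lambda>y. C * E y"])
  show "AE y in \<mu>. norm (KK k y (X n)) <= C * E y" for n
   using order_trans[OF KK_le C(2)] by (intro AE_I2) (simp add: KK_nonneg)
  show "AE y in \<mu>. (\<lambda>n. KK k y (X n)) \<longlonglongrightarrow> KK k y z"
  proof (rule AE_I2)
   fix y
   have "z \<in> {z. 0 < snd z}" "!!n. X n \<in> {z. 0 < snd z}" using z X Q_int_subset by blast+
   then show "(\<lambda>n. KK k y (X n)) \<longlonglongrightarrow> KK k y z"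
    using KK_continuous[of k y] X unfolding continuous_on_sequentially comp_def by blast
  qed
 qed (use E_integrable KK_mu_measurable in auto)
qed

text \<open>\<open>g\<close> is bounded Borel rather than continuous, because it is applied also to
  the product of a truncated potential with a test function.\<close>

lemma wk_Fubini:
 fixes g :: "'a stfun"
 assumes [measurable]: "g \<in> borel_measurable borel" and B: "!!z. \<bar>g z\<bar> <= B"
  and K: "compact K" "K \<subseteq> Q_int T" "!!z. z \<notin> K ==> g z = 0"
 shows "(LBINT z. wk k z * g z) = (\<integral>y. (LBINT z. KK k y z * g z) \<partial>\<mu>)"
proof -
 interpret P: pair_sigma_finite \<mu> "lborel :: ('a \<times> real) measure" ..
 obtain C where C: "C > 0" "!!z y. z \<in> K ==> hk (z - (y, 0)) <= C * E y" using hk_E_bound[OF K(1,2)] by blast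
 have B0: "0 <= B" using B[of undefined] by linarith
 have [measurable]: "K \<in> sets borel" using K(1) by (rule borel_compact)
 have iK: "integrable lborel (indicator K :: _ => real)"
  using emeasure_compact_finite[OF K(1)] by (intro integrable_real_indicator) auto
 have bd: "norm (KK k y z * g z) <= C * B * (E y * indicator K z)" for y z
 proof (cases "z \<in> K")
  case True
  have "KK k y z * \<bar>g z\<bar> <= (C * E y) * B"
   using order_trans[OF KK_le C(2)[OF True]] C(1) E_pos by (intro mult_mono B) (auto intro: less_imp_le)
  then show ?thesis using True by (simp add: abs_mult KK_nonneg mult_ac)
 qed (simp add: K(3))
 have "integrable (\<mu> \<Otimes>\<^sub>M lborel) (\<lambda>(y, z). C * B * (E y * indicator K z))"
 proof (rule P.Fubini_integrable)
  show "(\<lambda>(y, z). C * B * (E y * indicator K z)) \<in> borel_measurable (\<mu> \<Otimes>\<^sub>M lborel)" by measurable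
  show "integrable \<mu> (\<lambda>y. LBINT z. norm (case (y, z) of (y, z) => C * B * (E y * indicator K z)))"
   using E_integrable by (simp add: abs_mult)
 qed (use iK in auto)
 then have "integrable (\<mu> \<Otimes>\<^sub>M lborel) (\<lambda>(y, z). KK k y z * g z)"
 proof (rule L1_bound)
  have m: "sets (\<mu> \<Otimes>\<^sub>M lborel) = sets (borel :: ('a \<times> 'a \<times> real) measure)"
   by (subst borel_prod[symmetric]) (intro sets_pair_measure_cong sets_mu sets_lborel)
  have "(\<lambda>p :: 'a \<times> 'a \<times> real. KK k (fst p) (snd p) * g (snd p)) \<in> borel_measurable borel"
   using KK_measurable[of k] by measurable
  then show "(\<lambda>(y, z). KK k y z * g z) \<in> borel_measurable (\<mu> \<Otimes>\<^sub>M lborel)"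
   by (simp add: measurable_cong_sets[OF m refl] case_prod_beta')
  show "AE p in \<mu> \<Otimes>\<^sub>M lborel. norm (case p of (y, z) => KK k y z * g z) <= norm (case p of (y, z) => C * B * (E y * indicator K z))"
  proof (rule AE_I2)
   fix p :: "'a \<times> 'a \<times> real"
   have "norm (KK k (fst p) (snd p) * g (snd p)) <= norm (C * B * (E (fst p) * indicator K (snd p)))"
    using bd[of "fst p" "snd p"] by (metis abs_ge_self order_trans real_norm_def)
   then show "norm (case p of (y, z) => KK k y z * g z) <= norm (case p of (y, z) => C * B * (E y * indicator K z))"
    by (simp add: case_prod_beta')
  qed
 qed
 from P.Fubini_integral[OF this] show ?thesis by (simp add: wk_def)
qed

lemma wk_weak:
 assumes \<phi>: "test_function (Q_int T) \<phi>"
 shows "(LBINT z. wk k z * adj_heat \<phi> z) = - (LBINT z. Vk k z * wk k z * \<phi> z)"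
proof -
 obtain K where s\<phi>: "smooth \<phi>" and K: "compact K" "K \<subseteq> Q_int T" "!!z. z \<notin> K ==> \<phi> z = 0"
  using \<phi> by (rule test_functionE) blast
 have c\<phi>: "continuous_on UNIV \<phi>" and ca: "continuous_on UNIV (adj_heat \<phi>)"
  using s\<phi> by (auto intro: smooth_continuous continuous_adj_heat)
 have aoff: "adj_heat \<phi> z = 0" if "z \<notin> K" for z using adj_heat_zero_off[OF K(1,3) that] .
 have [measurable]: "\<phi> \<in> borel_measurable borel" "adj_heat \<phi> \<in> borel_measurable borel"
  using c\<phi> ca by (auto intro: borel_measurable_continuous_onI)
 obtain M where M: "M \<ge> 0" "!!z. \<bar>\<phi> z\<bar> <= M" using bounded_compact_support[OF c\<phi> K(1,3)] by blast
 obtain N where N: "N \<ge> 0" "!!z. \<bar>adj_heat \<phi> z\<bar> <= N" using bounded_compact_support[OF ca K(1) aoff] by blast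
 have 1: "(LBINT z. wk k z * adj_heat \<phi> z) = (\<integral>y. (LBINT z. KK k y z * adj_heat \<phi> z) \<partial>\<mu>)"
  by (rule wk_Fubini[OF _ N(2) K(1,2) aoff]) measurable
 have 2: "(LBINT z. wk k z * (Vk k z * \<phi> z)) = (\<integral>y. (LBINT z. KK k y z * (Vk k z * \<phi> z)) \<partial>\<mu>)"
 proof (rule wk_Fubini[OF _ _ K(1,2)])
  show "\<bar>Vk k z * \<phi> z\<bar> <= real k * M" for z
   unfolding abs_mult using Vk_le[of k z] Vk_nonneg[of k z] by (intro mult_mono M) auto
 qed (use K in auto)
 have "(LBINT z. KK k y z * adj_heat \<phi> z) = - (LBINT z. KK k y z * (Vk k z * \<phi> z))" for y
  using KK_weak[OF test_function_mono[OF \<phi> Q_int_subset]] by (simp add: mult_ac)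
 then show ?thesis using 1 2 by (simp add: mult_ac)
qed

lemma nn_wk:
 assumes z: "z \<in> Q_int T"
 shows "ennreal (wk k z) = (\<integral>\<^sup>+ y. ennreal (KK k y z) \<partial>\<mu>)"
 unfolding wk_def using KK_mu_integrable[OF z] by (intro nn_integral_eq_integral[symmetric]) (auto simp: KK_nonneg)

text \<open>One constant for all k: every kernel is below the Gauss kernel, whose averages over a
  ball are bounded by the weight, and the weight is integrable.\<close>

lemma wk_average:
 fixes R :: real
 obtains C where "0 <= C" "!!k t. 0 < t ==> t <= T / 4 ==> (\<integral>\<^sup>+ x. indicator (cball 0 R) x * ennreal (wk k (x, t)) \<partial>lborel) <= ennreal C"
proof -
 interpret P: pair_sigma_finite \<mu> "lborel :: 'a measure" ..
 obtain C where C: "C > 0" "!!(y::'a) t. 0 < t ==> t <= T / 4 ==>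
   (\<integral>\<^sup>+ x. indicator (cball 0 R) x * ennreal (hk (x - y, t)) \<partial>lborel) <= ennreal (C * exp (- (norm y)\<^sup>2 / (4 * T)))"
  using heat_average_bound[OF T, where 'a='a] by blast
 show ?thesis
 proof (rule that[of "C * (\<integral>y. E y \<partial>\<mu>)"])
  show "0 <= C * (\<integral>y. E y \<partial>\<mu>)" using C(1) E_pos by (intro mult_nonneg_nonneg lint_nonneg) (auto intro: less_imp_le)
  fix k t assume t: "0 < t" "t <= T / 4"
  have zt: "(x, t) \<in> Q_int T" for x :: 'a using t T by (auto simp: Q_int_def)
  have "(\<integral>\<^sup>+ x. indicator (cball 0 R) x * ennreal (wk k (x, t)) \<partial>lborel)
    = (\<integral>\<^sup>+ x. (\<integral>\<^sup>+ y. indicator (cball 0 R) x * ennreal (KK k y (x, t)) \<partial>\<mu>) \<partial>lborel)"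
   unfolding nn_wk[OF zt] using KK_mu_measurable by (intro nn_integral_cong nn_integral_cmult[symmetric]) auto
  also have "\<dots> <= (\<integral>\<^sup>+ x. (\<integral>\<^sup>+ y. indicator (cball 0 R) x * ennreal (hk (x - y, t)) \<partial>\<mu>) \<partial>lborel)"
   using KK_le[of k _ "(_, t)"] by (intro nn_integral_mono mult_left_mono ennreal_leI) auto
  also have "\<dots> = (\<integral>\<^sup>+ y. (\<integral>\<^sup>+ x. indicator (cball 0 R) x * ennreal (hk (x - y, t)) \<partial>lborel) \<partial>\<mu>)"
  proof (rule P.Fubini')
   have "(\<lambda>p. indicator (cball 0 R) (snd p) * ennreal (hk (snd p - fst p, t))) \<in> borel_measurable (\<mu> \<Otimes>\<^sub>M lborel)"
   proof (intro borel_measurable_times_ennreal measurable_compose[OF _ measurable_ennreal])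
    have m: "sets (\<mu> \<Otimes>\<^sub>M lborel) = sets (borel :: ('a \<times> 'a) measure)"
     by (subst borel_prod[symmetric]) (intro sets_pair_measure_cong sets_mu sets_lborel)
    have "(\<lambda>p::'a \<times> 'a. (snd p - fst p, t)) \<in> borel_measurable borel"
     by (intro borel_measurable_continuous_onI continuous_intros)
    then have "(\<lambda>p::'a \<times> 'a. hk (snd p - fst p, t)) \<in> borel_measurable borel" by measurable
    then show "(\<lambda>p. hk (snd p - fst p, t)) \<in> borel_measurable (\<mu> \<Otimes>\<^sub>M lborel)" by (simp add: measurable_cong_sets[OF m refl])
   qed (rule measurable_compose[OF measurable_snd], rule borel_measurable_indicator, simp)
   then show "(\<lambda>(y, x). indicator (cball 0 R) x * ennreal (hk (x - y, t))) \<in> borel_measurable (\<mu> \<Otimes>\<^sub>M lborel)"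
    by (simp add: case_prod_beta')
  qed
  also have "\<dots> <= (\<integral>\<^sup>+ y. ennreal (C * E y) \<partial>\<mu>)"
   unfolding E_def by (intro nn_integral_mono C t)
  also have "\<dots> = ennreal (\<integral>y. C * E y \<partial>\<mu>)"
   using C(1) E_pos E_integrable by (intro nn_integral_eq_integral AE_I2 mult_nonneg_nonneg integrable_mult_right) (auto intro: less_imp_le)
  finally show "(\<integral>\<^sup>+ x. indicator (cball 0 R) x * ennreal (wk k (x, t)) \<partial>lborel) <= ennreal (C * (\<integral>y. E y \<partial>\<mu>))" by simp
 qed
qed

end

section \<open>Measures from positive functionals\<close>

definition Cc :: "('a::euclidean_space => real) => bool" where
 "Cc f \<longleftrightarrow> continuous_on UNIV f \<and> compact (closure {x. f x \<noteq> 0})"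

lemma CcI: "continuous_on UNIV f ==> compact K ==> (!!x. x \<notin> K ==> f x = 0) ==> Cc f"
 unfolding Cc_def
proof
 assume "compact K" "!!x. x \<notin> K ==> f x = 0"
 then have "closure {x. f x \<noteq> 0} \<subseteq> K" by (intro closure_minimal compact_imp_closed) auto
 then show "compact (closure {x. f x \<noteq> 0})"
  using \<open>compact K\<close> by (meson bounded_subset closed_closure compact_eq_bounded_closed)
qed

lemma CcE:
 assumes "Cc f"
 obtains K where "continuous_on UNIV f" "compact K" "!!x. x \<notin> K ==> f x = 0"
proof (rule that[of "closure {x. f x \<noteq> 0}"])
 show "f x = 0" if "x \<notin> closure {x. f x \<noteq> 0}" for x
  using that closure_subset[of "{x. f x \<noteq> 0}"] by blast
qed (use assms in \<open>simp_all add: Cc_def\<close>)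

lemma Cc_ball:
 fixes f :: "'a::euclidean_space => real"
 assumes "Cc f"
 obtains R where "R > 0" "!!x. x \<notin> cball 0 R ==> f x = 0"
proof -
 obtain K where K: "compact K" "!!x. x \<notin> K ==> f x = 0" using assms by (rule CcE) blast
 obtain R where R: "R > 0" "\<forall>x\<in>K. norm x <= R" using compact_imp_bounded[OF K(1)] unfolding bounded_pos by blast
 show ?thesis
 proof (rule that[OF R(1)])
  fix x :: 'a assume "x \<notin> cball 0 R"
  then have "x \<notin> K" using R(2) by auto
  then show "f x = 0" by (rule K(2))
 qed
qed

lemma Cc_bounded: "Cc f ==> \<exists>B\<ge>0. \<forall>x. \<bar>f x\<bar> <= B"
 by (elim CcE) (metis bounded_compact_support)

lemma Cc_measurable: "Cc f ==> f \<in> borel_measurable borel"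
 by (auto simp: Cc_def intro: borel_measurable_continuous_onI)

lemma Cc_add: "Cc f ==> Cc g ==> Cc (\<lambda>x. f x + g x)"
proof (elim CcE)
 fix K K' assume "continuous_on UNIV f" "continuous_on UNIV g" "compact K" "compact K'"
  "!!x. x \<notin> K ==> f x = 0" "!!x. x \<notin> K' ==> g x = 0"
 then show "Cc (\<lambda>x. f x + g x)" by (intro CcI[of _ "K \<union> K'"] continuous_intros compact_Un) auto
qed

lemma Cc_mult: "continuous_on UNIV g ==> Cc f ==> Cc (\<lambda>x. g x * f x)"
proof (elim CcE)
 fix K assume "continuous_on UNIV g" "continuous_on UNIV f" "compact K" "!!x. x \<notin> K ==> f x = 0"
 then show "Cc (\<lambda>x. g x * f x)" by (intro CcI[of _ K] continuous_intros) auto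
qed

lemma Cc_cmult: "Cc f ==> Cc (\<lambda>x. c * f x)"
 by (rule Cc_mult) auto

lemma Cc_diff: "Cc f ==> Cc g ==> Cc (\<lambda>x. f x - g x)"
 using Cc_add[of f "\<lambda>x. - 1 * g x"] Cc_cmult[of g "- 1"] by simp

lemma Cc_abs: "Cc f ==> Cc (\<lambda>x. \<bar>f x\<bar>)"
proof (elim CcE)
 fix K assume "continuous_on UNIV f" "compact K" "!!x. x \<notin> K ==> f x = 0"
 then show "Cc (\<lambda>x. \<bar>f x\<bar>)" by (intro CcI[of _ K] continuous_intros) auto
qed

lemma Cc_integrable:
 assumes \<mu>: "radon_measure \<mu>" and f: "Cc f"
 shows "integrable \<mu> f"
proof -
 obtain K where K: "compact K" "!!x. x \<notin> K ==> f x = 0" using f by (rule CcE) blast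
 obtain B where B: "B \<ge> 0" "!!x. \<bar>f x\<bar> <= B" using Cc_bounded[OF f] by blast
 have s: "sets \<mu> = sets borel" using \<mu> by (simp add: radon_measure_def)
 have KS: "K \<in> sets \<mu>" unfolding s using K(1) by (rule borel_compact)
 have "emeasure \<mu> K < \<infinity>" using \<mu> K(1) by (simp add: radon_measure_def)
 then have "integrable \<mu> (\<lambda>x. B * indicator K x)"
  using KS by (intro integrable_mult_right integrable_real_indicator) auto
 then show ?thesis
 proof (rule L1_bound)
  show "f \<in> borel_measurable \<mu>" using Cc_measurable[OF f] by (simp add: measurable_cong_sets[OF s refl])
  show "AE x in \<mu>. norm (f x) <= norm (B * indicator K x)"
   using B K(2) by (intro AE_I2) (auto simp: indicator_def)
 qed
qed

text \<open>Tents in the distance to \<open>K\<close> that steepen with n. They decrease to the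
  indicator, and compactness of \<open>K\<close> gives it positive distance from the complement of
  an open neighbourhood, so late tents vanish there.\<close>

lemma compact_approx:
 fixes K :: "'a::euclidean_space set"
 assumes K: "compact K"
 obtains g :: "nat => 'a => real" where "!!n. Cc (g n)" "!!n x. 0 <= g n x" "!!n x. g n x <= 1" "!!n x. x \<in> K ==> g n x = 1"
  "!!x. (\<lambda>n. g n x) \<longlonglongrightarrow> indicator K x" "!!n m x. n <= m ==> g m x <= g n x"
  "!!U. open U ==> K \<subseteq> U ==> \<exists>n. \<forall>x. x \<notin> U --> g n x = 0"
proof (cases "K = {}")
 case True
 have "Cc (\<lambda>_::'a. 0)" by (rule CcI[of _ "{}"]) auto
 then show ?thesis using True by (intro that[of "\<lambda>_ _. 0"]) auto
next
 case False
 define g where "g n x = max 0 (1 - real (Suc n) * infdist x K)" for n x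
 have z: "x \<in> K \<longleftrightarrow> infdist x K = 0" for x
  using in_closed_iff_infdist_zero[OF compact_imp_closed[OF K] False] by blast
 have g0: "g n x = 0" if "1 / real (Suc n) <= infdist x K" for n x
  using that by (simp add: g_def field_simps)
 have sup: "g n x = 0" if "x \<notin> {z + h |z h. z \<in> K \<and> h \<in> cball 0 1}" for n x
 proof (rule g0, rule ccontr)
  assume "\<not> 1 / real (Suc n) <= infdist x K"
  then have "infdist x K < 1" by (rule order_less_le_trans[OF not_le_imp_less]) simp
  then obtain a where "a \<in> K" "dist x a < 1"
   using infdist_attains_inf[OF compact_imp_closed[OF K] False, of x] by metis
  then have "x = a + (x - a) \<and> a \<in> K \<and> x - a \<in> cball 0 1" by (auto simp: dist_norm norm_minus_commute)
  then have "x \<in> {z + h |z h. z \<in> K \<and> h \<in> cball 0 1}" by blast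
  then show False using that by simp
 qed
 show ?thesis
 proof (rule that[of g])
  show "Cc (g n)" for n
  proof (rule CcI[OF _ compact_cthicken[OF K, of 1] sup])
   show "continuous_on UNIV (g n)" unfolding g_def[abs_def] by (intro continuous_intros)
  qed
  show "0 <= g n x" "g n x <= 1" for n x by (auto simp: g_def infdist_nonneg)
  show "g n x = 1" if "x \<in> K" for n x using that z by (simp add: g_def)
  show "g m x <= g n x" if "n <= m" for n m x
   using that mult_right_mono[of "real (Suc n)" "real (Suc m)" "infdist x K"]
   by (auto simp: g_def infdist_nonneg)
  have small: "\<exists>N. \<forall>n\<ge>N. 1 / real (Suc n) <= e" if "e > 0" for e :: real
  proof -
   obtain N where N: "1 / e < real N" using reals_Archimedean2 by blast
   have "1 / real (Suc n) <= e" if "n \<ge> N" for n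
   proof -
    have "1 / e <= real (Suc n)" using N that by linarith
    then show ?thesis using \<open>e > 0\<close> by (simp add: field_simps)
   qed
   then show ?thesis by blast
  qed
  show "(\<lambda>n. g n x) \<longlonglongrightarrow> indicator K x" for x
  proof (rule tendsto_eventually)
   show "\<forall>\<^sub>F n in sequentially. g n x = indicator K x"
   proof (cases "x \<in> K")
    case True
    then show ?thesis using z by (simp add: g_def)
   next
    case False
    then have "infdist x K > 0" using z infdist_nonneg[of x K] by (metis less_eq_real_def)
    then show ?thesis using small[of "infdist x K"] g0 False by (auto simp: eventually_sequentially)
   qed
  qed
  fix U assume U: "open U" "K \<subseteq> U"
  obtain e where e: "e > 0" "(\<Union>x\<in>K. ball x e) \<subseteq> U"
   using compact_subset_open_imp_ball_epsilon_subset[OF K U] by metis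
  obtain n where n: "1 / real (Suc n) <= e" using small[OF e(1)] by blast
  have "g n x = 0" if "x \<notin> U" for x
  proof (rule g0, rule ccontr)
   assume "\<not> 1 / real (Suc n) <= infdist x K"
   then have "infdist x K < e" using n by linarith
   then obtain a where "a \<in> K" "dist x a < e"
    using infdist_attains_inf[OF compact_imp_closed[OF K] False, of x] by metis
   then have "x \<in> (\<Union>x\<in>K. ball x e)" by (auto simp: dist_commute)
   then show False using e(2) that by blast
  qed
  then show "\<exists>n. \<forall>x. x \<notin> U --> g n x = 0" by blast
 qed
qed

text \<open>Regularity traps \<open>A\<close> between a compact and an open set of nearly equal
  measure; a function equal to 1 on the former and 0 off the latter is then close to the indicator
  in L^1.\<close>

lemma Cc_approx_indicator:
 fixes M :: "'a::euclidean_space measure"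
 assumes s: "sets M = sets borel" and fin: "emeasure M UNIV < \<infinity>" and A: "A \<in> sets borel" and e: "0 < e"
 obtains g where "Cc g" "!!x. 0 <= g x" "!!x. g x <= 1" "(\<integral>x. \<bar>indicator A x - g x\<bar> \<partial>M) < e"
proof -
 have sp: "space M = UNIV" using sets_eq_imp_space_eq[OF s] by simp
 interpret finite_measure M by standard (use fin sp in auto)
 note [measurable_cong] = s
 have AM: "A \<in> sets M" using A s by simp
 have in_reg: "emeasure M A = (SUP K\<in>{K. K \<subseteq> A \<and> compact K}. emeasure M K)"
  using inner_regular[OF s _ A] fin sp by auto
 \<comment> \<open>If the measure of \<open>A\<close> is below e/2, the empty set serves; otherwise
   the difference \<open>measure M A - e / 2\<close> is nonnegative and can be compared in
   \<open>ennreal\<close>.\<close>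
 obtain K where K: "K \<subseteq> A" "compact K" "measure M A < measure M K + e / 2"
 proof (cases "measure M A < e / 2")
  case True
  then show ?thesis by (intro that[of "{}"]) auto
 next
  case False
  have "ennreal (measure M A - e / 2) < emeasure M A"
   unfolding emeasure_eq_measure using False e by (intro ennreal_lessI) auto
  then obtain K where "K \<subseteq> A" "compact K" "ennreal (measure M A - e / 2) < emeasure M K"
   unfolding in_reg less_SUP_iff by auto
  then show ?thesis using that[of K] False by (auto simp: emeasure_eq_measure ennreal_less_iff)
 qed
 have "emeasure M A = (INF U\<in>{U. A \<subseteq> U \<and> open U}. emeasure M U)"
  using outer_regular[OF s _ A] fin sp by auto
 moreover have "emeasure M A < ennreal (measure M A + e / 2)"
  unfolding emeasure_eq_measure using e by (intro ennreal_lessI) (auto intro: add_nonneg_pos)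
 ultimately have "(INF U\<in>{U. A \<subseteq> U \<and> open U}. emeasure M U) < ennreal (measure M A + e / 2)" by (rule back_subst[of "\<lambda>a. a < _", rotated])
 then obtain U where U: "A \<subseteq> U" "open U" "emeasure M U < ennreal (measure M A + e / 2)"
  unfolding INF_less_iff by blast
 then have U': "measure M U < measure M A + e / 2" using e by (simp add: emeasure_eq_measure ennreal_less_iff del: ennreal_plus)
 obtain h :: "nat => 'a => real" where h: "!!n. Cc (h n)" "!!n x. 0 <= h n x" "!!n x. h n x <= 1" "!!n x. x \<in> K ==> h n x = 1"
  "!!U. open U ==> K \<subseteq> U ==> \<exists>n. \<forall>x. x \<notin> U --> h n x = 0"
  using compact_approx[OF K(2)] by metis
 obtain n where n: "\<forall>x. x \<notin> U --> h n x = 0" using h(5)[of U] U(1,2) K(1) by blast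
 define g where "g = h n"
 have g: "Cc g" "0 <= g x" "g x <= 1" "x \<in> K ==> g x = 1" "x \<notin> U ==> g x = 0" for x
  using h n by (auto simp: g_def)
 have KM: "K \<in> sets M" "U \<in> sets M" unfolding s using K(2) U(2) by (auto intro: borel_compact)
 have "(\<integral>x. \<bar>indicator A x - g x\<bar> \<partial>M) <= (\<integral>x. indicator U x - indicator K x \<partial>M)"
 proof (rule integral_mono)
  show "integrable M (\<lambda>x. \<bar>indicator A x - g x\<bar>)"
  proof (rule integrable_const_bound[of _ 1])
   show "(\<lambda>x. \<bar>indicator A x - g x\<bar>) \<in> borel_measurable M" using Cc_measurable[OF g(1)] AM by measurable
   show "AE x in M. norm \<bar>indicator A x - g x\<bar> <= 1" using g(2,3) by (intro AE_I2) (auto simp: indicator_def)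
  qed
  show "\<bar>indicator A x - g x\<bar> <= indicator U x - indicator K x" for x
   using g(2-5)[of x] K(1) U(1) by (cases "x \<in> K"; cases "x \<in> A"; cases "x \<in> U") auto
 qed (use KM in \<open>auto intro!: integrable_real_indicator simp: emeasure_eq_measure\<close>)
 also have "\<dots> = measure M U - measure M K"
  using KM by (subst lint_diff) (auto intro!: integrable_real_indicator simp: emeasure_eq_measure)
 also have "\<dots> < e" using K(3) U' by linarith
 finally show ?thesis using that g by blast
qed

text \<open>A functional on \<open>C\<^sub>c\<close> dominated by a finite measure \<open>M\<close> is \<open>L\<^sup>1\<close>-continuous, so it extends to
 indicator functions; the extension is countably additive because it is dominated by \<open>M\<close>.\<close>

locale dominated_functional =
 fixes M :: "'a::euclidean_space measure" and L :: "('a => real) => real"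
 assumes sM: "sets M = sets borel" and finM: "emeasure M UNIV < \<infinity>"
  and L_add: "Cc f ==> Cc g ==> L (\<lambda>x. f x + g x) = L f + L g"
  and L_cmult: "Cc f ==> L (\<lambda>x. c * f x) = c * L f"
  and L_nonneg: "Cc f ==> (!!x. 0 <= f x) ==> 0 <= L f"
  and L_le: "Cc f ==> (!!x. 0 <= f x) ==> L f <= (\<integral>x. f x \<partial>M)"
begin

lemma spM: "space M = UNIV" using sets_eq_imp_space_eq[OF sM] by simp

sublocale finite_measure M by standard (use finM spM in auto)

declare sM [measurable_cong]

lemma L_diff: "Cc f ==> Cc g ==> L (\<lambda>x. f x - g x) = L f - L g"
 using L_add[of f "\<lambda>x. - 1 * g x"] L_cmult[of g "- 1"] Cc_cmult[of g "- 1"] by simp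

lemma L_abs:
 assumes f: "Cc f"
 shows "\<bar>L f\<bar> <= (\<integral>x. \<bar>f x\<bar> \<partial>M)"
proof -
 have p: "Cc (\<lambda>x. (1 / 2) * (\<bar>f x\<bar> + f x))" "Cc (\<lambda>x. (1 / 2) * (\<bar>f x\<bar> - f x))"
  by (intro Cc_cmult Cc_add Cc_diff Cc_abs f)+
 have "0 <= L (\<lambda>x. (1 / 2) * (\<bar>f x\<bar> + f x))" "0 <= L (\<lambda>x. (1 / 2) * (\<bar>f x\<bar> - f x))"
  by (rule L_nonneg[OF p(1)], simp, rule L_nonneg[OF p(2)], simp)
 then have "0 <= (1 / 2) * (L (\<lambda>x. \<bar>f x\<bar>) + L f)" "0 <= (1 / 2) * (L (\<lambda>x. \<bar>f x\<bar>) - L f)"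
  using f Cc_abs[OF f] by (simp_all only: L_cmult Cc_add Cc_diff L_add L_diff)
 moreover have "- b <= a \<and> b <= a" if "0 <= (1 / 2) * (a + b)" "0 <= (1 / 2) * (a - b)" for a b :: real
  using that by (simp add: zero_le_mult_iff)
 ultimately have "- L f <= L (\<lambda>x. \<bar>f x\<bar>)" "L f <= L (\<lambda>x. \<bar>f x\<bar>)" by blast+
 moreover have "L (\<lambda>x. \<bar>f x\<bar>) <= (\<integral>x. \<bar>f x\<bar> \<partial>M)" by (rule L_le[OF Cc_abs[OF f]]) simp
 ultimately show ?thesis by linarith
qed

lemma Cc_int: "Cc f ==> integrable M f"
proof (rule Cc_integrable)
 show "radon_measure M" unfolding radon_measure_def using sM by (simp add: emeasure_eq_measure)
qed

lemma L_dist: "Cc f ==> Cc g ==> \<bar>L f - L g\<bar> <= (\<integral>x. \<bar>f x - g x\<bar> \<partial>M)"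
 using L_abs[OF Cc_diff] by (simp add: L_diff)

text \<open>The extension of \<open>L\<close> to an indicator, written as the infimum of all upper
  estimates L g + ||1_A - g||; this avoids choosing an approximating sequence.\<close>

definition ell :: "'a set => real" where
 "ell A = (INF g\<in>{g. Cc g}. L g + (\<integral>x. \<bar>indicator A x - g x\<bar> \<partial>M))"

lemma ind_int: "A \<in> sets borel ==> Cc g ==> integrable M (\<lambda>x. \<bar>indicator A x - g x\<bar>)"
 using Cc_int[of g] by (intro integrable_abs Bochner_Integration.integrable_diff integrable_real_indicator)
  (auto simp: sM emeasure_eq_measure)

text \<open>Since |L h - L g| is at most the L^1 distance of h and g, every lower estimate L h -
  ||1_A - h|| lies below every upper one, so \<open>ell\<close> sits between them.\<close>

lemma l_approx:
 assumes A: "A \<in> sets borel" and g: "Cc g"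
 shows "\<bar>ell A - L g\<bar> <= (\<integral>x. \<bar>indicator A x - g x\<bar> \<partial>M)"
proof -
 have low: "L h - (\<integral>x. \<bar>indicator A x - h x\<bar> \<partial>M) <= L g + (\<integral>x. \<bar>indicator A x - g x\<bar> \<partial>M)"
  if h: "Cc h" and g: "Cc g" for g h
 proof -
  have "L h - L g <= (\<integral>x. \<bar>h x - g x\<bar> \<partial>M)" using L_dist[OF h g] by linarith
  also have "\<dots> <= (\<integral>x. \<bar>indicator A x - h x\<bar> + \<bar>indicator A x - g x\<bar> \<partial>M)"
   using ind_int[OF A h] ind_int[OF A g] Cc_int[OF h] Cc_int[OF g] by (intro integral_mono) auto
  also have "\<dots> = (\<integral>x. \<bar>indicator A x - h x\<bar> \<partial>M) + (\<integral>x. \<bar>indicator A x - g x\<bar> \<partial>M)"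
   using ind_int[OF A h] ind_int[OF A g] by simp
  finally show ?thesis by linarith
 qed
 have c0: "Cc (\<lambda>_::'a. 0)" by (rule CcI[of _ "{}"]) auto
 have "L g - (\<integral>x. \<bar>indicator A x - g x\<bar> \<partial>M) <= ell A"
  unfolding ell_def using c0 by (intro cINF_greatest low g) auto
 moreover have "ell A <= L g + (\<integral>x. \<bar>indicator A x - g x\<bar> \<partial>M)"
  unfolding ell_def by (rule cINF_lower) (use low[OF c0] g in \<open>auto intro!: bdd_belowI2\<close>)
 ultimately show ?thesis by linarith
qed

lemma approx:
 assumes A: "A \<in> sets borel" and e: "0 < e"
 obtains g where "Cc g" "(\<integral>x. \<bar>indicator A x - g x\<bar> \<partial>M) < e" "\<bar>ell A - L g\<bar> < e" "!!x. 0 <= g x"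
proof -
 obtain g where g: "Cc g" "!!x. 0 <= g x" "(\<integral>x. \<bar>indicator A x - g x\<bar> \<partial>M) < e"
  by (rule Cc_approx_indicator[OF sM finM A e]) (rule that)
 show ?thesis by (rule that[OF g(1,3) le_less_trans[OF l_approx[OF A g(1)] g(3)] g(2)])
qed

lemma l_nonneg: "A \<in> sets borel ==> 0 <= ell A"
proof (rule field_le_epsilon)
 fix e :: real assume A: "A \<in> sets borel" and e: "0 < e"
 obtain g where g: "Cc g" "!!x. 0 <= g x" "\<bar>ell A - L g\<bar> < e" by (rule approx[OF A e]) (rule that)
 have "0 <= L g" by (rule L_nonneg[OF g(1,2)])
 then show "0 <= ell A + e" using g(3) by linarith
qed

lemma l_le: "A \<in> sets borel ==> ell A <= measure M A"
proof (rule field_le_epsilon)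
 fix e :: real assume A: "A \<in> sets borel" and e: "0 < e"
 then have e2: "0 < e / 2" by simp
 obtain g where g: "Cc g" "!!x. 0 <= g x" "(\<integral>x. \<bar>indicator A x - g x\<bar> \<partial>M) < e / 2" "\<bar>ell A - L g\<bar> < e / 2"
  by (rule approx[OF A e2]) (rule that)
 have "(\<integral>x. g x \<partial>M) <= (\<integral>x. indicator A x + \<bar>indicator A x - g x\<bar> \<partial>M)"
  using ind_int[OF A g(1)] Cc_int[OF g(1)] A
  by (intro integral_mono) (auto simp: sM emeasure_eq_measure intro!: integrable_real_indicator)
 also have "\<dots> = measure M A + (\<integral>x. \<bar>indicator A x - g x\<bar> \<partial>M)"
  using ind_int[OF A g(1)] A by (subst lint_add) (auto simp: sM emeasure_eq_measure intro!: integrable_real_indicator)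
 finally have "(\<integral>x. g x \<partial>M) <= measure M A + (\<integral>x. \<bar>indicator A x - g x\<bar> \<partial>M)" .
 then show "ell A <= measure M A + e" using g L_le[OF g(1,2)] by linarith
qed

text \<open>If g and h approximate the indicators of disjoint sets, their sum approximates the
  indicator of the union, and \<open>L\<close> is additive on functions.\<close>

lemma l_additive:
 assumes A: "A \<in> sets borel" and B: "B \<in> sets borel" and d: "A \<inter> B = {}"
 shows "ell (A \<union> B) = ell A + ell B"
proof -
 have "\<bar>ell (A \<union> B) - (ell A + ell B)\<bar> <= 0 + e" if e: "0 < e" for e
 proof -
  have e4: "0 < e / 4" using e by simp
  obtain g where g: "Cc g" "(\<integral>x. \<bar>indicator A x - g x\<bar> \<partial>M) < e / 4" "\<bar>ell A - L g\<bar> < e / 4" "!!x. 0 <= g x"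
   by (rule approx[OF A e4]) (rule that)
  obtain h where h: "Cc h" "(\<integral>x. \<bar>indicator B x - h x\<bar> \<partial>M) < e / 4" "\<bar>ell B - L h\<bar> < e / 4" "!!x. 0 <= h x"
   by (rule approx[OF B e4]) (rule that)
  have AB: "A \<union> B \<in> sets borel" using A B by simp
  have gh: "Cc (\<lambda>x. g x + h x)" by (rule Cc_add[OF g(1) h(1)])
  have "\<bar>ell (A \<union> B) - L (\<lambda>x. g x + h x)\<bar> <= (\<integral>x. \<bar>indicator (A \<union> B) x - (g x + h x)\<bar> \<partial>M)"
   by (rule l_approx[OF AB gh])
  also have "\<dots> <= (\<integral>x. \<bar>indicator A x - g x\<bar> + \<bar>indicator B x - h x\<bar> \<partial>M)"
  proof (rule integral_mono[OF ind_int[OF AB gh] L1_add[OF ind_int[OF A g(1)] ind_int[OF B h(1)]]])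
   fix x
   have "indicator (A \<union> B) x = (indicator A x + indicator B x :: real)" using d by (auto simp: indicator_def)
   then show "\<bar>indicator (A \<union> B) x - (g x + h x)\<bar> <= \<bar>indicator A x - g x\<bar> + \<bar>indicator B x - h x\<bar>" by linarith
  qed
  also have "\<dots> = (\<integral>x. \<bar>indicator A x - g x\<bar> \<partial>M) + (\<integral>x. \<bar>indicator B x - h x\<bar> \<partial>M)"
   by (rule lint_add[OF ind_int[OF A g(1)] ind_int[OF B h(1)]])
  finally have "\<bar>ell (A \<union> B) - (L g + L h)\<bar> < e / 2" using g h by (simp add: L_add)
  then show ?thesis using g(3) h(3) by linarith
 qed
 then have "\<bar>ell (A \<union> B) - (ell A + ell B)\<bar> <= 0" by (rule field_le_epsilon)
 then show ?thesis by simp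
qed

definition N :: "'a measure" where "N = measure_of UNIV (sets borel) (\<lambda>A. ennreal (ell A))"

lemma sets_N: "sets N = sets borel" and space_N: "space N = UNIV"
 unfolding N_def using sets.space_closed[of "borel :: 'a measure"] sets.sigma_sets_eq[of "borel :: 'a measure"]
 by (auto simp: sets_measure_of space_measure_of)

lemma emeasure_N:
 assumes A: "A \<in> sets borel"
 shows "emeasure N A = ennreal (ell A)"
 unfolding N_def
proof (rule emeasure_measure_of_sigma[OF _ _ _ A])
 show "sigma_algebra (UNIV :: 'a set) (sets borel)" using sets.sigma_algebra_axioms[of "borel :: 'a measure"] by simp
 interpret sigma_algebra UNIV "sets borel :: 'a set set" by fact
 have "ell {} = 0" using l_le[of "{}"] l_nonneg[of "{}"] by simp
 then show pos: "positive (sets borel) (\<lambda>A. ennreal (ell A))" by (simp add: positive_def)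
 show "countably_additive (sets borel) (\<lambda>A. ennreal (ell A))"
 \<comment> \<open>For a finite additive set function continuity at the empty set suffices, and
   being below the measure of \<open>M\<close> provides it.\<close>
 proof (rule empty_continuous_imp_countably_additive[OF pos])
  show "additive (sets borel) (\<lambda>A. ennreal (ell A))"
   by (auto simp: additive_def l_additive l_nonneg)
  show "\<forall>A\<in>sets borel. ennreal (ell A) \<noteq> \<infinity>" by simp
  fix A :: "nat => 'a set" assume A: "range A \<subseteq> sets borel" "decseq A" "(\<Inter>i. A i) = {}"
  have "(\<lambda>i. measure M (A i)) \<longlonglongrightarrow> measure M (\<Inter>i. A i)"
   by (rule finite_Lim_measure_decseq) (use A sM in auto)
  then have lim: "(\<lambda>i. measure M (A i)) \<longlonglongrightarrow> 0" using A(3) by simp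
  have "(\<lambda>i. ell (A i)) \<longlonglongrightarrow> 0"
   by (rule tendsto_sandwich[OF _ _ tendsto_const lim]) (use A(1) l_le l_nonneg in auto)
  then show "(\<lambda>i. ennreal (ell (A i))) \<longlonglongrightarrow> 0" using tendsto_ennrealI by fastforce
 qed
qed

lemma N_le: "N <= M"
 unfolding le_measure[OF trans[OF sets_N sM[symmetric]]]
 using l_le by (auto simp: sets_N emeasure_N emeasure_eq_measure intro: ennreal_leI)

lemma N_integral_dist:
 fixes f :: "'a => real"
 assumes f: "integrable M f"
 shows "integrable N f" "(\<integral>x. \<bar>f x\<bar> \<partial>N) <= (\<integral>x. \<bar>f x\<bar> \<partial>M)"
proof -
 have le: "(\<integral>\<^sup>+ x. ennreal \<bar>f x\<bar> \<partial>N) <= (\<integral>\<^sup>+ x. ennreal \<bar>f x\<bar> \<partial>M)"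
  by (rule nn_integral_mono_measure[OF trans[OF sets_N sM[symmetric]] N_le])
 have m: "f \<in> borel_measurable N" using f by (simp add: measurable_cong_sets[OF trans[OF sets_N sM[symmetric]] refl])
 have "(\<integral>\<^sup>+ x. ennreal \<bar>f x\<bar> \<partial>M) < \<infinity>" using f unfolding integrable_iff_bounded by simp
 then show i: "integrable N f" unfolding integrable_iff_bounded using m le by (auto intro: le_less_trans)
 have "ennreal (\<integral>x. \<bar>f x\<bar> \<partial>N) <= ennreal (\<integral>x. \<bar>f x\<bar> \<partial>M)"
  using le i f by (simp add: nn_integral_eq_integral)
 then show "(\<integral>x. \<bar>f x\<bar> \<partial>N) <= (\<integral>x. \<bar>f x\<bar> \<partial>M)" by simp
qed

text \<open>One function g must approximate \<open>f\<close> in L^1 and have L g near the integral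
  of \<open>f\<close>. Asking both of the same g is what survives sums and limits in the induction
  over integrable functions.\<close>

lemma N_integral_approx:
 fixes f :: "'a => real"
 assumes "integrable M f"
 shows "\<forall>e>0. \<exists>g. Cc g \<and> (\<integral>x. \<bar>f x - g x\<bar> \<partial>M) < e \<and> \<bar>(\<integral>x. f x \<partial>N) - L g\<bar> < e"
 using assms
proof (induction rule: integrable_induct)
 case (base A c)
 then have A: "A \<in> sets borel" by (simp add: sM)
 show ?case
 proof (intro allI impI)
  fix e :: real assume e: "0 < e"
  then have e': "0 < e / (\<bar>c\<bar> + 1)" by simp
  obtain g where g: "Cc g" "(\<integral>x. \<bar>indicator A x - g x\<bar> \<partial>M) < e / (\<bar>c\<bar> + 1)" "\<bar>ell A - L g\<bar> < e / (\<bar>c\<bar> + 1)" "!!x. 0 <= g x"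
   by (rule approx[OF A e']) (rule that)
  have lt: "\<bar>c\<bar> * r < e" if "r < e / (\<bar>c\<bar> + 1)" for r
  proof -
   have "\<bar>c\<bar> * r <= \<bar>c\<bar> * (e / (\<bar>c\<bar> + 1))" using that by (intro mult_left_mono) auto
   also have "\<dots> < e" using e by (simp add: field_simps)
   finally show ?thesis .
  qed
  have "(\<integral>x. \<bar>indicator A x *\<^sub>R c - c * g x\<bar> \<partial>M) = \<bar>c\<bar> * (\<integral>x. \<bar>indicator A x - g x\<bar> \<partial>M)"
   by (subst integral_mult_right_zero[symmetric]) (simp add: abs_mult[symmetric] right_diff_distrib mult.commute)
  moreover have "(\<integral>x. indicator A x *\<^sub>R c \<partial>N) = c * ell A"
   using A emeasure_N[OF A] l_nonneg[OF A] by (simp add: sets_N measure_def)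
  moreover have "\<bar>c * ell A - L (\<lambda>x. c * g x)\<bar> = \<bar>c\<bar> * \<bar>ell A - L g\<bar>"
   by (simp add: L_cmult[OF g(1)] abs_mult[symmetric] right_diff_distrib)
  ultimately show "\<exists>g. Cc g \<and> (\<integral>x. \<bar>indicator A x *\<^sub>R c - g x\<bar> \<partial>M) < e \<and> \<bar>(\<integral>x. indicator A x *\<^sub>R c \<partial>N) - L g\<bar> < e"
   using lt[OF g(2)] lt[OF g(3)] Cc_cmult[OF g(1), of c] by (intro exI[of _ "\<lambda>x. c * g x"] conjI) (simp_all only:)
 qed
next
 case (add f f')
 show ?case
 proof (intro allI impI)
  fix e :: real assume "0 < e"
  then have e: "0 < e / 2" by simp
  obtain g where g: "Cc g" "(\<integral>x. \<bar>f x - g x\<bar> \<partial>M) < e / 2" "\<bar>(\<integral>x. f x \<partial>N) - L g\<bar> < e / 2" using add.IH(1)[rule_format, OF e] by blast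
  obtain g' where g': "Cc g'" "(\<integral>x. \<bar>f' x - g' x\<bar> \<partial>M) < e / 2" "\<bar>(\<integral>x. f' x \<partial>N) - L g'\<bar> < e / 2" using add.IH(2)[rule_format, OF e] by blast
  note i = add.hyps Cc_int[OF g(1)] Cc_int[OF g'(1)]
  have "(\<integral>x. \<bar>f x + f' x - (g x + g' x)\<bar> \<partial>M) <= (\<integral>x. \<bar>f x - g x\<bar> + \<bar>f' x - g' x\<bar> \<partial>M)"
   using i by (intro integral_mono) auto
  also have "\<dots> = (\<integral>x. \<bar>f x - g x\<bar> \<partial>M) + (\<integral>x. \<bar>f' x - g' x\<bar> \<partial>M)"
   using i by (intro lint_add) auto
  finally have "(\<integral>x. \<bar>f x + f' x - (g x + g' x)\<bar> \<partial>M) < e" using g g' by linarith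
  moreover have "\<bar>(\<integral>x. f x + f' x \<partial>N) - L (\<lambda>x. g x + g' x)\<bar> < e"
   using N_integral_dist(1)[OF add.hyps(1)] N_integral_dist(1)[OF add.hyps(2)] g(3) g'(3)
   unfolding abs_less_iff by (simp add: L_add[OF g(1) g'(1)])
  ultimately show "\<exists>g. Cc g \<and> (\<integral>x. \<bar>f x + f' x - g x\<bar> \<partial>M) < e \<and> \<bar>(\<integral>x. f x + f' x \<partial>N) - L g\<bar> < e"
   using Cc_add[OF g(1) g'(1)] by blast
 qed
next
 case (lim f s)
 show ?case
 proof (intro allI impI)
  fix e :: real assume "0 < e"
  then have e: "0 < e / 2" by simp
  have "(\<lambda>i. \<integral>x. \<bar>f x - s i x\<bar> \<partial>M) \<longlonglongrightarrow> (\<integral>x. 0 \<partial>M)"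
  \<comment> \<open>The induction rule supplies approximants of modulus at most 2 \<bar>f\<bar>, so
    their distance to f is at most 3 \<bar>f\<bar>.\<close>
  proof (rule integral_dominated_convergence[where w = "\<lambda>x. 3 * \<bar>f x\<bar>"])
   show "AE x in M. (\<lambda>i. \<bar>f x - s i x\<bar>) \<longlonglongrightarrow> 0"
   proof (rule AE_I2)
    fix x assume "x \<in> space M"
    have "(\<lambda>i. \<bar>f x - s i x\<bar>) \<longlonglongrightarrow> \<bar>f x - f x\<bar>" by (intro tendsto_intros lim \<open>x \<in> space M\<close>)
    then show "(\<lambda>i. \<bar>f x - s i x\<bar>) \<longlonglongrightarrow> 0" by simp
   qed
   show "AE x in M. norm \<bar>f x - s i x\<bar> <= 3 * \<bar>f x\<bar>" for i
   proof (rule AE_I2)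
    fix x assume "x \<in> space M"
    then have "\<bar>s i x\<bar> <= 2 * \<bar>f x\<bar>" using lim.hyps(3)[OF \<open>x \<in> space M\<close>, of i] by simp
    then show "norm \<bar>f x - s i x\<bar> <= 3 * \<bar>f x\<bar>" by simp
   qed
  qed (use lim in auto)
  then have "\<forall>\<^sub>F i in sequentially. (\<integral>x. \<bar>f x - s i x\<bar> \<partial>M) < e / 2" using e by (intro order_tendstoD) auto
  then obtain i where i: "(\<integral>x. \<bar>f x - s i x\<bar> \<partial>M) < e / 2" by (auto simp: eventually_sequentially)
  obtain g where g: "Cc g" "(\<integral>x. \<bar>s i x - g x\<bar> \<partial>M) < e / 2" "\<bar>(\<integral>x. s i x \<partial>N) - L g\<bar> < e / 2" using lim.IH[rule_format, OF e] by blast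
  have int: "integrable M f" "integrable M (s i)" "integrable M g" using lim Cc_int[OF g(1)] by auto
  have "(\<integral>x. \<bar>f x - g x\<bar> \<partial>M) <= (\<integral>x. \<bar>f x - s i x\<bar> + \<bar>s i x - g x\<bar> \<partial>M)"
   using int by (intro integral_mono) auto
  also have "\<dots> = (\<integral>x. \<bar>f x - s i x\<bar> \<partial>M) + (\<integral>x. \<bar>s i x - g x\<bar> \<partial>M)" using int by (intro lint_add) auto
  finally have 1: "(\<integral>x. \<bar>f x - g x\<bar> \<partial>M) < e" using i g(2) by linarith
  have "\<bar>(\<integral>x. f x \<partial>N) - (\<integral>x. s i x \<partial>N)\<bar> = \<bar>\<integral>x. f x - s i x \<partial>N\<bar>"
   using N_integral_dist(1)[OF int(1)] N_integral_dist(1)[OF int(2)] by simp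
  also have "\<dots> <= (\<integral>x. \<bar>f x - s i x\<bar> \<partial>N)" by (rule integral_abs_bound)
  also have "\<dots> <= (\<integral>x. \<bar>f x - s i x\<bar> \<partial>M)" using int by (intro N_integral_dist) auto
  finally have "\<bar>(\<integral>x. f x \<partial>N) - L g\<bar> < e" using i g(3) by linarith
  with 1 g(1) show "\<exists>g. Cc g \<and> (\<integral>x. \<bar>f x - g x\<bar> \<partial>M) < e \<and> \<bar>(\<integral>x. f x \<partial>N) - L g\<bar> < e" by blast
 qed
qed

lemma N_integral:
 assumes f: "Cc f"
 shows "(\<integral>x. f x \<partial>N) = L f"
proof -
 have "\<bar>(\<integral>x. f x \<partial>N) - L f\<bar> <= 0 + e" if "0 < e" for e
 proof -
  have e: "0 < e / 2" using that by simp
  obtain g where g: "Cc g" "(\<integral>x. \<bar>f x - g x\<bar> \<partial>M) < e / 2" "\<bar>(\<integral>x. f x \<partial>N) - L g\<bar> < e / 2"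
   using N_integral_approx[OF Cc_int[OF f], rule_format, OF e] by blast
  then show ?thesis using L_dist[OF f g(1)] by linarith
 qed
 then have "\<bar>(\<integral>x. f x \<partial>N) - L f\<bar> <= 0" by (rule field_le_epsilon)
 then show ?thesis by simp
qed

end

text \<open>\<mu> may be infinite, but E \<mu> is finite. So \<open>L\<close> is represented after
  multiplying its argument by the positive continuous weight \<open>E\<close>, and the resulting
  measure is divided by \<open>E\<close>; both operations preserve compactly supported continuous
  functions.\<close>

lemma (in weighted_measure) functional_measure:
 assumes L_add: "!!f g. Cc f ==> Cc g ==> L (\<lambda>x. f x + g x) = L f + L g"
  and L_cmult: "!!f c. Cc f ==> L (\<lambda>x. c * f x) = c * L f"
  and L_nonneg: "!!f. Cc f ==> (!!x. 0 <= f x) ==> 0 <= L f"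
  and L_le: "!!f. Cc f ==> (!!x. 0 <= f x) ==> L f <= (\<integral>x. f x \<partial>\<mu>)"
 obtains \<gamma> where "radon_measure \<gamma>" "!!f. Cc f ==> (\<integral>x. f x \<partial>\<gamma>) = L f" "\<gamma> <= \<mu>"
proof -
 have sp: "space \<mu> = UNIV" using sets_eq_imp_space_eq[OF sets_mu] by simp
 define M where "M = density \<mu> (\<lambda>x. ennreal (E x))"
 have cE: "continuous_on UNIV E" unfolding E_def[abs_def] using T by (intro continuous_intros) auto
 have cE': "continuous_on UNIV (\<lambda>x. 1 / E x)" using cE E_pos by (intro continuous_intros) (auto simp: less_imp_neq[symmetric])
 have EM: "(\<lambda>x. ennreal (E x)) \<in> borel_measurable \<mu>" by measurable
 interpret D: dominated_functional M "\<lambda>f. L (\<lambda>x. E x * f x)"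
 proof
  show sM: "sets M = sets borel" by (simp add: M_def sets_mu)
  show "emeasure M UNIV < \<infinity>"
   unfolding M_def using finite_weight sp by (subst emeasure_density) (auto simp: E_def)
  fix f g :: "'a => real" assume f: "Cc f"
  note Ef = Cc_mult[OF cE f]
  show "L (\<lambda>x. E x * (f x + g x)) = L (\<lambda>x. E x * f x) + L (\<lambda>x. E x * g x)" if g: "Cc g"
   using L_add[OF Ef Cc_mult[OF cE g]] by (simp add: distrib_left)
  show "L (\<lambda>x. E x * (c * f x)) = c * L (\<lambda>x. E x * f x)" for c
   using L_cmult[OF Ef, of c] by (simp add: mult.left_commute)
  assume nn: "!!x. 0 <= f x"
  have nn': "0 <= E x * f x" for x using nn[of x] E_pos[of x] by (intro mult_nonneg_nonneg) auto
  show "0 <= L (\<lambda>x. E x * f x)" by (rule L_nonneg[OF Ef nn'])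
  have "L (\<lambda>x. E x * f x) <= (\<integral>x. E x * f x \<partial>\<mu>)" by (rule L_le[OF Ef nn'])
  also have "\<dots> = (\<integral>x. f x \<partial>M)"
   unfolding M_def using Cc_measurable[OF f] E_pos
   by (subst integral_density) (auto simp: less_imp_le measurable_cong_sets[OF sets_mu refl])
  finally show "L (\<lambda>x. E x * f x) <= (\<integral>x. f x \<partial>M)" .
 qed
 define \<gamma> where "\<gamma> = density D.N (\<lambda>x. ennreal (1 / E x))"
 have EN: "(\<lambda>x. ennreal (1 / E x)) \<in> borel_measurable D.N"
  unfolding measurable_cong_sets[OF D.sets_N refl] by measurable
 have s\<gamma>: "sets \<gamma> = sets borel" by (simp add: \<gamma>_def D.sets_N)
 have le: "\<gamma> <= \<mu>"
  unfolding le_measure[OF trans[OF s\<gamma> sets_mu[symmetric]]]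
 proof
  fix A assume "A \<in> sets \<gamma>"
  then have A: "A \<in> sets borel" "A \<in> sets D.N" "A \<in> sets M" "A \<in> sets \<mu>" by (simp_all add: s\<gamma> D.sets_N D.sM sets_mu)
  have "emeasure \<gamma> A = (\<integral>\<^sup>+ x. ennreal (1 / E x) * indicator A x \<partial>D.N)"
   unfolding \<gamma>_def by (rule emeasure_density[OF EN A(2)])
  also have "\<dots> <= (\<integral>\<^sup>+ x. ennreal (1 / E x) * indicator A x \<partial>M)"
   by (rule nn_integral_mono_measure[OF trans[OF D.sets_N D.sM[symmetric]] D.N_le])
  also have "\<dots> = (\<integral>\<^sup>+ x. ennreal (E x) * (ennreal (1 / E x) * indicator A x) \<partial>\<mu>)"
   unfolding M_def using A(1) by (subst nn_integral_density) (auto simp: measurable_cong_sets[OF sets_mu refl])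
  also have "\<dots> = (\<integral>\<^sup>+ x. indicator A x \<partial>\<mu>)"
  proof (rule nn_integral_cong)
   fix x
   have "ennreal (E x) * ennreal (1 / E x) = 1"
    using E_pos[of x] by (simp add: ennreal_mult[symmetric] less_imp_le)
   then show "ennreal (E x) * (ennreal (1 / E x) * indicator A x) = indicator A x" by (simp add: mult.assoc[symmetric])
  qed
  also have "\<dots> = emeasure \<mu> A" using A(4) by simp
  finally show "emeasure \<gamma> A <= emeasure \<mu> A" .
 qed
 have "radon_measure \<gamma>"
  unfolding radon_measure_def
 proof (intro conjI allI impI s\<gamma>)
  fix K :: "'a set" assume K: "compact K"
  have "emeasure \<gamma> K <= emeasure \<mu> K" by (rule le_measureD3[OF le trans[OF s\<gamma> sets_mu[symmetric]]])
  also have "\<dots> < \<infinity>" using radon K by (simp add: radon_measure_def)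
  finally show "emeasure \<gamma> K < \<infinity>" .
 qed
 moreover have "(\<integral>x. f x \<partial>\<gamma>) = L f" if f: "Cc f" for f
 proof -
  have "(\<integral>x. f x \<partial>\<gamma>) = (\<integral>x. (1 / E x) * f x \<partial>D.N)"
   unfolding \<gamma>_def using Cc_measurable[OF f] E_pos
   by (subst integral_density) (auto simp: less_imp_le measurable_cong_sets[OF D.sets_N refl])
  also have "\<dots> = L (\<lambda>x. E x * ((1 / E x) * f x))" by (rule D.N_integral[OF Cc_mult[OF cE' f]])
  also have "(\<lambda>x. E x * ((1 / E x) * f x)) = f" using E_pos by (auto simp: fun_eq_iff less_imp_neq[symmetric])
  finally show ?thesis .
 qed
 ultimately show ?thesis using le by (intro that) auto
qed

text \<open>Compact sets are reached by decreasing limits of test functions, bounded Borel sets from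
  inside by compact ones, and arbitrary Borel sets by exhausting the space with balls.\<close>

lemma radon_le_if_integral_le:
 fixes \<gamma> \<gamma>' :: "'a::euclidean_space measure"
 assumes r: "radon_measure \<gamma>" "radon_measure \<gamma>'"
  and le: "!!f. Cc f ==> (!!x. 0 <= f x) ==> (\<integral>x. f x \<partial>\<gamma>) <= (\<integral>x. f x \<partial>\<gamma>')"
 shows "\<gamma> <= \<gamma>'"
proof -
 have s: "sets \<gamma> = sets borel" "sets \<gamma>' = sets borel" using r by (auto simp: radon_measure_def)
 have sp: "space \<gamma> = UNIV" using sets_eq_imp_space_eq[OF s(1)] by simp
 have K: "emeasure \<gamma> K <= emeasure \<gamma>' K" if K: "compact K" for K
 proof -
  obtain g :: "nat => 'a => real" where g: "!!n. Cc (g n)" "!!n x. 0 <= g n x" "!!x. (\<lambda>n. g n x) \<longlonglongrightarrow> indicator K x" "!!n m x. n <= m ==> g m x <= g n x"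
   using compact_approx[OF K] by metis
  have KS: "K \<in> sets borel" using K by (rule borel_compact)
  have lim: "(\<lambda>n. \<integral>x. g n x \<partial>\<nu>) \<longlonglongrightarrow> measure \<nu> K" if \<nu>: "radon_measure \<nu>" for \<nu> :: "'a measure"
  proof -
   have s\<nu>: "sets \<nu> = sets borel" using \<nu> by (simp add: radon_measure_def)
   have "(\<lambda>n. \<integral>x. g n x \<partial>\<nu>) \<longlonglongrightarrow> (\<integral>x. indicator K x \<partial>\<nu>)"
   proof (rule integral_dominated_convergence[where w = "g 0"])
    show "integrable \<nu> (g 0)" by (rule Cc_integrable[OF \<nu> g(1)])
    show "g n \<in> borel_measurable \<nu>" for n using Cc_integrable[OF \<nu> g(1)] by auto
    show "(\<lambda>x. indicator K x) \<in> borel_measurable \<nu>" using KS s\<nu> by simp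
    show "AE x in \<nu>. norm (g n x) <= g 0 x" for n using g(2,4) by simp
   qed (use g(3) in auto)
   then show ?thesis using KS s\<nu> by simp
  qed
  have "measure \<gamma> K <= measure \<gamma>' K"
   by (rule LIMSEQ_le[OF lim[OF r(1)] lim[OF r(2)]]) (use le g in blast)
  moreover have "emeasure \<gamma> K \<noteq> \<top>" "emeasure \<gamma>' K \<noteq> \<top>" using r K by (auto simp: radon_measure_def)
  ultimately show ?thesis by (simp add: emeasure_eq_ennreal_measure)
 qed
 show ?thesis
  unfolding le_measure[OF trans[OF s(1) s(2)[symmetric]]]
 proof
  fix A assume "A \<in> sets \<gamma>"
  then have A: "A \<in> sets borel" by (simp add: s)
  define B where "B n = A \<inter> cball 0 (real n)" for n
  have B: "B n \<in> sets borel" for n using A by (simp add: B_def)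
  have Bn: "emeasure \<gamma> (B n) <= emeasure \<gamma>' A" for n
  proof -
   \<comment> \<open>Inner regularity is invoked for finite measures, so \<gamma> is restricted to a
     ball.\<close>
   define M where "M = density \<gamma> (indicator (cball 0 (real n)))"
   have sM: "sets M = sets borel" by (simp add: M_def s)
   have ball: "cball 0 (real n) \<in> sets \<gamma>" by (simp add: s)
   have eM: "emeasure M C = emeasure \<gamma> (C \<inter> cball 0 (real n))" if C: "C \<in> sets borel" for C
   proof -
    have "emeasure M C = (\<integral>\<^sup>+ x. indicator (cball 0 (real n)) x * indicator C x \<partial>\<gamma>)"
     unfolding M_def by (rule emeasure_density[OF borel_measurable_indicator[OF ball]]) (use C in \<open>simp add: s\<close>)
    also have "\<dots> = (\<integral>\<^sup>+ x. indicator (C \<inter> cball 0 (real n)) x \<partial>\<gamma>)"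
     by (intro nn_integral_cong) (auto simp: indicator_def)
    also have "\<dots> = emeasure \<gamma> (C \<inter> cball 0 (real n))"
     using C by (intro nn_integral_indicator) (simp add: s)
    finally show ?thesis .
   qed
   have "emeasure M (space M) \<noteq> \<infinity>"
   proof -
    have "space M = UNIV" using sets_eq_imp_space_eq[OF sM] by simp
    moreover have "emeasure \<gamma> (cball 0 (real n)) < \<infinity>" using r(1) compact_cball unfolding radon_measure_def by blast
    ultimately show ?thesis using eM[of UNIV] by simp
   qed
   from inner_regular[OF sM this B[of n]]
   have "emeasure M (B n) = (SUP K\<in>{K. K \<subseteq> B n \<and> compact K}. emeasure M K)" .
   also have "\<dots> <= emeasure \<gamma>' A"
   proof (rule SUP_least)
    fix C assume C: "C \<in> {K. K \<subseteq> B n \<and> compact K}"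
    then have CS: "C \<in> sets borel" by (auto intro: borel_compact)
    have "C \<inter> cball 0 (real n) = C" using C by (auto simp: B_def)
    then have "emeasure M C = emeasure \<gamma> C" using eM[OF CS] by simp
    also have "\<dots> <= emeasure \<gamma>' C" using C K by auto
    also have "\<dots> <= emeasure \<gamma>' A" using C A by (intro emeasure_mono) (auto simp: B_def s)
    finally show "emeasure M C <= emeasure \<gamma>' A" .
   qed
   finally show ?thesis using eM[OF B[of n]] by (simp add: B_def Int_assoc)
  qed
  have "emeasure \<gamma> A = emeasure \<gamma> (\<Union>n. B n)"
  proof -
   have "(\<Union>n. B n) = A" unfolding B_def using real_arch_simple by fastforce
   then show ?thesis by simp
  qed
  also have "\<dots> = (SUP n. emeasure \<gamma> (B n))"
   by (rule SUP_emeasure_incseq[symmetric]) (use B in \<open>auto simp: s incseq_def B_def\<close>)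
  also have "\<dots> <= emeasure \<gamma>' A" by (rule SUP_least) (rule Bn)
  finally show "emeasure \<gamma> A <= emeasure \<gamma>' A" .
 qed
qed

lemma radon_eq_if_integral_eq:
 fixes \<gamma> \<gamma>' :: "'a::euclidean_space measure"
 assumes "radon_measure \<gamma>" "radon_measure \<gamma>'" "!!f. Cc f ==> (\<integral>x. f x \<partial>\<gamma>) = (\<integral>x. f x \<partial>\<gamma>')"
 shows "\<gamma> = \<gamma>'"
 using assms by (intro antisym radon_le_if_integral_le) auto

section \<open>The minimum of two solutions and its trace\<close>

lemma monotone_bounded_limit_at_right:
 fixes G :: "real => real"
 assumes t0: "0 < t0" and mono: "!!s t. 0 < s ==> s < t ==> t < t0 ==> G s <= G t"
  and bdd: "!!s. 0 < s ==> s < t0 ==> B <= G s"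
 shows "\<exists>l. (G \<longlongrightarrow> l) (at_right 0)"
proof -
 define l where "l = (INF s\<in>{0<..<t0}. G s)"
 have ne: "{0<..<t0} \<noteq> {}" using t0 by auto
 have bb: "bdd_below (G ` {0<..<t0})" using bdd by (intro bdd_belowI2[of _ B]) auto
 have "(G \<longlongrightarrow> l) (at_right 0)"
 proof (rule tendstoI)
  fix e :: real assume "0 < e"
  then have "(INF s\<in>{0<..<t0}. G s) < l + e" by (simp add: l_def)
  then obtain s where "s \<in> {0<..<t0}" "G s < l + e"
   unfolding cINF_less_iff[OF ne bb] by blast
  then have s: "0 < s" "s < t0" "G s < l + e" by auto
  have "dist (G t) l < e" if "0 < t" "t < s" for t
  proof -
   have "l <= G t" unfolding l_def using that s by (intro cINF_lower[OF bb]) auto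
   moreover have "G t <= G s" using that s by (intro mono) auto
   ultimately show ?thesis using s(3) by (simp add: dist_real_def)
  qed
  then show "\<forall>\<^sub>F t in at_right 0. dist (G t) l < e"
   unfolding eventually_at_right_field using s(1) by blast
 qed
 then show ?thesis by blast
qed

text \<open>Limits of two approximants differ by at most the sum of their errors, so they form a
  Cauchy sequence whose limit is the limit of \<open>A\<close>. This passes from smooth to
  continuous test functions.\<close>

lemma limit_if_approximable:
 fixes A :: "'b => real"
 assumes F: "F \<noteq> bot" and ap: "!!e. 0 < e ==> \<exists>g l. (g \<longlongrightarrow> l) F \<and> (\<forall>\<^sub>F t in F. \<bar>A t - g t\<bar> <= e)"
 shows "\<exists>l. (A \<longlongrightarrow> l) F"
proof -
 have "\<forall>n. \<exists>g l. (g \<longlongrightarrow> l) F \<and> (\<forall>\<^sub>F t in F. \<bar>A t - g t\<bar> <= 1 / real (Suc n))" using ap by simp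
 then obtain g l where g: "!!n. (g n \<longlongrightarrow> l n) F" "!!n. \<forall>\<^sub>F t in F. \<bar>A t - g n t\<bar> <= 1 / real (Suc n)" by metis
 have dist: "\<bar>l n - l m\<bar> <= 1 / real (Suc n) + 1 / real (Suc m)" for n m
 proof (rule tendsto_upperbound[OF _ _ F])
  show "((\<lambda>t. \<bar>g n t - g m t\<bar>) \<longlongrightarrow> \<bar>l n - l m\<bar>) F" by (intro tendsto_intros g)
  show "\<forall>\<^sub>F t in F. \<bar>g n t - g m t\<bar> <= 1 / real (Suc n) + 1 / real (Suc m)"
   using g(2)[of n] g(2)[of m] by eventually_elim linarith
 qed
 have small: "\<exists>N. \<forall>n\<ge>N. 1 / real (Suc n) < e" if "e > 0" for e :: real
  using order_tendstoD(2)[OF LIMSEQ_Suc[OF lim_1_over_n] that] by (simp add: eventually_sequentially)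
 have "Cauchy l"
 proof (rule CauchyI)
  fix e :: real assume "0 < e"
  then obtain N where N: "!!n. n \<ge> N ==> 1 / real (Suc n) < e / 2" using small[of "e / 2"] by auto
  have "norm (l m - l n) < e" if "m \<ge> N" "n \<ge> N" for m n
   using dist[of m n] N[OF that(1)] N[OF that(2)] unfolding real_norm_def by linarith
  then show "\<exists>M. \<forall>m\<ge>M. \<forall>n\<ge>M. norm (l m - l n) < e" by blast
 qed
 then obtain L where L: "l \<longlonglongrightarrow> L" using Cauchy_convergent_iff convergent_def by blast
 have "(A \<longlongrightarrow> L) F"
 proof (rule tendstoI)
  fix e :: real assume e: "0 < e"
  obtain N where N: "!!n. n \<ge> N ==> 1 / real (Suc n) < e / 3" using small[of "e / 3"] e by auto
  obtain N' where N': "!!n. n \<ge> N' ==> \<bar>l n - L\<bar> < e / 3"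
   using tendstoD[OF L, of "e / 3"] e by (auto simp: eventually_sequentially dist_real_def)
  define n where "n = max N N'"
  have n: "1 / real (Suc n) < e / 3" "\<bar>l n - L\<bar> < e / 3" using N N' by (auto simp: n_def)
  have "\<forall>\<^sub>F t in F. dist (g n t) (l n) < e / 3" by (rule tendstoD[OF g(1)]) (use e in simp)
  with g(2)[of n] show "\<forall>\<^sub>F t in F. dist (A t) L < e"
   by eventually_elim (use n in \<open>unfold dist_real_def, linarith\<close>)
 qed
 then show ?thesis by blast
qed

lemma continuous_times_test:
 fixes p \<phi> :: "'a::euclidean_space stfun"
 assumes p: "continuous_on (Q_int T) p" and \<phi>: "test_function (Q_int T) \<phi>"
 shows "integrable lborel (\<lambda>z. p z * \<phi> z)" "integrable lborel (\<lambda>z. p z * adj_heat \<phi> z)"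
proof -
 obtain K where s\<phi>: "smooth \<phi>" and K: "compact K" "K \<subseteq> Q_int T" "!!z. z \<notin> K ==> \<phi> z = 0"
  using \<phi> by (rule test_functionE) blast
 show "integrable lborel (\<lambda>z. p z * \<phi> z)" by (rule integrable_times_compact[OF p smooth_continuous[OF s\<phi>] K])
 show "integrable lborel (\<lambda>z. p z * adj_heat \<phi> z)"
  by (rule integrable_times_compact[OF p continuous_adj_heat[OF s\<phi>] K(1,2) adj_heat_zero_off[OF K(1,3)]])
qed

locale min_solution = potential_measure V T \<mu>
 for V :: "'a::euclidean_space stfun" and T :: real and \<mu> :: "'a measure" +
 fixes u :: "'a stfun"
 assumes V_loc: "compact K ==> K \<subseteq> Q_int T ==> \<exists>C. AE z in lborel. z \<in> K --> V z <= C"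
  and u_cont: "continuous_on (Q_int T) u" and u_nonneg: "z \<in> Q_int T ==> 0 <= u z"
  and u_weak: "test_function (Q_int T) \<phi> ==> (LBINT z. u z * adj_heat \<phi> z) = - (LBINT z. V z * u z * \<phi> z)"
begin

lemma Q_int_borel [measurable]: "(Q_int T :: ('a \<times> real) set) \<in> sets borel"
 using open_Q_int by (rule borel_open)

text \<open>Extension by 0: functions controlled only on the open cylinder become Borel functions on
  the whole space, ready for product measurability and global integrals.\<close>

definition onQ :: "('a stfun) => 'a \<times> real => real" where
 "onQ p z = indicator (Q_int T) z * p z"

lemma onQ_in: "z \<in> Q_int T ==> onQ p z = p z" by (simp add: onQ_def)

lemma onQ_measurable: "continuous_on (Q_int T) p ==> onQ p \<in> borel_measurable borel"
 using borel_measurable_continuous_on_indicator[of "Q_int T" p] by (simp add: onQ_def[abs_def])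

lemma V_bounded_integrable:
 fixes p g :: "'a stfun"
 assumes pm [measurable]: "p \<in> borel_measurable borel" "g \<in> borel_measurable borel"
  and K: "compact K" "K \<subseteq> Q_int T" "!!z. z \<notin> K ==> g z = 0"
  and B: "!!z. z \<in> K ==> \<bar>p z * g z\<bar> <= B"
 shows "integrable lborel (\<lambda>z. p z * g z)" "integrable lborel (\<lambda>z. V z * (p z * g z))"
proof -
 obtain C where C: "AE z in lborel. z \<in> K --> V z <= C" using V_loc[OF K(1,2)] by blast
 have [measurable]: "K \<in> sets borel" using K(1) by (rule borel_compact)
 have iK: "integrable lborel (\<lambda>z. c * indicator K z :: real)" for c
  using emeasure_compact_finite[OF K(1)] by (intro integrable_mult_right integrable_real_indicator) auto
 show "integrable lborel (\<lambda>z. p z * g z)"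
 proof (rule L1_bound[OF iK[of B]])
  show "AE z in lborel. norm (p z * g z) <= norm (B * indicator K z)"
   using B K(3) by (intro AE_I2) (force simp: indicator_def)
 qed measurable
 show "integrable lborel (\<lambda>z. V z * (p z * g z))"
 proof (rule L1_bound[OF iK[of "\<bar>C\<bar> * B"]])
  show "AE z in lborel. norm (V z * (p z * g z)) <= norm (\<bar>C\<bar> * B * indicator K z)"
   using C
  proof eventually_elim
   case (elim z)
   show ?case
   proof (cases "z \<in> K")
    case True
    then have "V z * \<bar>p z * g z\<bar> <= \<bar>C\<bar> * B"
     using elim B[OF True] V_nonneg[of z] by (intro mult_mono) auto
    moreover have "0 <= B" using B[OF True] by linarith
    ultimately show ?thesis using True V_nonneg[of z] by (simp add: abs_mult)
   qed (simp add: K(3))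
  qed
 qed measurable
qed

lemma V_integrable:
 assumes p: "continuous_on (Q_int T) p" and g: "continuous_on UNIV g"
  and K: "compact K" "K \<subseteq> Q_int T" "!!z. z \<notin> K ==> g z = 0"
 shows "integrable lborel (\<lambda>z. V z * (onQ p z * g z))"
proof -
 have "bounded ((\<lambda>z. p z * g z) ` K)"
  by (intro compact_imp_bounded compact_continuous_image K continuous_intros continuous_on_subset[OF p] continuous_on_subset[OF g]) auto
 then obtain B where B: "!!z. z \<in> K ==> \<bar>p z * g z\<bar> <= B" by (auto simp: bounded_iff)
 show ?thesis
 proof (rule V_bounded_integrable(2)[OF onQ_measurable[OF p] borel_measurable_continuous_onI[OF g] K])
  show "\<bar>onQ p z * g z\<bar> <= B" if "z \<in> K" for z using B[OF that] onQ_in[of z p] that K(2) by auto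
 qed
qed

lemma V_set_integrable:
 assumes p: "continuous_on (Q_int T) p" and c: "\<bar>c\<bar> <= (1::real)" and K: "compact K" "K \<subseteq> Q_int T"
 shows "set_integrable lborel K (\<lambda>z. c * (V z * onQ p z))" "set_integrable lborel K (\<lambda>z. Vk k z * onQ p z)"
proof -
 note [measurable] = onQ_measurable[OF p]
 have [measurable]: "K \<in> sets borel" using K(1) by (rule borel_compact)
 have "bounded (p ` K)" by (intro compact_imp_bounded compact_continuous_image K continuous_on_subset[OF p])
 then obtain B where B: "!!z. z \<in> K ==> \<bar>p z\<bar> <= B" by (auto simp: bounded_iff)
 have i: "integrable lborel (\<lambda>z. V z * (onQ p z * indicator K z))"
  by (rule V_bounded_integrable(2)[where K = K and B = B]) (use K B onQ_in in \<open>auto simp: subset_iff\<close>)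
 then show "set_integrable lborel K (\<lambda>z. c * (V z * onQ p z))"
  unfolding set_integrable_def by (simp add: mult_ac integrable_mult_right)
 show "set_integrable lborel K (\<lambda>z. Vk k z * onQ p z)"
  unfolding set_integrable_def
 proof (rule L1_bound[OF i])
  show "AE z in lborel. norm (indicator K z *\<^sub>R (Vk k z * onQ p z)) <= norm (V z * (onQ p z * indicator K z))"
   using Vk_le_V[of k] Vk_nonneg[of k] V_nonneg
   by (intro AE_I2) (auto simp: indicator_def abs_mult intro!: mult_right_mono)
 qed measurable
qed

definition vk where "vk k z = min (u z) (wk k z)"
definition v where "v z = min (u z) (w z)"

lemma vk_cont: "continuous_on (Q_int T) (vk k)"
 unfolding vk_def[abs_def] by (intro continuous_on_min u_cont continuous_wk)

lemma vk_bounds: "z \<in> Q_int T ==> 0 <= vk k z" "vk k z <= u z" "vk k z <= wk k z"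
 by (auto simp: vk_def u_nonneg wk_nonneg)

lemma v_bounds: "z \<in> Q_int T ==> 0 <= v z" "v z <= u z" "v z <= w z" "z \<in> Q_int T ==> v z <= wk k z"
 using w_le_wk[of z k] by (auto simp: v_def u_nonneg w_nonneg)

lemma vk_lim: "z \<in> Q_int T ==> (\<lambda>k. vk k z) \<longlonglongrightarrow> v z"
 unfolding vk_def v_def by (intro tendsto_min tendsto_const wk_lim)

lemma onQ_vk_lim: "(\<lambda>k. onQ (vk k) z) \<longlonglongrightarrow> onQ v z"
 using vk_lim[of z] by (cases "z \<in> Q_int T") (auto simp: onQ_def)

lemma onQ_v_measurable [measurable]: "onQ v \<in> borel_measurable borel"
 by (rule borel_measurable_LIMSEQ_real[OF onQ_vk_lim onQ_measurable[OF vk_cont]])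

lemma onQ_bounds: "0 <= onQ (vk k) z" "onQ (vk k) z <= onQ u z" "0 <= onQ v z" "onQ v z <= onQ u z"
 using vk_bounds v_bounds by (auto simp: onQ_def indicator_def)

text \<open>Write the minimum as half of u + wk - \<bar>u - wk\<bar> and apply Kato's inequality to
  the continuous difference. The truncated potential of \<open>wk\<close> is at most V, so replacing
  it by V keeps the inequality.\<close>

lemma vk_super:
 assumes \<phi>: "test_function (Q_int T) \<phi>" "!!z. 0 <= \<phi> z"
 shows "(LBINT z. - 1 * (V z * onQ (vk k) z) * \<phi> z) <= (LBINT z. vk k z * adj_heat \<phi> z)"
proof -
 obtain K where s\<phi>: "smooth \<phi>" and K: "compact K" "K \<subseteq> Q_int T" "!!z. z \<notin> K ==> \<phi> z = 0"
  using \<phi>(1) by (rule test_functionE) blast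
 have c\<phi>: "continuous_on UNIV \<phi>" by (rule smooth_continuous[OF s\<phi>])
 have aoff: "adj_heat \<phi> z = 0" if "z \<notin> K" for z using adj_heat_zero_off[OF K(1,3) that] .
 have [measurable]: "\<phi> \<in> borel_measurable borel" using c\<phi> by (rule borel_measurable_continuous_onI)
 note [measurable] = onQ_measurable[OF u_cont] onQ_measurable[OF continuous_wk] onQ_measurable[OF vk_cont]
 define d where "d z = u z - wk k z" for z
 define F where "F z = - 1 * (V z * onQ u z) + Vk k z * onQ (wk k) z" for z
 have cd: "continuous_on (Q_int T) d" unfolding d_def by (intro continuous_intros u_cont continuous_wk)
 have Fm: "F \<in> borel_measurable borel" unfolding F_def[abs_def] by measurable
 have Fi: "set_integrable lborel C F" if C: "compact C" "C \<subseteq> Q_int T" for C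
  unfolding F_def
  by (rule set_integral_add(1)[OF V_set_integrable(1)[OF u_cont _ C] V_set_integrable(2)[where c = 1, OF continuous_wk _ C]]) simp_all
 have iadj: "integrable lborel (\<lambda>z. p z * adj_heat \<psi> z)"
  if p: "continuous_on (Q_int T) p" and \<psi>: "test_function (Q_int T) \<psi>" for p \<psi>
  by (rule continuous_times_test(2)[OF p \<psi>])
 have iV: "integrable lborel (\<lambda>z. V z * (onQ p z * \<psi> z))" "integrable lborel (\<lambda>z. Vk k z * (onQ p z * \<psi> z))"
  if p: "continuous_on (Q_int T) p" and \<psi>: "test_function (Q_int T) \<psi>" for p \<psi>
 proof -
  obtain C where C: "smooth \<psi>" "compact C" "C \<subseteq> Q_int T" "!!z. z \<notin> C ==> \<psi> z = 0"
   using \<psi> by (rule test_functionE) blast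
  note c\<psi> = smooth_continuous[OF C(1), of UNIV]
  note [measurable] = onQ_measurable[OF p] borel_measurable_continuous_onI[OF c\<psi>]
  show i: "integrable lborel (\<lambda>z. V z * (onQ p z * \<psi> z))" by (rule V_integrable[OF p c\<psi> C(2,3,4)])
  show "integrable lborel (\<lambda>z. Vk k z * (onQ p z * \<psi> z))"
  proof (rule L1_bound[OF i])
   show "AE z in lborel. norm (Vk k z * (onQ p z * \<psi> z)) <= norm (V z * (onQ p z * \<psi> z))"
    using Vk_le_V[of k] Vk_nonneg[of k] V_nonneg
    by (intro AE_I2) (simp only: real_norm_def abs_mult abs_of_nonneg, intro mult_right_mono, auto)
  qed measurable
 qed
 have onQ\<psi>: "p z * \<psi> z = onQ p z * \<psi> z" if \<psi>: "test_function (Q_int T) \<psi>" for p \<psi> z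
 proof -
  obtain C where C: "C \<subseteq> Q_int T" "!!z. z \<notin> C ==> \<psi> z = 0" using \<psi> by (rule test_functionE) blast
  then show ?thesis by (cases "z \<in> C") (auto simp: onQ_def)
 qed
 have uw: "(LBINT z. u z * adj_heat \<psi> z) = - (LBINT z. V z * (onQ u z * \<psi> z))"
  "(LBINT z. wk k z * adj_heat \<psi> z) = - (LBINT z. Vk k z * (onQ (wk k) z * \<psi> z))"
  if \<psi>: "test_function (Q_int T) \<psi>" for \<psi>
  using u_weak[OF \<psi>] wk_weak[OF \<psi>, of k] by (simp_all add: onQ\<psi>[OF \<psi>, symmetric] mult.assoc)
 have weak: "(LBINT z. d z * adj_heat \<psi> z) = (LBINT z. F z * \<psi> z)" if \<psi>: "test_function (Q_int T) \<psi>" for \<psi>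
 proof -
  have "(LBINT z. d z * adj_heat \<psi> z) = - (LBINT z. V z * (onQ u z * \<psi> z)) + (LBINT z. Vk k z * (onQ (wk k) z * \<psi> z))"
   using iadj[OF u_cont \<psi>] iadj[OF continuous_wk \<psi>, of k] uw[OF \<psi>] by (simp add: d_def left_diff_distrib)
  also have "\<dots> = (LBINT z. - (V z * (onQ u z * \<psi> z)) + Vk k z * (onQ (wk k) z * \<psi> z))"
   using iV(1)[OF u_cont \<psi>] iV(2)[OF continuous_wk \<psi>, of k] by simp
  also have "\<dots> = (LBINT z. F z * \<psi> z)"
   by (intro lint_cong) (simp add: F_def algebra_simps)
  finally show ?thesis .
 qed
 have ks: "(LBINT z. \<bar>d z\<bar> * adj_heat \<phi> z) <= (LBINT z. sgn (d z) * F z * \<phi> z)"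
  by (rule kato[OF open_Q_int cd Fm Fi weak \<phi>])
 have ad: "integrable lborel (\<lambda>z. \<bar>d z\<bar> * adj_heat \<phi> z)" by (intro iadj \<phi>(1) continuous_intros cd)
 have iF: "integrable lborel (\<lambda>z. F z * \<phi> z)"
  using L1_add[OF integrable_mult_right[OF iV(1)[OF u_cont \<phi>(1)], of "- 1"] iV(2)[OF continuous_wk \<phi>(1), of k]]
  by (simp add: F_def algebra_simps)
 have sF: "integrable lborel (\<lambda>z. sgn (d z) * F z * \<phi> z)"
 proof (rule L1_bound[OF iF])
  have "onQ d \<in> borel_measurable borel" by (rule onQ_measurable[OF cd])
  then have [measurable]: "(\<lambda>z. sgn (onQ d z)) \<in> borel_measurable borel" by measurable
  have "sgn (d z) * F z * \<phi> z = sgn (onQ d z) * (F z * \<phi> z)" for z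
   using onQ\<psi>[OF \<phi>(1), of "\<lambda>_. 1" z] by (cases "z \<in> Q_int T") (auto simp: onQ_def)
  then have "(\<lambda>z. sgn (d z) * F z * \<phi> z) = (\<lambda>z. sgn (onQ d z) * (F z * \<phi> z))" by blast
  moreover have "(\<lambda>z. sgn (onQ d z) * (F z * \<phi> z)) \<in> borel_measurable lborel" using Fm by measurable
  ultimately show "(\<lambda>z. sgn (d z) * F z * \<phi> z) \<in> borel_measurable lborel" by simp
  show "AE z in lborel. norm (sgn (d z) * F z * \<phi> z) <= norm (F z * \<phi> z)"
   by (intro AE_I2) (simp add: abs_mult sgn_if)
 qed
 have "(LBINT z. - 1 * (V z * onQ (vk k) z) * \<phi> z) <=
   (LBINT z. (1 / 2) * (- (V z * (onQ u z * \<phi> z)) - Vk k z * (onQ (wk k) z * \<phi> z) - sgn (d z) * F z * \<phi> z))"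
 proof (rule integral_mono)
  show "integrable lborel (\<lambda>z. - 1 * (V z * onQ (vk k) z) * \<phi> z)"
   using integrable_mult_right[OF iV(1)[OF vk_cont \<phi>(1)], of "- 1"] by (simp add: mult_ac)
  show "integrable lborel (\<lambda>z. (1 / 2) * (- (V z * (onQ u z * \<phi> z)) - Vk k z * (onQ (wk k) z * \<phi> z) - sgn (d z) * F z * \<phi> z))"
   using iV(1)[OF u_cont \<phi>(1)] iV(2)[OF continuous_wk \<phi>(1), of k] sF by (intro integrable_mult_right Bochner_Integration.integrable_diff Bochner_Integration.integrable_minus) auto
  fix z
  show "- 1 * (V z * onQ (vk k) z) * \<phi> z <=
   (1 / 2) * (- (V z * (onQ u z * \<phi> z)) - Vk k z * (onQ (wk k) z * \<phi> z) - sgn (d z) * F z * \<phi> z)"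
  proof (cases "z \<in> Q_int T")
   case True
   \<comment> \<open>Where d > 0 the minimum is \<open>wk\<close>, whose potential is at most V;
     where d < 0 it is u, with equality; where d = 0 the sign factor is 0 and the average of both
     terms is compared.\<close>
   have key: "- (V z * vk k z) <= (1 / 2) * (- (V z * u z) - Vk k z * wk k z - sgn (d z) * (- (V z * u z) + Vk k z * wk k z))"
   proof -
    have a: "Vk k z * wk k z <= V z * wk k z" by (intro mult_right_mono Vk_le_V wk_nonneg)
    consider "d z > 0" | "d z < 0" | "d z = 0" by linarith
    then show ?thesis
    proof cases
     case 1
     then have "vk k z = wk k z" by (simp add: d_def vk_def)
     then show ?thesis using 1 a by simp
    next
     case 2
     then have "vk k z = u z" by (simp add: d_def vk_def)
     then show ?thesis using 2 by simp
    next
     case 3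
     then have "vk k z = u z" "wk k z = u z" by (simp_all add: d_def vk_def)
     then show ?thesis using 3 a by simp
    qed
   qed
   have "- 1 * (V z * onQ (vk k) z) * \<phi> z = - (V z * vk k z) * \<phi> z" by (simp add: onQ_in[OF True])
   also have "\<dots> <= ((1 / 2) * (- (V z * u z) - Vk k z * wk k z - sgn (d z) * (- (V z * u z) + Vk k z * wk k z))) * \<phi> z"
    by (rule mult_right_mono[OF key \<phi>(2)])
   also have "\<dots> = (1 / 2) * (- (V z * (onQ u z * \<phi> z)) - Vk k z * (onQ (wk k) z * \<phi> z) - sgn (d z) * F z * \<phi> z)"
    by (simp add: onQ_in[OF True] F_def algebra_simps)
   finally show ?thesis .
  qed (simp add: onQ_def F_def)
 qed
 also have "\<dots> = (1 / 2) * (- (LBINT z. V z * (onQ u z * \<phi> z)) - (LBINT z. Vk k z * (onQ (wk k) z * \<phi> z)) - (LBINT z. sgn (d z) * F z * \<phi> z))"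
  using iV(1)[OF u_cont \<phi>(1)] iV(2)[OF continuous_wk \<phi>(1), of k] sF by simp
 also have "\<dots> <= (1 / 2) * ((LBINT z. u z * adj_heat \<phi> z) + (LBINT z. wk k z * adj_heat \<phi> z) - (LBINT z. \<bar>d z\<bar> * adj_heat \<phi> z))"
  using ks uw[OF \<phi>(1)] by simp
 also have "\<dots> = (LBINT z. (1 / 2) * (u z * adj_heat \<phi> z + wk k z * adj_heat \<phi> z - \<bar>d z\<bar> * adj_heat \<phi> z))"
  using iadj[OF u_cont \<phi>(1)] iadj[OF continuous_wk \<phi>(1), of k] ad by simp
 also have "\<dots> = (LBINT z. vk k z * adj_heat \<phi> z)"
 proof (intro lint_cong)
  fix z
  have vkz: "vk k z = (1 / 2) * (u z + wk k z - \<bar>d z\<bar>)" by (simp add: vk_def d_def min_def)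
  show "(1 / 2) * (u z * adj_heat \<phi> z + wk k z * adj_heat \<phi> z - \<bar>d z\<bar> * adj_heat \<phi> z) = vk k z * adj_heat \<phi> z"
   by (simp only: vkz, simp add: algebra_simps)
 qed
 finally show ?thesis .
qed

text \<open>Both inequalities pass to the limit \<open>k \<rightarrow> \<infinity>\<close> since \<open>vk k \<le> u\<close>.\<close>

lemma onQ_limit:
 assumes g: "g \<in> borel_measurable borel" "!!z. \<bar>g z\<bar> <= B"
  and K: "compact K" "K \<subseteq> Q_int T" "!!z. z \<notin> K ==> g z = 0"
 shows "(\<lambda>k. LBINT z. onQ (vk k) z * g z) \<longlonglongrightarrow> (LBINT z. onQ v z * g z)"
  and "(\<lambda>k. LBINT z. V z * (onQ (vk k) z * g z)) \<longlonglongrightarrow> (LBINT z. V z * (onQ v z * g z))"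
  and "integrable lborel (\<lambda>z. onQ v z * g z)" "integrable lborel (\<lambda>z. V z * (onQ v z * g z))"
  and "integrable lborel (\<lambda>z. onQ (vk k) z * g z)" "integrable lborel (\<lambda>z. V z * (onQ (vk k) z * g z))"
proof -
 note [measurable] = g(1) onQ_measurable[OF u_cont] onQ_measurable[OF vk_cont]
 have "bounded (u ` K)" by (intro compact_imp_bounded compact_continuous_image K continuous_on_subset[OF u_cont])
 then obtain M where M: "!!z. z \<in> K ==> \<bar>u z\<bar> <= M" by (auto simp: bounded_iff)
 have B0: "0 <= B" using g(2)[of undefined] by linarith
 have Bd: "\<bar>p z * g z\<bar> <= M * B" if "z \<in> K" "0 <= p z" "p z <= onQ u z" for p z
 proof -
  have "\<bar>p z\<bar> <= M" using that M[OF that(1)] onQ_in[of z u] K(2) by auto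
  then show ?thesis unfolding abs_mult using g(2)[of z] by (intro mult_mono) auto
 qed
 note bi = V_bounded_integrable[OF _ g(1) K, of _ "M * B"]
 have iu: "integrable lborel (\<lambda>z. \<bar>onQ u z * g z\<bar>)" "integrable lborel (\<lambda>z. \<bar>V z * (onQ u z * g z)\<bar>)"
  by (intro integrable_abs bi; use Bd onQ_bounds order_trans[OF onQ_bounds(1,2)] in auto)+
 show "integrable lborel (\<lambda>z. onQ v z * g z)" "integrable lborel (\<lambda>z. V z * (onQ v z * g z))"
  by (intro bi; use Bd onQ_bounds in auto)+
 show "integrable lborel (\<lambda>z. onQ (vk k) z * g z)" "integrable lborel (\<lambda>z. V z * (onQ (vk k) z * g z))" for k
  by (intro bi; use Bd onQ_bounds in auto)+
 have dom: "\<bar>onQ (vk k) z * g z\<bar> <= \<bar>onQ u z * g z\<bar>" for k z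
  using onQ_bounds(1,2)[of k z] by (simp add: abs_mult mult_right_mono)
 show "(\<lambda>k. LBINT z. onQ (vk k) z * g z) \<longlonglongrightarrow> (LBINT z. onQ v z * g z)"
  by (rule integral_dominated_convergence[OF _ _ iu(1)])
   (use dom in \<open>auto intro!: tendsto_mult onQ_vk_lim\<close>)
 show "(\<lambda>k. LBINT z. V z * (onQ (vk k) z * g z)) \<longlonglongrightarrow> (LBINT z. V z * (onQ v z * g z))"
  by (rule integral_dominated_convergence[OF _ _ iu(2)])
   (use dom V_nonneg in \<open>auto simp: abs_mult[of "V _"] intro!: tendsto_mult onQ_vk_lim mult_left_mono\<close>)
qed

lemma v_super:
 assumes \<phi>: "test_function (Q_int T) \<phi>" "!!z. 0 <= \<phi> z"
 shows "0 <= (LBINT z. onQ v z * adj_heat \<phi> z) + (LBINT z. V z * (onQ v z * \<phi> z))"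
proof -
 obtain K where s\<phi>: "smooth \<phi>" and K: "compact K" "K \<subseteq> Q_int T" "!!z. z \<notin> K ==> \<phi> z = 0"
  using \<phi>(1) by (rule test_functionE) blast
 have c\<phi>: "continuous_on UNIV \<phi>" and ca: "continuous_on UNIV (adj_heat \<phi>)"
  using s\<phi> by (auto intro: smooth_continuous continuous_adj_heat)
 have aoff: "adj_heat \<phi> z = 0" if "z \<notin> K" for z using adj_heat_zero_off[OF K(1,3) that] .
 obtain M where M: "!!z. \<bar>\<phi> z\<bar> <= M" using bounded_compact_support[OF c\<phi> K(1,3)] by blast
 obtain N where N: "!!z. \<bar>adj_heat \<phi> z\<bar> <= N" using bounded_compact_support[OF ca K(1) aoff] by blast
 note l1 = onQ_limit(1)[OF borel_measurable_continuous_onI[OF ca] N K(1,2) aoff]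
 note l2 = onQ_limit(2)[OF borel_measurable_continuous_onI[OF c\<phi>] M K]
 have "0 <= (LBINT z. onQ (vk k) z * adj_heat \<phi> z) + (LBINT z. V z * (onQ (vk k) z * \<phi> z))" for k
 proof -
  have "vk k z * adj_heat \<phi> z = onQ (vk k) z * adj_heat \<phi> z" for z
   using aoff[of z] K(2) by (cases "z \<in> K") (auto simp: onQ_def)
  then have "(LBINT z. vk k z * adj_heat \<phi> z) = (LBINT z. onQ (vk k) z * adj_heat \<phi> z)"
   by (intro lint_cong)
  then show ?thesis using vk_super[OF \<phi>, of k] by (simp add: mult.assoc)
 qed
 then show ?thesis by (intro LIMSEQ_le_const[OF tendsto_add[OF l1 l2]]) auto
qed

end

section \<open>Bounds that are uniform down to t = 0\<close>

lemma integrable_from_nn_bound: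
 fixes f :: "'b::euclidean_space => real"
 assumes "f \<in> borel_measurable borel" "(\<integral>\<^sup>+ x. ennreal \<bar>f x\<bar> \<partial>lborel) <= ennreal D" "0 <= D"
 shows "integrable lborel f" "\<bar>\<integral>x. f x \<partial>lborel\<bar> <= D"
proof -
 show i: "integrable lborel f"
  unfolding integrable_iff_bounded using assms(1,2) by (auto intro: le_less_trans)
 have "ennreal (LBINT x. \<bar>f x\<bar>) <= ennreal D"
  using assms(2) i by (simp add: nn_integral_eq_integral)
 then have "(LBINT x. \<bar>f x\<bar>) <= D" using assms(3) by simp
 then show "\<bar>\<integral>x. f x \<partial>lborel\<bar> <= D" using integral_abs_bound[of lborel f] by linarith
qed

lemma measurable_slice: "p \<in> borel_measurable borel ==> (\<lambda>x::'a::euclidean_space. p (x, t::real)) \<in> borel_measurable borel"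
 by (rule measurable_compose[OF borel_measurable_continuous_onI]) (auto intro: continuous_intros)

abbreviation slab :: "real => real => ('a::euclidean_space => real) => 'a \<times> real => real" where
 "slab s t g z \<equiv> indicator {s..t} (snd z) * g (fst z)"

context potential_measure
begin

text \<open>The constant is that of \<open>wk_average\<close>, independent of k and t. Stated for
  nonnegative integrals, the estimate passes from \<open>wk\<close> to every function below it by
  monotonicity alone.\<close>

lemma average_bounds:
 fixes R :: real
 obtains C where "0 <= C"
  "!!k t p g B. 0 < t ==> t <= T / 4 ==> (!!x. 0 <= p x) ==> (!!x. p x <= wk k (x, t)) ==>
    0 <= B ==> (!!x. \<bar>g x\<bar> <= B * indicator (cball 0 R) x) ==>
    (\<integral>\<^sup>+ x. ennreal \<bar>p x * g x\<bar> \<partial>lborel) <= ennreal (B * C)"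
proof -
 obtain C where C: "0 <= C" "!!k t. 0 < t ==> t <= T / 4 ==> (\<integral>\<^sup>+ x. indicator (cball 0 R) x * ennreal (wk k (x, t)) \<partial>lborel) <= ennreal C"
  using wk_average[of R] by blast
 show ?thesis
 proof (rule that[OF C(1)])
  fix k :: nat and t B :: real and p g :: "'a => real"
  assume t: "0 < t" "t <= T / 4" and p: "!!x. 0 <= p x" "!!x. p x <= wk k (x, t)"
   and B: "0 <= B" "!!x. \<bar>g x\<bar> <= B * indicator (cball 0 R) x"
  have "continuous_on UNIV (\<lambda>x. wk k (x, t))"
   by (rule continuous_on_compose2[OF continuous_wk]) (use t T in \<open>auto simp: Q_int_def intro!: continuous_intros\<close>)
  then have m: "(\<lambda>x. indicator (cball 0 R) x * ennreal (wk k (x, t))) \<in> borel_measurable lborel"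
   by (intro borel_measurable_times_ennreal measurable_compose[OF _ measurable_ennreal])
    (auto intro: borel_measurable_continuous_onI borel_measurable_indicator)
  have "ennreal \<bar>p x * g x\<bar> <= ennreal B * (indicator (cball 0 R) x * ennreal (wk k (x, t)))" for x
  proof -
   have "\<bar>p x * g x\<bar> <= wk k (x, t) * (B * indicator (cball 0 R) x)"
    using p[of x] B by (simp add: abs_mult) (intro mult_mono, auto)
   then have "ennreal \<bar>p x * g x\<bar> <= ennreal (B * (indicator (cball 0 R) x * wk k (x, t)))"
    by (intro ennreal_leI) (simp add: mult_ac)
   also have "\<dots> = ennreal B * (indicator (cball 0 R) x * ennreal (wk k (x, t)))"
    using B(1) wk_nonneg by (auto simp: ennreal_mult indicator_def)
   finally show ?thesis .
  qed
  then have "(\<integral>\<^sup>+ x. ennreal \<bar>p x * g x\<bar> \<partial>lborel) <= (\<integral>\<^sup>+ x. ennreal B * (indicator (cball 0 R) x * ennreal (wk k (x, t))) \<partial>lborel)"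
   by (rule nn_integral_mono)
  also have "\<dots> = ennreal B * (\<integral>\<^sup>+ x. indicator (cball 0 R) x * ennreal (wk k (x, t)) \<partial>lborel)"
   by (rule nn_integral_cmult[OF m])
  also have "\<dots> <= ennreal B * ennreal C" by (intro mult_left_mono C t) simp
  finally show "(\<integral>\<^sup>+ x. ennreal \<bar>p x * g x\<bar> \<partial>lborel) <= ennreal (B * C)" using B(1) C(1) by (simp add: ennreal_mult)
 qed
qed

text \<open>The slice bound is integrated over time; the crude estimate t - s \<le> T makes the
  constant independent of the slab.\<close>

lemma slab_bounds:
 fixes R :: real
 obtains C where "0 <= C"
  "!!k s t p g B. 0 < s ==> s <= t ==> t <= T / 4 ==> p \<in> borel_measurable borel ==> (!!z. 0 <= p z) ==>
    (!!z. z \<in> Q_int T ==> p z <= wk k z) ==>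
    g \<in> borel_measurable borel ==> 0 <= B ==> (!!x. \<bar>g x\<bar> <= B * indicator (cball 0 R) x) ==>
    \<bar>\<integral>z. p z * slab s t g z \<partial>lborel\<bar> <= B * C"
proof -
 obtain C where C: "0 <= C"
  "!!k t p g B. 0 < t ==> t <= T / 4 ==> (!!x. 0 <= p x) ==> (!!x. p x <= wk k (x, t)) ==>
    0 <= B ==> (!!x. \<bar>g x\<bar> <= B * indicator (cball 0 R) x) ==>
    (\<integral>\<^sup>+ x. ennreal \<bar>p x * g x\<bar> \<partial>lborel) <= ennreal (B * C)"
  using average_bounds[of R] by blast
 show ?thesis
 proof (rule that)
  show "0 <= C * T" using C(1) T by simp
  fix k :: nat and s t B :: real and p :: "'a stfun" and g :: "'a => real"
  assume st: "0 < s" "s <= t" "t <= T / 4" and pm: "p \<in> borel_measurable borel" and p: "!!z. 0 <= p z" "!!z. z \<in> Q_int T ==> p z <= wk k z"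
   and gm: "g \<in> borel_measurable borel" and B: "0 <= B" "!!x. \<bar>g x\<bar> <= B * indicator (cball 0 R) x"
  have m: "(\<lambda>z. p z * slab s t g z) \<in> borel_measurable borel"
  proof (intro borel_measurable_times pm)
   show "(\<lambda>z::'a \<times> real. indicator {s..t} (snd z)) \<in> borel_measurable borel"
    by (rule measurable_compose[OF borel_measurable_snd_borel]) simp
   show "(\<lambda>z::'a \<times> real. g (fst z)) \<in> borel_measurable borel"
    by (rule measurable_compose[OF borel_measurable_fst_borel gm])
  qed
  have m': "(\<lambda>z. ennreal \<bar>p z * slab s t g z\<bar>) \<in> borel_measurable (lborel \<Otimes>\<^sub>M lborel)"
   unfolding lborel_prod using m by simp
  have "(\<integral>\<^sup>+ z. ennreal \<bar>p z * slab s t g z\<bar> \<partial>lborel)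
    = (\<integral>\<^sup>+ \<tau>. (\<integral>\<^sup>+ x. ennreal \<bar>p (x, \<tau>) * (indicator {s..t} \<tau> * g x)\<bar> \<partial>lborel) \<partial>lborel)"
   using lborel_pair.nn_integral_snd[OF m'] unfolding lborel_prod by simp
  also have "\<dots> <= (\<integral>\<^sup>+ \<tau>. ennreal (B * C) * indicator {s..t} \<tau> \<partial>lborel)"
  proof (rule nn_integral_mono)
   fix \<tau> :: real
   show "(\<integral>\<^sup>+ x. ennreal \<bar>p (x, \<tau>) * (indicator {s..t} \<tau> * g x)\<bar> \<partial>lborel) <= ennreal (B * C) * indicator {s..t} \<tau>"
   proof (cases "\<tau> \<in> {s..t}")
    case True
    then have \<tau>: "0 < \<tau>" "\<tau> <= T / 4" and zt: "(x, \<tau>) \<in> Q_int T" for x :: 'a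
     using st T by (auto simp: Q_int_def)
    show ?thesis using True C(2)[of \<tau> "\<lambda>x. p (x, \<tau>)" k B g, OF \<tau> p(1) p(2)[OF zt] B] by simp
   qed simp
  qed
  also have "\<dots> = ennreal (B * C) * ennreal (t - s)" using st by (subst nn_integral_cmult) auto
  also have "\<dots> = ennreal (B * C * (t - s))" using B(1) C(1) st by (simp add: ennreal_mult)
  also have "\<dots> <= ennreal (B * (C * T))"
   unfolding mult.assoc using B(1) C(1) st T by (intro ennreal_leI mult_left_mono) auto
  finally show "\<bar>\<integral>z. p z * slab s t g z \<partial>lborel\<bar> <= B * (C * T)"
   using m B(1) C(1) T by (intro integrable_from_nn_bound) auto
 qed
qed

end

context min_solution
begin

lemma onQ_slice_integrable:
 fixes p :: "'a stfun" and g :: "'a => real"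
 assumes p: "continuous_on (Q_int T) p" and t: "0 < t" "t < T"
  and g: "continuous_on UNIV g" "compact K" "!!x. x \<notin> K ==> g x = 0"
 shows "integrable lborel (\<lambda>x. p (x, t) * g x)"
proof (rule integrable_times_compact[OF _ g(1,2) subset_UNIV])
 show "continuous_on UNIV (\<lambda>x. p (x, t))"
  by (rule continuous_on_compose2[OF p]) (use t in \<open>auto simp: Q_int_def intro!: continuous_intros\<close>)
qed (rule g(3))

lemma onQ_v_slice_measurable [measurable]: "(\<lambda>x. onQ v (x, t)) \<in> borel_measurable borel"
 by (rule measurable_slice) measurable

lemma slab_compact:
 assumes "0 < s" "t < T"
 shows "compact (cball (0::'a) R \<times> {s..t})" "cball (0::'a) R \<times> {s..t} \<subseteq> Q_int T"
 using assms by (auto intro!: compact_Times simp: Q_int_def)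

lemma slab_function:
 fixes g :: "'a => real" and s t R :: real
 assumes g: "continuous_on UNIV g" "!!x. x \<notin> cball 0 R ==> g x = 0"
 defines "h \<equiv> \<lambda>z::'a \<times> real. indicator {s..t} (snd z) * g (fst z)"
 shows "h \<in> borel_measurable borel" "\<exists>B\<ge>0. (\<forall>z. \<bar>h z\<bar> <= B) \<and> (\<forall>x. \<bar>g x\<bar> <= B * indicator (cball 0 R) x)"
  "z \<notin> cball 0 R \<times> {s..t} ==> h z = 0"
proof -
 have gm: "g \<in> borel_measurable borel" using g(1) by (rule borel_measurable_continuous_onI)
 show "h \<in> borel_measurable borel"
  unfolding h_def
 proof (intro borel_measurable_times)
  show "(\<lambda>z::'a \<times> real. indicator {s..t} (snd z)) \<in> borel_measurable borel"
   by (rule measurable_compose[OF borel_measurable_snd_borel]) simp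
  show "(\<lambda>z::'a \<times> real. g (fst z)) \<in> borel_measurable borel"
   by (rule measurable_compose[OF borel_measurable_fst_borel gm])
 qed
 obtain B where B: "B \<ge> 0" "!!x. \<bar>g x\<bar> <= B" using bounded_compact_support[OF g(1) compact_cball g(2)] by blast
 have "\<bar>h z\<bar> <= B" for z using B by (simp add: h_def indicator_def)
 moreover have "\<bar>g x\<bar> <= B * indicator (cball 0 R) x" for x using B(2)[of x] g(2)[of x] by (auto simp: indicator_def)
 ultimately show "\<exists>B\<ge>0. (\<forall>z. \<bar>h z\<bar> <= B) \<and> (\<forall>x. \<bar>g x\<bar> <= B * indicator (cball 0 R) x)" using B(1) by blast
 show "h z = 0" if "z \<notin> cball 0 R \<times> {s..t}"
  using that g(2)[of "fst z"] by (cases z) (auto simp: h_def indicator_def)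
qed

text \<open>The slab inequality needs continuity, so it is applied to \<open>vk\<close>. In the
  limit the slab terms follow from \<open>onQ_limit\<close>, and the slices from domination by
  \<open>u\<close>.\<close>

lemma vk_slice:
 assumes \<xi>: "smooth \<xi>" "!!x. 0 <= \<xi> x" "!!x. x \<notin> cball 0 R ==> \<xi> x = 0"
  and st: "0 < s" "s < t" "t < T"
 shows "(LBINT z. onQ v z * slab s t (lap \<xi>) z)
   - (LBINT z. V z * (onQ v z * slab s t \<xi> z))
  <= (LBINT x. onQ v (x, t) * \<xi> x) - (LBINT x. onQ v (x, s) * \<xi> x)"
proof -
 have c\<xi>: "continuous_on UNIV \<xi>" by (rule smooth_continuous[OF \<xi>(1)])
 have cl: "continuous_on UNIV (lap \<xi>)" by (rule continuous_lap[OF \<xi>(1)])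
 have lo: "lap \<xi> x = 0" if "x \<notin> cball 0 R" for x by (rule lap_zero_off[OF compact_cball \<xi>(3) that])
 note K = slab_compact[OF st(1,3), of R]
 note h1 = slab_function[where R = R and s = s and t = t, OF cl lo] and h2 = slab_function[where R = R and s = s and t = t, OF c\<xi> \<xi>(3)]
 obtain B1 where B1: "!!z::'a \<times> real. \<bar>slab s t (lap \<xi>) z\<bar> <= B1" using h1(2) by blast
 obtain B2 where B2: "!!z::'a \<times> real. \<bar>slab s t \<xi> z\<bar> <= B2" using h2(2) by blast
 note l1 = onQ_limit[OF h1(1) B1 K h1(3)] and l2 = onQ_limit[OF h2(1) B2 K h2(3)]
 have ineq: "(LBINT z. onQ (vk k) z * slab s t (lap \<xi>) z)
   - (LBINT z. V z * (onQ (vk k) z * slab s t \<xi> z))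
  <= (LBINT x. vk k (x, t) * \<xi> x) - (LBINT x. vk k (x, s) * \<xi> x)" for k
 proof -
  note [measurable] = onQ_measurable[OF vk_cont, of k]
  have "(LBINT z. indicator {s..t} (snd z) * (vk k z * lap \<xi> (fst z) + (- 1 * (V z * onQ (vk k) z)) * \<xi> (fst z)))
   <= (LBINT x. vk k (x, t) * \<xi> x) - (LBINT x. vk k (x, s) * \<xi> x)"
  proof (rule time_slice[OF vk_cont _ _ vk_super \<xi>(1,2) compact_cball \<xi>(3) st])
   show "(\<lambda>z. - 1 * (V z * onQ (vk k) z)) \<in> borel_measurable borel" by measurable
   show "set_integrable lborel K (\<lambda>z. - 1 * (V z * onQ (vk k) z))" if "compact K" "K \<subseteq> Q_int T" for K
    by (rule V_set_integrable(1)[OF vk_cont _ that]) simp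
  qed
  also have "(LBINT z. indicator {s..t} (snd z) * (vk k z * lap \<xi> (fst z) + (- 1 * (V z * onQ (vk k) z)) * \<xi> (fst z)))
   = (LBINT z. onQ (vk k) z * slab s t (lap \<xi>) z - V z * (onQ (vk k) z * slab s t \<xi> z))"
  proof (intro lint_cong)
   fix z :: "'a \<times> real"
   have "snd z \<in> {s..t} ==> z \<in> Q_int T" using st by (cases z) (auto simp: Q_int_def)
   then show "indicator {s..t} (snd z) * (vk k z * lap \<xi> (fst z) + (- 1 * (V z * onQ (vk k) z)) * \<xi> (fst z)) =
    onQ (vk k) z * slab s t (lap \<xi>) z - V z * (onQ (vk k) z * slab s t \<xi> z)"
    by (cases "snd z \<in> {s..t}") (simp_all add: onQ_in algebra_simps)
  qed
  also have "\<dots> = (LBINT z. onQ (vk k) z * slab s t (lap \<xi>) z)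
   - (LBINT z. V z * (onQ (vk k) z * slab s t \<xi> z))"
   by (rule lint_diff[OF l1(5) l2(6)])
  finally show ?thesis .
 qed
 have sl: "(\<lambda>k. LBINT x. vk k (x, \<tau>) * \<xi> x) \<longlonglongrightarrow> (LBINT x. onQ v (x, \<tau>) * \<xi> x)" if \<tau>: "0 < \<tau>" "\<tau> < T" for \<tau>
 proof (rule integral_dominated_convergence[where w = "\<lambda>x. u (x, \<tau>) * \<xi> x"])
  have zt: "(x, \<tau>) \<in> Q_int T" for x :: 'a using \<tau> by (auto simp: Q_int_def)
  show "integrable lborel (\<lambda>x. u (x, \<tau>) * \<xi> x)"
   by (rule onQ_slice_integrable[OF u_cont \<tau> c\<xi> compact_cball \<xi>(3)])
  show "(\<lambda>x. vk k (x, \<tau>) * \<xi> x) \<in> borel_measurable lborel" for k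
  proof -
   have "integrable lborel (\<lambda>x. vk k (x, \<tau>) * \<xi> x)"
    by (rule onQ_slice_integrable[OF vk_cont \<tau> c\<xi> compact_cball \<xi>(3)])
   then show ?thesis by auto
  qed
  show "(\<lambda>x. onQ v (x, \<tau>) * \<xi> x) \<in> borel_measurable lborel"
   using borel_measurable_continuous_onI[OF c\<xi>] by measurable
  show "AE x in lborel. (\<lambda>k. vk k (x, \<tau>) * \<xi> x) \<longlonglongrightarrow> onQ v (x, \<tau>) * \<xi> x"
   using vk_lim[OF zt] by (intro AE_I2 tendsto_mult tendsto_const) (simp add: onQ_in[OF zt])
  show "AE x in lborel. norm (vk k (x, \<tau>) * \<xi> x) <= u (x, \<tau>) * \<xi> x" for k
   using onQ_bounds(1,2)[of k "(_, \<tau>)"] \<xi>(2) by (intro AE_I2) (auto simp: onQ_in[OF zt] abs_mult intro!: mult_right_mono)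
 qed
 show ?thesis
  by (rule LIMSEQ_le[OF tendsto_diff[OF l1(1) l2(2)] tendsto_diff[OF sl sl]]) (use ineq st in auto)
qed

text \<open>What the potential absorbs from \<open>wk\<close> on a slab cannot exceed the mass
  present at the lower time plus the flux measured by the Laplacian of the cut-off. Both are bounded
  uniformly in k, and \<open>v\<close> lies below every \<open>wk\<close>.\<close>

lemma absorption_bound:
 assumes \<xi>: "smooth \<xi>" "!!x. 0 <= \<xi> x" "!!x. x \<notin> cball 0 R ==> \<xi> x = 0"
 obtains D where "!!s t. 0 < s ==> s < t ==> t <= T / 4 ==>
  (LBINT z. V z * (onQ v z * slab s t \<xi> z)) <= D"
proof -
 have c\<xi>: "continuous_on UNIV \<xi>" by (rule smooth_continuous[OF \<xi>(1)])
 have cl: "continuous_on UNIV (lap \<xi>)" by (rule continuous_lap[OF \<xi>(1)])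
 note [measurable] = borel_measurable_continuous_onI[OF cl] borel_measurable_continuous_onI[OF c\<xi>]
 have lo: "lap \<xi> x = 0" if "x \<notin> cball 0 R" for x by (rule lap_zero_off[OF compact_cball \<xi>(3) that])
 obtain B1 where B1: "B1 \<ge> 0" "!!x. \<bar>lap \<xi> x\<bar> <= B1 * indicator (cball 0 R) x" using slab_function(2)[OF cl lo] by blast
 obtain B2 where B2: "B2 \<ge> 0" "!!x. \<bar>\<xi> x\<bar> <= B2 * indicator (cball 0 R) x" using slab_function(2)[OF c\<xi> \<xi>(3)] by blast
 obtain C1 where C1: "0 <= C1"
  "!!k s t p g B. 0 < s ==> s <= t ==> t <= T / 4 ==> p \<in> borel_measurable borel ==> (!!z. 0 <= p z) ==>
    (!!z. z \<in> Q_int T ==> p z <= wk k z) ==>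
    g \<in> borel_measurable borel ==> 0 <= B ==> (!!x. \<bar>g x\<bar> <= B * indicator (cball 0 R) x) ==>
    \<bar>\<integral>z. p z * slab s t g z \<partial>lborel\<bar> <= B * C1" using slab_bounds[of R] by blast
 obtain C2 where C2: "0 <= C2"
  "!!k t p g B. 0 < t ==> t <= T / 4 ==> (!!x. 0 <= p x) ==> (!!x. p x <= wk k (x, t)) ==>
    0 <= B ==> (!!x. \<bar>g x\<bar> <= B * indicator (cball 0 R) x) ==>
    (\<integral>\<^sup>+ x. ennreal \<bar>p x * g x\<bar> \<partial>lborel) <= ennreal (B * C2)" using average_bounds[of R] by blast
 show ?thesis
 proof (rule that)
  fix s t :: real assume st: "0 < s" "s < t" "t <= T / 4"
  then have tT: "t < T" using T by linarith
  note K = slab_compact[OF st(1) tT, of R]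
  note h1 = slab_function[where R = R and s = s and t = t, OF cl lo] and h2 = slab_function[where R = R and s = s and t = t, OF c\<xi> \<xi>(3)]
  have inQ: "snd z \<in> {s..t} ==> z \<in> Q_int T" for z :: "'a \<times> real" using st tT by (cases z) (auto simp: Q_int_def)
  \<comment> \<open>Here \<open>B2 * C2\<close> bounds the mass at time s and \<open>B1 * C1\<close>
    the Laplacian term; neither depends on k, s or t.\<close>
  have fin: "(LBINT z. Vk k z * (onQ v z * slab s t \<xi> z)) <= B2 * C2 + B1 * C1" for k
  proof -
   note [measurable] = onQ_measurable[OF continuous_wk, of k]
   have bd: "\<exists>B. \<forall>z. z \<in> cball 0 R \<times> {s..t} --> \<bar>onQ (wk k) z * h z\<bar> <= B"
    if B: "0 <= B" "!!z. \<bar>h z\<bar> <= B" for h :: "'a stfun" and B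
   proof -
    obtain M where M: "M \<ge> 0" "!!k z. z \<in> cball (0::'a) R \<times> {s..t} ==> wk k z <= M" using wk_bound[OF K] by blast
    have "\<bar>onQ (wk k) z * h z\<bar> <= M * B" if z: "z \<in> cball 0 R \<times> {s..t}" for z
    proof -
     have "z \<in> Q_int T" using z K(2) by blast
     then have "\<bar>onQ (wk k) z\<bar> <= M" using M(2)[OF z, of k] wk_nonneg[of k z] by (simp add: onQ_in)
     then show ?thesis unfolding abs_mult using M(1) B(2)[of z] by (intro mult_mono) auto
    qed
    then show ?thesis by blast
   qed
   obtain b1 where b1: "0 <= b1" "!!z::'a \<times> real. \<bar>slab s t (lap \<xi>) z\<bar> <= b1" using h1(2) by blast
   obtain b2 where b2: "0 <= b2" "!!z::'a \<times> real. \<bar>slab s t \<xi> z\<bar> <= b2" using h2(2) by blast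
   have "\<exists>B. \<forall>z. z \<in> cball 0 R \<times> {s..t} --> \<bar>onQ (wk k) z * slab s t (lap \<xi>) z\<bar> <= B"
    by (rule bd[OF b1])
   then obtain M1 where "\<forall>z. z \<in> cball 0 R \<times> {s..t} --> \<bar>onQ (wk k) z * slab s t (lap \<xi>) z\<bar> <= M1" ..
   note M1 = this[rule_format]
   have "\<exists>B. \<forall>z. z \<in> cball 0 R \<times> {s..t} --> \<bar>onQ (wk k) z * slab s t \<xi> z\<bar> <= B"
    by (rule bd[OF b2])
   then obtain M2 where "\<forall>z. z \<in> cball 0 R \<times> {s..t} --> \<bar>onQ (wk k) z * slab s t \<xi> z\<bar> <= M2" ..
   note M2 = this[rule_format]
   have i1: "integrable lborel (\<lambda>z. onQ (wk k) z * slab s t (lap \<xi>) z)"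
    by (rule V_bounded_integrable(1)[OF _ h1(1) K h1(3) M1]) measurable
   have i2: "integrable lborel (\<lambda>z. V z * (onQ (wk k) z * slab s t \<xi> z))"
    by (rule V_bounded_integrable(2)[OF _ h2(1) K h2(3) M2]) measurable
   have i3: "integrable lborel (\<lambda>z. Vk k z * (onQ (wk k) z * slab s t \<xi> z))"
   proof (rule L1_bound[OF i2])
    show "(\<lambda>z. Vk k z * (onQ (wk k) z * slab s t \<xi> z)) \<in> borel_measurable lborel"
     using h2(1) by measurable
    show "AE z in lborel. norm (Vk k z * (onQ (wk k) z * slab s t \<xi> z)) <=
     norm (V z * (onQ (wk k) z * slab s t \<xi> z))"
     using Vk_le_V[of k] Vk_nonneg[of k] V_nonneg
     by (intro AE_I2) (simp only: real_norm_def abs_mult abs_of_nonneg, intro mult_right_mono, auto)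
   qed
   have wnn: "0 <= onQ (wk k) z" "onQ v z <= onQ (wk k) z" for z
    using wk_nonneg[of k z] v_bounds(4)[of z k] by (auto simp: onQ_def indicator_def)
   have hnn: "0 <= indicator {s..t} (snd z) * \<xi> (fst z)" for z :: "'a \<times> real" using \<xi>(2) by simp
   have i4: "integrable lborel (\<lambda>z. Vk k z * (onQ v z * slab s t \<xi> z))"
   proof (rule L1_bound[OF i3])
    show "(\<lambda>z. Vk k z * (onQ v z * slab s t \<xi> z)) \<in> borel_measurable lborel"
     using h2(1) by measurable
    show "AE z in lborel. norm (Vk k z * (onQ v z * slab s t \<xi> z)) <=
     norm (Vk k z * (onQ (wk k) z * slab s t \<xi> z))"
     using Vk_nonneg[of k] wnn onQ_bounds(3) hnn
     by (intro AE_I2) (simp only: real_norm_def abs_mult abs_of_nonneg, intro mult_left_mono mult_right_mono, auto)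
   qed
   have "(LBINT z. Vk k z * (onQ v z * slab s t \<xi> z))
    <= (LBINT z. Vk k z * (onQ (wk k) z * slab s t \<xi> z))"
    using Vk_nonneg[of k] wnn hnn by (intro integral_mono i3 i4 mult_left_mono mult_right_mono) auto
   also have "\<dots> <= (LBINT x. wk k (x, s) * \<xi> x) - (LBINT x. wk k (x, t) * \<xi> x)
     + (LBINT z. onQ (wk k) z * slab s t (lap \<xi>) z)"
   proof -
    \<comment> \<open>\<open>time_slice\<close> is stated for supersolutions, so it is applied to
      \<open>- wk k\<close>, which satisfies the heat equation with source
      \<open>Vk k * wk k\<close>.\<close>
    have "(LBINT z. indicator {s..t} (snd z) * ((- wk k z) * lap \<xi> (fst z) + (Vk k z * onQ (wk k) z) * \<xi> (fst z)))
     <= (LBINT x. - wk k (x, t) * \<xi> x) - (LBINT x. - wk k (x, s) * \<xi> x)"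
    proof (rule time_slice[OF _ _ _ _ \<xi>(1,2) compact_cball \<xi>(3) st(1,2) tT])
     show "continuous_on (Q_int T) (\<lambda>z. - wk k z)" by (intro continuous_intros continuous_wk)
     show "(\<lambda>z. Vk k z * onQ (wk k) z) \<in> borel_measurable borel" by measurable
     show "set_integrable lborel K (\<lambda>z. Vk k z * onQ (wk k) z)" if "compact K" "K \<subseteq> Q_int T" for K
      by (rule V_set_integrable(2)[where c = 1, OF continuous_wk _ that]) simp
     fix \<phi> :: "'a stfun" assume \<phi>: "test_function (Q_int T) \<phi>"
     obtain K where K: "K \<subseteq> Q_int T" "!!z. z \<notin> K ==> \<phi> z = 0" using \<phi> by (rule test_functionE) blast
     have "Vk k z * onQ (wk k) z * \<phi> z = Vk k z * wk k z * \<phi> z" for z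
     proof (cases "z \<in> K")
      case True
      then have "z \<in> Q_int T" using K(1) by blast
      then show ?thesis by (simp add: onQ_in)
     qed (simp add: K(2))
     then have "(LBINT z. Vk k z * onQ (wk k) z * \<phi> z) = (LBINT z. Vk k z * wk k z * \<phi> z)"
      by (intro lint_cong)
     then show "(LBINT z. Vk k z * onQ (wk k) z * \<phi> z) <= (LBINT z. - wk k z * adj_heat \<phi> z)"
      using wk_weak[OF \<phi>, of k] by simp
    qed
    also have "(LBINT z. indicator {s..t} (snd z) * ((- wk k z) * lap \<xi> (fst z) + (Vk k z * onQ (wk k) z) * \<xi> (fst z)))
     = (LBINT z. Vk k z * (onQ (wk k) z * slab s t \<xi> z) - onQ (wk k) z * slab s t (lap \<xi>) z)"
    proof (intro lint_cong)
     fix z :: "'a \<times> real"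
     show "indicator {s..t} (snd z) * ((- wk k z) * lap \<xi> (fst z) + (Vk k z * onQ (wk k) z) * \<xi> (fst z)) =
      Vk k z * (onQ (wk k) z * slab s t \<xi> z) - onQ (wk k) z * slab s t (lap \<xi>) z"
      using inQ[of z] by (cases "snd z \<in> {s..t}") (simp_all add: onQ_in algebra_simps)
    qed
    also have "\<dots> = (LBINT z. Vk k z * (onQ (wk k) z * slab s t \<xi> z))
     - (LBINT z. onQ (wk k) z * slab s t (lap \<xi>) z)"
     by (rule lint_diff[OF i3 i1])
    finally show ?thesis by simp
   qed
   \<comment> \<open>The mass at the upper time enters with a minus sign and is dropped.\<close>
   also have "\<dots> <= B2 * C2 - 0 + B1 * C1"
   proof (intro add_mono diff_mono)
    have sT: "s < T" using st tT by linarith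
    have "integrable lborel (\<lambda>x. wk k (x, s) * \<xi> x)"
     by (rule onQ_slice_integrable[OF continuous_wk st(1) sT c\<xi> compact_cball \<xi>(3)])
    then have m: "(\<lambda>x. wk k (x, s) * \<xi> x) \<in> borel_measurable borel" by auto
    have "(\<integral>\<^sup>+ x. ennreal \<bar>wk k (x, s) * \<xi> x\<bar> \<partial>lborel) <= ennreal (B2 * C2)"
     by (rule C2(2)[where k = k and t = s]) (use st B2 wk_nonneg in auto)
    then have "\<bar>\<integral>x. wk k (x, s) * \<xi> x \<partial>lborel\<bar> <= B2 * C2"
     using m B2(1) C2(1) by (intro integrable_from_nn_bound) auto
    then show "(LBINT x. wk k (x, s) * \<xi> x) <= B2 * C2" by linarith
    show "0 <= (LBINT x. wk k (x, t) * \<xi> x)"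
     by (intro lint_nonneg mult_nonneg_nonneg wk_nonneg \<xi>(2))
    have "\<bar>\<integral>z. onQ (wk k) z * slab s t (lap \<xi>) z \<partial>lborel\<bar> <= B1 * C1"
     by (rule C1(2)[where k = k]) (use st wnn B1 in \<open>auto simp: onQ_in\<close>)
    then show "(LBINT z. onQ (wk k) z * slab s t (lap \<xi>) z) <= B1 * C1" by linarith
   qed
   finally show ?thesis by simp
  qed
  obtain B where B: "!!z::'a \<times> real. \<bar>slab s t \<xi> z\<bar> <= B" using h2(2) by blast
  note iV = onQ_limit(4)[OF h2(1) B K h2(3)]
  \<comment> \<open>On a fixed slab V v \<xi> is integrable, since V is essentially bounded and v
    \<le> u is bounded there; it dominates the truncated integrands, so the bound survives k
    \<rightarrow> \<infinity>.\<close>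
  have "(\<lambda>k. LBINT z. Vk k z * (onQ v z * slab s t \<xi> z))
   \<longlonglongrightarrow> (LBINT z. V z * (onQ v z * slab s t \<xi> z))"
  proof (rule integral_dominated_convergence[OF _ _ integrable_abs[OF iV]])
   show "AE z in lborel. (\<lambda>k. Vk k z * (onQ v z * slab s t \<xi> z)) \<longlonglongrightarrow> V z * (onQ v z * slab s t \<xi> z)"
    by (intro AE_I2 tendsto_mult Vk_lim tendsto_const)
   have "\<bar>Vk k z * q\<bar> <= \<bar>V z * q\<bar>" for k z q
    using Vk_le_V[of k z] Vk_nonneg[of k z] V_nonneg[of z] by (simp add: abs_mult mult_right_mono)
   then show "AE z in lborel. norm (Vk k z * (onQ v z * slab s t \<xi> z)) <= \<bar>V z * (onQ v z * slab s t \<xi> z)\<bar>" for k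
    by simp
   show "(\<lambda>z. V z * (onQ v z * slab s t \<xi> z)) \<in> borel_measurable lborel" using iV by auto
   show "(\<lambda>z. Vk k z * (onQ v z * slab s t \<xi> z)) \<in> borel_measurable lborel" for k
    using h2(1) by measurable
  qed
  then show "(LBINT z. V z * (onQ v z * slab s t \<xi> z)) <= B2 * C2 + B1 * C1"
   by (rule LIMSEQ_le_const2) (use fin in auto)
 qed
qed

end

section \<open>Existence of the initial trace\<close>

context min_solution
begin

text \<open>With \<open>H s t\<close> the total possible loss on the slab from s to t, the quantity
  \<open>A s - H s t0\<close> is nondecreasing in s and bounded below, so it converges as s tends to
  0; so does \<open>H s t0\<close>, being monotone and bounded.\<close>

lemma smooth_trace_exists:
 assumes \<xi>: "smooth \<xi>" "!!x. 0 <= \<xi> x" "!!x. x \<notin> cball 0 R ==> \<xi> x = 0"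
 shows "\<exists>l. ((\<lambda>t. LBINT x. onQ v (x, t) * \<xi> x) \<longlongrightarrow> l) (at_right 0)"
proof -
 define A where "A t = (LBINT x. onQ v (x, t) * \<xi> x)" for t
 have c\<xi>: "continuous_on UNIV \<xi>" by (rule smooth_continuous[OF \<xi>(1)])
 have cl: "continuous_on UNIV (lap \<xi>)" by (rule continuous_lap[OF \<xi>(1)])
 have lo: "\<bar>lap \<xi> x\<bar> = 0" "lap \<xi> x = 0" if "x \<notin> cball 0 R" for x using lap_zero_off[OF compact_cball \<xi>(3) that] by auto
 have cal: "continuous_on UNIV (\<lambda>x. \<bar>lap \<xi> x\<bar>)" by (intro continuous_intros cl)
 obtain B1 where B1: "B1 \<ge> 0" "!!x. \<bar>\<bar>lap \<xi> x\<bar>\<bar> <= B1 * indicator (cball 0 R) x" using slab_function(2)[OF cal lo(1)] by blast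
 obtain C1 where C1: "0 <= C1"
  "!!k s t p g B. 0 < s ==> s <= t ==> t <= T / 4 ==> p \<in> borel_measurable borel ==> (!!z. 0 <= p z) ==>
    (!!z. z \<in> Q_int T ==> p z <= wk k z) ==>
    g \<in> borel_measurable borel ==> 0 <= B ==> (!!x. \<bar>g x\<bar> <= B * indicator (cball 0 R) x) ==>
    \<bar>\<integral>z. p z * slab s t g z \<partial>lborel\<bar> <= B * C1" using slab_bounds[of R] by blast
 obtain D where D: "!!s t. 0 < s ==> s < t ==> t <= T / 4 ==>
  (LBINT z. V z * (onQ v z * slab s t \<xi> z)) <= D"
  using absorption_bound[OF \<xi>] by blast
 define HV where "HV s t = (LBINT z. V z * (onQ v z * slab s t \<xi> z))" for s t :: real
 \<comment> \<open>Taking the modulus of the Laplacian keeps the slab integral nonnegative, hence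
   monotone in the slab, while its negative still bounds the signed integral from below.\<close>
 define HL where "HL s t = (LBINT z. onQ v z * (indicator {s..t} (snd z) * \<bar>lap \<xi> (fst z)\<bar>))" for s t :: real
 define H where "H s t = HV s t + HL s t" for s t
 let ?t0 = "T / 4"
 have t0: "0 < ?t0" "?t0 < T" using T by auto
 have slab: "integrable lborel (\<lambda>z. onQ v z * slab s t g z)"
   "integrable lborel (\<lambda>z. V z * (onQ v z * slab s t g z))"
  if "0 < s" "t < T" "continuous_on UNIV g" "!!x. x \<notin> cball 0 R ==> g x = 0" for s t g
 proof -
  note h = slab_function[where R = R and s = s and t = t, OF that(3,4)]
  obtain B where B: "!!z::'a \<times> real. \<bar>slab s t g z\<bar> <= B" using h(2) by blast
  note l = onQ_limit[OF h(1) B slab_compact[OF that(1,2), of R] h(3)]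
  show "integrable lborel (\<lambda>z. onQ v z * slab s t g z)" by (rule l(3))
  show "integrable lborel (\<lambda>z. V z * (onQ v z * slab s t g z))" by (rule l(4))
 qed
 have split: "(LBINT z. p z * slab s ?t0 g z) =
   (LBINT z. p z * slab s t g z) + (LBINT z. p z * slab t ?t0 g z)"
  if st: "0 < s" "s < t" "t < ?t0"
   and i: "integrable lborel (\<lambda>z. p z * slab s t g z)"
   "integrable lborel (\<lambda>z. p z * slab t ?t0 g z)"
   "integrable lborel (\<lambda>z. p z * slab s ?t0 g z)"
  for p :: "'a stfun" and g s t
 proof -
  have "(LBINT z. p z * slab s ?t0 g z)
   = (LBINT z. p z * slab s t g z + p z * slab t ?t0 g z)"
  proof (rule integral_cong_AE)
   show "AE z in lborel. p z * slab s ?t0 g z =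
     p z * slab s t g z + p z * slab t ?t0 g z"
    \<comment> \<open>The two closed time intervals overlap at t, which is a null hyperplane of
      space-time.\<close>
    using AE_snd_neq[of t]
   proof eventually_elim
    case (elim z)
    have "indicator {s..?t0} (snd z) = (indicator {s..t} (snd z) + indicator {t..?t0} (snd z) :: real)"
     using elim st by (auto simp: indicator_def)
    then show ?case by (simp add: algebra_simps)
   qed
  qed (use i in auto)
  also have "\<dots> = (LBINT z. p z * slab s t g z) + (LBINT z. p z * slab t ?t0 g z)"
   by (rule lint_add[OF i(1,2)])
  finally show ?thesis .
 qed
 have Hs: "H s ?t0 = H s t + H t ?t0" if st: "0 < s" "s < t" "t < ?t0" for s t
 proof -
  have tT: "0 < t" "t < T" using st t0 by auto
  have 1: "HL s ?t0 = HL s t + HL t ?t0"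
   unfolding HL_def by (intro split st slab(1) tT t0 cal lo)
  have 2: "HV s ?t0 = HV s t + HV t ?t0"
   using split[OF st, of "\<lambda>z. V z * onQ v z" \<xi>] slab(2)[OF _ _ c\<xi> \<xi>(3)] st tT t0
   unfolding HV_def mult.assoc by auto
  show ?thesis using 1 2 by (simp add: H_def)
 qed
 have Hn: "0 <= H s t" for s t
  unfolding H_def HV_def HL_def using V_nonneg onQ_bounds(3) \<xi>(2)
  by (intro add_nonneg_nonneg lint_nonneg mult_nonneg_nonneg) auto
 have Hb: "H s ?t0 <= D + B1 * C1" if s: "0 < s" "s < ?t0" for s
 proof -
  have "\<bar>HL s ?t0\<bar> <= B1 * C1"
   unfolding HL_def
  proof (rule C1(2)[where k = 0])
   show "(\<lambda>x. \<bar>lap \<xi> x\<bar>) \<in> borel_measurable borel" by (rule borel_measurable_continuous_onI[OF cal])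
  qed (use s B1 onQ_bounds(3) v_bounds(4) in \<open>auto simp: onQ_in\<close>)
  then show ?thesis using D[OF s] unfolding H_def HV_def by linarith
 qed
 have As: "A s - H s ?t0 <= A t - H t ?t0" if st: "0 < s" "s < t" "t < ?t0" for s t
 proof -
  have tT: "t < T" using st t0 by auto
  have "- HL s t <= (LBINT z. onQ v z * slab s t (lap \<xi>) z)"
  proof -
   have "- HL s t = (LBINT z. - (onQ v z * (indicator {s..t} (snd z) * \<bar>lap \<xi> (fst z)\<bar>)))"
    by (simp add: HL_def)
   also have "\<dots> <= (LBINT z. onQ v z * slab s t (lap \<xi>) z)"
   proof (rule integral_mono)
    show "integrable lborel (\<lambda>z. - (onQ v z * (indicator {s..t} (snd z) * \<bar>lap \<xi> (fst z)\<bar>)))"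
     by (intro Bochner_Integration.integrable_minus slab(1)[OF st(1) tT cal lo(1)])
    show "integrable lborel (\<lambda>z. onQ v z * slab s t (lap \<xi>) z)"
     by (rule slab(1)[OF st(1) tT cl lo(2)])
    show "- (onQ v z * (indicator {s..t} (snd z) * \<bar>lap \<xi> (fst z)\<bar>)) <= onQ v z * slab s t (lap \<xi>) z" for z
    proof -
     have "onQ v z * (indicator {s..t} (snd z) * (- \<bar>lap \<xi> (fst z)\<bar>)) <= onQ v z * slab s t (lap \<xi>) z"
      using onQ_bounds(3) by (intro mult_left_mono) auto
     then show ?thesis by simp
    qed
   qed
   finally show ?thesis .
  qed
  moreover have "(LBINT z. onQ v z * slab s t (lap \<xi>) z) - HV s t <= A t - A s"
   unfolding HV_def A_def by (rule vk_slice[OF \<xi> st(1,2) tT])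
  ultimately have "- H s t <= A t - A s" unfolding H_def by linarith
  then show ?thesis using Hs[OF st] by linarith
 qed
 have An: "0 <= A t" for t
  unfolding A_def using onQ_bounds(3) \<xi>(2) by (intro lint_nonneg mult_nonneg_nonneg) auto
 \<comment> \<open>The two monotone quantities \<open>A s - H s ?t0\<close> and
   \<open>- H s ?t0\<close> have limits separately, and \<open>A\<close> is their
   difference.\<close>
 obtain l1 where l1: "((\<lambda>s. A s - H s ?t0) \<longlongrightarrow> l1) (at_right 0)"
  using monotone_bounded_limit_at_right[OF t0(1), of "\<lambda>s. A s - H s ?t0" "- (D + B1 * C1)"] As An Hb by (smt (verit))
 obtain l2 where l2: "((\<lambda>s. - H s ?t0) \<longlongrightarrow> l2) (at_right 0)"
  using monotone_bounded_limit_at_right[OF t0(1), of "\<lambda>s. - H s ?t0" "- (D + B1 * C1)"] Hs Hn Hb by (smt (verit))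
 have "((\<lambda>s. (A s - H s ?t0) - (- H s ?t0)) \<longlongrightarrow> l1 - l2) (at_right 0)" by (intro tendsto_diff l1 l2)
 then have "(A \<longlongrightarrow> l1 - l2) (at_right 0)" by simp
 then show ?thesis unfolding A_def by blast
qed

text \<open>For small times the slices of \<open>v\<close> are functionals on functions supported in
  a fixed ball, bounded in the sup norm uniformly in t. This stability extends the trace from smooth
  to continuous test functions.\<close>

lemma v_average:
 fixes R :: real
 shows "\<exists>C\<ge>0. \<forall>t g B. 0 < t --> t <= T / 4 --> g \<in> borel_measurable borel --> 0 <= B --> (\<forall>x. \<bar>g x\<bar> <= B * indicator (cball 0 R) x) -->
    integrable lborel (\<lambda>x. onQ v (x, t) * g x) \<and> \<bar>\<integral>x. onQ v (x, t) * g x \<partial>lborel\<bar> <= B * C"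
proof -
 obtain C where C: "0 <= C"
  "!!k t p g B. 0 < t ==> t <= T / 4 ==> (!!x. 0 <= p x) ==> (!!x. p x <= wk k (x, t)) ==>
    0 <= B ==> (!!x. \<bar>g x\<bar> <= B * indicator (cball 0 R) x) ==>
    (\<integral>\<^sup>+ x. ennreal \<bar>p x * g x\<bar> \<partial>lborel) <= ennreal (B * C)" using average_bounds[of R] by blast
 show ?thesis
 proof (intro exI[of _ C] conjI C(1) allI impI)
  fix t B :: real and g :: "'a => real"
  assume t: "0 < t" "t <= T / 4" and gm [measurable]: "g \<in> borel_measurable borel" and B: "0 <= B" and gB: "\<forall>x. \<bar>g x\<bar> <= B * indicator (cball 0 R) x"
  have zt: "(x, t) \<in> Q_int T" for x :: 'a using t T by (auto simp: Q_int_def)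
  have p: "0 <= onQ v (x, t)" "onQ v (x, t) <= wk 0 (x, t)" for x
   by (rule onQ_bounds(3)) (simp only: onQ_in[OF zt] v_bounds(4)[OF zt])
  have nn: "(\<integral>\<^sup>+ x. ennreal \<bar>onQ v (x, t) * g x\<bar> \<partial>lborel) <= ennreal (B * C)"
   by (rule C(2)[OF t p B gB[rule_format]])
  have m: "(\<lambda>x. onQ v (x, t) * g x) \<in> borel_measurable borel" by measurable
  have BC: "0 <= B * C" using B C(1) by simp
  show "integrable lborel (\<lambda>x. onQ v (x, t) * g x)" "\<bar>\<integral>x. onQ v (x, t) * g x \<partial>lborel\<bar> <= B * C"
   using integrable_from_nn_bound[OF m nn BC] by blast+
 qed
qed

lemma Cc_indicator_bound:
 fixes f :: "'a => real"
 assumes "Cc f"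
 obtains B R where "0 <= B" "0 < R" "!!x. \<bar>f x\<bar> <= B * indicator (cball 0 R) x" "!!x. x \<notin> cball 0 R ==> f x = 0"
proof -
 obtain R where R: "R > 0" "!!x. x \<notin> cball 0 R ==> f x = 0" using Cc_ball[OF assms] by blast
 obtain B where B: "B \<ge> 0" "!!x. \<bar>f x\<bar> <= B" using Cc_bounded[OF assms] by blast
 have "\<bar>f x\<bar> <= B * indicator (cball 0 R) x" for x using B(2)[of x] R(2)[of x] by (auto simp: indicator_def)
 then show ?thesis using that B R by blast
qed

lemma v_slice_integrable:
 assumes "Cc f" "0 < t" "t <= T / 4"
 shows "integrable lborel (\<lambda>x. onQ v (x, t) * f x)"
proof -
 obtain B R where BR: "0 <= B" "0 < R" "!!x. \<bar>f x\<bar> <= B * indicator (cball 0 R) x" by (rule Cc_indicator_bound[OF assms(1)]) (rule that)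
 obtain C where C0: "0 <= C" and Ca:
  "\<forall>t g B. 0 < t --> t <= T / 4 --> g \<in> borel_measurable borel --> 0 <= B --> (\<forall>x. \<bar>g x\<bar> <= B * indicator (cball 0 R) x) -->
    integrable lborel (\<lambda>x. onQ v (x, t) * g x) \<and> \<bar>\<integral>x. onQ v (x, t) * g x \<partial>lborel\<bar> <= B * C"
  using v_average[of R] by (elim exE conjE) (rule that)
 note C = C0 Ca[rule_format]
 show ?thesis using C(2)[OF assms(2,3) Cc_measurable[OF assms(1)] BR(1,3)] by blast
qed

lemma eventually_small: "\<forall>\<^sub>F t in at_right (0::real). 0 < t \<and> t <= T / 4"
 unfolding eventually_at_right_field using T by (intro exI[of _ "T / 4"]) auto

text \<open>The test function is mollified; the uniform error is paid for by the mass of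
  \<open>v\<close> over a slightly larger ball, uniformly for small t.\<close>

lemma nonneg_trace_exists:
 assumes f: "Cc f" "!!x. 0 <= f x"
 shows "\<exists>l. ((\<lambda>t. LBINT x. onQ v (x, t) * f x) \<longlongrightarrow> l) (at_right 0)"
proof (rule limit_if_approximable)
 fix e :: real assume e: "0 < e"
 obtain B R where BR: "0 <= B" "0 < R" "!!x. \<bar>f x\<bar> <= B * indicator (cball 0 R) x" "!!x. x \<notin> cball 0 R ==> f x = 0"
  by (rule Cc_indicator_bound[OF f(1)]) (rule that)
 obtain C where C0: "0 <= C" and Ca:
  "\<forall>t g B. 0 < t --> t <= T / 4 --> g \<in> borel_measurable borel --> 0 <= B --> (\<forall>x. \<bar>g x\<bar> <= B * indicator (cball 0 (R + 1)) x) -->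
    integrable lborel (\<lambda>x. onQ v (x, t) * g x) \<and> \<bar>\<integral>x. onQ v (x, t) * g x \<partial>lborel\<bar> <= B * C"
  using v_average[of "R + 1"] by (elim exE conjE) (rule that)
 note C = C0 Ca[rule_format]
 have cf: "continuous_on UNIV f" using f(1) by (simp add: Cc_def)
 \<comment> \<open>\<open>C\<close> bounds the mass of \<open>v\<close> over the ball of radius R +
   1, so a uniform error e/(C + 1) costs at most e; the radius R + 1 leaves room for mollification
   at scale r \<le> 1.\<close>
 have e': "0 < e / (C + 1)" using e C(1) by simp
 obtain d where d: "d > 0" "!!a b. norm (b - a) < d ==> \<bar>f b - f a\<bar> < e / (C + 1)"
  by (rule uniformly_continuous_compact_support[OF cf compact_cball[of 0 R] BR(4) e']) (assumption, blast)
 define r where "r = min (d / 2) 1"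
 have r: "0 < r" "r < d" "r <= 1" using d(1) by (auto simp: r_def)
 have fi: "integrable lborel f" by (rule integrable_compact_support[OF cf compact_cball BR(4)])
 define g where "g = conv f (moll r)"
 have mo: "moll r z = 0" if "z \<notin> cball 0 r" for z :: 'a using that by (rule moll_eq_0[OF r(1)])
 have sg: "smooth g" unfolding g_def by (rule smooth_conv[OF fi smooth_moll[OF r(1)] compact_cball mo])
 have g0: "0 <= g x" for x
  unfolding g_def conv_def using f(2) moll_nonneg[OF r(1)] by (intro lint_nonneg mult_nonneg_nonneg) auto
 have goff: "g x = 0" if "x \<notin> cball 0 (R + 1)" for x
 proof -
  have "f \<zeta> * moll r (x - \<zeta>) = 0" for \<zeta>
  proof (cases "\<zeta> \<in> cball 0 R")
   case True
   then have "x - \<zeta> \<notin> cball 0 r" using that r(3) norm_triangle_ineq[of "x - \<zeta>" \<zeta>] by auto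
   then show ?thesis by (simp add: mo)
  qed (simp add: BR(4))
  then have "(\<lambda>\<zeta>. f \<zeta> * moll r (x - \<zeta>)) = (\<lambda>_. 0)" by (rule ext)
  then show ?thesis by (simp add: g_def conv_def)
 qed
 have close: "\<bar>f x - g x\<bar> <= e / (C + 1)" for x
 proof -
  have "\<bar>conv f (moll r) x - f x\<bar> <= e / (C + 1)"
  proof (rule conv_moll_close[OF r(1) fi])
   fix \<zeta> assume "norm (\<zeta> - x) <= r"
   then have "norm (\<zeta> - x) < d" using r(2) by linarith
   then show "\<bar>f \<zeta> - f x\<bar> <= e / (C + 1)" using d(2)[of \<zeta> x] by linarith
  qed
  then show ?thesis by (simp add: g_def abs_minus_commute)
 qed
 have Ccg: "Cc g" by (rule CcI[OF smooth_continuous[OF sg] compact_cball goff])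
 obtain l where l: "((\<lambda>t. LBINT x. onQ v (x, t) * g x) \<longlongrightarrow> l) (at_right 0)"
  using smooth_trace_exists[OF sg g0 goff] by blast
 have "\<forall>\<^sub>F t in at_right 0. \<bar>(LBINT x. onQ v (x, t) * f x) - (LBINT x. onQ v (x, t) * g x)\<bar> <= e"
  using eventually_small
 proof eventually_elim
  case (elim t)
  have "(LBINT x. onQ v (x, t) * f x) - (LBINT x. onQ v (x, t) * g x) = (LBINT x. onQ v (x, t) * (f x - g x))"
   using v_slice_integrable[OF f(1), of t] v_slice_integrable[OF Ccg, of t] elim
   by (simp add: right_diff_distrib)
  also have "\<bar>\<dots>\<bar> <= e / (C + 1) * C"
  proof -
   have "\<bar>f x - g x\<bar> <= e / (C + 1) * indicator (cball 0 (R + 1)) x" for x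
    using close[of x] goff[of x] BR(2) BR(4)[of x] by (auto simp: indicator_def)
   then show ?thesis
    using C(2)[of t "\<lambda>x. f x - g x" "e / (C + 1)"] elim e' Cc_measurable[OF f(1)] Cc_measurable[OF Ccg] by auto
  qed
  also have "\<dots> <= e" using e C(1) by (simp add: field_simps)
  finally show ?case .
 qed
 with l show "\<exists>g l. (g \<longlongrightarrow> l) (at_right 0) \<and> (\<forall>\<^sub>F t in at_right 0. \<bar>(LBINT x. onQ v (x, t) * f x) - g t\<bar> <= e)"
  by blast
qed simp

text \<open>Split f into its positive and negative parts, which are again continuous with compact
  support.\<close>

lemma trace_exists:
 assumes f: "Cc f"
 shows "\<exists>l. ((\<lambda>t. LBINT x. onQ v (x, t) * f x) \<longlongrightarrow> l) (at_right 0)"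
proof -
 let ?p = "\<lambda>x. (1 / 2) * (\<bar>f x\<bar> + f x)" and ?n = "\<lambda>x. (1 / 2) * (\<bar>f x\<bar> - f x)"
 have c: "Cc ?p" "Cc ?n" by (intro Cc_cmult Cc_add Cc_diff Cc_abs f)+
 have nn: "0 <= ?p x" "0 <= ?n x" for x by (auto simp: abs_if)
 obtain a where a: "((\<lambda>t. LBINT x. onQ v (x, t) * ?p x) \<longlongrightarrow> a) (at_right 0)" using nonneg_trace_exists[OF c(1) nn(1)] by blast
 obtain b where b: "((\<lambda>t. LBINT x. onQ v (x, t) * ?n x) \<longlongrightarrow> b) (at_right 0)" using nonneg_trace_exists[OF c(2) nn(2)] by blast
 have "((\<lambda>t. LBINT x. onQ v (x, t) * f x) \<longlongrightarrow> a - b) (at_right 0)"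
 proof (rule Lim_transform_eventually[OF tendsto_diff[OF a b]])
  show "\<forall>\<^sub>F t in at_right 0. (LBINT x. onQ v (x, t) * ?p x) - (LBINT x. onQ v (x, t) * ?n x) = (LBINT x. onQ v (x, t) * f x)"
   using eventually_small
  proof eventually_elim
   case (elim t)
   have "(LBINT x. onQ v (x, t) * ?p x) - (LBINT x. onQ v (x, t) * ?n x) = (LBINT x. onQ v (x, t) * ?p x - onQ v (x, t) * ?n x)"
    using elim by (intro lint_diff[symmetric] v_slice_integrable c) auto
   also have "\<dots> = (LBINT x. onQ v (x, t) * f x)"
    by (intro lint_cong) (simp add: field_simps)
   finally show ?case .
  qed
 qed
 then show ?thesis by blast
qed

text \<open>Compare \<open>v\<close> with \<open>wk 0\<close>. By Fubini its slice integral is the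
  \<mu>-integral of the kernel averages \<open>h t y\<close>, and these tend to f y.\<close>

lemma trace_le:
 assumes f: "Cc f" "!!x. 0 <= f x" and l: "((\<lambda>t. LBINT x. onQ v (x, t) * f x) \<longlongrightarrow> l) (at_right 0)"
 shows "l <= (\<integral>x. f x \<partial>\<mu>)"
proof -
 interpret P: pair_sigma_finite \<mu> "lborel :: 'a measure" ..
 obtain B R where BR: "0 <= B" "0 < R" "!!x. \<bar>f x\<bar> <= B * indicator (cball 0 R) x"
  by (rule Cc_indicator_bound[OF f(1)]) (rule that)
 have fB: "\<bar>f x\<bar> <= B" for x using BR(1) BR(3)[of x] by (cases "x \<in> cball 0 R") auto
 have cf: "continuous_on UNIV f" using f(1) by (simp add: Cc_def)
 note fm [measurable] = Cc_measurable[OF f(1)]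
 obtain C where C: "C > 0" "!!(y::'a) t. 0 < t ==> t <= T / 4 ==>
   (\<integral>\<^sup>+ x. indicator (cball 0 R) x * ennreal (hk (x - y, t)) \<partial>lborel) <= ennreal (C * exp (- (norm y)\<^sup>2 / (4 * T)))"
  by (rule heat_average_bound[OF T, where 'a='a]) (rule that)
 define h where "h t y = (LBINT x. KK 0 y (x, t) * f x)" for t y
 have m: "sets (\<mu> \<Otimes>\<^sub>M lborel) = sets (borel :: ('a \<times> 'a) measure)"
  by (subst borel_prod[symmetric]) (intro sets_pair_measure_cong sets_mu sets_lborel)
 have Km: "(\<lambda>p. KK 0 (fst p) (snd p, t) * f (snd p)) \<in> borel_measurable (\<mu> \<Otimes>\<^sub>M lborel)" for t
 proof (intro borel_measurable_times)
  have "(\<lambda>p::'a \<times> 'a. (fst p, (snd p, t))) \<in> borel_measurable borel"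
   by (intro borel_measurable_continuous_onI continuous_intros)
  from measurable_compose[OF this KK_measurable, of 0]
  show "(\<lambda>p. KK 0 (fst p) (snd p, t)) \<in> borel_measurable (\<mu> \<Otimes>\<^sub>M lborel)" by (simp add: measurable_cong_sets[OF m refl])
  show "(\<lambda>p. f (snd p)) \<in> borel_measurable (\<mu> \<Otimes>\<^sub>M lborel)"
   by (rule measurable_compose[OF measurable_snd]) simp
 qed
 have hm: "h t \<in> borel_measurable \<mu>" for t
  unfolding h_def[abs_def] by (rule lborel.borel_measurable_lebesgue_integral) (use Km[of t] in \<open>simp add: case_prod_beta'\<close>)
 have h0: "0 <= h t y" for t y
  unfolding h_def by (intro lint_nonneg mult_nonneg_nonneg KK_nonneg f(2))
 have hnn: "(\<integral>\<^sup>+ x. ennreal (KK 0 y (x, t) * f x) \<partial>lborel) = ennreal (h t y)" if "0 < t" for t y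
  unfolding h_def by (intro nn_integral_eq_integral KK_trace(1)[OF cf fB] that AE_I2 mult_nonneg_nonneg KK_nonneg f(2))
 have hb: "h t y <= B * C * E y" if t: "0 < t" "t <= T / 4" for t y
 proof -
  have "ennreal (h t y) <= (\<integral>\<^sup>+ x. ennreal B * (indicator (cball 0 R) x * ennreal (hk (x - y, t))) \<partial>lborel)"
   unfolding hnn[OF t(1), symmetric]
  proof (rule nn_integral_mono)
   fix x
   have "KK 0 y (x, t) * f x <= hk (x - y, t) * (B * indicator (cball 0 R) x)"
    using KK_le[of 0 y "(x, t)"] KK_nonneg BR(3)[of x] f(2) hk_nonneg by (intro mult_mono) auto
   then have "ennreal (KK 0 y (x, t) * f x) <= ennreal (B * (indicator (cball 0 R) x * hk (x - y, t)))"
    by (intro ennreal_leI) (simp add: mult_ac)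
   also have "\<dots> = ennreal B * (indicator (cball 0 R) x * ennreal (hk (x - y, t)))"
    by (cases "x \<in> cball 0 R") (simp_all add: ennreal_mult[OF BR(1) hk_nonneg])
   finally show "ennreal (KK 0 y (x, t) * f x) <= ennreal B * (indicator (cball 0 R) x * ennreal (hk (x - y, t)))" .
  qed
  also have "\<dots> = ennreal B * (\<integral>\<^sup>+ x. indicator (cball 0 R) x * ennreal (hk (x - y, t)) \<partial>lborel)"
  proof (rule nn_integral_cmult)
   have "(\<lambda>x::'a. (x - y, t)) \<in> borel_measurable borel" by (intro borel_measurable_continuous_onI continuous_intros)
   then have "(\<lambda>x::'a. hk (x - y, t)) \<in> borel_measurable borel" by measurable
   then show "(\<lambda>x. indicator (cball 0 R) x * ennreal (hk (x - y, t))) \<in> borel_measurable lborel"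
    by (intro borel_measurable_times_ennreal measurable_compose[OF _ measurable_ennreal]) (auto intro: borel_measurable_indicator)
  qed
  also have "\<dots> <= ennreal B * ennreal (C * E y)" unfolding E_def by (intro mult_left_mono C(2) t) simp
  also have "\<dots> = ennreal (B * C * E y)" using BR(1) C(1) E_pos[of y] by (simp add: ennreal_mult mult.assoc)
  finally show ?thesis using BR(1) C(1) E_pos[of y] by (subst (asm) ennreal_le_iff) auto
 qed
 have iE: "integrable \<mu> (\<lambda>y. B * C * E y)" using E_integrable by simp
 have hi: "integrable \<mu> (h t)" if t: "0 < t" "t <= T / 4" for t
  by (rule L1_bound[OF iE hm]) (use hb[OF t] h0[of t] in \<open>auto simp: abs_of_nonneg intro!: AE_I2 order_trans[OF _ abs_ge_self]\<close>)
 \<comment> \<open>The averages converge pointwise by the trace of each kernel and are dominated by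
   a multiple of the weight \<open>E\<close>, so dominated convergence applies in \<mu>.\<close>
 have lim: "((\<lambda>t. \<integral>y. h t y \<partial>\<mu>) \<longlongrightarrow> (\<integral>y. f y \<partial>\<mu>)) (at_right 0)"
 proof (rule integral_dominated_convergence_at_right[OF _ hm iE])
  show "f \<in> borel_measurable \<mu>" using fm by (simp add: measurable_cong_sets[OF sets_mu refl])
  show "AE y in \<mu>. ((\<lambda>t. h t y) \<longlongrightarrow> f y) (at_right 0)" unfolding h_def by (rule AE_I2, rule KK_trace(2)[OF cf fB])
  show "\<forall>\<^sub>F t in at_right 0. AE y in \<mu>. norm (h t y) <= B * C * E y"
   using eventually_small by eventually_elim (use hb h0 in \<open>auto simp: abs_of_nonneg\<close>)
 qed
 have "\<forall>\<^sub>F t in at_right 0. (LBINT x. onQ v (x, t) * f x) <= (\<integral>y. h t y \<partial>\<mu>)"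
  using eventually_small
 proof eventually_elim
  case (elim t)
  then have t: "0 < t" "t <= T / 4" by auto
  have zt: "(x, t) \<in> Q_int T" for x :: 'a using t T by (auto simp: Q_int_def)
  have "ennreal (LBINT x. onQ v (x, t) * f x) = (\<integral>\<^sup>+ x. ennreal (onQ v (x, t) * f x) \<partial>lborel)"
   by (intro nn_integral_eq_integral[symmetric] v_slice_integrable f(1) t AE_I2 mult_nonneg_nonneg onQ_bounds f(2))
  also have "\<dots> <= (\<integral>\<^sup>+ x. (\<integral>\<^sup>+ y. ennreal (KK 0 y (x, t) * f x) \<partial>\<mu>) \<partial>lborel)"
  proof (rule nn_integral_mono)
   fix x
   have "onQ v (x, t) * f x <= wk 0 (x, t) * f x"
    using v_bounds(4)[OF zt] f(2) by (intro mult_right_mono) (auto simp: onQ_in[OF zt])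
   also have "\<dots> = (\<integral>y. KK 0 y (x, t) * f x \<partial>\<mu>)" by (simp add: wk_def)
   finally have "ennreal (onQ v (x, t) * f x) <= ennreal (\<integral>y. KK 0 y (x, t) * f x \<partial>\<mu>)" by (rule ennreal_leI)
   also have "\<dots> = (\<integral>\<^sup>+ y. ennreal (KK 0 y (x, t) * f x) \<partial>\<mu>)"
    by (intro nn_integral_eq_integral[symmetric] integrable_mult_left KK_mu_integrable zt AE_I2 mult_nonneg_nonneg KK_nonneg f(2))
   finally show "ennreal (onQ v (x, t) * f x) <= (\<integral>\<^sup>+ y. ennreal (KK 0 y (x, t) * f x) \<partial>\<mu>)" .
  qed
  also have "\<dots> = (\<integral>\<^sup>+ y. (\<integral>\<^sup>+ x. ennreal (KK 0 y (x, t) * f x) \<partial>lborel) \<partial>\<mu>)"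
  proof (rule P.Fubini')
   show "(\<lambda>(y, x). ennreal (KK 0 y (x, t) * f x)) \<in> borel_measurable (\<mu> \<Otimes>\<^sub>M lborel)"
    using measurable_compose[OF Km[of t] measurable_ennreal] by (simp add: case_prod_beta')
  qed
  also have "\<dots> = (\<integral>\<^sup>+ y. ennreal (h t y) \<partial>\<mu>)" by (simp add: hnn[OF t(1)])
  also have "\<dots> = ennreal (\<integral>y. h t y \<partial>\<mu>)" by (intro nn_integral_eq_integral hi t AE_I2 h0)
  finally show ?case
   using h0 by (subst (asm) ennreal_le_iff) (auto intro!: lint_nonneg)
 qed
 then show ?thesis by (intro tendsto_le[OF _ lim l]) auto
qed

lemma trace_measure:
 obtains \<gamma> where "radon_measure \<gamma>" "\<gamma> <= \<mu>"
  "!!f. Cc f ==> ((\<lambda>t. LBINT x. onQ v (x, t) * f x) \<longlongrightarrow> (\<integral>x. f x \<partial>\<gamma>)) (at_right 0)"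
proof -
 define L where "L f = Lim (at_right 0) (\<lambda>t. LBINT x. onQ v (x, t) * f x)" for f
 have L: "((\<lambda>t. LBINT x. onQ v (x, t) * f x) \<longlongrightarrow> L f) (at_right 0)" if f: "Cc f" for f
 proof -
  obtain l where l: "((\<lambda>t. LBINT x. onQ v (x, t) * f x) \<longlongrightarrow> l) (at_right 0)" using trace_exists[OF f] by blast
  then have "L f = l" unfolding L_def by (intro tendsto_Lim) auto
  then show ?thesis using l by simp
 qed
 have "L (\<lambda>x. f x + g x) = L f + L g" if fg: "Cc f" "Cc g" for f g
 proof (rule tendsto_unique[OF _ L[OF Cc_add[OF fg]]])
  show "((\<lambda>t. LBINT x. onQ v (x, t) * (f x + g x)) \<longlongrightarrow> L f + L g) (at_right 0)"
  proof (rule Lim_transform_eventually[OF tendsto_add[OF L[OF fg(1)] L[OF fg(2)]]])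
   show "\<forall>\<^sub>F t in at_right 0. (LBINT x. onQ v (x, t) * f x) + (LBINT x. onQ v (x, t) * g x) = (LBINT x. onQ v (x, t) * (f x + g x))"
    using eventually_small
    by eventually_elim (use v_slice_integrable fg in \<open>simp add: distrib_left\<close>)
  qed
 qed simp
 moreover have "L (\<lambda>x. c * f x) = c * L f" if f: "Cc f" for f c
 proof (rule tendsto_unique[OF _ L[OF Cc_cmult[OF f]]])
  have "((\<lambda>t. c * (LBINT x. onQ v (x, t) * f x)) \<longlongrightarrow> c * L f) (at_right 0)" by (intro tendsto_intros L f)
  then show "((\<lambda>t. LBINT x. onQ v (x, t) * (c * f x)) \<longlongrightarrow> c * L f) (at_right 0)"
   by (simp add: mult.left_commute[of _ c])
 qed simp
 moreover have "0 <= L f" if f: "Cc f" "!!x. 0 <= f x" for f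
  using f(2) onQ_bounds(3)
  by (intro tendsto_lowerbound[OF L[OF f(1)]] always_eventually allI lint_nonneg mult_nonneg_nonneg) auto
 moreover have "L f <= (\<integral>x. f x \<partial>\<mu>)" if f: "Cc f" "!!x. 0 <= f x" for f by (rule trace_le[OF f L[OF f(1)]])
 ultimately obtain \<gamma> where \<gamma>: "radon_measure \<gamma>" "!!f. Cc f ==> (\<integral>x. f x \<partial>\<gamma>) = L f" "\<gamma> <= \<mu>"
  using functional_measure[of L] by blast
 show ?thesis using \<gamma> L by (intro that[of \<gamma>]) auto
qed

end

section \<open>Borel representatives and the heat kernels of the definition\<close>

text \<open>The definitions use the completed measure, the analysis works with Borel functions;
  these rules translate between the two.\<close>

lemma lebesgue_of_lborel:
 fixes f :: "'b::euclidean_space => real"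
 shows "f \<in> borel_measurable lborel ==> integral\<^sup>L lebesgue f = integral\<^sup>L lborel f"
  and "integrable lborel f ==> integrable lebesgue f"
  and "f \<in> borel_measurable lborel ==> f \<in> borel_measurable lebesgue"
 by (auto intro: integral_completion measurable_completion simp: integrable_completion)

lemma AE_lebesgue_on_iff:
 fixes S :: "'b::euclidean_space set"
 assumes "S \<in> sets borel"
 shows "(AE z in lebesgue_on S. P z) \<longleftrightarrow> (AE z in lborel. z \<in> S --> P z)"
 using assms by (subst AE_restrict_space_iff) (auto simp: AE_completion_iff)

lemma measurable_lebesgue_on_iff:
 fixes S :: "'b::euclidean_space set" and f :: "'b => real"
 assumes "S \<in> sets borel"
 shows "f \<in> borel_measurable (lebesgue_on S) \<longleftrightarrow> (\<lambda>z. indicator S z * f z) \<in> borel_measurable lebesgue"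
 using assms by (subst borel_measurable_restrict_space_iff) auto

lemma Q_int_in_borel: "(Q_int T :: ('a::euclidean_space \<times> real) set) \<in> sets borel"
 using open_Q_int by (rule borel_open)

lemma Q_in_borel: "(Q T :: ('a::euclidean_space \<times> real) set) \<in> sets borel"
proof -
 have "(Q T :: ('a \<times> real) set) = {z. 0 < snd z} \<inter> {z. snd z <= T}" by (auto simp: Q_def)
 moreover have "open {z::'a \<times> real. 0 < snd z}" "closed {z::'a \<times> real. snd z <= T}"
  by (intro open_Collect_less closed_Collect_le continuous_intros)+
 ultimately show ?thesis by (auto intro: borel_open borel_closed)
qed

lemma Q_int_sub_Q: "Q_int T \<subseteq> Q T"
 by (auto simp: Q_int_def Q_def)

text \<open>Local integrability is checked for a function \<open>P\<close> with respect to
  \<open>lborel\<close> and transferred to \<open>p\<close>, which agrees with it almost everywhere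
  but may involve a potential that is only Lebesgue measurable.\<close>

lemma Lp_loc_1I:
 fixes p P :: "'b::euclidean_space => real"
 assumes S: "S \<in> sets borel" and pm: "p \<in> borel_measurable (lebesgue_on S)"
  and eq: "AE z in lborel. z \<in> S --> p z = P z"
  and P: "!!K. compact K ==> K \<subseteq> S ==> set_integrable lborel K P"
 shows "Lp_loc 1 S p"
 unfolding Lp_loc_def
proof (intro conjI allI impI pm)
 fix K :: "'b set" assume K: "compact K \<and> K \<subseteq> S"
 then have [measurable]: "K \<in> sets borel" by (auto intro: borel_compact)
 have iP: "integrable lebesgue (\<lambda>z. \<bar>indicator K z * P z\<bar>)"
  using P[of K] K by (intro lebesgue_of_lborel(2) integrable_abs) (auto simp: set_integrable_def)
 have m: "(\<lambda>z. \<bar>indicator S z * p z\<bar>) \<in> borel_measurable lebesgue"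
  using pm measurable_lebesgue_on_iff[OF S, of p] by auto
 have [measurable]: "(indicator K :: 'b => real) \<in> borel_measurable lebesgue"
  by (intro lebesgue_of_lborel(3)) simp
 have "(\<lambda>z. indicator K z * \<bar>indicator S z * p z\<bar>) \<in> borel_measurable lebesgue"
  using m by (intro borel_measurable_times) auto
 then have "integrable lebesgue (\<lambda>z. indicator K z * \<bar>indicator S z * p z\<bar>)"
 proof (rule L1_bound[OF iP])
  show "AE z in lebesgue. norm (indicator K z * \<bar>indicator S z * p z\<bar>) <= norm \<bar>indicator K z * P z\<bar>"
   unfolding AE_completion_iff using eq by eventually_elim (use K in \<open>auto simp: indicator_def\<close>)
 qed
 moreover have "(\<lambda>z. indicator K z *\<^sub>R (\<bar>p z\<bar> powr 1)) = (\<lambda>z. indicator K z * \<bar>indicator S z * p z\<bar>)"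
  using K by (auto simp: fun_eq_iff indicator_def)
 ultimately show "set_integrable lebesgue K (\<lambda>z. \<bar>p z\<bar> powr 1)" by (simp add: set_integrable_def)
qed

lemma Lp_loc_1_times:
 fixes f \<psi> :: "'b::euclidean_space => real"
 assumes f: "Lp_loc 1 S f" and S: "S \<in> sets borel" and \<psi>: "continuous_on UNIV \<psi>" "compact K" "K \<subseteq> S" "!!z. z \<notin> K ==> \<psi> z = 0"
 shows "integrable lebesgue (\<lambda>z. f z * \<psi> z)"
proof -
 obtain M where M: "M \<ge> 0" "!!z. \<bar>\<psi> z\<bar> <= M" using bounded_compact_support[OF \<psi>(1,2,4)] by blast
 have i: "integrable lebesgue (\<lambda>z. M * (indicator K z *\<^sub>R (\<bar>f z\<bar> powr 1)))"
  using f \<psi>(2,3) unfolding Lp_loc_def set_integrable_def by (intro integrable_mult_right) auto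
 have "f \<in> borel_measurable (lebesgue_on S)" using f by (simp add: Lp_loc_def)
 then have "(\<lambda>z. indicator S z * f z) \<in> borel_measurable lebesgue" by (simp add: measurable_lebesgue_on_iff[OF S])
 moreover have "\<psi> \<in> borel_measurable lebesgue"
  using borel_measurable_continuous_onI[OF \<psi>(1)] by (intro lebesgue_of_lborel(3)) simp
 ultimately have "(\<lambda>z. indicator S z * f z * \<psi> z) \<in> borel_measurable lebesgue" by (rule borel_measurable_times)
 moreover have "(\<lambda>z. indicator S z * f z * \<psi> z) = (\<lambda>z. f z * \<psi> z)"
  using \<psi>(3,4) by (auto simp: fun_eq_iff indicator_def)
 ultimately have "(\<lambda>z. f z * \<psi> z) \<in> borel_measurable lebesgue" by simp
 then show ?thesis
 proof (rule L1_bound[OF i])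
  show "AE z in lebesgue. norm (f z * \<psi> z) <= norm (M * (indicator K z *\<^sub>R (\<bar>f z\<bar> powr 1)))"
  proof (rule AE_I2)
   fix z
   show "norm (f z * \<psi> z) <= norm (M * (indicator K z *\<^sub>R (\<bar>f z\<bar> powr 1)))"
    using M(1) M(2)[of z] \<psi>(4)[of z] mult_left_mono[OF M(2)[of z], of "\<bar>f z\<bar>"]
    by (cases "z \<in> K") (auto simp: abs_mult mult.commute)
  qed
 qed
qed

lemma set_lint_support:
 fixes F :: "'b::euclidean_space => real"
 assumes "!!z. z \<notin> S ==> F z = 0"
 shows "(LINT z:S|lebesgue. F z) = (\<integral>z. F z \<partial>lebesgue)"
 unfolding set_lebesgue_integral_def using assms
 by (intro lint_cong) (auto simp: indicator_def)

text \<open>Turns the integral in the definitions into one over \<open>lborel\<close> with the Borel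
  representative of the potential; the test function restricts everything to a compact set where
  both potentials agree almost everywhere.\<close>

lemma dist_integral:
 fixes p \<phi> V' W' :: "'a::euclidean_space stfun"
 assumes \<phi>: "test_function (Q_int T) \<phi>"
  and V': "V' \<in> borel_measurable (lebesgue_on (Q T))" and eq: "AE z in lborel. z \<in> Q T --> V' z = W' z"
  and i0: "(\<lambda>z. p z * \<phi> z) \<in> borel_measurable borel"
  and i1: "integrable lborel (\<lambda>z. p z * adj_heat \<phi> z)"
  and i2: "integrable lborel (\<lambda>z. W' z * (p z * \<phi> z))"
 shows "(LINT z:Q_int T|lebesgue. p z * adjoint_op V' \<phi> z) = (LBINT z. p z * adj_heat \<phi> z) + (LBINT z. W' z * (p z * \<phi> z))"
proof -
 obtain K where K: "compact K" "K \<subseteq> Q_int T" "!!z. z \<notin> K ==> \<phi> z = 0" using \<phi> by (rule test_functionE) blast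
 have aoff: "adj_heat \<phi> z = 0" if "z \<notin> K" for z using adj_heat_zero_off[OF K(1,3) that] .
 have "(LINT z:Q_int T|lebesgue. p z * adjoint_op V' \<phi> z) = (\<integral>z. p z * adjoint_op V' \<phi> z \<partial>lebesgue)"
 proof (rule set_lint_support)
  fix z :: "'a \<times> real" assume "z \<notin> Q_int T"
  then have "z \<notin> K" using K(2) by blast
  then show "p z * adjoint_op V' \<phi> z = 0" by (simp add: adjoint_op_eq K(3) aoff)
 qed
 also have "\<dots> = (\<integral>z. p z * adj_heat \<phi> z + W' z * (p z * \<phi> z) \<partial>lebesgue)"
 proof (rule integral_cong_AE)
  have "(\<lambda>z. p z * adjoint_op V' \<phi> z) = (\<lambda>z. p z * adj_heat \<phi> z + (indicator (Q T) z * V' z) * (p z * \<phi> z))"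
  proof
   fix z
   show "p z * adjoint_op V' \<phi> z = p z * adj_heat \<phi> z + (indicator (Q T) z * V' z) * (p z * \<phi> z)"
    using K(2,3) Q_int_sub_Q[of T] by (cases "z \<in> K") (auto simp: adjoint_op_eq algebra_simps indicator_def)
  qed
  moreover have "(\<lambda>z. p z * adj_heat \<phi> z + (indicator (Q T) z * V' z) * (p z * \<phi> z)) \<in> borel_measurable lebesgue"
  proof (rule borel_measurable_add[OF _ borel_measurable_times])
   show "(\<lambda>z. p z * adj_heat \<phi> z) \<in> borel_measurable lebesgue" by (rule lebesgue_of_lborel(3)) (use i1 in auto)
   show "(\<lambda>z. indicator (Q T) z * V' z) \<in> borel_measurable lebesgue" using V' measurable_lebesgue_on_iff[OF Q_in_borel] by blast
   show "(\<lambda>z. p z * \<phi> z) \<in> borel_measurable lebesgue" by (rule lebesgue_of_lborel(3)) (use i0 in simp)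
  qed
  ultimately show "(\<lambda>z. p z * adjoint_op V' \<phi> z) \<in> borel_measurable lebesgue" by simp
  show "(\<lambda>z. p z * adj_heat \<phi> z + W' z * (p z * \<phi> z)) \<in> borel_measurable lebesgue"
   using i1 i2 by (intro lebesgue_of_lborel(3)) auto
  show "AE z in lebesgue. p z * adjoint_op V' \<phi> z = p z * adj_heat \<phi> z + W' z * (p z * \<phi> z)"
   unfolding AE_completion_iff using eq
  proof eventually_elim
   case (elim z)
   then show ?case using K(2,3) Q_int_sub_Q[of T] by (cases "z \<in> K") (auto simp: adjoint_op_eq algebra_simps)
  qed
 qed
 also have "\<dots> = (LBINT z. p z * adj_heat \<phi> z + W' z * (p z * \<phi> z))"
  by (rule lebesgue_of_lborel(1)) (use i1 i2 in auto)
 also have "\<dots> = (LBINT z. p z * adj_heat \<phi> z) + (LBINT z. W' z * (p z * \<phi> z))"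
  by (rule lint_add[OF i1 i2])
 finally show ?thesis .
qed

text \<open>A Lebesgue measurable function agrees almost everywhere with a Borel one; the maximum
  with 0 repairs its sign everywhere.\<close>

lemma borel_representative:
 fixes V :: "'a::euclidean_space stfun"
 assumes V: "V \<in> borel_measurable (lebesgue_on (Q T))" and nn: "AE z in lebesgue_on (Q T). V z \<ge> 0"
 obtains W where "W \<in> borel_measurable borel" "!!z. 0 <= W z" "AE z in lborel. z \<in> Q T --> V z = W z"
proof -
 obtain g where g: "g \<in> borel_measurable lborel" "AE z in lborel. indicator (Q T) z * V z = g z"
  using completion_ex_borel_measurable_real V[unfolded measurable_lebesgue_on_iff[OF Q_in_borel]] by blast
 show ?thesis
 proof (rule that[of "\<lambda>z. max 0 (g z)"])
  show "(\<lambda>z. max 0 (g z)) \<in> borel_measurable borel" using g(1) by simp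
  show "AE z in lborel. z \<in> Q T --> V z = max 0 (g z)"
   using g(2) nn[unfolded AE_lebesgue_on_iff[OF Q_in_borel]] by eventually_elim auto
 qed simp
qed

lemma strong_solution_weak:
 fixes u V W :: "'a::euclidean_space stfun"
 assumes ss: "strong_solution T V u" and uc: "continuous_on (Q_int T) u"
  and eq: "AE z in lborel. z \<in> Q T --> V z = W z" and Wm: "W \<in> borel_measurable borel"
  and \<phi>: "test_function (Q_int T) \<phi>"
 shows "(LBINT z. u z * adj_heat \<phi> z) = - (LBINT z. W z * u z * \<phi> z)"
proof -
 obtain K where s\<phi>: "smooth \<phi>" and K: "compact K" "K \<subseteq> Q_int T" "!!z. z \<notin> K ==> \<phi> z = 0"
  using \<phi> by (rule test_functionE) blast
 have c: "continuous_on UNIV \<phi>" by (rule smooth_continuous[OF s\<phi>])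
 have ca: "continuous_on UNIV (adj_heat \<phi>)" by (rule continuous_adj_heat[OF s\<phi>])
 have off: "dir_deriv \<phi> a z = 0" "dir_deriv (dir_deriv \<phi> a) a z = 0" if "z \<notin> K" for a z
  using dir_deriv_zero_off[OF K(1,3) that] dir_deriv_zero_off[OF K(1) dir_deriv_zero_off[OF K(1,3)] that] by auto
 have cd: "continuous_on UNIV (dir_deriv \<phi> a)" "continuous_on UNIV (dir_deriv (dir_deriv \<phi> a) a)" for a
  by (intro smooth_continuous smooth_dir_deriv s\<phi>)+
 obtain ut g h where ut: "has_weak_deriv (Q_int T) u (0, 1) ut"
  and gh: "!!i. i \<in> Basis ==> has_weak_deriv (Q_int T) u (i, 0) (g i) \<and> has_weak_deriv (Q_int T) (g i) (i, 0) (h i)"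
  and ae: "AE z in lebesgue_on (Q T). ut z - (\<Sum>i\<in>Basis. h i z) + V z * u z = 0"
  using ss unfolding strong_solution_def by blast
 have wd: "(\<integral>z. f z * dir_deriv \<psi> a z \<partial>lebesgue) = - (\<integral>z. f' z * \<psi> z \<partial>lebesgue)"
  if wd: "has_weak_deriv (Q_int T) f a f'" and \<psi>: "test_function (Q_int T) \<psi>" for f f' a and \<psi> :: "'a stfun"
 proof -
  obtain C where C: "compact C" "C \<subseteq> Q_int T" "!!z. z \<notin> C ==> \<psi> z = 0" using \<psi> by (rule test_functionE) blast
  have "(LINT z:Q_int T|lebesgue. f z * dir_deriv \<psi> a z) = - (LINT z:Q_int T|lebesgue. f' z * \<psi> z)"
   using wd \<psi> unfolding has_weak_deriv_def by blast
  moreover have "(LINT z:Q_int T|lebesgue. f z * dir_deriv \<psi> a z) = (\<integral>z. f z * dir_deriv \<psi> a z \<partial>lebesgue)"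
  proof (rule set_lint_support)
   fix z :: "'a \<times> real" assume "z \<notin> Q_int T"
   then have "z \<notin> C" using C(2) by blast
   then show "f z * dir_deriv \<psi> a z = 0" using dir_deriv_zero_off[OF C(1,3)] by simp
  qed
  moreover have "(LINT z:Q_int T|lebesgue. f' z * \<psi> z) = (\<integral>z. f' z * \<psi> z \<partial>lebesgue)"
   by (rule set_lint_support) (use C in auto)
  ultimately show ?thesis by simp
 qed
 have L: "Lp_loc 1 (Q_int T) u" "Lp_loc 1 (Q_int T) ut" "!!i. i \<in> Basis ==> Lp_loc 1 (Q_int T) (h i)"
  using ut gh by (auto simp: has_weak_deriv_def)
 \<comment> \<open>The weak derivative is used twice: for \<open>u\<close> with the test function
   \<partial>_i \<phi>, then for \<open>g i\<close> with \<phi> itself; the two signs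
   cancel.\<close>
 have second: "(\<integral>z. u z * dir_deriv (dir_deriv \<phi> (i, 0)) (i, 0) z \<partial>lebesgue) = (\<integral>z. h i z * \<phi> z \<partial>lebesgue)" if i: "i \<in> Basis" for i
  using wd[OF conjunct1[OF gh[OF i]] test_function_dir_deriv[OF \<phi>]] wd[OF conjunct2[OF gh[OF i]] \<phi>] by simp
 have iu: "integrable lebesgue (\<lambda>z. u z * dir_deriv \<phi> (0, 1) z)"
  "integrable lebesgue (\<lambda>z. u z * dir_deriv (dir_deriv \<phi> (i, 0)) (i, 0) z)" for i
  by (rule Lp_loc_1_times[OF L(1) Q_int_in_borel cd(1) K(1,2) off(1)], assumption,
   rule Lp_loc_1_times[OF L(1) Q_int_in_borel cd(2) K(1,2) off(2)])
 have iut: "integrable lebesgue (\<lambda>z. ut z * \<phi> z)" by (rule Lp_loc_1_times[OF L(2) Q_int_in_borel c K])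
 have ih: "integrable lebesgue (\<lambda>z. h i z * \<phi> z)" if "i \<in> Basis" for i
  by (rule Lp_loc_1_times[OF L(3)[OF that] Q_int_in_borel c K])
 have "(\<lambda>z. u z * adj_heat \<phi> z) \<in> borel_measurable lborel"
  using integrable_times_compact[OF uc ca K(1,2) adj_heat_zero_off[OF K(1,3)]] by auto
 then have "(LBINT z. u z * adj_heat \<phi> z) = (\<integral>z. u z * adj_heat \<phi> z \<partial>lebesgue)"
  by (rule lebesgue_of_lborel(1)[symmetric])
 also have "\<dots> = (\<integral>z. - (u z * dir_deriv \<phi> (0, 1) z) - (\<Sum>i\<in>Basis. u z * dir_deriv (dir_deriv \<phi> (i, 0)) (i, 0) z) \<partial>lebesgue)"
  by (intro lint_cong) (simp add: adj_heat_def right_diff_distrib sum_distrib_left)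
 also have "\<dots> = (\<integral>z. ut z * \<phi> z \<partial>lebesgue) - (\<Sum>i\<in>Basis. \<integral>z. h i z * \<phi> z \<partial>lebesgue)"
  using iu wd[OF ut \<phi>] second by (simp add: lint_diff lint_sum)
 also have "\<dots> = (\<integral>z. ut z * \<phi> z - (\<Sum>i\<in>Basis. h i z * \<phi> z) \<partial>lebesgue)"
  using iut ih by (simp add: lint_diff lint_sum)
 also have "\<dots> = (\<integral>z. - (W z * (u z * \<phi> z)) \<partial>lebesgue)"
 proof (rule integral_cong_AE)
  show "(\<lambda>z. ut z * \<phi> z - (\<Sum>i\<in>Basis. h i z * \<phi> z)) \<in> borel_measurable lebesgue"
   using iut ih by (intro borel_measurable_diff borel_measurable_sum) auto
  show "(\<lambda>z. - (W z * (u z * \<phi> z))) \<in> borel_measurable lebesgue"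
   using integrable_times_compact[OF uc c K] Wm by (intro lebesgue_of_lborel(3)) auto
  show "AE z in lebesgue. ut z * \<phi> z - (\<Sum>i\<in>Basis. h i z * \<phi> z) = - (W z * (u z * \<phi> z))"
   unfolding AE_completion_iff using eq ae[unfolded AE_lebesgue_on_iff[OF Q_in_borel]]
  proof eventually_elim
   case (elim z)
   show ?case
   proof (cases "z \<in> K")
    case True
    then have "z \<in> Q T" using K(2) Q_int_sub_Q by blast
    then have "ut z - (\<Sum>i\<in>Basis. h i z) = - (W z * u z)" using elim by simp
    then have "(ut z - (\<Sum>i\<in>Basis. h i z)) * \<phi> z = - (W z * u z) * \<phi> z" by simp
    then show ?thesis by (simp add: left_diff_distrib sum_distrib_right mult.assoc)
   qed (simp add: K(3))
  qed
 qed
 also have "\<dots> = (LBINT z. - (W z * (u z * \<phi> z)))"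
  using integrable_times_compact[OF uc c K] Wm by (intro lebesgue_of_lborel(1)) auto
 finally show ?thesis by (simp add: mult.assoc)
qed

lemma hk_gauss_kernel: "0 < t ==> hk ((x, t) - (y, 0)) = gauss_kernel (x - y) t"
 by (simp add: hk_def)

lemma bounded_times_integrable:
 fixes W f :: "'b::euclidean_space => real"
 assumes "W \<in> borel_measurable borel" "!!z. 0 <= W z" "!!z. W z <= k" "integrable lborel f"
 shows "integrable lborel (\<lambda>z. W z * f z)"
proof (rule L1_bound)
 show "integrable lborel (\<lambda>z. k * f z)" using assms(4) by simp
 have "norm (W z * f z) <= norm (k * f z)" for z
  using assms(2,3)[of z] by (simp add: abs_mult mult_right_mono)
 then show "AE z in lborel. norm (W z * f z) <= norm (k * f z)" by simp
qed (use assms in auto)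

text \<open>The description operator in \<open>heat_kernel_bdd\<close> is justified by exhibiting
  the series kernel as a heat kernel and by the uniqueness theorem, which covers the top t = T as
  well.\<close>

lemma heat_kernel_bdd_eq:
 fixes V W :: "'a::euclidean_space stfun"
 assumes W: "potential W" and Vm: "V \<in> borel_measurable (lebesgue_on (Q T))"
  and eq: "AE z in lborel. z \<in> Q T --> V z = W z" and xt: "(x, t) \<in> Q T"
 shows "heat_kernel_bdd T (\<lambda>z. min (V z) (real k)) x y t = potential.KK W k y (x, t)"
proof -
 interpret potential W by (rule W)
 have T: "0 < T" using xt by (auto simp: Q_def)
 let ?V = "\<lambda>z. min (V z) (real k)"
 have Vm': "?V \<in> borel_measurable (lebesgue_on (Q T))" using Vm by simp
 have eq': "AE z in lborel. z \<in> Q T --> ?V z = Vk k z"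
  using eq by eventually_elim (auto simp: Vk_def)
 have cQ: "continuous_on (Q T) (KK k y)" by (rule continuous_on_subset[OF KK_continuous Q_subset])
 have di: "(LINT z:Q_int T|lebesgue. p z * adjoint_op ?V \<phi> z) = (LBINT z. p z * adj_heat \<phi> z) + (LBINT z. Vk k z * p z * \<phi> z)"
  if p: "continuous_on (Q T) p" and \<phi>: "test_function (Q_int T) \<phi>" for p \<phi> :: "'a stfun"
 proof -
  note i = continuous_times_test[OF continuous_on_subset[OF p Q_int_sub_Q] \<phi>]
  have "integrable lborel (\<lambda>z. Vk k z * (p z * \<phi> z))"
   by (rule bounded_times_integrable[OF Vk_measurable Vk_nonneg Vk_le i(1)])
  then show ?thesis using dist_integral[OF \<phi> Vm' eq' _ i(2)] i(1) by (simp add: mult.assoc)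
 qed
 have cloc: "set_integrable lborel C p" if "continuous_on (Q T) p" "compact C" "C \<subseteq> Q_int T" for p :: "'a stfun" and C :: "('a \<times> real) set"
  unfolding set_integrable_def using that Q_int_sub_Q
  by (intro borel_integrable_compact continuous_on_subset[OF that(1)]) auto
 have slice: "integrable lborel (\<lambda>x. p (x, t) * \<phi> x)"
  if p: "continuous_on (Q T) p" and \<phi>: "Cc \<phi>" and t: "0 < t" "t <= T" for p :: "'a stfun" and \<phi> t
 proof -
  obtain C where C: "continuous_on UNIV \<phi>" "compact C" "!!x. x \<notin> C ==> \<phi> x = 0" using \<phi> by (rule CcE) blast
  have "continuous_on UNIV (\<lambda>x. p (x, t))"
   by (rule continuous_on_compose2[OF p]) (use t in \<open>auto simp: Q_def intro!: continuous_intros\<close>)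
  then show ?thesis by (rule integrable_times_compact[OF _ C(1,2) _ C(3)]) auto
 qed
 have ev: "\<forall>\<^sub>F t in at_right 0. 0 < t \<and> t <= T"
  unfolding eventually_at_right_field using T by (intro exI[of _ T]) auto
 have hkb: "is_heat_kernel T ?V y (KK k y)"
  unfolding is_heat_kernel_def
 proof (intro conjI cQ)
  show "\<forall>(x, t)\<in>Q T. 0 <= KK k y (x, t) \<and> KK k y (x, t) <= gauss_kernel (x - y) t"
  proof (safe)
   fix x :: 'a and t assume "(x, t) \<in> Q T"
   then have "0 < t" by (auto simp: Q_def)
   then show "KK k y (x, t) <= gauss_kernel (x - y) t" using KK_le[of k y "(x, t)"] hk_gauss_kernel[of t x y] by simp
   show "0 <= KK k y (x, t)" by (rule KK_nonneg)
  qed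
  show "dist_solution T ?V (KK k y)"
   unfolding dist_solution_def
  proof (intro conjI allI impI)
   have m: "KK k y \<in> borel_measurable lebesgue" by (rule lebesgue_of_lborel(3)) simp
   have mQ: "KK k y \<in> borel_measurable (lebesgue_on (Q_int T))" by (rule measurable_restrict_space1[OF m])
   show "Lp_loc 1 (Q_int T) (KK k y)"
    by (rule Lp_loc_1I[OF Q_int_in_borel mQ _ cloc[OF cQ]]) auto
   have vm: "?V \<in> borel_measurable (lebesgue_on (Q_int T))"
    using measurable_restrict_mono[OF Vm' Q_int_sub_Q] .
   show "Lp_loc 1 (Q_int T) (\<lambda>z. ?V z * KK k y z)"
   proof (rule Lp_loc_1I[OF Q_int_in_borel borel_measurable_times[OF vm mQ]])
    show "AE z in lborel. z \<in> Q_int T --> ?V z * KK k y z = Vk k z * KK k y z"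
     using eq' by eventually_elim (use Q_int_sub_Q in auto)
    show "set_integrable lborel C (\<lambda>z. Vk k z * KK k y z)" if "compact C" "C \<subseteq> Q_int T" for C
     using bounded_times_integrable[OF Vk_measurable Vk_nonneg Vk_le cloc[OF cQ that, unfolded set_integrable_def], of k]
     by (simp add: set_integrable_def mult_ac)
   qed
   fix \<phi> :: "'a stfun" assume \<phi>: "test_function (Q_int T) \<phi>"
   show "(LINT z:Q_int T|lebesgue. KK k y z * adjoint_op ?V \<phi> z) = 0"
    using di[OF cQ \<phi>] KK_weak[OF test_function_mono[OF \<phi> Q_int_subset], of k y] by simp
  qed
  show "has_initial_trace (KK k y) (return borel y)"
   unfolding has_initial_trace_def
  proof (intro conjI allI impI)
   show "radon_measure (return borel y)"
    unfolding radon_measure_def by (auto simp: borel_compact emeasure_return indicator_def)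
   fix \<phi> :: "'a => real" assume "continuous_on UNIV \<phi> \<and> compact (closure {x. \<phi> x \<noteq> 0})"
   then have \<phi>: "Cc \<phi>" "continuous_on UNIV \<phi>" by (simp_all add: Cc_def)
   obtain B where B: "!!x. \<bar>\<phi> x\<bar> <= B" using Cc_bounded[OF \<phi>(1)] by blast
   note tr = KK_trace[OF \<phi>(2) B]
   show "\<forall>\<^sub>F t in at_right 0. integrable lebesgue (\<lambda>x. KK k y (x, t) * \<phi> x)"
    using ev by eventually_elim (intro lebesgue_of_lborel(2) tr(1), auto)
   have "((\<lambda>t. \<integral>x. KK k y (x, t) * \<phi> x \<partial>lebesgue) \<longlongrightarrow> \<phi> y) (at_right 0)"
   proof (rule Lim_transform_eventually[OF tr(2)])
    show "\<forall>\<^sub>F t in at_right 0. (LBINT x. KK k y (x, t) * \<phi> x) = (\<integral>x. KK k y (x, t) * \<phi> x \<partial>lebesgue)"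
     using ev by eventually_elim (rule lebesgue_of_lborel(1)[symmetric], use tr(1) in auto)
   qed
   then show "((\<lambda>t. \<integral>x. KK k y (x, t) * \<phi> x \<partial>lebesgue) \<longlongrightarrow> (\<integral>x. \<phi> x \<partial>return borel y)) (at_right 0)"
    using Cc_measurable[OF \<phi>(1)] by (simp add: integral_return)
  qed
 qed
 have uniq: "K (x, t) = KK k y (x, t)" if K: "is_heat_kernel T ?V y K" for K
 proof (rule heat_kernel_unique[OF Vk_measurable Vk_nonneg Vk_le _ cQ _ _ _ _ _ _ xt])
  show cK: "continuous_on (Q T) K" using K by (simp add: is_heat_kernel_def)
  show "0 <= K z \<and> K z <= hk (z - (y, 0))" if "z \<in> Q T" for z
  proof (cases z)
   case (Pair a b)
   then have "0 < b" using that by (auto simp: Q_def)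
   then show ?thesis using K that unfolding is_heat_kernel_def Pair by (auto simp: hk_def)
  qed
  show "0 <= KK k y z \<and> KK k y z <= hk (z - (y, 0))" for z using KK_nonneg KK_le by blast
  show "(LBINT z. K z * adj_heat \<phi> z) = - (LBINT z. Vk k z * K z * \<phi> z)" if \<phi>: "test_function (Q_int T) \<phi>" for \<phi>
  proof -
   have "(LINT z:Q_int T|lebesgue. K z * adjoint_op ?V \<phi> z) = 0"
    using K \<phi> unfolding is_heat_kernel_def dist_solution_def by blast
   then show ?thesis using di[OF cK \<phi>] by simp
  qed
  show "(LBINT z. KK k y z * adj_heat \<phi> z) = - (LBINT z. Vk k z * KK k y z * \<phi> z)" if \<phi>: "test_function (Q_int T) \<phi>" for \<phi>
   by (rule KK_weak[OF test_function_mono[OF \<phi> Q_int_subset]])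
  fix \<phi> :: "'a => real" assume c: "continuous_on UNIV \<phi>" "compact (closure {x. \<phi> x \<noteq> 0})"
  then have \<phi>: "Cc \<phi>" by (simp add: Cc_def)
  obtain B where B: "!!x. \<bar>\<phi> x\<bar> <= B" using Cc_bounded[OF \<phi>] by blast
  show "((\<lambda>t. LBINT x. KK k y (x, t) * \<phi> x) \<longlongrightarrow> \<phi> y) (at_right 0)" by (rule KK_trace(2)[OF c(1) B])
  have "((\<lambda>t. \<integral>x. K (x, t) * \<phi> x \<partial>lebesgue) \<longlongrightarrow> (\<integral>x. \<phi> x \<partial>return borel y)) (at_right 0)"
   using K c unfolding is_heat_kernel_def has_initial_trace_def by blast
  then have "((\<lambda>t. \<integral>x. K (x, t) * \<phi> x \<partial>lebesgue) \<longlongrightarrow> \<phi> y) (at_right 0)"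
   using Cc_measurable[OF \<phi>] by (simp add: integral_return)
  then show "((\<lambda>t. LBINT x. K (x, t) * \<phi> x) \<longlongrightarrow> \<phi> y) (at_right 0)"
  proof (rule Lim_transform_eventually)
   show "\<forall>\<^sub>F t in at_right 0. (\<integral>x. K (x, t) * \<phi> x \<partial>lebesgue) = (LBINT x. K (x, t) * \<phi> x)"
    using ev by eventually_elim (rule lebesgue_of_lborel(1), use slice[OF cK \<phi>] in auto)
  qed
 qed
 show ?thesis
  unfolding heat_kernel_bdd_def
 proof (rule the_equality)
  show "\<exists>K. is_heat_kernel T ?V y K \<and> KK k y (x, t) = K (x, t)" using hkb by blast
  show "r = KK k y (x, t)" if "\<exists>K. is_heat_kernel T ?V y K \<and> r = K (x, t)" for r using that uniq by blast
 qed
qed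

lemma heat_kernel_eq:
 fixes V W :: "'a::euclidean_space stfun"
 assumes W: "potential W" and Vm: "V \<in> borel_measurable (lebesgue_on (Q T))"
  and eq: "AE z in lborel. z \<in> Q T --> V z = W z" and xt: "(x, t) \<in> Q T"
 shows "heat_kernel T V x y t = potential.Kinf W y (x, t)"
 unfolding heat_kernel_def potential.Kinf_def[OF W] heat_kernel_bdd_eq[OF W Vm eq xt] ..

text \<open>Limits along t \<rightarrow> 0 are unique, and a Radon measure is determined by its
  integrals of compactly supported continuous functions.\<close>

lemma initial_trace_unique:
 fixes f :: "'a::euclidean_space stfun"
 assumes "has_initial_trace f \<gamma>"
 shows "initial_trace f = \<gamma>"
 unfolding initial_trace_def
proof (rule the_equality)
 fix \<gamma>' assume \<gamma>': "has_initial_trace f \<gamma>'"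
 show "\<gamma>' = \<gamma>"
 proof (rule radon_eq_if_integral_eq)
  show "radon_measure \<gamma>'" "radon_measure \<gamma>" using assms \<gamma>' by (auto simp: has_initial_trace_def)
  fix \<phi> :: "'a => real" assume "Cc \<phi>"
  then show "(\<integral>x. \<phi> x \<partial>\<gamma>') = (\<integral>x. \<phi> x \<partial>\<gamma>)"
   using assms \<gamma>' unfolding has_initial_trace_def Cc_def
   by (intro tendsto_unique[of "at_right 0" "\<lambda>t. \<integral>x. f (x, t) * \<phi> x \<partial>lebesgue"]) auto
 qed
qed (rule assms)

text \<open>\<mu> does not charge the complement of \<open>A\<close>, so finiteness of the weight
  integral over \<open>A\<close> is finiteness over the whole space.\<close>

lemma weighted_measureI:
 assumes T: "0 < T" and \<mu>: "\<mu> \<in> M_plus T A"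
 shows "weighted_measure T \<mu>"
proof
 show "0 < T" "radon_measure \<mu>" using T \<mu> by (auto simp: M_plus_def)
 have "- A \<in> null_sets \<mu>" using \<mu> by (simp add: M_plus_def)
 from AE_not_in[OF this]
 have "(\<integral>\<^sup>+ y. ennreal (exp (- (norm y)\<^sup>2 / (4 * T))) \<partial>\<mu>) = (\<integral>\<^sup>+ y\<in>A. ennreal (exp (- (norm y)\<^sup>2 / (4 * T))) \<partial>\<mu>)"
  by (intro nn_integral_cong_AE) (auto simp: indicator_def elim!: eventually_mono)
 then show "(\<integral>\<^sup>+ y. ennreal (exp (- (norm y)\<^sup>2 / (4 * T))) \<partial>\<mu>) < \<infinity>" using \<mu> by (simp add: M_plus_def)
qed

locale positive_solution =
 fixes T :: real and V u :: "'a::euclidean_space stfun"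
 assumes T_pos: "0 < T" and V_bounded: "Linf_loc (Q T) V" and V_nn: "AE z in lebesgue_on (Q T). V z \<ge> 0"
  and u_continuous: "continuous_on (Q T) u" and u_pos: "!!z. z \<in> Q T ==> 0 < u z" and u_sol: "strong_solution T V u"
begin

lemma V_meas: "V \<in> borel_measurable (lebesgue_on (Q T))"
 using V_bounded by (simp add: Linf_loc_def)

text \<open>A representative fixed once, depending on V only, so that the kernels built from it
  serve all initial measures.\<close>

definition W :: "'a stfun" where
 "W = (SOME W. W \<in> borel_measurable borel \<and> (\<forall>z. 0 <= W z) \<and> (AE z in lborel. z \<in> Q T --> V z = W z))"

lemma W: "W \<in> borel_measurable borel" "0 <= W z" "AE z in lborel. z \<in> Q T --> V z = W z"
proof -
 have "\<exists>W. W \<in> borel_measurable borel \<and> (\<forall>z. 0 <= W z) \<and> (AE z in lborel. z \<in> Q T --> V z = W z)"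
  by (rule borel_representative[OF V_meas V_nn]) blast
 from someI_ex[OF this] show "W \<in> borel_measurable borel" "0 <= W z" "AE z in lborel. z \<in> Q T --> V z = W z"
  unfolding W_def by blast+
qed

sublocale potential W
 by standard (rule W)+

lemma u_cont_int: "continuous_on (Q_int T) u"
 by (rule continuous_on_subset[OF u_continuous Q_int_sub_Q])

lemma min_solutionI:
 assumes \<mu>: "\<mu> \<in> M_plus T A"
 shows "min_solution W T \<mu> u"
proof -
 interpret weighted_measure T \<mu> by (rule weighted_measureI[OF T_pos \<mu>])
 show ?thesis
 proof
  show "continuous_on (Q_int T) u" by (rule u_cont_int)
  show "0 <= u z" if "z \<in> Q_int T" for z using u_pos[of z] that Q_int_sub_Q by force
  show "(LBINT z. u z * adj_heat \<phi> z) = - (LBINT z. W z * u z * \<phi> z)" if "test_function (Q_int T) \<phi>" for \<phi>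
   by (rule strong_solution_weak[OF u_sol u_cont_int W(3,1) that])
  fix K :: "('a \<times> real) set" assume K: "compact K" "K \<subseteq> Q_int T"
  then have "K \<subseteq> Q T" using Q_int_sub_Q by blast
  then obtain C where "AE z in lebesgue_on K. \<bar>V z\<bar> <= C" using V_bounded K(1) unfolding Linf_loc_def by blast
  then have "AE z in lborel. z \<in> K --> \<bar>V z\<bar> <= C" using K(1) by (simp add: AE_lebesgue_on_iff borel_compact)
  then have "AE z in lborel. z \<in> K --> W z <= C"
   using W(3) by eventually_elim (use \<open>K \<subseteq> Q T\<close> in auto)
  then show "\<exists>C. AE z in lborel. z \<in> K --> W z <= C" by blast
 qed
qed

lemma reduced_solution_eq:
 assumes \<mu>: "\<mu> \<in> M_plus T A" and z: "z \<in> Q_int T"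
 shows "reduced_solution T V \<mu> z = (\<integral>\<^sup>+ y. ennreal (Kinf y z) \<partial>\<mu>)"
proof (cases z)
 case (Pair x t)
 then have "(x, t) \<in> Q T" using z Q_int_sub_Q by blast
 then show ?thesis
  unfolding reduced_solution_def Pair using heat_kernel_eq[OF potential_axioms V_meas W(3)] by simp
qed

text \<open>On the open cylinder both arguments of the minimum are finite, so \<open>v_inf\<close>
  is there the real function \<open>min u w\<close> built from the representative; distributions and
  traces only look at that region.\<close>

lemma supersolution_and_trace:
 assumes \<mu>: "\<mu> \<in> M_plus T A"
 shows "dist_supersolution T V (v_inf T V u \<mu>)"
  and "\<exists>\<gamma>. radon_measure \<gamma> \<and> \<gamma> <= \<mu> \<and> has_initial_trace (v_inf T V u \<mu>) \<gamma>"
proof -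
 interpret m: min_solution W T \<mu> u by (rule min_solutionI[OF \<mu>])
 let ?v = "v_inf T V u \<mu>"
 have v: "?v z = m.onQ m.v z" if z: "z \<in> Q_int T" for z
 proof -
  have "?v z = enn2real (ennreal (min (u z) (m.w z)))"
   unfolding v_inf_def reduced_solution_eq[OF \<mu> z] m.nn_Kinf[OF z]
   using m.u_nonneg[OF z] m.w_nonneg[OF z] by (simp add: min_def)
  also have "\<dots> = m.v z" using m.u_nonneg[OF z] m.w_nonneg[OF z] by (simp add: m.v_def)
  finally show ?thesis by (simp add: m.onQ_in[OF z])
 qed
 have onQm: "m.onQ m.v \<in> borel_measurable lebesgue" by (rule lebesgue_of_lborel(3)) simp
 have vm: "?v \<in> borel_measurable (lebesgue_on (Q_int T))"
  using measurable_restrict_space1[OF onQm, of "Q_int T"]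
  by (rule measurable_cong[THEN iffD1, rotated]) (use v in \<open>auto simp: space_restrict_space\<close>)
 have Vm: "V \<in> borel_measurable (lebesgue_on (Q_int T))"
  using measurable_restrict_mono[OF V_meas Q_int_sub_Q] .
 have iK: "set_integrable lborel K (m.onQ m.v)" "set_integrable lborel K (\<lambda>z. W z * m.onQ m.v z)"
  if K: "compact K" "K \<subseteq> Q_int T" for K
 proof -
  have g: "(indicator K :: _ => real) \<in> borel_measurable borel" using borel_compact[OF K(1)] by simp
  have "\<bar>indicator K z :: real\<bar> <= 1" for z :: "'a \<times> real" by (simp add: indicator_def)
  note l = m.onQ_limit(3,4)[OF g this K]
  show "set_integrable lborel K (m.onQ m.v)" "set_integrable lborel K (\<lambda>z. W z * m.onQ m.v z)"
   using l by (simp_all add: set_integrable_def mult_ac)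
 qed
 show "dist_supersolution T V ?v"
  unfolding dist_supersolution_def
 proof (intro conjI allI impI)
  show "Lp_loc 1 (Q_int T) ?v"
   by (rule Lp_loc_1I[OF Q_int_in_borel vm _ iK(1)]) (use v in auto)
  show "Lp_loc 1 (Q_int T) (\<lambda>z. V z * ?v z)"
  proof (rule Lp_loc_1I[OF Q_int_in_borel borel_measurable_times[OF Vm vm] _ iK(2)])
   show "AE z in lborel. z \<in> Q_int T --> V z * ?v z = W z * m.onQ m.v z"
    using W(3) by eventually_elim (use v Q_int_sub_Q in auto)
  qed auto
  fix \<phi> :: "'a stfun" assume "test_function (Q_int T) \<phi> \<and> (\<forall>z. 0 <= \<phi> z)"
  then have \<phi>: "test_function (Q_int T) \<phi>" "!!z. 0 <= \<phi> z" by auto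
  obtain K where s\<phi>: "smooth \<phi>" and K: "compact K" "K \<subseteq> Q_int T" "!!z. z \<notin> K ==> \<phi> z = 0"
   using \<phi>(1) by (rule test_functionE) blast
  have c: "continuous_on UNIV \<phi>" "continuous_on UNIV (adj_heat \<phi>)"
   using s\<phi> by (auto intro: smooth_continuous continuous_adj_heat)
  have aoff: "adj_heat \<phi> z = 0" if "z \<notin> K" for z using adj_heat_zero_off[OF K(1,3) that] .
  obtain M where M: "!!z. \<bar>\<phi> z\<bar> <= M" using bounded_compact_support[OF c(1) K(1,3)] by blast
  obtain N where N: "!!z. \<bar>adj_heat \<phi> z\<bar> <= N" using bounded_compact_support[OF c(2) K(1) aoff] by blast
  note bm = borel_measurable_continuous_onI[OF c(1)] borel_measurable_continuous_onI[OF c(2)]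
  have "(LINT z:Q_int T|lebesgue. ?v z * adjoint_op V \<phi> z) = (LINT z:Q_int T|lebesgue. m.onQ m.v z * adjoint_op V \<phi> z)"
   unfolding set_lebesgue_integral_def using v by (intro lint_cong) (auto simp: indicator_def)
  also have "\<dots> = (LBINT z. m.onQ m.v z * adj_heat \<phi> z) + (LBINT z. W z * (m.onQ m.v z * \<phi> z))"
  proof (rule dist_integral[OF \<phi>(1) V_meas W(3)])
   show "(\<lambda>z. m.onQ m.v z * \<phi> z) \<in> borel_measurable borel" using m.onQ_limit(3)[OF bm(1) M K] by auto
  qed (rule m.onQ_limit(3)[OF bm(2) N K(1,2) aoff], assumption, rule m.onQ_limit(4)[OF bm(1) M K])
  finally show "0 <= (LINT z:Q_int T|lebesgue. ?v z * adjoint_op V \<phi> z)" using m.v_super[OF \<phi>] by simp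
 qed
 obtain \<gamma> where \<gamma>: "radon_measure \<gamma>" "\<gamma> <= \<mu>"
  "!!f. Cc f ==> ((\<lambda>t. LBINT x. m.onQ m.v (x, t) * f x) \<longlongrightarrow> (\<integral>x. f x \<partial>\<gamma>)) (at_right 0)"
  using m.trace_measure by blast
 have vt: "?v (x, t) = m.onQ m.v (x, t)" if "0 < t \<and> t <= T / 4" for x t
  using that T_pos by (intro v) (auto simp: Q_int_def)
 have "has_initial_trace ?v \<gamma>"
  unfolding has_initial_trace_def
 proof (intro conjI allI impI \<gamma>(1))
  fix \<phi> :: "'a => real" assume "continuous_on UNIV \<phi> \<and> compact (closure {x. \<phi> x \<noteq> 0})"
  then have \<phi>: "Cc \<phi>" by (simp add: Cc_def)
  show "\<forall>\<^sub>F t in at_right 0. integrable lebesgue (\<lambda>x. ?v (x, t) * \<phi> x)"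
   using m.eventually_small
   by eventually_elim (simp add: vt lebesgue_of_lborel(2)[OF m.v_slice_integrable[OF \<phi>]])
  show "((\<lambda>t. \<integral>x. ?v (x, t) * \<phi> x \<partial>lebesgue) \<longlongrightarrow> (\<integral>x. \<phi> x \<partial>\<gamma>)) (at_right 0)"
  proof (rule Lim_transform_eventually[OF \<gamma>(3)[OF \<phi>]])
   show "\<forall>\<^sub>F t in at_right 0. (LBINT x. m.onQ m.v (x, t) * \<phi> x) = (\<integral>x. ?v (x, t) * \<phi> x \<partial>lebesgue)"
    using m.eventually_small
   proof eventually_elim
    case (elim t)
    then have "integrable lborel (\<lambda>x. m.onQ m.v (x, t) * \<phi> x)" using m.v_slice_integrable[OF \<phi>] by blast
    then show ?case unfolding vt[OF elim] by (intro lebesgue_of_lborel(1)[symmetric]) auto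
   qed
  qed
 qed
 then show "\<exists>\<gamma>. radon_measure \<gamma> \<and> \<gamma> <= \<mu> \<and> has_initial_trace ?v \<gamma>" using \<gamma>(1,2) by blast
qed

text \<open>The trace lies below \<mu>, hence inherits from it both the null complement of
  \<open>A\<close> and the finite weight integral.\<close>

lemma gamma_trace:
 assumes \<mu>: "\<mu> \<in> M_plus T A"
 shows "has_initial_trace (v_inf T V u \<mu>) (gamma_trace T V u \<mu>)" "gamma_trace T V u \<mu> <= \<mu>"
  "gamma_trace T V u \<mu> \<in> M_plus T A"
proof -
 obtain \<gamma> where \<gamma>: "radon_measure \<gamma>" "\<gamma> <= \<mu>" "has_initial_trace (v_inf T V u \<mu>) \<gamma>"
  using supersolution_and_trace(2)[OF \<mu>] by blast
 have g: "gamma_trace T V u \<mu> = \<gamma>" unfolding gamma_trace_def by (rule initial_trace_unique[OF \<gamma>(3)])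
 show "has_initial_trace (v_inf T V u \<mu>) (gamma_trace T V u \<mu>)" "gamma_trace T V u \<mu> <= \<mu>"
  using \<gamma> g by auto
 have s: "sets \<gamma> = sets \<mu>" using \<gamma>(1) \<mu> by (simp add: radon_measure_def M_plus_def)
 have "emeasure \<gamma> (- A) <= emeasure \<mu> (- A)" by (rule le_measureD3[OF \<gamma>(2) s])
 then have "- A \<in> null_sets \<gamma>" using \<mu> s by (auto simp: M_plus_def null_sets_def)
 moreover have "(\<integral>\<^sup>+ x\<in>A. ennreal (exp (- (norm x)\<^sup>2 / (4 * T))) \<partial>\<gamma>) < \<infinity>"
  using nn_integral_mono_measure[OF s \<gamma>(2)] \<mu> unfolding M_plus_def by (blast intro: le_less_trans)
 ultimately show "gamma_trace T V u \<mu> \<in> M_plus T A" using \<gamma>(1) g by (simp add: M_plus_def)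
qed

text \<open>The reduced solution integrates one fixed nonnegative kernel, so it is monotone in the
  measure; the minimum with \<open>u\<close> keeps the order, and limits against nonnegative test
  functions pass it to the traces.\<close>

lemma gamma_trace_mono:
 assumes \<mu>: "\<mu> \<in> M_plus T A" and \<nu>: "\<nu> \<in> M_plus T A" and le: "\<mu> <= \<nu>"
 shows "gamma_trace T V u \<mu> <= gamma_trace T V u \<nu>"
proof (rule radon_le_if_integral_le)
 note t\<mu> = gamma_trace(1)[OF \<mu>] and t\<nu> = gamma_trace(1)[OF \<nu>]
 show "radon_measure (gamma_trace T V u \<mu>)" "radon_measure (gamma_trace T V u \<nu>)"
  using t\<mu> t\<nu> by (auto simp: has_initial_trace_def)
 fix f :: "'a => real" assume f: "Cc f" "!!x. 0 <= f x"
 have s: "sets \<mu> = sets \<nu>" using \<mu> \<nu> by (simp add: M_plus_def radon_measure_def)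
 have v: "v_inf T V u \<mu> z <= v_inf T V u \<nu> z" for z
 proof -
  have "reduced_solution T V \<mu> z <= reduced_solution T V \<nu> z"
   unfolding reduced_solution_def by (cases z) (simp add: nn_integral_mono_measure[OF s le])
  \<comment> \<open>\<open>enn2real\<close> sends infinity to 0, so its monotonicity requires the
    larger argument to be finite; the minimum with the finite value \<open>u z\<close> ensures this
    even where the reduced solution is infinite.\<close>
  then show ?thesis unfolding v_inf_def by (intro enn2real_mono min.mono order_refl) (auto simp: min_less_iff_disj)
 qed
 have "\<forall>\<^sub>F t in at_right 0. integrable lebesgue (\<lambda>x. v_inf T V u \<mu> (x, t) * f x)"
  "\<forall>\<^sub>F t in at_right 0. integrable lebesgue (\<lambda>x. v_inf T V u \<nu> (x, t) * f x)"
  using t\<mu> t\<nu> f(1) unfolding has_initial_trace_def Cc_def by blast+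
 then have "\<forall>\<^sub>F t in at_right 0. (\<integral>x. v_inf T V u \<mu> (x, t) * f x \<partial>lebesgue) <= (\<integral>x. v_inf T V u \<nu> (x, t) * f x \<partial>lebesgue)"
  by eventually_elim (intro integral_mono mult_right_mono v f(2))
 moreover have "((\<lambda>t. \<integral>x. v_inf T V u \<mu> (x, t) * f x \<partial>lebesgue) \<longlongrightarrow> (\<integral>x. f x \<partial>gamma_trace T V u \<mu>)) (at_right 0)"
  "((\<lambda>t. \<integral>x. v_inf T V u \<nu> (x, t) * f x \<partial>lebesgue) \<longlongrightarrow> (\<integral>x. f x \<partial>gamma_trace T V u \<nu>)) (at_right 0)"
  using t\<mu> t\<nu> f(1) unfolding has_initial_trace_def Cc_def by blast+
 ultimately show "(\<integral>x. f x \<partial>gamma_trace T V u \<mu>) <= (\<integral>x. f x \<partial>gamma_trace T V u \<nu>)"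
  by (intro tendsto_le[of "at_right 0"]) auto
qed

end

theorem proposition4p6:
  fixes T :: real and V u :: "(real ^ 'n) \<times> real \<Rightarrow> real"
  assumes "T > 0"
    and "Linf_loc (Q T) V"
    and "AE z in lebesgue_on (Q T). V z \<ge> 0"
    and "\<forall>p\<ge>1. W21_loc p T u"
    and "continuous_on (Q T) u"
    and "\<forall>z\<in>Q T. u z > 0"
    and "strong_solution T V u"
    and "singular_set T V u \<subset> UNIV"
  shows "(\<forall>\<mu>\<in>M_plus T (singular_set T V u).
            dist_supersolution T V (v_inf T V u \<mu>) \<and>
            has_initial_trace (v_inf T V u \<mu>) (gamma_trace T V u \<mu>) \<and>
            gamma_trace T V u \<mu> \<in> M_plus T (singular_set T V u) \<and>
            gamma_trace T V u \<mu> \<le> \<mu>) \<and>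
         (\<forall>\<mu>\<in>M_plus T (singular_set T V u). \<forall>\<nu>\<in>M_plus T (singular_set T V u).
            \<mu> \<le> \<nu> \<longrightarrow> gamma_trace T V u \<mu> \<le> gamma_trace T V u \<nu>)"
proof -
 interpret positive_solution T V u
  by standard (use assms in auto)
 show ?thesis using supersolution_and_trace(1) gamma_trace gamma_trace_mono by blast
qed

end
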